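(* Let $\Omega \subset \mathbb{R}^N$, $N \ge 2$, be a bounded domain, let $1 < p < N$ and $p^\ast = Np/(N-p)$, let $b > 0$ and $\gamma > 1$, and let $f : \Omega \times \mathbb{R} \to \mathbb{R}$ be a Carathéodory function such that $$|f(x,t)| \le a_1 |t|^{q-1} + a_2 \quad \text{for a.a. } x \in \Omega \text{ and all } t \in \mathbb{R}$$ for some constants $a_1, a_2 > 0$ and $1 < q < p^\ast$. Then the problem $$\left\{\begin{aligned} - \left[1 + b \left(\int_\Omega |\nabla u|^p\, dx\right)^{\gamma-1}\right] \Delta_p u & = f(x,u) + |u|^{p^\ast-2} u && \text{in } \Omega \\ u & = 0 && \text{on } \partial\Omega \end{aligned}\right.$$ has a (weak) solution in each of the following cases: (i) $\gamma = p^\ast/p$, $b = S_{N,p}^{-p^\ast/p}$, and $q < p$; (ii) $\gamma = p^\ast/p$ and $b > S_{N,p}^{-p^\ast/p}$; (iii) $\gamma > p^\ast/p$ and $$b^{p^\ast/p-1} > \frac{(\gamma - p^\ast/p)^{\gamma - p^\ast/p}\, (p^\ast/p - 1)^{p^\ast/p-1}}{(\gamma-1)^{\gamma-1}}\, S_{N,p}^{-(p^\ast/p)(\gamma-1)}.$$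
   Context: $\Delta_p u = \operatorname{div}(|\nabla u|^{p-2} \nabla u)$ is the $p$-Laplacian. $S_{N,p}$ denotes the best Sobolev constant $$S_{N,p} = \inf_{u \in W^{1,p}_0(\Omega) \setminus \{0\}} \frac{\int_\Omega |\nabla u|^p\, dx}{\left(\int_\Omega |u|^{p^\ast} dx\right)^{p/p^\ast}}.$$ A (weak) solution of the problem is a function $u \in W^{1,p}_0(\Omega)$ such that $$\left[1 + b\left(\int_\Omega |\nabla u|^p\, dx\right)^{\gamma-1}\right] \int_\Omega |\nabla u|^{p-2} \nabla u \cdot \nabla v\, dx = \int_\Omega f(x,u)\, v\, dx + \int_\Omega |u|^{p^\ast-2} u\, v\, dx \quad \text{for all } v \in W^{1,p}_0(\Omega).$$ *)

theory Defs
  imports "HOL-Analysis.Analysis"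
begin

(* Functions on Omega are total functions on the ambient space; every notion below looks at them
   only up to equality almost everywhere in Omega, through the measure lebesgue_on Omega. *)

fun Ck_fun :: "nat \<Rightarrow> ('a::euclidean_space \<Rightarrow> real) \<Rightarrow> bool" where
  "Ck_fun 0 \<phi> \<longleftrightarrow> continuous_on UNIV \<phi>"
| "Ck_fun (Suc k) \<phi> \<longleftrightarrow>
     (\<forall>x. \<phi> differentiable (at x)) \<and>
     (\<forall>i\<in>Basis. Ck_fun k (\<lambda>x. frechet_derivative \<phi> (at x) i))"

definition test_functions :: "'a::euclidean_space set \<Rightarrow> ('a \<Rightarrow> real) set" where
  "test_functions \<Omega> =
     {\<phi>. (\<forall>k. Ck_fun k \<phi>) \<and> compact (closure {x. \<phi> x \<noteq> 0}) \<and> closure {x. \<phi> x \<noteq> 0} \<subseteq> \<Omega>}"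

definition Lp_on ::
    "'a::euclidean_space set \<Rightarrow> real \<Rightarrow> ('a \<Rightarrow> 'b::euclidean_space) set" where
  "Lp_on \<Omega> p =
     {u \<in> borel_measurable (lebesgue_on \<Omega>). integrable (lebesgue_on \<Omega>) (\<lambda>x. norm (u x) powr p)}"

definition locally_integrable_on ::
    "('a::euclidean_space \<Rightarrow> 'b::euclidean_space) \<Rightarrow> 'a set \<Rightarrow> bool" where
  "locally_integrable_on u \<Omega> \<longleftrightarrow> (\<forall>K\<subseteq>\<Omega>. compact K \<longrightarrow> integrable (lebesgue_on K) u)"

definition has_weak_gradient ::
    "'a::euclidean_space set \<Rightarrow> ('a \<Rightarrow> real) \<Rightarrow> ('a \<Rightarrow> 'a) \<Rightarrow> bool" where
  "has_weak_gradient \<Omega> u g \<longleftrightarrow>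
     locally_integrable_on u \<Omega> \<and> locally_integrable_on g \<Omega> \<and>
     (\<forall>\<phi>\<in>test_functions \<Omega>. \<forall>i\<in>Basis.
        (\<integral>x. u x * frechet_derivative \<phi> (at x) i \<partial>lebesgue_on \<Omega>) =
        - (\<integral>x. (g x \<bullet> i) * \<phi> x \<partial>lebesgue_on \<Omega>))"

(* For open Omega a weak gradient is unique up to a null subset of Omega, so the choice made here
   does not affect any of the integrals below. *)
definition weak_grad :: "'a::euclidean_space set \<Rightarrow> ('a \<Rightarrow> real) \<Rightarrow> 'a \<Rightarrow> 'a" where
  "weak_grad \<Omega> u = (SOME g. has_weak_gradient \<Omega> u g)"

definition W1p :: "'a::euclidean_space set \<Rightarrow> real \<Rightarrow> ('a \<Rightarrow> real) set" where
  "W1p \<Omega> p = {u \<in> Lp_on \<Omega> p. \<exists>g \<in> Lp_on \<Omega> p. has_weak_gradient \<Omega> u g}"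

definition sobolev_norm :: "'a::euclidean_space set \<Rightarrow> real \<Rightarrow> ('a \<Rightarrow> real) \<Rightarrow> real" where
  "sobolev_norm \<Omega> p u =
     ((\<integral>x. \<bar>u x\<bar> powr p \<partial>lebesgue_on \<Omega>) +
      (\<integral>x. norm (weak_grad \<Omega> u x) powr p \<partial>lebesgue_on \<Omega>)) powr (1 / p)"

(* the closure of the test functions in W1p *)
definition W1p_0 :: "'a::euclidean_space set \<Rightarrow> real \<Rightarrow> ('a \<Rightarrow> real) set" where
  "W1p_0 \<Omega> p =
     {u \<in> W1p \<Omega> p. \<forall>\<epsilon>>0. \<exists>\<phi>\<in>test_functions \<Omega>. sobolev_norm \<Omega> p (\<lambda>x. u x - \<phi> x) < \<epsilon>}"

definition crit_exp :: "nat \<Rightarrow> real \<Rightarrow> real" where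
  "crit_exp N p = real N * p / (real N - p)"

definition sobolev_const :: "'a::euclidean_space set \<Rightarrow> real \<Rightarrow> real" where
  "sobolev_const \<Omega> p =
     (INF u \<in> {u \<in> W1p_0 \<Omega> p. \<not> (AE x in lebesgue_on \<Omega>. u x = 0)}.
        (\<integral>x. norm (weak_grad \<Omega> u x) powr p \<partial>lebesgue_on \<Omega>) /
        (\<integral>x. \<bar>u x\<bar> powr crit_exp DIM('a) p \<partial>lebesgue_on \<Omega>) powr (p / crit_exp DIM('a) p))"

definition caratheodory ::
    "'a::euclidean_space set \<Rightarrow> ('a \<Rightarrow> real \<Rightarrow> real) \<Rightarrow> bool" where
  "caratheodory \<Omega> f \<longleftrightarrow>
     (\<forall>t. (\<lambda>x. f x t) \<in> borel_measurable (lebesgue_on \<Omega>)) \<and>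
     (AE x in lebesgue_on \<Omega>. continuous_on UNIV (f x))"

(* Since 0 powr s = 0 for every s, the factors norm z powr (p - 2) and abs t powr (r - 2) give the
   usual value 0 of the products at z = 0 and t = 0, also for exponents below 2. *)
definition weak_solution ::
    "'a::euclidean_space set \<Rightarrow> real \<Rightarrow> real \<Rightarrow> real \<Rightarrow> ('a \<Rightarrow> real \<Rightarrow> real) \<Rightarrow> ('a \<Rightarrow> real) \<Rightarrow> bool" where
  "weak_solution \<Omega> p b \<gamma> f u \<longleftrightarrow>
     u \<in> W1p_0 \<Omega> p \<and>
     (\<forall>v \<in> W1p_0 \<Omega> p.
        (1 + b * (\<integral>x. norm (weak_grad \<Omega> u x) powr p \<partial>lebesgue_on \<Omega>) powr (\<gamma> - 1)) *
        (\<integral>x. norm (weak_grad \<Omega> u x) powr (p - 2) * (weak_grad \<Omega> u x \<bullet> weak_grad \<Omega> v x)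
           \<partial>lebesgue_on \<Omega>) =
        (\<integral>x. f x (u x) * v x \<partial>lebesgue_on \<Omega>) +
        (\<integral>x. \<bar>u x\<bar> powr (crit_exp DIM('a) p - 2) * u x * v x \<partial>lebesgue_on \<Omega>))"

end

theory Submission
  imports Defs "HOL-Computational_Algebra.Polynomial" "HOL-Complex_Analysis.Great_Picard"
begin

text \<open>
  A weak solution is found as a global minimiser of
  \<open>\<Phi> u = E / p + b / (p \<gamma>) E powr \<gamma> - \<integral> F(x, u) - (1 / ps) \<integral> \<bar>u\<bar> powr ps\<close>, where \<open>E = \<integral> \<bar>\<nabla>u\<bar> powr p\<close>.
  In each of the three cases \<open>S powr (- ps / p) * r powr (ps / p - 1) \<le> 1 + b * r powr (\<gamma> - 1)\<close> for all \<open>r \<ge> 0\<close>,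
  so by the Sobolev inequality the nonlocal term dominates the critical one. This makes \<open>\<Phi>\<close> coercive, the
  condition \<open>q < p\<close> being needed only when the domination is exact. The displayed inequality compares
  the derivatives of the two terms in \<open>E\<close>, so an increase of the energy of a minimising sequence over that of its limit
  always outweighs the critical mass that is lost, and \<open>\<Phi>\<close> is lower semicontinuous along the sequence although the
  critical embedding is not compact. The minimiser satisfies the Euler-Lagrange equation, which is the weak
  formulation.
\<close>

subsection \<open>Real inequalities\<close>

text \<open>The obstacle is the critical term: along a minimising sequence with a.e. limit
  \<open>u\<close>, energy and critical mass may both drop in the limit. If \<open>s\<close> is the
  lost energy, the Sobolev constant bounds the lost mass by
  \<open>S powr (- ps / p) * s powr (ps / p)\<close>. Since \<open>\<gamma> > 1\<close>, \<open>(e +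
  s) powr \<gamma> \<ge> e powr \<gamma> + s powr \<gamma>\<close>, so the lost part can be weighed
  against its own energy, whatever the energy \<open>e\<close> of the limit is; hence it is enough
  to integrate the inequality between the derivatives from \<open>0\<close> to \<open>s\<close>. The
  thresholds on \<open>b\<close> are the conditions for that inequality: for
  \<open>\<gamma> = ps / p\<close> both sides carry the same power of \<open>r\<close>, and for
  \<open>\<gamma> > ps / p\<close> the constant in (iii) comes from minimising
  \<open>(1 + b * r powr (\<gamma> - 1)) / r powr (ps / p - 1)\<close> over \<open>r > 0\<close>.
  The minimising sequence is taken among test functions, so that truncation, gradients and the
  compactness argument stay classical; that its limit belongs to \<open>W1p_0\<close> follows from
  uniform convexity of the norm instead of weak topologies.\<close>

text \<open>The two powers balance at \<open>t0\<close>, where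
  \<open>t0 powr r = e * t0 powr s\<close>; the constant covers the range below. In this form
  subcritical powers are later absorbed by the critical one, and in case (iii) the critical power by
  the power \<open>\<gamma>\<close> of the energy.\<close>

lemma powr_absorb:
  fixes r s e :: real
  assumes "0 < r" "r < s" "0 < e"
  shows "\<exists>C\<ge>0. \<forall>t\<ge>0. t powr r \<le> e * t powr s + C"
proof -
  define t0 where "t0 = (1/e) powr (1/(s-r))"
  have t0: "t0 > 0" using assms by (auto simp: t0_def)
  have "t powr r \<le> e * t powr s + t0 powr r" if "t \<ge> 0" for t
  proof (cases "t \<le> t0")
    case True
    then have "t powr r \<le> t0 powr r" using that assms by (intro powr_mono2) auto
    moreover have "0 \<le> e * t powr s" using assms by auto
    ultimately show ?thesis by linarith
  next
    case False
    then have t: "t > t0" "t > 0" using t0 by auto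
    have "1/e = t0 powr (s-r)" using assms by (simp add: t0_def powr_powr)
    also have "\<dots> \<le> t powr (s-r)" using t t0 assms by (intro powr_mono2) auto
    finally have "1 \<le> e * t powr (s-r)" using assms by (simp add: field_simps)
    then have "t powr r \<le> (e * t powr (s-r)) * t powr r" using mult_right_mono[of 1 _ "t powr r"] by auto
    also have "\<dots> = e * t powr s" using t by (simp add: powr_add[symmetric] mult.assoc)
    finally show ?thesis using t0 by (smt (verit) powr_ge_zero)
  qed
  then show ?thesis by (intro exI[of _ "t0 powr r"]) auto
qed

lemma powr_add_le:
  fixes a b r :: real
  assumes "a \<ge> 0" "b \<ge> 0" "r \<ge> 0"
  shows "(a + b) powr r \<le> 2 powr r * (a powr r + b powr r)"
proof -
  have "(a + b) powr r \<le> (2 * max a b) powr r" using assms by (intro powr_mono2) auto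
  also have "\<dots> = 2 powr r * max a b powr r" using assms by (simp add: powr_mult)
  also have "\<dots> \<le> 2 powr r * (a powr r + b powr r)"
    by (intro mult_left_mono) (auto simp: max_def)
  finally show ?thesis .
qed

section \<open>Derivatives and increments of powers of the norm\<close>

text \<open>At \<open>0\<close> the difference quotient is at most
  \<open>\<bar>h\<bar> powr (r - 1)\<close>, which is where \<open>1 < r\<close> enters; the factor
  \<open>\<bar>x\<bar> powr (r - 2)\<close> causes no harm there, since
  \<open>0 powr (r - 2) = 0\<close> and \<open>x = 0\<close>.\<close>

lemma has_real_derivative_abs_powr:
  fixes r x :: real
  assumes "1 < r"
  shows "((\<lambda>t. \<bar>t\<bar> powr r) has_real_derivative (r * \<bar>x\<bar> powr (r - 2) * x)) (at x)"
proof (cases "x = 0")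
  case True
  have "((\<lambda>h. (\<bar>0 + h\<bar> powr r - \<bar>0\<bar> powr r) / h) \<longlongrightarrow> 0) (at 0)"
  proof (rule Lim_null_comparison[where g="\<lambda>h. \<bar>h\<bar> powr (r - 1)"])
    have "norm ((\<bar>0 + h\<bar> powr r - \<bar>0\<bar> powr r) / h) \<le> \<bar>h\<bar> powr (r - 1)" for h :: real
      by (cases "h = 0") (auto simp: powr_diff)
    then show "\<forall>\<^sub>F h in at 0. norm ((\<bar>0 + h\<bar> powr r - \<bar>0\<bar> powr r) / h) \<le> \<bar>h\<bar> powr (r - 1)" 
      by auto
    have "((\<lambda>h::real. \<bar>h\<bar> powr (r - 1)) \<longlongrightarrow> \<bar>0\<bar> powr (r - 1)) (at 0)"
      using assms by (intro tendsto_intros tendsto_powr') auto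
    then show "((\<lambda>h::real. \<bar>h\<bar> powr (r - 1)) \<longlongrightarrow> 0) (at 0)" by simp
  qed
  then show ?thesis using True by (simp add: DERIV_def)
next
  case False
  show ?thesis
  proof (cases "x > 0")
    case True
    have "((\<lambda>t. t powr r) has_real_derivative (r * x powr (r - 1))) (at x)"
      using True by (intro derivative_eq_intros | simp)+ 
    moreover have "r * x powr (r - 1) = r * \<bar>x\<bar> powr (r - 2) * x"
      using True powr_add[of x "r-2" 1] by (simp)
    ultimately have *: "((\<lambda>t. t powr r) has_real_derivative (r * \<bar>x\<bar> powr (r - 2) * x)) (at x)" by simp
    show ?thesis
      by (rule has_field_derivative_transform_within_open[OF *, where S="{0<..}"]) (use True in auto)
  next
    assume "\<not> x > 0"
    with False have neg: "x < 0" by simp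
    have "((\<lambda>t. (-t) powr r) has_real_derivative (r * (-x) powr (r - 1) * (-1))) (at x)"
      using neg by (intro derivative_eq_intros | simp)+ 
    moreover have "r * (-x) powr (r - 1) * (-1) = r * \<bar>x\<bar> powr (r - 2) * x"
      using neg powr_add[of "-x" "r-2" 1] by (simp)
    ultimately have *: "((\<lambda>t. (-t) powr r) has_real_derivative (r * \<bar>x\<bar> powr (r - 2) * x)) (at x)" by simp
    show ?thesis
      by (rule has_field_derivative_transform_within_open[OF *, where S="{..<0}"]) (use neg in auto)
  qed
qed

lemma powr_diff_le:
  fixes x y r :: real
  assumes "1 < r" "0 \<le> x" "x \<le> y"
  shows "y powr r - x powr r \<le> r * y powr (r - 1) * (y - x)"
proof (cases "x < y")
  case True
  obtain z where z: "x < z" "z < y" "\<bar>y\<bar> powr r - \<bar>x\<bar> powr r = (y - x) * (r * \<bar>z\<bar> powr (r - 2) * z)"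
    using MVT2[OF True, of "\<lambda>t. \<bar>t\<bar> powr r" "\<lambda>z. r * \<bar>z\<bar> powr (r - 2) * z"]
      has_real_derivative_abs_powr[OF assms(1)] by metis
  have "\<bar>z\<bar> powr (r - 2) * z = z powr (r - 1)"
    using z assms powr_add[of z "r-2" 1] by simp
  also have "\<dots> \<le> y powr (r - 1)" using z assms by (intro powr_mono2) auto
  finally have "(y - x) * (r * (\<bar>z\<bar> powr (r - 2) * z)) \<le> (y - x) * (r * y powr (r - 1))"
    using assms by (intro mult_left_mono) auto
  then show ?thesis using z assms by (simp add: mult_ac)
qed (use assms in auto)

lemma abs_powr_diff_le:
  fixes x y r :: real
  assumes "1 < r" "0 \<le> x" "0 \<le> y"
  shows "\<bar>y powr r - x powr r\<bar> \<le> r * (max x y) powr (r - 1) * \<bar>y - x\<bar>"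
proof (cases "x \<le> y")
  case True
  then show ?thesis using powr_diff_le[OF assms(1,2) True] powr_mono2[of r x y] assms by (simp add: max_def)
next
  case False
  then show ?thesis using powr_diff_le[of r y x] powr_mono2[of r y x] assms by (simp add: max_def)
qed

text \<open>Serves as the domination when integrals of
  \<open>norm (a + s *\<^sub>R b) powr r\<close> are differentiated in \<open>s\<close>: the bound
  is linear in \<open>\<bar>s\<bar>\<close> with a factor that does not depend on
  \<open>s\<close>.\<close>

lemma norm_powr_increment_le:
  fixes a b :: "'b::real_normed_vector" and r s :: real
  assumes "1 < r" "\<bar>s\<bar> \<le> 1"
  shows "\<bar>norm (a + s *\<^sub>R b) powr r - norm a powr r\<bar> \<le> \<bar>s\<bar> * (r * (norm a + norm b) powr (r - 1) * norm b)"
proof -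
  have sb: "norm (s *\<^sub>R b) \<le> norm b" using assms by (simp add: mult_left_le_one_le)
  have m: "max (norm a) (norm (a + s *\<^sub>R b)) \<le> norm a + norm b"
    using norm_triangle_ineq[of a "s *\<^sub>R b"] sb by (auto)
  have d: "\<bar>norm (a + s *\<^sub>R b) - norm a\<bar> \<le> \<bar>s\<bar> * norm b"
    using norm_triangle_ineq3[of "a + s *\<^sub>R b" a] by simp
  have "\<bar>norm (a + s *\<^sub>R b) powr r - norm a powr r\<bar> 
     \<le> r * (max (norm a) (norm (a + s *\<^sub>R b))) powr (r - 1) * \<bar>norm (a + s *\<^sub>R b) - norm a\<bar>"
    using assms by (intro abs_powr_diff_le) auto
  also have "\<dots> \<le> r * (norm a + norm b) powr (r - 1) * (\<bar>s\<bar> * norm b)"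
    using assms m d by (intro mult_mono mult_left_mono powr_mono2) (auto simp: le_max_iff_disj)
  finally show ?thesis by (simp add: mult_ac)
qed

lemma has_real_derivative_norm_powr:
  fixes a b :: "'b::real_inner" and r :: real
  assumes "1 < r"
  shows "((\<lambda>s. norm (a + s *\<^sub>R b) powr r) has_real_derivative (r * norm a powr (r - 2) * (a \<bullet> b))) (at 0)"
proof (cases "a = 0")
  case True
  have "((\<lambda>s. \<bar>s\<bar> powr r * norm b powr r) has_real_derivative (r * \<bar>0\<bar> powr (r - 2) * 0 * norm b powr r)) (at 0)"
    by (intro DERIV_cmult_right has_real_derivative_abs_powr assms)
  then show ?thesis using True by (simp add: powr_mult)
next
  case False
  have n: "((\<lambda>s. norm (a + s *\<^sub>R b)) has_real_derivative ((a \<bullet> b) / norm a)) (at 0)"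
  proof -
    have i: "((\<lambda>s. (a + s *\<^sub>R b) \<bullet> (a + s *\<^sub>R b)) has_real_derivative (2 * (a \<bullet> b))) (at 0)"
      unfolding inner_add_left inner_add_right inner_scaleR_left inner_scaleR_right
      by (rule derivative_eq_intros refl | simp add: inner_commute)+
    have "((\<lambda>s. sqrt ((a + s *\<^sub>R b) \<bullet> (a + s *\<^sub>R b))) has_real_derivative (inverse (sqrt (a \<bullet> a)) / 2 * (2 * (a \<bullet> b)))) (at 0)"
    proof (rule DERIV_chain'[OF i])
      have "0 < a \<bullet> a" using False by simp
      from DERIV_real_sqrt[OF this] 
      show "(sqrt has_real_derivative inverse (sqrt (a \<bullet> a)) / 2) (at ((a + 0 *\<^sub>R b) \<bullet> (a + 0 *\<^sub>R b)))"
        by simp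
    qed
    moreover have "inverse (sqrt (a \<bullet> a)) / 2 * (2 * (a \<bullet> b)) = (a \<bullet> b) / sqrt (a \<bullet> a)"
      by (simp add: inverse_eq_divide)
    ultimately show ?thesis unfolding norm_eq_sqrt_inner by (simp only:)
  qed
  have "((\<lambda>s. \<bar>norm (a + s *\<^sub>R b)\<bar> powr r) has_real_derivative 
      (r * \<bar>norm (a + 0 *\<^sub>R b)\<bar> powr (r - 2) * norm (a + 0 *\<^sub>R b) * ((a \<bullet> b) / norm a))) (at 0)"
    by (rule DERIV_chain'[OF n has_real_derivative_abs_powr[OF assms]])
  then show ?thesis using False by (simp add: mult.assoc)
qed

section \<open>Convexity inequalities\<close>

text \<open>Jensen's inequality for \<open>exp\<close> at the points
  \<open>ln (x j)\<close>.\<close>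

lemma weighted_arith_geo_mean:
  fixes w x :: "'i \<Rightarrow> real"
  assumes "finite J" "\<And>j. j \<in> J \<Longrightarrow> 0 \<le> w j" "sum w J = 1" "\<And>j. j \<in> J \<Longrightarrow> 0 < x j"
  shows "(\<Prod>j\<in>J. x j powr w j) \<le> (\<Sum>j\<in>J. w j * x j)"
proof -
  have ne: "J \<noteq> {}" using assms(3) by auto
  have "exp (\<Sum>j\<in>J. w j *\<^sub>R ln (x j)) \<le> (\<Sum>j\<in>J. w j * exp (ln (x j)))"
    by (rule convex_on_sum[where C=UNIV]) (use assms ne exp_convex in auto)
  moreover have "exp (\<Sum>j\<in>J. w j *\<^sub>R ln (x j)) = (\<Prod>j\<in>J. x j powr w j)"
    using assms by (simp add: exp_sum powr_def) (intro prod.cong refl, metis less_irrefl)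
  ultimately show ?thesis using assms by simp
qed

text \<open>Strictness has two sources. If the norms differ, it is strict convexity of
  \<open>t powr p\<close>, obtained from the mean value theorem on both halves of the interval. If
  they agree, it is the strict triangle inequality, whose equality case would force
  \<open>a = b\<close>.\<close>

lemma norm_powr_strictly_midconvex:
  fixes a b :: "'b::real_inner" and p :: real
  assumes "1 < p" "a \<noteq> b"
  shows "norm ((1/2) *\<^sub>R (a + b)) powr p < (norm a powr p + norm b powr p) / 2"
proof -
  define m where "m = (norm a + norm b) / 2"
  have le: "norm ((1/2) *\<^sub>R (a + b)) \<le> m" using norm_triangle_ineq[of a b] by (simp add: m_def)
  have mid: "m powr p \<le> (norm a powr p + norm b powr p) / 2 \<and> 
     (norm a \<noteq> norm b \<longrightarrow> m powr p < (norm a powr p + norm b powr p) / 2)"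
  proof (cases "norm a = norm b")
    case True then show ?thesis by (simp add: m_def)
  next
    case False
    define x where "x = min (norm a) (norm b)" 
    define y where "y = max (norm a) (norm b)"
    have xy: "0 \<le> x" "x < y" "m = (x + y) / 2" "norm a powr p + norm b powr p = x powr p + y powr p"
      using False by (auto simp: x_def y_def m_def min_def max_def)
    define c where "c = p * m powr (p - 1)"
    have m: "x < m" "m < y" "0 < m" using xy by auto
    have eq: "m - x = y - m" using xy by (simp add: field_simps)
    obtain z where z: "x < z" "z < m" "\<bar>m\<bar> powr p - \<bar>x\<bar> powr p = (m - x) * (p * \<bar>z\<bar> powr (p - 2) * z)"
      using MVT2[OF m(1), of "\<lambda>t. \<bar>t\<bar> powr p" "\<lambda>z. p * \<bar>z\<bar> powr (p - 2) * z"]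
      has_real_derivative_abs_powr[OF assms(1)] by metis
    obtain z' where z': "m < z'" "z' < y" "\<bar>y\<bar> powr p - \<bar>m\<bar> powr p = (y - m) * (p * \<bar>z'\<bar> powr (p - 2) * z')"
      using MVT2[OF m(2), of "\<lambda>t. \<bar>t\<bar> powr p" "\<lambda>z. p * \<bar>z\<bar> powr (p - 2) * z"]
      has_real_derivative_abs_powr[OF assms(1)] by metis
    have e: "\<bar>z\<bar> powr (p - 2) * z = z powr (p - 1)" "\<bar>z'\<bar> powr (p - 2) * z' = z' powr (p - 1)"
      using z z' m xy powr_add[of z "p-2" 1] powr_add[of z' "p-2" 1] by simp_all
    have "z powr (p - 1) < z' powr (p - 1)" using z z' xy assms by (intro powr_less_mono2) auto
    then have "(m - x) * (p * z powr (p - 1)) < (y - m) * (p * z' powr (p - 1))"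
      using xy assms unfolding eq by (intro mult_strict_left_mono) auto
    then have "m powr p - x powr p < y powr p - m powr p" using z(3) z'(3) e m xy(1,2) by (simp add: mult.assoc)
    then show ?thesis using xy(4) by auto
  qed
  show ?thesis
  proof (cases "norm a = norm b")
    case True
    have "norm ((1/2) *\<^sub>R (a + b)) \<noteq> m"
    proof
      assume "norm ((1/2) *\<^sub>R (a + b)) = m"
      then have "norm (a + b) = norm a + norm b" by (simp add: m_def)
      then have "norm a *\<^sub>R b = norm b *\<^sub>R a" by (simp add: norm_triangle_eq)
      then show False using True assms(2) by (cases "norm a = 0") auto
    qed
    then have "norm ((1/2) *\<^sub>R (a + b)) powr p < m powr p"
      using le assms by (intro powr_less_mono2) auto
    then show ?thesis using mid by linarith
  next
    case False
    have "norm ((1/2) *\<^sub>R (a + b)) powr p \<le> m powr p"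
      using le assms by (intro powr_mono2) auto
    then show ?thesis using mid False by linarith
  qed
qed

lemma norm_powr_midconvex:
  fixes a b :: "'b::real_inner" and p :: real
  assumes "1 < p"
  shows "norm ((1/2) *\<^sub>R (a + b)) powr p \<le> (norm a powr p + norm b powr p) / 2"
proof (cases "a = b")
  case True
  have "(1/2) *\<^sub>R (b + b) = b" by (simp add: scaleR_2[symmetric])
  then show ?thesis using True by simp
qed (use norm_powr_strictly_midconvex[OF assms] in \<open>auto intro: less_imp_le\<close>)

text \<open>By homogeneity it suffices to consider \<open>norm a powr p + norm b powr p = 1\<close>, a compact set.\<close>

lemma norm_powr_uniformly_convex:
  fixes p e :: real
  assumes "1 < p" "0 < e"
  shows "\<exists>C\<ge>0. \<forall>a b :: 'b::euclidean_space. norm (a - b) powr p \<le> e * (norm a powr p + norm b powr p)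
     + C * ((norm a powr p + norm b powr p) / 2 - norm ((1/2) *\<^sub>R (a + b)) powr p)"
proof -
  define D where "D a b = (norm a powr p + norm b powr p) / 2 - norm ((1/2) *\<^sub>R (a + b)) powr p" for a b :: 'b
  define K where "K = {(a, b :: 'b). norm a powr p + norm b powr p = 1 \<and> e \<le> norm (a - b) powr p}"
  have D0: "0 \<le> D a b" for a b using norm_powr_midconvex[OF assms(1), of a b] by (simp add: D_def)
  have K: "compact K"
  proof -
    have "closed {x :: 'b \<times> 'b. norm (fst x) powr p + norm (snd x) powr p = 1}"
      using assms by (intro closed_Collect_eq continuous_intros continuous_on_powr') auto
    moreover have "closed {x :: 'b \<times> 'b. e \<le> norm (fst x - snd x) powr p}"
      using assms by (intro closed_Collect_le continuous_intros continuous_on_powr') auto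
    moreover have "K = {x. norm (fst x) powr p + norm (snd x) powr p = 1} \<inter> {x. e \<le> norm (fst x - snd x) powr p}"
      by (auto simp: K_def)
    ultimately have "closed K" by (simp only: closed_Int)
    moreover have "K \<subseteq> cball 0 1 \<times> cball 0 1"
    proof (clarsimp simp: K_def)
      fix a b :: 'b assume h: "norm a powr p + norm b powr p = 1"
      have l: "norm x \<le> 1" if "norm x powr p \<le> 1" for x :: 'b
      proof (rule ccontr)
        assume "\<not> norm x \<le> 1"
        then have "1 powr p < norm x powr p" using assms by (intro powr_less_mono2) auto
        then show False using that by simp
      qed
      show "norm a \<le> 1 \<and> norm b \<le> 1" using h l[of a] l[of b] 
        by (smt (verit) powr_ge_zero)
    qed
    then have "bounded K" by (rule bounded_subset[OF bounded_Times[OF bounded_cball bounded_cball]])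
    ultimately show ?thesis by (simp add: compact_eq_bounded_closed)
  qed
  have cont: "continuous_on K (\<lambda>x. D (fst x) (snd x))"
    unfolding D_def using assms by (intro continuous_intros continuous_on_powr') auto
  \<comment> \<open>On \<open>K\<close> the two points differ, because
    \<open>e \<le> norm (a - b) powr p\<close> with \<open>e > 0\<close>; so the continuous defect
    \<open>D\<close> has a positive minimum there.\<close>
  obtain d where d: "d > 0" "\<And>a b. (a, b) \<in> K \<Longrightarrow> d \<le> D a b"
  proof (cases "K = {}")
    case True then show ?thesis using that[of 1] by auto
  next
    case False
    then obtain x0 where x0: "x0 \<in> K" "\<And>x. x \<in> K \<Longrightarrow> D (fst x0) (snd x0) \<le> D (fst x) (snd x)"
      using continuous_attains_inf[OF K False cont] by auto
    have "fst x0 \<noteq> snd x0" using x0(1) assms by (auto simp: K_def)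
    then have "0 < D (fst x0) (snd x0)" 
      using norm_powr_strictly_midconvex[OF assms(1)] by (auto simp: D_def)
    then show ?thesis using x0 that[of "D (fst x0) (snd x0)"] by auto
  qed
  \<comment> \<open>On \<open>K\<close> the left-hand side is at most \<open>2 powr p\<close> and
    the defect at least \<open>d\<close>.\<close>
  define C where "C = 2 powr p / d"
  have "norm (a - b) powr p \<le> e * (norm a powr p + norm b powr p) + C * D a b" for a b :: 'b
  proof (cases "norm a powr p + norm b powr p = 0")
    case True
    then have "norm a powr p = 0" "norm b powr p = 0" by (smt (verit) powr_ge_zero)+
    then show ?thesis by (simp add: D_def)
  next
    case False
    define s where "s = norm a powr p + norm b powr p"
    have s: "s > 0" using False unfolding s_def by (smt (verit) powr_ge_zero)
    define l where "l = s powr (1/p)"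
    have l: "l > 0" "l powr p = s" using s assms by (auto simp: l_def powr_powr)
    define a' where "a' = (1/l) *\<^sub>R a" 
    define b' where "b' = (1/l) *\<^sub>R b"
    have ab: "a = l *\<^sub>R a'" "b = l *\<^sub>R b'" using l by (auto simp: a'_def b'_def)
    have hom: "norm (l *\<^sub>R x) powr p = s * norm x powr p" for x :: 'b
      using l by (simp add: powr_mult)
    have one: "norm a' powr p + norm b' powr p = 1"
      using s s_def unfolding ab hom by (simp add: distrib_left[symmetric])
    have Dh: "D a b = s * D a' b'"
      unfolding D_def ab hom using hom[of "(1/2) *\<^sub>R (a' + b')"] 
      by (simp add: hom distrib_left[symmetric] right_diff_distrib scaleR_right_distrib mult.commute)
    have dh: "norm (a - b) powr p = s * norm (a' - b') powr p"
      using hom[of "a' - b'"] unfolding ab scaleR_diff_right .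
    have "norm (a' - b') powr p \<le> e + C * D a' b'"
    proof (cases "e \<le> norm (a' - b') powr p")
      case True
      then have "d \<le> D a' b'" using one d by (auto simp: K_def)
      then have "1 \<le> D a' b' / d" using d by simp
      then have c: "2 powr p \<le> C * D a' b'" 
        using mult_left_mono[of 1 "D a' b' / d" "2 powr p"] by (simp add: C_def)
      have "norm (a' - b') powr p \<le> (norm a' + norm b') powr p"
        using assms norm_triangle_ineq4 by (intro powr_mono2) auto
      also have "\<dots> \<le> 2 powr p * (norm a' powr p + norm b' powr p)"
        using assms by (intro powr_add_le) auto
      finally show ?thesis using c one assms by simp
    next
      case False
      have "0 \<le> C * D a' b'" using D0 d by (simp add: C_def)
      with False show ?thesis by linarith
    qed
    then have "s * norm (a' - b') powr p \<le> s * (e + C * D a' b')" using s by simp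
    then show ?thesis unfolding dh Dh s_def[symmetric] by (simp add: algebra_simps)
  qed
  moreover have "C \<ge> 0" using d by (simp add: C_def)
  ultimately show ?thesis unfolding D_def by blast
qed

text \<open>The mean value theorem gives the mixed term
  \<open>norm b powr (r - 1) * norm (a - b)\<close>, which is split according to whether
  \<open>norm (a - b)\<close> is below or above \<open>h * norm b\<close>.\<close>

lemma powr_diff_absorb:
  fixes r e :: real
  assumes "1 < r" "0 < e"
  shows "\<exists>C\<ge>0. \<forall>a b :: 'b::real_normed_vector.
    \<bar>norm a powr r - norm b powr r\<bar> \<le> e * norm b powr r + C * norm (a - b) powr r"
proof -
  define c where "c = r * 2 powr (r - 1)"
  \<comment> \<open>Chosen so that the factor \<open>c\<close> in front of the mixed term turns
    \<open>h\<close> into \<open>e\<close>.\<close>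
  define h where "h = e / c"
  have c: "c > 0" and h: "h > 0" using assms by (auto simp: c_def h_def)
  define C where "C = c * (h powr (1 - r) + 1)"
  have "\<bar>norm a powr r - norm b powr r\<bar> \<le> e * norm b powr r + C * norm (a - b) powr r" for a b :: 'b
  proof -
    define y where "y = norm b"
    define d where "d = norm (a - b)"
    have yd: "0 \<le> y" "0 \<le> d" by (auto simp: y_def d_def)
    have "\<bar>norm a powr r - y powr r\<bar> \<le> r * (max y (norm a)) powr (r - 1) * \<bar>norm a - y\<bar>"
      using assms by (intro abs_powr_diff_le) (auto simp: y_def)
    also have "\<dots> \<le> r * (y + d) powr (r - 1) * d"
      using assms norm_triangle_ineq3[of a b] norm_triangle_sub[of a b]
      by (intro mult_mono mult_left_mono powr_mono2) (auto simp: y_def d_def le_max_iff_disj)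
    also have "\<dots> \<le> r * (2 powr (r - 1) * (y powr (r - 1) + d powr (r - 1))) * d"
      using assms yd by (intro mult_right_mono mult_left_mono powr_add_le) auto
    also have "\<dots> = c * (y powr (r - 1) * d + d powr (r - 1) * d)"
      by (simp add: c_def algebra_simps)
    also have dr: "d powr (r - 1) * d = d powr r"
      using yd assms by (cases "d = 0") (auto simp: powr_diff)
    also have "y powr (r - 1) * d \<le> h * y powr r + h powr (1 - r) * d powr r"
    proof (cases "d \<le> h * y")
      case True
      then have "y powr (r - 1) * d \<le> y powr (r - 1) * (h * y)" by (intro mult_left_mono) auto
      also have "\<dots> = h * y powr r" using yd by (cases "y = 0") (auto simp: powr_diff)
      also have "\<dots> \<le> h * y powr r + h powr (1 - r) * d powr r" by simp
      finally show ?thesis .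
    next
      case False
      then have "y \<le> d / h" using h by (simp add: field_simps)
      then have "y powr (r - 1) * d \<le> (d / h) powr (r - 1) * d" 
        using yd assms by (intro mult_right_mono powr_mono2) auto
      also have "\<dots> = (1 / h powr (r - 1)) * (d powr (r - 1) * d)" 
        using yd h by (simp add: powr_divide)
      also have "1 / h powr (r - 1) = h powr (1 - r)"
        using powr_minus_divide[of h "r - 1"] by simp
      also have "d powr (r - 1) * d = d powr r" by (rule dr)
      also have "h powr (1 - r) * d powr r \<le> h * y powr r + h powr (1 - r) * d powr r" using h by simp
      finally show ?thesis .
    qed
    also have "c * (h * y powr r + h powr (1 - r) * d powr r + d powr r) = e * y powr r + C * d powr r"
      using c by (simp add: C_def h_def algebra_simps)
    finally show ?thesis using c by (simp add: y_def d_def)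
  qed
  moreover have "C \<ge> 0" using c by (simp add: C_def)
  ultimately show ?thesis by blast
qed

subsection \<open>Convergence in \<open>Lp\<close>\<close>

lemma integrable_norm_powr_add:
  fixes f g :: "'a \<Rightarrow> 'b::euclidean_space"
  assumes [measurable]: "f \<in> borel_measurable M" "g \<in> borel_measurable M"
    and "integrable M (\<lambda>x. norm (f x) powr p)" "integrable M (\<lambda>x. norm (g x) powr p)" "0 \<le> p"
  shows "integrable M (\<lambda>x. norm (f x + g x) powr p)"
proof (rule Bochner_Integration.integrable_bound)
  show "integrable M (\<lambda>x. 2 powr p * (norm (f x) powr p + norm (g x) powr p))"
    using assms by auto
  have "norm (f x + g x) powr p \<le> 2 powr p * (norm (f x) powr p + norm (g x) powr p)" for x
  proof -
    have "norm (f x + g x) powr p \<le> (norm (f x) + norm (g x)) powr p"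
      using assms norm_triangle_ineq by (intro powr_mono2) auto
    then show ?thesis using powr_add_le[of "norm (f x)" "norm (g x)" p] assms by auto
  qed
  then show "AE x in M. norm (norm (f x + g x) powr p) \<le> norm (2 powr p * (norm (f x) powr p + norm (g x) powr p))"
    by (auto intro!: AE_I2 order_trans[OF _ abs_ge_self])
qed measurable

lemma integrable_norm_powr_scaleR:
  fixes f :: "'a \<Rightarrow> 'b::euclidean_space"
  assumes "integrable M (\<lambda>x. norm (f x) powr p)"
  shows "integrable M (\<lambda>x. norm (c *\<^sub>R f x) powr p)"
  using assms by (simp add: powr_mult)

lemma integrable_norm_powr_diff:
  fixes f g :: "'a \<Rightarrow> 'b::euclidean_space"
  assumes [measurable]: "f \<in> borel_measurable M" "g \<in> borel_measurable M"
    and "integrable M (\<lambda>x. norm (f x) powr p)" "integrable M (\<lambda>x. norm (g x) powr p)" "0 \<le> p"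
  shows "integrable M (\<lambda>x. norm (f x - g x) powr p)"
  using integrable_norm_powr_add[of f M "\<lambda>x. - g x" p] assms by simp

text \<open>Fatou's lemma for real-valued functions with uniformly bounded integrals, the only
  information available about the sequences below; integrability of the limit is part of the
  conclusion.\<close>

lemma Fatou_bounded:
  fixes h :: "nat \<Rightarrow> 'a \<Rightarrow> real"
  assumes "\<And>n. integrable M (h n)" "\<And>n x. 0 \<le> h n x" "\<And>n. integral\<^sup>L M (h n) \<le> C"
    and [measurable]: "h' \<in> borel_measurable M" and lim: "AE x in M. (\<lambda>n. h n x) \<longlonglongrightarrow> h' x"
  shows "integrable M h'" "integral\<^sup>L M h' \<le> C"
proof -
  have [measurable]: "h n \<in> borel_measurable M" for n using assms(1) by auto
  have pos: "AE x in M. 0 \<le> h' x"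
    using lim by eventually_elim (auto intro: LIMSEQ_le_const assms(2))
  have C: "0 \<le> C" using assms(2,3)[of 0] Bochner_Integration.integral_nonneg[of M "h 0"] by (meson order_trans)
  have "(\<integral>\<^sup>+x. ennreal (h' x) \<partial>M) = (\<integral>\<^sup>+x. liminf (\<lambda>n. ennreal (h n x)) \<partial>M)"
  proof (rule nn_integral_cong_AE)
    show "AE x in M. ennreal (h' x) = liminf (\<lambda>n. ennreal (h n x))"
      using lim
    proof eventually_elim
      case (elim x)
      then have "(\<lambda>n. ennreal (h n x)) \<longlonglongrightarrow> ennreal (h' x)" by (intro tendsto_ennrealI)
      then show ?case using lim_imp_Liminf trivial_limit_sequentially by metis
    qed
  qed
  also have "\<dots> \<le> liminf (\<lambda>n. \<integral>\<^sup>+x. ennreal (h n x) \<partial>M)"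
    by (rule nn_integral_liminf) auto
  also have "\<dots> \<le> ennreal C"
  proof (rule Liminf_le, simp, rule always_eventually, rule allI)
    fix n show "(\<integral>\<^sup>+x. ennreal (h n x) \<partial>M) \<le> ennreal C"
      using assms(1,2,3) by (subst nn_integral_eq_integral) (auto simp: ennreal_leI)
  qed
  finally have *: "(\<integral>\<^sup>+x. ennreal (h' x) \<partial>M) \<le> ennreal C" .
  show int: "integrable M h'"
    using * pos by (intro integrableI_nonneg) (auto simp: less_top[symmetric] top_unique)
  have "ennreal (integral\<^sup>L M h') \<le> ennreal C"
    using * nn_integral_eq_integral[OF int pos] by simp
  then show "integral\<^sup>L M h' \<le> C" using C by simp
qed

text \<open>A form of Vitali's theorem. Subtracting \<open>e * w n\<close> from \<open>\<bar>g n - g'\<bar>\<close> makes dominated convergence applicable.\<close>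

lemma Vitali_convergence:
  fixes g w :: "nat \<Rightarrow> 'a \<Rightarrow> real" and g' :: "'a \<Rightarrow> real"
  assumes "finite_measure M"
    and [measurable]: "\<And>n. g n \<in> borel_measurable M" "g' \<in> borel_measurable M"
    and lim: "AE x in M. (\<lambda>n. g n x) \<longlonglongrightarrow> g' x"
    and w: "\<And>n. integrable M (w n)" "\<And>n x. 0 \<le> w n x" "\<And>n. integral\<^sup>L M (w n) \<le> C"
    and bound: "\<And>e. 0 < e \<Longrightarrow> \<exists>K. \<forall>n x. \<bar>g n x\<bar> \<le> e * w n x + K"
  shows "integrable M g'" "\<And>n. integrable M (g n)"
    "(\<lambda>n. \<integral>x. \<bar>g n x - g' x\<bar> \<partial>M) \<longlonglongrightarrow> 0"
    "(\<lambda>n. integral\<^sup>L M (g n)) \<longlonglongrightarrow> integral\<^sup>L M g'"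
proof -
  interpret finite_measure M by fact
  have [measurable]: "w n \<in> borel_measurable M" for n using w(1) by auto
  obtain K1 where K1: "\<And>n x. \<bar>g n x\<bar> \<le> 1 * w n x + K1" using bound[of 1] by auto
  show gi: "integrable M (g n)" for n
    by (rule Bochner_Integration.integrable_bound[where f="\<lambda>x. w n x + K1"])
      (use w K1 in \<open>auto intro!: AE_I2 order_trans[OF _ abs_ge_self]\<close>)
  have C: "0 \<le> C" using w(2,3)[of 0] Bochner_Integration.integral_nonneg[of M "w 0"] by (meson order_trans)
  have "integrable M (\<lambda>x. \<bar>g' x\<bar>)"
  proof (rule Fatou_bounded(1))
    show "integrable M (\<lambda>x. \<bar>g n x\<bar>)" for n using gi by auto
    show "(\<integral>x. \<bar>g n x\<bar> \<partial>M) \<le> C + K1 * measure M (space M)" for n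
    proof -
      have "(\<integral>x. \<bar>g n x\<bar> \<partial>M) \<le> (\<integral>x. w n x + K1 \<partial>M)"
        using gi w K1 by (intro integral_mono) auto
      also have "\<dots> = integral\<^sup>L M (w n) + K1 * measure M (space M)" using w by simp
      finally show ?thesis using w(3)[of n] by simp
    qed
    show "AE x in M. (\<lambda>n. \<bar>g n x\<bar>) \<longlonglongrightarrow> \<bar>g' x\<bar>" using lim by eventually_elim (intro tendsto_rabs)
  qed auto
  then show g'i: "integrable M g'" using integrable_abs_iff[of g' M] by simp
  show L1: "(\<lambda>n. \<integral>x. \<bar>g n x - g' x\<bar> \<partial>M) \<longlonglongrightarrow> 0"
  proof (rule LIMSEQ_I)
    fix r :: real assume r: "0 < r"
    define e where "e = r / (2 * (C + 1))"
    have e: "0 < e" "e * C < r / 2" using r C by (auto simp: e_def field_simps add_pos_nonneg)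
    obtain K where K: "\<And>n x. \<bar>g n x\<bar> \<le> e * w n x + K" using bound[OF e(1)] by auto
    define f where "f n x = max 0 (\<bar>g n x - g' x\<bar> - e * w n x)" for n x
    have f: "(\<lambda>n. integral\<^sup>L M (f n)) \<longlonglongrightarrow> integral\<^sup>L M (\<lambda>x. 0)"
    proof (rule integral_dominated_convergence[where w="\<lambda>x. \<bar>K\<bar> + \<bar>g' x\<bar>"])
      show "AE x in M. (\<lambda>n. f n x) \<longlonglongrightarrow> 0"
        using lim
      proof eventually_elim
        case (elim x)
        have "(\<lambda>n. \<bar>g n x - g' x\<bar>) \<longlonglongrightarrow> 0"
          using tendsto_rabs[OF tendsto_diff[OF elim tendsto_const[of "g' x"]]] by simp
        moreover have "0 \<le> f n x" "f n x \<le> \<bar>g n x - g' x\<bar>" for n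
          using mult_nonneg_nonneg[OF less_imp_le[OF e(1)] w(2)[of n x]] by (auto simp: f_def)
        ultimately show ?case
          by (intro tendsto_sandwich[of "\<lambda>_. 0" "\<lambda>n. f n x" sequentially "\<lambda>n. \<bar>g n x - g' x\<bar>" 0]) auto
      qed
      show "AE x in M. norm (f n x) \<le> \<bar>K\<bar> + \<bar>g' x\<bar>" for n
      proof (intro AE_I2)
        fix x show "norm (f n x) \<le> \<bar>K\<bar> + \<bar>g' x\<bar>" using K[of n x] by (auto simp: f_def)
      qed
      show "f n \<in> borel_measurable M" for n unfolding f_def by measurable
    qed (use g'i in auto)
    then obtain N where N: "\<And>n. N \<le> n \<Longrightarrow> \<bar>integral\<^sup>L M (f n)\<bar> < r / 2"
      using LIMSEQ_D[OF f, of "r/2"] r by auto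
    have fi: "integrable M (f n)" for n
      unfolding f_def using gi g'i w by (intro integrable_max) auto
    show "\<exists>N. \<forall>n\<ge>N. norm ((\<integral>x. \<bar>g n x - g' x\<bar> \<partial>M) - 0) < r"
    proof (intro exI[of _ N] allI impI)
      fix n assume n: "N \<le> n"
      have "(\<integral>x. \<bar>g n x - g' x\<bar> \<partial>M) \<le> (\<integral>x. f n x + e * w n x \<partial>M)"
        using gi g'i w fi by (intro integral_mono) (auto simp: f_def)
      also have "\<dots> = integral\<^sup>L M (f n) + e * integral\<^sup>L M (w n)" using fi w by simp
      also have "\<dots> < r" using N[OF n] e(2) mult_left_mono[OF w(3)[of n] less_imp_le[OF e(1)]] by linarith
      finally show "norm ((\<integral>x. \<bar>g n x - g' x\<bar> \<partial>M) - 0) < r" by simp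
    qed
  qed
  have "norm (integral\<^sup>L M (g n) - integral\<^sup>L M g') \<le> (\<integral>x. \<bar>g n x - g' x\<bar> \<partial>M)" for n
    using integral_norm_bound[of M "\<lambda>x. g n x - g' x"] gi g'i by simp
  then have "(\<lambda>n. integral\<^sup>L M (g n) - integral\<^sup>L M g') \<longlonglongrightarrow> 0"
    by (intro Lim_null_comparison[OF _ L1]) auto
  then show "(\<lambda>n. integral\<^sup>L M (g n)) \<longlonglongrightarrow> integral\<^sup>L M g'" by (simp add: LIM_zero_iff)
qed

lemma tendsto_Lp_AE_subseq:
  fixes f :: "nat \<Rightarrow> 'a \<Rightarrow> 'b::euclidean_space"
  assumes "0 < p" "\<And>n. integrable M (\<lambda>x. norm (f n x - f' x) powr p)"
    and "(\<lambda>n. \<integral>x. norm (f n x - f' x) powr p \<partial>M) \<longlonglongrightarrow> 0"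
  shows "\<exists>r::nat\<Rightarrow>nat. strict_mono r \<and> (AE x in M. (\<lambda>n. f (r n) x) \<longlonglongrightarrow> f' x)"
proof -
  obtain r :: "nat \<Rightarrow> nat" where r: "strict_mono r" 
    "AE x in M. (\<lambda>n. norm (f (r n) x - f' x) powr p) \<longlonglongrightarrow> 0"
    using tendsto_L1_AE_subseq[of M "\<lambda>n x. norm (f n x - f' x) powr p"] assms by auto
  have "AE x in M. (\<lambda>n. f (r n) x) \<longlonglongrightarrow> f' x"
    using r(2)
  proof eventually_elim
    case (elim x)
    have "(\<lambda>n. (norm (f (r n) x - f' x) powr p) powr (1/p)) \<longlonglongrightarrow> 0 powr (1/p)"
      using elim assms(1) by (intro tendsto_powr') auto
    then have "(\<lambda>n. norm (f (r n) x - f' x)) \<longlonglongrightarrow> 0" using assms(1) by (simp add: powr_powr)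
    then show ?case using LIM_zero_iff tendsto_norm_zero_iff by blast
  qed
  then show ?thesis using r by auto
qed

text \<open>Continuity of the \<open>p\<close>-th power integral under strong convergence;
  integrating \<open>powr_diff_absorb\<close> takes the place of Minkowski's inequality.\<close>

lemma tendsto_integral_norm_powr:
  fixes f :: "nat \<Rightarrow> 'a \<Rightarrow> 'b::euclidean_space"
  assumes "1 < p"
    and [measurable]: "\<And>n. f n \<in> borel_measurable M" "f' \<in> borel_measurable M"
    and int: "\<And>n. integrable M (\<lambda>x. norm (f n x) powr p)" "integrable M (\<lambda>x. norm (f' x) powr p)"
    and lim: "(\<lambda>n. \<integral>x. norm (f n x - f' x) powr p \<partial>M) \<longlonglongrightarrow> 0"
  shows "(\<lambda>n. \<integral>x. norm (f n x) powr p \<partial>M) \<longlonglongrightarrow> (\<integral>x. norm (f' x) powr p \<partial>M)"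
proof (rule LIMSEQ_I)
  fix r :: real assume r: "0 < r"
  define A where "A = (\<integral>x. norm (f' x) powr p \<partial>M)"
  have A: "0 \<le> A" by (auto simp: A_def)
  define e where "e = r / (2 * (A + 1))"
  have e: "0 < e" "e * A < r / 2" using r A by (auto simp: e_def field_simps add_pos_nonneg)
  obtain C where C: "C \<ge> 0" "\<And>a b :: 'b. \<bar>norm a powr p - norm b powr p\<bar> \<le> e * norm b powr p + C * norm (a - b) powr p"
    using powr_diff_absorb[OF assms(1) e(1)] by blast
  have di: "integrable M (\<lambda>x. norm (f n x - f' x) powr p)" for n
    using assms by (intro integrable_norm_powr_diff) auto
  have "0 < r / (2 * (C + 1))" using r C by auto
  from LIMSEQ_D[OF lim this] obtain N where N: "\<And>n. N \<le> n \<Longrightarrow> (\<integral>x. norm (f n x - f' x) powr p \<partial>M) < r / (2 * (C + 1))"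
    by fastforce
  show "\<exists>N. \<forall>n\<ge>N. norm ((\<integral>x. norm (f n x) powr p \<partial>M) - (\<integral>x. norm (f' x) powr p \<partial>M)) < r"
  proof (intro exI[of _ N] allI impI)
    fix n assume n: "N \<le> n"
    have "norm ((\<integral>x. norm (f n x) powr p \<partial>M) - (\<integral>x. norm (f' x) powr p \<partial>M))
      = norm (\<integral>x. norm (f n x) powr p - norm (f' x) powr p \<partial>M)" using int by simp
    also have "\<dots> \<le> (\<integral>x. norm (norm (f n x) powr p - norm (f' x) powr p) \<partial>M)"
      by (rule integral_norm_bound)
    also have "\<dots> \<le> (\<integral>x. e * norm (f' x) powr p + C * norm (f n x - f' x) powr p \<partial>M)"
      using int di C by (intro integral_mono) auto
    also have "\<dots> = e * A + C * (\<integral>x. norm (f n x - f' x) powr p \<partial>M)"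
      using int di by (simp add: A_def)
    also have "\<dots> < r"
    proof -
      have "C * (\<integral>x. norm (f n x - f' x) powr p \<partial>M) \<le> C * (r / (2 * (C + 1)))"
        using N[OF n] C by (intro mult_left_mono) auto
      also have "\<dots> \<le> r / 2" using C r by (simp add: field_simps)
      finally show ?thesis using e by simp
    qed
    finally show "norm ((\<integral>x. norm (f n x) powr p \<partial>M) - (\<integral>x. norm (f' x) powr p \<partial>M)) < r" .
  qed
qed

section \<open>Differentiation under the integral\<close>

text \<open>Dominated convergence along every sequence of increments tending to \<open>0\<close>.
  The bound concerns increments and not derivatives, so \<open>H x\<close> has to be differentiable
  at \<open>0\<close> only.\<close>

lemma has_real_derivative_integral:
  fixes H :: "'a \<Rightarrow> real \<Rightarrow> real"
  assumes H: "\<And>s. integrable M (\<lambda>x. H x s)" and W: "integrable M W"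
    and [measurable]: "D \<in> borel_measurable M"
    and deriv: "AE x in M. (H x has_real_derivative D x) (at 0)"
    and bound: "AE x in M. \<forall>s. \<bar>s\<bar> \<le> 1 \<longrightarrow> \<bar>H x s - H x 0\<bar> \<le> \<bar>s\<bar> * W x"
  shows "integrable M D" "((\<lambda>s. \<integral>x. H x s \<partial>M) has_real_derivative (integral\<^sup>L M D)) (at 0)"
proof -
  have [measurable]: "(\<lambda>x. H x s) \<in> borel_measurable M" for s using H by auto
  have key: "integrable M D \<and> (\<lambda>n. ((\<integral>x. H x (X n) \<partial>M) - (\<integral>x. H x 0 \<partial>M)) / X n) \<longlonglongrightarrow> integral\<^sup>L M D"
    if X: "\<And>n. X n \<noteq> 0" "\<And>n. \<bar>X n\<bar> \<le> 1" "X \<longlonglongrightarrow> 0" for X :: "nat \<Rightarrow> real"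
  proof -
    have lim: "AE x in M. (\<lambda>n. (H x (X n) - H x 0) / X n) \<longlonglongrightarrow> D x"
      using deriv
    proof eventually_elim
      case (elim x)
      then have "((\<lambda>h. (H x h - H x 0) / h) \<longlongrightarrow> D x) (at 0)" by (simp add: DERIV_def)
      then show ?case
        using X by (auto simp: tendsto_at_iff_sequentially comp_def)
    qed
    have bd: "AE x in M. norm ((H x (X n) - H x 0) / X n) \<le> W x" for n
      using bound
    proof eventually_elim
      case (elim x)
      then have "\<bar>H x (X n) - H x 0\<bar> \<le> \<bar>X n\<bar> * W x" using X by blast
      then show ?case using X(1)[of n] by (simp add: field_simps)
    qed
    have "integrable M D" by (rule integrable_dominated_convergence[OF _ _ W lim bd]) auto
    moreover have "(\<lambda>n. \<integral>x. (H x (X n) - H x 0) / X n \<partial>M) \<longlonglongrightarrow> integral\<^sup>L M D"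
      by (rule integral_dominated_convergence[OF _ _ W lim bd]) auto
    ultimately show ?thesis using H by simp
  qed
  show "integrable M D" 
    using key[of "\<lambda>n. 1 / real (Suc n)"] LIMSEQ_inverse_real_of_nat by (auto simp: inverse_eq_divide)
  show "((\<lambda>s. \<integral>x. H x s \<partial>M) has_real_derivative (integral\<^sup>L M D)) (at 0)"
    unfolding DERIV_def tendsto_at_iff_sequentially
  proof (intro allI impI, simp add: comp_def)
    fix X :: "nat \<Rightarrow> real" assume X: "\<forall>i. X i \<noteq> 0" "X \<longlonglongrightarrow> 0"
    \<comment> \<open>The increment bound is available for \<open>\<bar>s\<bar> \<le> 1\<close>
      only, hence the passage to a tail of the sequence.\<close>
    obtain N where N: "\<And>n. N \<le> n \<Longrightarrow> \<bar>X n\<bar> < 1" using LIMSEQ_D[OF X(2), of 1] by auto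
    have "(\<lambda>n. ((\<integral>x. H x (X (n + N)) \<partial>M) - (\<integral>x. H x 0 \<partial>M)) / X (n + N)) \<longlonglongrightarrow> integral\<^sup>L M D"
      using key[of "\<lambda>n. X (n + N)"] X less_imp_le[OF N] LIMSEQ_ignore_initial_segment[OF X(2), of N] by auto
    then show "(\<lambda>n. ((\<integral>x. H x (X n) \<partial>M) - (\<integral>x. H x 0 \<partial>M)) / X n) \<longlonglongrightarrow> integral\<^sup>L M D"
      by (rule LIMSEQ_offset)
  qed
qed

section \<open>Hoelder inequalities and completeness\<close>

text \<open>Young's inequality is integrated after both factors have been normalised; if one of the
  integrals is \<open>0\<close>, normalisation fails but the product vanishes a.e.\<close>

lemma Holder_inequality:
  fixes f g :: "'a \<Rightarrow> real"
  assumes pq: "1 < p" "1 < q" "1/p + 1/q = 1"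
    and [measurable]: "f \<in> borel_measurable M" "g \<in> borel_measurable M"
    and nn: "\<And>x. 0 \<le> f x" "\<And>x. 0 \<le> g x"
    and int: "integrable M (\<lambda>x. f x powr p)" "integrable M (\<lambda>x. g x powr q)"
  shows "integrable M (\<lambda>x. f x * g x)"
    "(\<integral>x. f x * g x \<partial>M) \<le> (\<integral>x. f x powr p \<partial>M) powr (1/p) * (\<integral>x. g x powr q \<partial>M) powr (1/q)"
proof -
  have Y: "f x * g x \<le> f x powr p / p + g x powr q / q" for x
    using Youngs_inequality[OF pq nn] .
  show I: "integrable M (\<lambda>x. f x * g x)"
    by (rule Bochner_Integration.integrable_bound[where f="\<lambda>x. f x powr p / p + g x powr q / q"])
      (use int nn Y in \<open>auto intro!: AE_I2 order_trans[OF _ abs_ge_self]\<close>)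
  define F where "F = (\<integral>x. f x powr p \<partial>M)"
  define G where "G = (\<integral>x. g x powr q \<partial>M)"
  have FG: "0 \<le> F" "0 \<le> G" by (auto simp: F_def G_def)
  show "(\<integral>x. f x * g x \<partial>M) \<le> F powr (1/p) * G powr (1/q)"
  proof (cases "F = 0 \<or> G = 0")
    case True
    have "AE x in M. f x * g x = 0"
    proof (cases "F = 0")
      case True
      then have "AE x in M. f x powr p = 0"
        using integral_nonneg_eq_0_iff_AE[OF int(1)] by (simp add: F_def)
      then show ?thesis by eventually_elim auto
    next
      case False
      then have "AE x in M. g x powr q = 0"
        using True integral_nonneg_eq_0_iff_AE[OF int(2)] by (simp add: G_def)
      then show ?thesis by eventually_elim auto
    qed
    then have "(\<integral>x. f x * g x \<partial>M) = (\<integral>x. 0 \<partial>M)" by (intro integral_cong_AE) auto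
    then show ?thesis using True by auto
  next
    case False
    then have p: "0 < F" "0 < G" using FG by auto
    define a where "a = F powr (1/p)"
    define b where "b = G powr (1/q)"
    have ab: "0 < a" "0 < b" "a powr p = F" "b powr q = G" using p pq by (auto simp: a_def b_def powr_powr)
    have "(\<integral>x. (f x / a) * (g x / b) \<partial>M) \<le> (\<integral>x. f x powr p / (p * F) + g x powr q / (q * G) \<partial>M)"
    proof (rule integral_mono)
      show "integrable M (\<lambda>x. (f x / a) * (g x / b))" using I by simp
      show "integrable M (\<lambda>x. f x powr p / (p * F) + g x powr q / (q * G))" using int by simp
      fix x
      have "(f x / a) * (g x / b) \<le> (f x / a) powr p / p + (g x / b) powr q / q"
        using Youngs_inequality[OF pq, of "f x / a" "g x / b"] nn ab by simp
      then show "(f x / a) * (g x / b) \<le> f x powr p / (p * F) + g x powr q / (q * G)"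
        using nn ab by (simp add: powr_divide mult.commute)
    qed
    also have "\<dots> = F / (p * F) + G / (q * G)" using int by (simp add: F_def G_def)
    also have "\<dots> = 1" using p pq by simp
    finally have "(\<integral>x. f x * g x \<partial>M) / (a * b) \<le> 1" by simp
    then show ?thesis using ab unfolding a_def[symmetric] b_def[symmetric] by (simp add: field_simps)
  qed
qed

text \<open>The weighted AM-GM inequality for the normalised functions \<open>g j x / G j\<close>,
  integrated. The lower bound \<open>c\<close> keeps the integrals \<open>G j\<close> and the
  arguments of the logarithms positive; the upper bound gives integrability on a finite measure
  space.\<close>

lemma generalized_Holder_inequality:
  fixes g :: "'i \<Rightarrow> 'a \<Rightarrow> real"
  assumes "finite_measure M" "measure M (space M) > 0"
    and J: "finite J" "\<And>j. j \<in> J \<Longrightarrow> 0 \<le> w j" "sum w J = 1"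
    and [measurable]: "\<And>j. j \<in> J \<Longrightarrow> g j \<in> borel_measurable M"
    and c: "0 < c" "\<And>j x. j \<in> J \<Longrightarrow> x \<in> space M \<Longrightarrow> c \<le> g j x \<and> g j x \<le> C"
  shows "(\<integral>x. (\<Prod>j\<in>J. g j x powr w j) \<partial>M) \<le> (\<Prod>j\<in>J. (\<integral>x. g j x \<partial>M) powr w j)"
proof -
  interpret finite_measure M by fact
  have int: "integrable M (g j)" if "j \<in> J" for j
    by (rule integrable_const_bound[where B=C]) (use c that in \<open>auto intro!: AE_I2 simp: abs_le_iff intro: order_trans\<close>, smt (verit))
  define G where "G j = (\<integral>x. g j x \<partial>M)" for j
  have G: "0 < G j" if "j \<in> J" for j
  proof -
    have "0 < c * measure M (space M)" using assms by simp
    also have "\<dots> = (\<integral>x. c \<partial>M)" by simp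
    also have "\<dots> \<le> G j" unfolding G_def using c int that by (intro integral_mono) auto
    finally show ?thesis .
  qed
  define P where "P = (\<Prod>j\<in>J. G j powr w j)"
  have P: "0 < P" unfolding P_def using G by (intro prod_pos) (auto simp: less_le)
  have pt: "(\<Prod>j\<in>J. g j x powr w j) \<le> P * (\<Sum>j\<in>J. w j * (g j x / G j))" if x: "x \<in> space M" for x
  proof -
    have "(\<Prod>j\<in>J. (g j x / G j) powr w j) \<le> (\<Sum>j\<in>J. w j * (g j x / G j))"
      using J G c x by (intro weighted_arith_geo_mean) (auto intro!: divide_pos_pos intro: less_le_trans)
    moreover have "(\<Prod>j\<in>J. (g j x / G j) powr w j) = (\<Prod>j\<in>J. g j x powr w j) / P"
      unfolding P_def prod_dividef[symmetric]
      by (intro prod.cong refl powr_divide)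
    ultimately show ?thesis using P by (simp add: field_simps)
  qed
  have "(\<integral>x. (\<Prod>j\<in>J. g j x powr w j) \<partial>M) \<le> (\<integral>x. P * (\<Sum>j\<in>J. w j * (g j x / G j)) \<partial>M)"
  proof (rule integral_mono')
    show "integrable M (\<lambda>x. P * (\<Sum>j\<in>J. w j * (g j x / G j)))" using int by simp
    show "0 \<le> P * (\<Sum>j\<in>J. w j * (g j x / G j))" if "x \<in> space M" for x
      using order_trans[OF _ pt[OF that]] by (simp add: prod_nonneg)
  qed (use pt in auto)
  also have "\<dots> = P * (\<Sum>j\<in>J. w j * (integral\<^sup>L M (g j) / G j))" using int by simp
  also have "(\<Sum>j\<in>J. w j * (integral\<^sup>L M (g j) / G j)) = sum w J"
    using G by (intro sum.cong) (auto simp: less_le G_def[symmetric])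
  finally show ?thesis using J by (simp add: P_def G_def)
qed


text \<open>Riesz-Fischer: a rapidly converging subsequence converges a.e., and Fatou's lemma
  carries the Cauchy estimate over to the limit, for the whole sequence.\<close>

lemma Lp_complete:
  fixes f :: "nat \<Rightarrow> 'a \<Rightarrow> 'b::euclidean_space"
  assumes "1 \<le> p"
    and [measurable]: "\<And>n. f n \<in> borel_measurable M"
    and int: "\<And>n. integrable M (\<lambda>x. norm (f n x) powr p)"
    and cauchy: "\<And>e. 0 < e \<Longrightarrow> \<exists>N. \<forall>m\<ge>N. \<forall>n\<ge>N. (\<integral>x. norm (f m x - f n x) powr p \<partial>M) < e"
  obtains f' where "f' \<in> borel_measurable M" "integrable M (\<lambda>x. norm (f' x) powr p)"
    "(\<lambda>n. \<integral>x. norm (f n x - f' x) powr p \<partial>M) \<longlonglongrightarrow> 0"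
proof -
  have di: "integrable M (\<lambda>x. norm (f m x - f n x) powr p)" for m n
    using assms by (intro integrable_norm_powr_diff) auto
  \<comment> \<open>The factor \<open>2 powr (- real k * p)\<close> pays for the weight in
    \<open>d k\<close>, so that the weighted differences are still summable in mean; summability at
    a point then forces consecutive terms to differ by at most \<open>(1/2)^k\<close>
    eventually.\<close>
  have ex: "\<exists>N. \<forall>m\<ge>N. \<forall>n\<ge>N. (\<integral>x. norm (f m x - f n x) powr p \<partial>M) < (1/2) ^ k * 2 powr (- real k * p)" for k
    by (rule cauchy) auto
  then obtain N where N: "\<And>k m n. N k \<le> m \<Longrightarrow> N k \<le> n \<Longrightarrow> (\<integral>x. norm (f m x - f n x) powr p \<partial>M) < (1/2) ^ k * 2 powr (- real k * p)"
    by metis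
  \<comment> \<open>A sum of the thresholds instead of a maximum: it lies above \<open>N k\<close>
    and above \<open>k\<close>, and \<open>r (Suc k)\<close> lies above \<open>N k\<close> as
    well.\<close>
  define r where "r k = (\<Sum>i\<le>k. N i) + k" for k
  have rN: "N k \<le> r k" for k unfolding r_def by (simp add: member_le_sum trans_le_add1)
  have rN': "N k \<le> r (Suc k)" for k 
    using rN[of k] by (simp add: r_def)
  define d where "d k x = 2 powr (real k * p) * norm (f (r k) x - f (r (Suc k)) x) powr p" for k x
  have dk: "(\<integral>\<^sup>+x. ennreal (d k x) \<partial>M) \<le> ennreal ((1/2)^k)" for k
  proof -
    have "(\<integral>\<^sup>+x. ennreal (d k x) \<partial>M) = ennreal (integral\<^sup>L M (d k))"
      unfolding d_def using di by (intro nn_integral_eq_integral) auto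
    also have "integral\<^sup>L M (d k) = 2 powr (real k * p) * (\<integral>x. norm (f (r k) x - f (r (Suc k)) x) powr p \<partial>M)"
      unfolding d_def by simp
    also have "\<dots> \<le> 2 powr (real k * p) * ((1/2) ^ k * 2 powr (- real k * p))"
      using N[OF rN rN', of k] by (intro mult_left_mono) auto
    also have "\<dots> = (1/2)^k" by (simp add: powr_minus field_simps)
    finally show ?thesis by (simp add: ennreal_leI)
  qed
  have "(\<integral>\<^sup>+x. (\<Sum>k. ennreal (d k x)) \<partial>M) = (\<Sum>k. \<integral>\<^sup>+x. ennreal (d k x) \<partial>M)"
    unfolding d_def by (intro nn_integral_suminf) measurable
  also have "\<dots> \<le> (\<Sum>k. ennreal ((1/2)^k))" by (intro suminf_le dk) auto
  also have "\<dots> = ennreal 2"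
  proof (rule suminf_ennreal_eq)
    show "(\<lambda>k. (1/2::real)^k) sums 2" using geometric_sums[of "1/2::real"] by simp
  qed simp
  finally have "(\<integral>\<^sup>+x. (\<Sum>k. ennreal (d k x)) \<partial>M) \<noteq> \<infinity>" by (auto simp: top_unique)
  then have "AE x in M. (\<Sum>k. ennreal (d k x)) \<noteq> \<infinity>"
    unfolding d_def by (intro nn_integral_PInf_AE) auto
  then have conv: "AE x in M. convergent (\<lambda>k. f (r k) x)"
  proof eventually_elim
    case (elim x)
    then have "summable (\<lambda>k. d k x)" by (intro summable_suminf_not_top) (auto simp: d_def)
    then have "(\<lambda>k. d k x) \<longlonglongrightarrow> 0" by (rule summable_LIMSEQ_zero)
    then obtain K where K: "\<And>k. K \<le> k \<Longrightarrow> d k x < 1" using LIMSEQ_D[of _ 0 1] by fastforce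
    have le: "norm (f (r (Suc k)) x - f (r k) x) \<le> (1/2)^k" if "K \<le> k" for k
    proof -
      have "d k x = (2 ^ k * norm (f (r k) x - f (r (Suc k)) x)) powr p"
        by (simp add: d_def powr_mult powr_powr[symmetric] powr_realpow)
      then have "(2 ^ k * norm (f (r k) x - f (r (Suc k)) x)) powr p < 1" using K[OF that] by simp
      then have "2 ^ k * norm (f (r k) x - f (r (Suc k)) x) < 1"
        using powr_mono2[of p 1 "2 ^ k * norm (f (r k) x - f (r (Suc k)) x)"] assms(1) by force
      then show ?thesis by (simp add: field_simps norm_minus_commute)
    qed
    have "summable (\<lambda>k. f (r (Suc k)) x - f (r k) x)"
      by (rule summable_comparison_test'[where g="\<lambda>k. (1/2)^k" and N=K]) (use le in auto)
    then have "convergent (\<lambda>n. \<Sum>k<n. f (r (Suc k)) x - f (r k) x)" by (simp add: summable_iff_convergent)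
    then have "convergent (\<lambda>n. f (r n) x - f (r 0) x)" by (simp only: sum_lessThan_telescope[of "\<lambda>k. f (r k) x"])
    then have "convergent (\<lambda>n. (f (r n) x - f (r 0) x) + f (r 0) x)" by (intro convergent_add convergent_const)
    then show ?case by simp
  qed
  define f' where "f' x = lim (\<lambda>k. f (r k) x)" for x
  have f'm [measurable]: "f' \<in> borel_measurable M" unfolding f'_def by measurable
  have lim: "AE x in M. (\<lambda>k. f (r k) x) \<longlonglongrightarrow> f' x"
    using conv by eventually_elim (simp add: f'_def convergent_LIMSEQ_iff)
  have rk: "k \<le> r k" for k by (simp add: r_def)
  \<comment> \<open>Fatou's lemma in the second index along the subsequence: a bound on the
    distances from \<open>f n\<close> to all late terms is inherited by the distance to
    \<open>f'\<close>.\<close>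
  have est: "integrable M (\<lambda>x. norm (f n x - f' x) powr p) \<and> (\<integral>x. norm (f n x - f' x) powr p \<partial>M) \<le> e"
    if "\<And>m. K \<le> m \<Longrightarrow> (\<integral>x. norm (f n x - f m x) powr p \<partial>M) \<le> e" for n K e
  proof -
    have l: "AE x in M. (\<lambda>k. norm (f n x - f (r (k + K)) x) powr p) \<longlonglongrightarrow> norm (f n x - f' x) powr p"
      using lim
    proof eventually_elim
      case (elim x)
      then have "(\<lambda>k. f (r (k + K)) x) \<longlonglongrightarrow> f' x" by (rule LIMSEQ_ignore_initial_segment)
      then show ?case using assms(1) by (intro tendsto_powr' tendsto_intros) auto
    qed
    have "K \<le> r (k + K)" for k using rk[of "k+K"] by simp
    then show ?thesis
      using Fatou_bounded[of M "\<lambda>k x. norm (f n x - f (r (k + K)) x) powr p" e, OF _ _ _ _ l] di that by simp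
  qed
  obtain N1 where N1: "\<And>m n. N1 \<le> m \<Longrightarrow> N1 \<le> n \<Longrightarrow> (\<integral>x. norm (f m x - f n x) powr p \<partial>M) < 1"
    using cauchy[of 1] by auto
  have "integrable M (\<lambda>x. norm (f N1 x - f' x) powr p)"
    using est[of N1 N1 1] N1 less_imp_le by auto
  then have "integrable M (\<lambda>x. norm (f N1 x - (f N1 x - f' x)) powr p)"
    using assms(1) int by (intro integrable_norm_powr_diff[of "f N1" M "\<lambda>x. f N1 x - f' x" p]) simp_all
  then have i: "integrable M (\<lambda>x. norm (f' x) powr p)" by simp
  have "(\<lambda>n. \<integral>x. norm (f n x - f' x) powr p \<partial>M) \<longlonglongrightarrow> 0"
  proof (rule LIMSEQ_I)
    fix e :: real assume e: "0 < e"
    obtain N2 where N2: "\<And>m n. N2 \<le> m \<Longrightarrow> N2 \<le> n \<Longrightarrow> (\<integral>x. norm (f m x - f n x) powr p \<partial>M) < e/2"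
      using cauchy[of "e/2"] e by auto
    have "(\<integral>x. norm (f n x - f' x) powr p \<partial>M) \<le> e/2" if "N2 \<le> n" for n
      using est[of N2 n "e/2"] N2[OF that] less_imp_le by blast
    then show "\<exists>N. \<forall>n\<ge>N. norm ((\<integral>x. norm (f n x - f' x) powr p \<partial>M) - 0) < e"
      using e by (intro exI[of _ N2]) fastforce
  qed
  then show ?thesis using that f'm i by blast
qed

subsection \<open>Smooth functions\<close>

lemma Ck_fun_SucI:
  assumes "\<And>x. (\<phi> has_derivative D x) (at x)" "\<And>i. i \<in> Basis \<Longrightarrow> Ck_fun k (\<lambda>x. D x i)"
  shows "Ck_fun (Suc k) \<phi>"
proof -
  have "frechet_derivative \<phi> (at x) = D x" for x using frechet_derivative_at[OF assms(1)] by simp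
  moreover have "\<phi> differentiable (at x)" for x using assms(1) unfolding differentiable_def by blast
  ultimately show ?thesis using assms(2) by auto
qed

lemma Ck_fun_SucD:
  assumes "Ck_fun (Suc k) \<phi>"
  shows "(\<phi> has_derivative frechet_derivative \<phi> (at x)) (at x)"
    "i \<in> Basis \<Longrightarrow> Ck_fun k (\<lambda>x. frechet_derivative \<phi> (at x) i)"
  using assms by (auto simp: frechet_derivative_works)

lemma Ck_fun_decr: "Ck_fun (Suc k) \<phi> \<Longrightarrow> Ck_fun k \<phi>"
proof (induction k arbitrary: \<phi>)
  case 0
  show ?case
    using has_derivative_continuous[OF Ck_fun_SucD(1)[OF 0]] by (simp add: continuous_at_imp_continuous_on)
next
  case (Suc k)
  show ?case
    by (rule Ck_fun_SucI[OF Ck_fun_SucD(1)[OF Suc.prems]]) (use Suc in auto)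
qed

lemma Ck_fun_const: "Ck_fun k (\<lambda>x. c)"
  by (induction k arbitrary: c) auto

lemma Ck_fun_inner: "Ck_fun k (\<lambda>x. x \<bullet> v)"
proof (cases k)
  case (Suc m)
  show ?thesis unfolding Suc
    by (rule Ck_fun_SucI[where D="\<lambda>x h. h \<bullet> v"]) (auto intro!: derivative_intros Ck_fun_const)
qed (auto intro!: continuous_intros)

lemma Ck_fun_add: "Ck_fun k \<phi> \<Longrightarrow> Ck_fun k \<psi> \<Longrightarrow> Ck_fun k (\<lambda>x. \<phi> x + \<psi> x)"
proof (induction k arbitrary: \<phi> \<psi>)
  case (Suc k)
  show ?case
    by (rule Ck_fun_SucI[OF has_derivative_add[OF Ck_fun_SucD(1)[OF Suc.prems(1)] Ck_fun_SucD(1)[OF Suc.prems(2)]]])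
      (use Suc in auto)
qed (auto intro!: continuous_intros)

lemma Ck_fun_mult: "Ck_fun k \<phi> \<Longrightarrow> Ck_fun k \<psi> \<Longrightarrow> Ck_fun k (\<lambda>x. \<phi> x * \<psi> x)"
proof (induction k arbitrary: \<phi> \<psi>)
  case (Suc k)
  show ?case
    by (rule Ck_fun_SucI[OF has_derivative_mult[OF Ck_fun_SucD(1)[OF Suc.prems(1)] Ck_fun_SucD(1)[OF Suc.prems(2)]]])
      (use Suc in \<open>auto intro!: Ck_fun_add Suc.IH Ck_fun_decr[of k \<phi>] Ck_fun_decr[of k \<psi>]\<close>)
qed (auto intro!: continuous_intros)

lemma Ck_fun_prod: "finite A \<Longrightarrow> (\<And>i. i \<in> A \<Longrightarrow> Ck_fun k (f i)) \<Longrightarrow> Ck_fun k (\<lambda>x. \<Prod>i\<in>A. f i x)"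
  by (induction A rule: finite_induct) (auto intro!: Ck_fun_const Ck_fun_mult)

lemma Ck_fun_inverse: "Ck_fun k \<phi> \<Longrightarrow> (\<And>x. \<phi> x \<noteq> 0) \<Longrightarrow> Ck_fun k (\<lambda>x. inverse (\<phi> x))"
proof (induction k arbitrary: \<phi>)
  case (Suc k)
  have k: "Ck_fun k (\<lambda>x. inverse (\<phi> x))" using Suc Ck_fun_decr by blast
  show ?case
  proof (rule Ck_fun_SucI[OF Deriv.has_derivative_inverse[OF _ Ck_fun_SucD(1)[OF Suc.prems(1)]]])
    fix i :: 'a assume i: "i \<in> Basis"
    have "Ck_fun k (\<lambda>x. (-1) * (inverse (\<phi> x) * frechet_derivative \<phi> (at x) i * inverse (\<phi> x)))"
      by (intro Ck_fun_mult Ck_fun_const k Ck_fun_SucD(2)[OF Suc.prems(1) i])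
    then show "Ck_fun k (\<lambda>x. - (inverse (\<phi> x) * frechet_derivative \<phi> (at x) i * inverse (\<phi> x)))" by simp
  qed (use Suc in auto)
qed (auto intro!: continuous_intros)

text \<open>Induction on \<open>k\<close> for a single outer function would stop at its derivative.
  A family indexed by \<open>P\<close> that is closed under differentiation lets the hypothesis be
  applied to \<open>E (D P)\<close>.\<close>

lemma Ck_fun_compose_family:
  fixes E :: "'p \<Rightarrow> real \<Rightarrow> real"
  assumes E: "\<And>P t. (E P has_real_derivative E (D P) t) (at t)"
  shows "Ck_fun k \<phi> \<Longrightarrow> Ck_fun k (\<lambda>x. E P (\<phi> x))"
proof (induction k arbitrary: P \<phi>)
  case 0
  have "continuous_on UNIV (E P)" using E DERIV_isCont continuous_at_imp_continuous_on by blast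
  then show ?case using 0 by (auto intro: continuous_on_compose2)
next
  case (Suc k)
  have "((\<lambda>x. E P (\<phi> x)) has_derivative (\<lambda>h. frechet_derivative \<phi> (at x) h * E (D P) (\<phi> x))) (at x)" for x
    using has_derivative_compose[OF Ck_fun_SucD(1)[OF Suc.prems] has_field_derivative_imp_has_derivative[OF E]]
    by (simp add: mult.commute)
  then show ?case
    by (rule Ck_fun_SucI) (use Suc Ck_fun_decr in \<open>auto intro!: Ck_fun_mult\<close>)
qed

lemma Ck_fun_arctan: "Ck_fun k \<phi> \<Longrightarrow> Ck_fun k (\<lambda>x. arctan (\<phi> x))"
proof (cases k)
  case (Suc m)
  assume k: "Ck_fun k \<phi>"
  have ne: "1 + \<phi> x * \<phi> x \<noteq> 0" for x by (metis add_pos_nonneg less_irrefl zero_le_square zero_less_one)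
  have "((\<lambda>x. arctan (\<phi> x)) has_derivative (\<lambda>h. frechet_derivative \<phi> (at x) h * inverse (1 + \<phi> x * \<phi> x))) (at x)" for x
    using has_derivative_compose[OF Ck_fun_SucD(1)[OF k[unfolded Suc]] has_field_derivative_imp_has_derivative[OF DERIV_arctan]]
    by (simp add: mult.commute power2_eq_square)
  then show ?thesis unfolding Suc
    by (rule Ck_fun_SucI) (use ne k Suc Ck_fun_decr in \<open>auto intro!: Ck_fun_mult Ck_fun_inverse Ck_fun_add Ck_fun_const\<close>)
qed (auto intro!: continuous_intros)

subsection \<open>Bump functions\<close>

text \<open>The derivatives of the flat function \<open>exp (- 1 / t)\<close>, extended by
  \<open>0\<close>, all have this form; carrying the polynomial as an index makes the family closed
  under differentiation.\<close>

definition exp_inv_poly :: "real poly \<Rightarrow> real \<Rightarrow> real" where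
  "exp_inv_poly P t = (if t > 0 then poly P (1 / t) * exp (- (1 / t)) else 0)"

lemma poly_times_exp_neg_tendsto_0: "((\<lambda>s::real. poly P s * exp (- s)) \<longlongrightarrow> 0) at_top"
proof -
  have "((\<lambda>s::real. \<Sum>i\<le>degree P. coeff P i * (s ^ i / exp s)) \<longlongrightarrow> (\<Sum>i\<le>degree P. coeff P i * 0)) at_top"
    by (intro tendsto_intros tendsto_power_div_exp_0)
  moreover have "(\<Sum>i\<le>degree P. coeff P i * (s ^ i / exp s)) = poly P s * exp (- s)" for s
    unfolding poly_altdef sum_distrib_right by (intro sum.cong refl) (simp add: exp_minus field_simps)
  ultimately show ?thesis by simp
qed

text \<open>With \<open>s = 1 / t\<close>, the derivative of \<open>s\<close> is
  \<open>- s\<^sup>2\<close>, so that of \<open>poly P s * exp (- s)\<close> is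
  \<open>s\<^sup>2 * (P - P')(s) * exp (- s)\<close>, which explains the factor
  \<open>[:0, 0, 1:]\<close>. At \<open>0\<close> the right quotient is a polynomial in
  \<open>1 / h\<close> times \<open>exp (- 1 / h)\<close>.\<close>

lemma exp_inv_poly_has_derivative:
  "(exp_inv_poly P has_real_derivative exp_inv_poly ([:0, 0, 1:] * (P - pderiv P)) t) (at t)"
proof -
  consider "t > 0" | "t < 0" | "t = 0" by linarith
  then show ?thesis
  proof cases
    case 1
    have "((\<lambda>t. poly P (1 / t) * exp (- (1 / t))) has_real_derivative 
        (poly (pderiv P) (1 / t) * (- (1 / t^2)) * exp (- (1 / t)) + poly P (1/t) * (exp (- (1/t)) * (1 / t^2)))) (at t)"
      using 1 by (auto intro!: derivative_eq_intros DERIV_chain2[OF poly_DERIV] simp: field_simps power2_eq_square)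
    moreover have "poly (pderiv P) (1 / t) * (- (1 / t^2)) * exp (- (1 / t)) + poly P (1/t) * (exp (- (1/t)) * (1 / t^2))
      = exp_inv_poly ([:0, 0, 1:] * (P - pderiv P)) t"
      using 1 by (simp add: exp_inv_poly_def field_simps power2_eq_square)
    ultimately have *: "((\<lambda>t. poly P (1 / t) * exp (- (1 / t))) has_real_derivative exp_inv_poly ([:0, 0, 1:] * (P - pderiv P)) t) (at t)"
      by simp
    show ?thesis
      by (rule has_field_derivative_transform_within_open[OF *, where S="{0<..}"]) (use 1 in \<open>auto simp: exp_inv_poly_def\<close>)
  next
    case 2
    have *: "((\<lambda>t. 0) has_real_derivative exp_inv_poly ([:0, 0, 1:] * (P - pderiv P)) t) (at t)"
      using 2 by (simp add: exp_inv_poly_def)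
    show ?thesis
      by (rule has_field_derivative_transform_within_open[OF *, where S="{..<0}"]) (use 2 in \<open>auto simp: exp_inv_poly_def\<close>)
  next
    case 3
    have "((\<lambda>h. exp_inv_poly P h / h) \<longlongrightarrow> 0) (at_right 0)"
    proof -
      have "((\<lambda>h::real. poly ([:0, 1:] * P) (inverse h) * exp (- inverse h)) \<longlongrightarrow> 0) (at_right 0)"
        by (rule filterlim_compose[OF poly_times_exp_neg_tendsto_0 filterlim_inverse_at_top_right])
      moreover have "\<forall>\<^sub>F h in at_right 0. poly ([:0, 1:] * P) (inverse h) * exp (- inverse h) = exp_inv_poly P h / h"
        by (rule eventually_at_rightI[of 0 1]) (auto simp: exp_inv_poly_def field_simps)
      ultimately show ?thesis by (rule Lim_transform_eventually)
    qed
    moreover have "((\<lambda>h. exp_inv_poly P h / h) \<longlongrightarrow> 0) (at_left 0)"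
    proof -
      have "\<forall>\<^sub>F h in at_left (0::real). 0 = exp_inv_poly P h / h"
        by (rule eventually_at_leftI[of "-1"]) (auto simp: exp_inv_poly_def)
      then show ?thesis by (rule Lim_transform_eventually[OF tendsto_const])
    qed
    ultimately have "((\<lambda>h. exp_inv_poly P h / h) \<longlongrightarrow> 0) (at 0)" by (simp add: filterlim_split_at)
    then show ?thesis using 3 by (simp add: DERIV_def exp_inv_poly_def)
  qed
qed

lemma Ck_fun_exp_inv_poly: "Ck_fun k \<phi> \<Longrightarrow> Ck_fun k (\<lambda>x. exp_inv_poly P (\<phi> x))"
  by (rule Ck_fun_compose_family[where E=exp_inv_poly and D="\<lambda>P. [:0, 0, 1:] * (P - pderiv P)", OF exp_inv_poly_has_derivative])

text \<open>Each factor has the form \<open>exp (- 1 / (n * c))\<close> inside the box, hence tends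
  to \<open>1\<close> as \<open>n\<close> grows, while outside the box some factor is
  \<open>0\<close>. The bumps are thus smooth functions with values in \<open>[0, 1]\<close> that
  converge to the indicator of the open box.\<close>

definition bump :: "'a::euclidean_space \<Rightarrow> 'a \<Rightarrow> nat \<Rightarrow> 'a \<Rightarrow> real" where
  "bump a b n x = (\<Prod>i\<in>Basis. exp_inv_poly 1 (real n * (x \<bullet> i - a \<bullet> i)) * exp_inv_poly 1 (real n * (b \<bullet> i - x \<bullet> i)))"

lemma Ck_fun_bump: "Ck_fun k (bump a b n)"
proof -
  have 1: "Ck_fun k (\<lambda>x::'a. real n * (x \<bullet> i + (- (a \<bullet> i))))" for i
    by (intro Ck_fun_mult Ck_fun_add Ck_fun_const Ck_fun_inner)
  have 2: "Ck_fun k (\<lambda>x::'a. real n * (b \<bullet> i + (-1) * (x \<bullet> i)))" for i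
    by (intro Ck_fun_mult Ck_fun_add Ck_fun_const Ck_fun_inner)
  show ?thesis unfolding bump_def
    using Ck_fun_mult[OF Ck_fun_exp_inv_poly[OF 1] Ck_fun_exp_inv_poly[OF 2]]
    by (intro Ck_fun_prod) (simp_all)
qed

lemma bump_outside:
  assumes "x \<notin> box a b"
  shows "bump a b n x = 0"
proof -
  obtain i where i: "i \<in> Basis" "x \<bullet> i - a \<bullet> i \<le> 0 \<or> b \<bullet> i - x \<bullet> i \<le> 0"
    using assms by (auto simp: mem_box not_less)
  have z: "exp_inv_poly 1 (real n * c) = 0" if "c \<le> 0" for c
    using mult_nonneg_nonpos[OF of_nat_0_le_iff that, of n] by (simp add: exp_inv_poly_def)
  have "exp_inv_poly 1 (real n * (x \<bullet> i - a \<bullet> i)) * exp_inv_poly 1 (real n * (b \<bullet> i - x \<bullet> i)) = 0"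
    using i(2) z by (metis mult_eq_0_iff)
  then show ?thesis unfolding bump_def using i(1) by (intro prod_zero) auto
qed

lemma bump_bounds: "0 \<le> bump a b n x" "bump a b n x \<le> 1"
proof -
  have e: "0 \<le> exp_inv_poly 1 t" "exp_inv_poly 1 t \<le> 1" for t by (auto simp: exp_inv_poly_def)
  show "0 \<le> bump a b n x" unfolding bump_def by (intro prod_nonneg mult_nonneg_nonneg ballI e)
  show "bump a b n x \<le> 1" unfolding bump_def by (intro prod_le_1 conjI mult_nonneg_nonneg mult_le_one e)
qed

lemma bump_tendsto: "(\<lambda>n. bump a b n x) \<longlonglongrightarrow> indicator (box a b) x"
proof (cases "x \<in> box a b")
  case True
  have *: "(\<lambda>n. exp_inv_poly 1 (real n * c)) \<longlonglongrightarrow> 1" if "c > 0" for c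
  proof -
    have "(\<lambda>n. exp (- ((1 / c) * (1 / real n)))) \<longlonglongrightarrow> exp (- ((1 / c) * 0))"
      by (intro tendsto_intros lim_1_over_n)
    moreover have "\<forall>\<^sub>F n in sequentially. exp (- ((1 / c) * (1 / real n))) = exp_inv_poly 1 (real n * c)"
      using eventually_gt_at_top[of 0] by eventually_elim (use that in \<open>auto simp: exp_inv_poly_def field_simps\<close>)
    ultimately show ?thesis using Lim_transform_eventually by fastforce
  qed
  have "(\<lambda>n. bump a b n x) \<longlonglongrightarrow> (\<Prod>i\<in>(Basis::'a set). 1 * 1)"
    unfolding bump_def using True by (intro tendsto_prod tendsto_mult *) (auto simp: mem_box)
  then show ?thesis using True by simp
qed (simp add: bump_outside)

subsection \<open>Test functions\<close>

lemma test_functionsI: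
  assumes "\<And>k. Ck_fun k \<phi>" "{x. \<phi> x \<noteq> 0} \<subseteq> K" "compact K" "K \<subseteq> \<Omega>"
  shows "\<phi> \<in> test_functions \<Omega>"
proof -
  have "closure {x. \<phi> x \<noteq> 0} \<subseteq> K" using assms by (simp add: closure_minimal compact_imp_closed)
  then show ?thesis using assms compact_Int_closed[of K "closure {x. \<phi> x \<noteq> 0}"]
    by (auto simp: test_functions_def Int_absorb1)
qed

lemma bump_test_function:
  assumes "cbox a b \<subseteq> \<Omega>"
  shows "bump a b n \<in> test_functions \<Omega>"
proof (rule test_functionsI)
  show "{x. bump a b n x \<noteq> 0} \<subseteq> cbox a b"
    using bump_outside[of _ a b n] box_subset_cbox[of a b] by auto
qed (use assms Ck_fun_bump in auto)

lemma test_function_support: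
  assumes "\<phi> \<in> test_functions \<Omega>"
  shows "\<exists>K. compact K \<and> K \<subseteq> \<Omega> \<and> (\<forall>x. x \<notin> K \<longrightarrow> \<phi> x = 0)"
  using assms closure_subset[of "{x. \<phi> x \<noteq> 0}"]
  unfolding test_functions_def by (intro exI[of _ "closure {x. \<phi> x \<noteq> 0}"]) blast

lemma test_function_Ck_fun: "\<phi> \<in> test_functions \<Omega> \<Longrightarrow> Ck_fun k \<phi>"
  unfolding test_functions_def by blast

lemma test_functions_0: "(\<lambda>x. 0) \<in> test_functions \<Omega>"
  by (rule test_functionsI[where K="{}"]) (auto intro: Ck_fun_const)

lemma test_functions_add:
  assumes "\<phi> \<in> test_functions \<Omega>" "\<psi> \<in> test_functions \<Omega>"
  shows "(\<lambda>x. \<phi> x + \<psi> x) \<in> test_functions \<Omega>"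
proof -
  obtain K where K: "compact K" "K \<subseteq> \<Omega>" "\<And>x. x \<notin> K \<Longrightarrow> \<phi> x = 0"
    using test_function_support[OF assms(1)] by blast
  obtain L where L: "compact L" "L \<subseteq> \<Omega>" "\<And>x. x \<notin> L \<Longrightarrow> \<psi> x = 0"
    using test_function_support[OF assms(2)] by blast
  show ?thesis
  proof (rule test_functionsI[where K="K \<union> L"])
    show "{x. \<phi> x + \<psi> x \<noteq> 0} \<subseteq> K \<union> L" using K(3) L(3) by force
  qed (use K L assms[THEN test_function_Ck_fun] in \<open>simp_all add: Ck_fun_add compact_Un\<close>)
qed

lemma test_functions_mult:
  assumes "\<phi> \<in> test_functions \<Omega>" "\<And>k. Ck_fun k \<psi>"
  shows "(\<lambda>x. \<psi> x * \<phi> x) \<in> test_functions \<Omega>"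
proof -
  obtain K where K: "compact K" "K \<subseteq> \<Omega>" "\<And>x. x \<notin> K \<Longrightarrow> \<phi> x = 0"
    using test_function_support[OF assms(1)] by blast
  show ?thesis
  proof (rule test_functionsI[where K="K"])
    show "{x. \<psi> x * \<phi> x \<noteq> 0} \<subseteq> K" using K(3) by force
  qed (use K assms(2) test_function_Ck_fun[OF assms(1)] in \<open>simp_all add: Ck_fun_mult\<close>)
qed

lemma test_functions_cmult: "\<phi> \<in> test_functions \<Omega> \<Longrightarrow> (\<lambda>x. c * \<phi> x) \<in> test_functions \<Omega>"
  by (rule test_functions_mult, assumption, rule Ck_fun_const)

lemma test_functions_diff:
  assumes "\<phi> \<in> test_functions \<Omega>" "\<psi> \<in> test_functions \<Omega>"
  shows "(\<lambda>x. \<phi> x - \<psi> x) \<in> test_functions \<Omega>"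
  using test_functions_add[OF assms(1) test_functions_cmult[OF assms(2), of "-1"]] by simp

section \<open>Gradients of test functions and integration by parts\<close>

definition gradient :: "('a::euclidean_space \<Rightarrow> real) \<Rightarrow> 'a \<Rightarrow> 'a" where
  "gradient \<phi> x = (\<Sum>i\<in>Basis. frechet_derivative \<phi> (at x) i *\<^sub>R i)"

lemma gradient_inner_Basis: "i \<in> Basis \<Longrightarrow> gradient \<phi> x \<bullet> i = frechet_derivative \<phi> (at x) i"
  by (simp add: gradient_def)

lemma has_derivative_gradient:
  assumes "(\<phi> has_derivative D) (at x)"
  shows "(\<phi> has_derivative (\<lambda>h. gradient \<phi> x \<bullet> h)) (at x)"
proof -
  have D: "frechet_derivative \<phi> (at x) = D" using frechet_derivative_at[OF assms] by simp
  have "linear D" using assms has_derivative_linear by blast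
  then have "D h = gradient \<phi> x \<bullet> h" for h
    using Linear_Algebra.linear_componentwise[of D h 1]
    by (simp add: gradient_def D inner_sum_left inner_sum_right inner_commute mult.commute)
  then show ?thesis using assms by (metis (no_types, lifting) ext)
qed

lemma gradient_eqI:
  assumes "(\<phi> has_derivative (\<lambda>h. g \<bullet> h)) (at x)"
  shows "gradient \<phi> x = g"
proof -
  have "frechet_derivative \<phi> (at x) = (\<lambda>h. g \<bullet> h)" using frechet_derivative_at[OF assms] by simp
  then show ?thesis by (simp add: gradient_def euclidean_representation)
qed

lemma test_function_has_derivative:
  assumes "\<phi> \<in> test_functions \<Omega>"
  shows "(\<phi> has_derivative (\<lambda>h. gradient \<phi> x \<bullet> h)) (at x)"
proof -
  have "Ck_fun (Suc 0) \<phi>" using assms by (auto simp: test_functions_def)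
  then show ?thesis using Ck_fun_SucD(1) has_derivative_gradient by blast
qed

lemma gradient_add:
  assumes "\<phi> \<in> test_functions \<Omega>" "\<psi> \<in> test_functions \<Omega>"
  shows "gradient (\<lambda>x. \<phi> x + \<psi> x) x = gradient \<phi> x + gradient \<psi> x"
  using has_derivative_add[OF assms[THEN test_function_has_derivative], of x]
  by (intro gradient_eqI) (simp add: inner_add_left)

lemma gradient_cmult:
  assumes "\<phi> \<in> test_functions \<Omega>"
  shows "gradient (\<lambda>x. c * \<phi> x) x = c *\<^sub>R gradient \<phi> x"
  using has_derivative_mult_right[OF assms[THEN test_function_has_derivative], of c x]
  by (intro gradient_eqI) simp

lemma gradient_diff:
  assumes "\<phi> \<in> test_functions \<Omega>" "\<psi> \<in> test_functions \<Omega>"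
  shows "gradient (\<lambda>x. \<phi> x - \<psi> x) x = gradient \<phi> x - gradient \<psi> x"
  using has_derivative_diff[OF assms[THEN test_function_has_derivative], of x]
  by (intro gradient_eqI) (simp add: inner_diff_left)

lemma gradient_mult:
  assumes "\<phi> \<in> test_functions \<Omega>" "\<psi> \<in> test_functions \<Omega>"
  shows "gradient (\<lambda>x. \<phi> x * \<psi> x) x = \<phi> x *\<^sub>R gradient \<psi> x + \<psi> x *\<^sub>R gradient \<phi> x"
  using has_derivative_mult[OF assms[THEN test_function_has_derivative], of x]
  by (intro gradient_eqI) (simp add: inner_add_left mult.commute)

lemma test_function_continuous:
  assumes "\<phi> \<in> test_functions \<Omega>"
  shows "continuous_on UNIV \<phi>" "continuous_on UNIV (gradient \<phi>)"
proof -
  have "Ck_fun 0 \<phi>" "Ck_fun (Suc 0) \<phi>" using assms unfolding test_functions_def by blast+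
  then show "continuous_on UNIV \<phi>" "continuous_on UNIV (gradient \<phi>)"
    unfolding gradient_def by (auto intro!: continuous_intros)
qed

lemma test_function_outside:
  assumes "\<phi> \<in> test_functions \<Omega>" "x \<notin> \<Omega>"
  shows "\<phi> x = 0" "gradient \<phi> x = 0"
proof -
  obtain K where K: "compact K" "K \<subseteq> \<Omega>" "\<And>x. x \<notin> K \<Longrightarrow> \<phi> x = 0" using test_function_support[OF assms(1)] by blast
  have x: "x \<in> - K" "open (- K)" using K assms compact_imp_closed by auto
  then show "\<phi> x = 0" using K by auto
  have "(\<phi> has_derivative (\<lambda>h. 0 \<bullet> h)) (at x)"
    by (rule has_derivative_transform_within_open[OF _ x(2,1), of "\<lambda>x. 0"]) (use K in auto)
  then show "gradient \<phi> x = 0" by (rule gradient_eqI)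
qed

lemma bounded_continuous_compact_support:
  fixes f :: "'a::euclidean_space \<Rightarrow> 'b::euclidean_space"
  assumes "continuous_on UNIV f" "bounded S" "\<And>x. x \<notin> S \<Longrightarrow> f x = 0"
  obtains B where "0 \<le> B" "\<And>x. norm (f x) \<le> B"
proof -
  have "compact (closure S)" using assms by simp
  then have "compact (f ` closure S)" using assms continuous_on_subset by (intro compact_continuous_image) blast+
  then obtain B where B: "\<And>y. y \<in> f ` closure S \<Longrightarrow> norm y \<le> B" using compact_imp_bounded bounded_iff by metis
  have "norm (f x) \<le> max B 0" for x
    using B[of "f x"] assms(3)[of x] closure_subset[of S] by (cases "x \<in> S") (auto simp: le_max_iff_disj)
  then show ?thesis using that[of "max B 0"] by auto
qed

lemma integrable_continuous_compact_support:
  fixes f :: "'a::euclidean_space \<Rightarrow> 'b::euclidean_space"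
  assumes "continuous_on UNIV f" "bounded S" "\<And>x. x \<notin> S \<Longrightarrow> f x = 0"
  shows "integrable lborel f"
proof -
  have "integrable lborel (\<lambda>x. indicator (closure S) x *\<^sub>R f x)"
    using assms continuous_on_subset by (intro borel_integrable_compact) (auto, blast)
  moreover have "indicator (closure S) x *\<^sub>R f x = f x" for x
    using assms(3)[of x] closure_subset[of S] by (auto simp: indicator_def)
  ultimately show ?thesis by simp
qed

lemma test_function_bounded:
  assumes "\<phi> \<in> test_functions \<Omega>" "bounded \<Omega>"
  obtains B where "0 \<le> B" "\<And>x. \<bar>\<phi> x\<bar> \<le> B" "\<And>x. norm (gradient \<phi> x) \<le> B"
proof -
  obtain B1 where "0 \<le> B1" "\<And>x. norm (\<phi> x) \<le> B1"
    using bounded_continuous_compact_support[OF test_function_continuous(1)[OF assms(1)] assms(2) test_function_outside(1)[OF assms(1)]] by metis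
  moreover obtain B2 where "0 \<le> B2" "\<And>x. norm (gradient \<phi> x) \<le> B2"
    using bounded_continuous_compact_support[OF test_function_continuous(2)[OF assms(1)] assms(2) test_function_outside(2)[OF assms(1)]] by metis
  ultimately show ?thesis using that[of "max B1 B2"] by (auto simp: le_max_iff_disj)
qed

lemma integral_lebesgue_on_eq_lborel:
  fixes f :: "'a::euclidean_space \<Rightarrow> 'b::euclidean_space"
  assumes "\<Omega> \<in> sets lebesgue" "f \<in> borel_measurable borel" "\<And>x. x \<notin> \<Omega> \<Longrightarrow> f x = 0"
  shows "integrable (lebesgue_on \<Omega>) f \<longleftrightarrow> integrable lborel f" "integral\<^sup>L (lebesgue_on \<Omega>) f = integral\<^sup>L lborel f"
proof -
  have "(\<lambda>x. indicator \<Omega> x *\<^sub>R f x) = f" using assms by (auto simp: indicator_def)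
  then show "integrable (lebesgue_on \<Omega>) f \<longleftrightarrow> integrable lborel f" "integral\<^sup>L (lebesgue_on \<Omega>) f = integral\<^sup>L lborel f"
    using assms by (simp_all add: integrable_restrict_space integral_restrict_space integrable_completion integral_completion)
qed

lemma test_function_lipschitz:
  assumes "\<phi> \<in> test_functions \<Omega>" "\<And>x. norm (gradient \<phi> x) \<le> B"
  shows "\<bar>\<phi> x - \<phi> y\<bar> \<le> B * norm (x - y)"
proof -
  have "norm (\<phi> x - \<phi> y) \<le> B * norm (x - y)"
  proof (rule differentiable_bound[where f'="\<lambda>x h. gradient \<phi> x \<bullet> h"])
    show "(\<phi> has_derivative (\<lambda>h. gradient \<phi> x \<bullet> h)) (at x within UNIV)" for x
      using test_function_has_derivative[OF assms(1)] by simp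
    show "onorm ((\<bullet>) (gradient \<phi> x)) \<le> B" for x
    proof (rule onorm_le)
      fix h show "norm (gradient \<phi> x \<bullet> h) \<le> B * norm h"
        using Cauchy_Schwarz_ineq2[of "gradient \<phi> x" h] mult_right_mono[OF assms(2)[of x], of "norm h"] by simp
    qed
  qed auto
  then show ?thesis by simp
qed

lemma integrable_lborel_translate:
  fixes f :: "'a::euclidean_space \<Rightarrow> 'b::{banach, second_countable_topology}"
  assumes "integrable lborel f" shows "integrable lborel (\<lambda>x. f (x + t))"
proof -
  have "integrable (distr lborel borel (\<lambda>x. t + x)) f" using assms by (simp add: lborel_distr_plus)
  then show ?thesis 
    using borel_measurable_integrable[OF assms]
    by (subst (asm) integrable_distr_eq) (simp_all add: add.commute)
qed

lemma integral_lborel_translate: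
  fixes f :: "'a::euclidean_space \<Rightarrow> 'b::{banach, second_countable_topology}"
  assumes [measurable]: "f \<in> borel_measurable borel"
  shows "(\<integral>x. f (x + t) \<partial>lborel) = (\<integral>x. f x \<partial>lborel)"
proof -
  have "(\<integral>x. f x \<partial>lborel) = (\<integral>x. f x \<partial>distr lborel borel (\<lambda>x. t + x))" by (simp add: lborel_distr_plus)
  also have "\<dots> = (\<integral>x. f (t + x) \<partial>lborel)" by (rule integral_distr) (use assms in auto)
  finally show ?thesis by (simp add: add.commute)
qed

text \<open>The integral of \<open>\<phi> (x + s *\<^sub>R v)\<close> does not depend on
  \<open>s\<close>, by translation invariance; its derivative at \<open>s = 0\<close> is the
  integral in question.\<close>

lemma integral_gradient_eq_0:
  assumes \<phi>: "\<phi> \<in> test_functions \<Omega>" and "bounded \<Omega>"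
  shows "(\<integral>x. gradient \<phi> x \<bullet> v \<partial>lborel) = 0"
proof -
  obtain B where B: "0 \<le> B" "\<And>x. norm (gradient \<phi> x) \<le> B" using test_function_bounded[OF assms] by metis
  obtain R where R: "\<And>x. x \<in> \<Omega> \<Longrightarrow> norm x \<le> R" using assms(2) bounded_iff by metis
  have [measurable]: "\<phi> \<in> borel_measurable borel" "gradient \<phi> \<in> borel_measurable borel"
    using test_function_continuous[OF \<phi>] borel_measurable_continuous_onI by auto
  have i: "integrable lborel \<phi>"
    using integrable_continuous_compact_support[OF test_function_continuous(1)[OF \<phi>] assms(2) test_function_outside(1)[OF \<phi>]] .
  \<comment> \<open>For \<open>\<bar>s\<bar> \<le> 1\<close> every translate vanishes outside the
    ball of radius \<open>R + norm v\<close>, and the Lipschitz constant bounds the increments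
    inside.\<close>
  define W where "W x = indicator (cball 0 (R + norm v)) x *\<^sub>R (B * norm v)" for x :: 'a
  have "((\<lambda>s. \<integral>x. \<phi> (x + s *\<^sub>R v) \<partial>lborel) has_real_derivative (\<integral>x. gradient \<phi> x \<bullet> v \<partial>lborel)) (at 0)"
  proof (rule has_real_derivative_integral(2)[where W=W])
    show "integrable lborel (\<lambda>x. \<phi> (x + s *\<^sub>R v))" for s using integrable_lborel_translate[OF i] .
    show "integrable lborel W" unfolding W_def by (intro borel_integrable_compact) auto
    show "AE x in lborel. ((\<lambda>s. \<phi> (x + s *\<^sub>R v)) has_real_derivative gradient \<phi> x \<bullet> v) (at 0)"
    proof (intro AE_I2)
      fix x
      have "((\<lambda>s::real. x + s *\<^sub>R v) has_derivative (\<lambda>s. s *\<^sub>R v)) (at 0)"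
        by (auto intro!: derivative_eq_intros)
      from has_derivative_compose[OF this, of \<phi> "\<lambda>h. gradient \<phi> x \<bullet> h"] test_function_has_derivative[OF \<phi>, of x]
      show "((\<lambda>s. \<phi> (x + s *\<^sub>R v)) has_real_derivative gradient \<phi> x \<bullet> v) (at 0)"
        by (simp add: has_field_derivative_def mult.commute[of _ "gradient \<phi> x \<bullet> v"])
    qed
    show "AE x in lborel. \<forall>s. \<bar>s\<bar> \<le> 1 \<longrightarrow> \<bar>\<phi> (x + s *\<^sub>R v) - \<phi> (x + 0 *\<^sub>R v)\<bar> \<le> \<bar>s\<bar> * W x"
    proof (intro AE_I2 allI impI)
      fix x :: 'a and s :: real assume s: "\<bar>s\<bar> \<le> 1"
      have le: "\<bar>\<phi> (x + s *\<^sub>R v) - \<phi> x\<bar> \<le> \<bar>s\<bar> * (B * norm v)"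
        using test_function_lipschitz[OF \<phi> B(2), of "x + s *\<^sub>R v" x] by (simp add: mult_ac)
      show "\<bar>\<phi> (x + s *\<^sub>R v) - \<phi> (x + 0 *\<^sub>R v)\<bar> \<le> \<bar>s\<bar> * W x"
      proof (cases "x \<in> cball 0 (R + norm v)")
        case True then show ?thesis using le by (simp add: W_def)
      next
        case False
        then have *: "norm x > R + norm v" by auto
        have "norm (s *\<^sub>R v) \<le> norm v" using s by (simp add: mult_left_le_one_le)
        then have "norm (x + s *\<^sub>R v) > R" using * norm_diff_ineq[of x "s *\<^sub>R v"] by linarith
        moreover have "norm x > R" using * norm_ge_zero[of v] by linarith
        ultimately have "x + s *\<^sub>R v \<notin> \<Omega>" "x \<notin> \<Omega>" using R not_le by blast+
        then show ?thesis using test_function_outside(1)[OF \<phi>] False by (simp add: W_def)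
      qed
    qed
  qed measurable
  moreover have "(\<integral>x. \<phi> (x + s *\<^sub>R v) \<partial>lborel) = integral\<^sup>L lborel \<phi>" for s
    by (rule integral_lborel_translate) auto
  ultimately have "((\<lambda>s. integral\<^sup>L lborel \<phi>) has_real_derivative (\<integral>x. gradient \<phi> x \<bullet> v \<partial>lborel)) (at 0)" by simp
  then show ?thesis using DERIV_unique[OF _ DERIV_const] by blast
qed

lemma integrable_test_mult:
  assumes "\<phi> \<in> test_functions \<Omega>" "bounded \<Omega>" "continuous_on UNIV f"
  shows "integrable lborel (\<lambda>x. \<phi> x *\<^sub>R (f x :: 'b :: euclidean_space))"
  using assms test_function_outside[OF assms(1)]
  by (intro integrable_continuous_compact_support[OF _ assms(2)] continuous_intros test_function_continuous(1)[OF assms(1)]) auto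

text \<open>The product of the two test functions is a test function, so its gradient integrates to
  \<open>0\<close>.\<close>

lemma integration_by_parts_test:
  assumes \<phi>: "\<phi> \<in> test_functions \<Omega>" and \<psi>: "\<psi> \<in> test_functions \<Omega>" and "bounded \<Omega>"
  shows "(\<integral>x. \<psi> x * (gradient \<phi> x \<bullet> v) \<partial>lborel) = - (\<integral>x. (gradient \<psi> x \<bullet> v) * \<phi> x \<partial>lborel)"
proof -
  have i: "integrable lborel (\<lambda>x. \<psi> x *\<^sub>R (gradient \<phi> x \<bullet> v))" "integrable lborel (\<lambda>x. \<phi> x *\<^sub>R (gradient \<psi> x \<bullet> v))"
    by (intro integrable_test_mult[OF _ assms(3)] \<phi> \<psi> continuous_intros test_function_continuous(2)[OF \<phi>] test_function_continuous(2)[OF \<psi>])+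
  have "0 = (\<integral>x. gradient (\<lambda>x. \<psi> x * \<phi> x) x \<bullet> v \<partial>lborel)"
    using integral_gradient_eq_0[OF test_functions_mult[OF \<phi> test_function_Ck_fun[OF \<psi>]] assms(3)] by simp
  also have "\<dots> = (\<integral>x. \<psi> x *\<^sub>R (gradient \<phi> x \<bullet> v) + \<phi> x *\<^sub>R (gradient \<psi> x \<bullet> v) \<partial>lborel)"
    using gradient_mult[OF \<psi> \<phi>] by (simp add: inner_add_left)
  also have "\<dots> = (\<integral>x. \<psi> x *\<^sub>R (gradient \<phi> x \<bullet> v) \<partial>lborel) + (\<integral>x. \<phi> x *\<^sub>R (gradient \<psi> x \<bullet> v) \<partial>lborel)"
    by (rule Bochner_Integration.integral_add[OF i])
  finally show ?thesis by (simp add: mult.commute)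
qed

subsection \<open>Uniqueness of weak gradients\<close>

text \<open>The Borel sets over which \<open>g\<close> integrates to \<open>0\<close> form a Dynkin
  system, and the open boxes are a generator stable under intersection.\<close>

lemma AE_eq_0_if_box_integrals_0:
  fixes g :: "'a::euclidean_space \<Rightarrow> real"
  assumes g: "integrable lborel g" and box: "\<And>c d. (\<integral>x. indicator (box c d) x *\<^sub>R g x \<partial>lborel) = 0"
  shows "AE x in lborel. g x = 0"
proof -
  let ?I = "\<lambda>A. \<integral>x. indicator A x *\<^sub>R g x \<partial>lborel"
  have gi: "integrable lborel (\<lambda>x. indicator A x *\<^sub>R g x)" if "A \<in> sets borel" for A
    using that g by (intro integrable_mult_indicator) auto
  have lim: "(\<lambda>n. ?I (F n)) \<longlonglongrightarrow> ?I A"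
    if F: "\<And>n. F n \<in> sets borel" "A \<in> sets borel" "\<And>x. (\<lambda>n. indicator (F n) x :: real) \<longlonglongrightarrow> indicator A x" 
    for F :: "nat \<Rightarrow> 'a set" and A
  proof (rule integral_dominated_convergence[where w="\<lambda>x. \<bar>g x\<bar>"])
    show "AE x in lborel. (\<lambda>n. indicator (F n) x *\<^sub>R g x) \<longlonglongrightarrow> indicator A x *\<^sub>R g x"
      using F(3) by (intro AE_I2 tendsto_intros)
  qed (use g F gi in \<open>auto simp: indicator_def abs_mult\<close>)
  \<comment> \<open>Needed for complements: the whole space is an increasing union of boxes.\<close>
  have U: "?I UNIV = 0"
  proof -
    let ?B = "\<lambda>n::nat. box (- (real n *\<^sub>R One)) (real n *\<^sub>R One) :: 'a set"
    have "incseq ?B" by (auto simp: incseq_def mem_box intro: less_le_trans le_less_trans) (smt (verit) of_nat_mono)+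
    then have "(\<lambda>n. indicator (?B n) x :: real) \<longlonglongrightarrow> indicator UNIV x" for x
      unfolding UN_box_eq_UNIV[symmetric] by (rule LIMSEQ_indicator_incseq)
    then have "(\<lambda>n. ?I (?B n)) \<longlonglongrightarrow> ?I UNIV" by (intro lim) auto
    then show ?thesis using box LIMSEQ_unique[OF _ tendsto_const] by auto
  qed
  have "?I A = 0" if A: "A \<in> sets borel" for A
  proof -
    have A': "A \<in> sigma_sets UNIV (range (\<lambda>(a, b). box a b :: 'a set))"
      using A unfolding borel_eq_box by simp
    have "Int_stable (range (\<lambda>(a, b). box a b :: 'a set))"
      by (auto simp: Int_stable_def box_Int_box)
    moreover have "range (\<lambda>(a, b). box a b :: 'a set) \<subseteq> Pow UNIV" by auto
    ultimately show ?thesis using A'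
    proof (induction rule: sigma_sets_induct_disjoint)
      case (basic A) then show ?case using box by auto
    next
      case empty then show ?case by simp
    next
      case (compl A)
      then have A: "A \<in> sets borel" unfolding borel_eq_box by simp
      have "?I (UNIV - A) = ?I UNIV - ?I A"
      proof -
        have "indicator (UNIV - A) x *\<^sub>R g x = indicator UNIV x *\<^sub>R g x - indicator A x *\<^sub>R g x" for x
          by (simp add: indicator_def)
        then show ?thesis 
          using Bochner_Integration.integral_diff[OF gi[of UNIV] gi[OF A]] by (simp only: space_borel[symmetric] sets.top)
      qed
      then show ?case using U compl by simp
    next
      case (union A)
      then have A: "A n \<in> sets borel" for n unfolding borel_eq_box by auto
      have "(\<lambda>n. ?I (\<Union>i<n. A i)) \<longlonglongrightarrow> ?I (\<Union>i. A i)"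
        using LIMSEQ_indicator_UN[of A] A by (intro lim) (auto intro!: sets.finite_UN)
      moreover have "?I (\<Union>i<n. A i) = 0" for n
      proof -
        have "indicator (\<Union>i<n. A i) x = (\<Sum>i<n. indicator (A i) x :: real)" for x
          using union(1) by (intro indicator_UN_disjoint) (auto intro: disjoint_family_on_mono)
        then have "?I (\<Union>i<n. A i) = (\<integral>x. (\<Sum>i<n. indicator (A i) x *\<^sub>R g x) \<partial>lborel)"
          by (simp only: scaleR_sum_left)
        also have "\<dots> = (\<Sum>i<n. ?I (A i))" by (rule Bochner_Integration.integral_sum) (rule gi[OF A])
        finally have "?I (\<Union>i<n. A i) = (\<Sum>i<n. ?I (A i))" .
        then show ?thesis using union by simp
      qed
      ultimately show ?case using LIMSEQ_unique[OF _ tendsto_const] by auto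
    qed
  qed
  then show ?thesis
    using g by (intro density_unique_real[of lborel g "\<lambda>x. 0"]) (auto simp: set_lebesgue_integral_def)
qed

text \<open>Bumps are admissible in \<open>zero\<close> and converge boundedly to indicators, so
  \<open>g\<close> integrates to \<open>0\<close> over every open box whose closure lies in
  \<open>\<Omega>\<close>. The previous lemma gives \<open>g = 0\<close> a.e. on each such box, and
  countably many closed boxes cover \<open>\<Omega>\<close>.\<close>

lemma fundamental_lemma_calculus_of_variations:
  fixes g :: "'a::euclidean_space \<Rightarrow> real"
  assumes "open \<Omega>" "locally_integrable_on g \<Omega>"
    and zero: "\<And>\<phi>. \<phi> \<in> test_functions \<Omega> \<Longrightarrow> (\<integral>x. g x * \<phi> x \<partial>lebesgue_on \<Omega>) = 0"
  shows "AE x in lebesgue_on \<Omega>. g x = 0"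
proof -
  have \<Omega>[simp]: "\<Omega> \<in> sets lebesgue" using assms(1) by simp
  have box: "(\<integral>x. indicator (box a b) x *\<^sub>R g x \<partial>lebesgue) = 0" if ab: "cbox a b \<subseteq> \<Omega>" for a b
  proof -
    have gi: "integrable lebesgue (\<lambda>x. indicator (cbox a b) x *\<^sub>R g x)"
    proof -
      have "integrable (lebesgue_on (cbox a b)) g" using assms(2) ab unfolding locally_integrable_on_def by auto
      then show ?thesis by (simp add: integrable_restrict_space)
    qed
    have "integrable lebesgue (\<lambda>x. indicator (box a b) x *\<^sub>R (indicator (cbox a b) x *\<^sub>R g x))"
      by (rule integrable_mult_indicator[OF _ gi]) simp
    have eq: "indicator (box a b) x *\<^sub>R (indicator (cbox a b) x *\<^sub>R g x) = indicator (box a b) x *\<^sub>R g x" for x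
      using box_subset_cbox[of a b] by (auto simp: indicator_def)
    have gm: "(\<lambda>x. indicator (box a b) x *\<^sub>R g x) \<in> borel_measurable lebesgue"
      using integrable_mult_indicator[OF _ gi, of "box a b"] unfolding eq by auto
    have bm: "(\<lambda>x. bump a b n x * (indicator (cbox a b) x *\<^sub>R g x)) \<in> borel_measurable lebesgue" for n
    proof (rule borel_measurable_times)
      have "bump a b n \<in> borel_measurable borel"
        using Ck_fun_bump[of 0 a b n] by (simp add: borel_measurable_continuous_onI)
      then show "bump a b n \<in> borel_measurable lebesgue" by (simp add: measurable_completion)
    qed (use gi in auto)
    have "(\<lambda>n. \<integral>x. bump a b n x * (indicator (cbox a b) x *\<^sub>R g x) \<partial>lebesgue) \<longlonglongrightarrow> (\<integral>x. indicator (box a b) x *\<^sub>R g x \<partial>lebesgue)"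
    proof (rule integral_dominated_convergence[where w="\<lambda>x. \<bar>indicator (cbox a b) x *\<^sub>R g x\<bar>"])
      show "AE x in lebesgue. (\<lambda>n. bump a b n x * (indicator (cbox a b) x *\<^sub>R g x)) \<longlonglongrightarrow> indicator (box a b) x *\<^sub>R g x"
      proof (intro AE_I2)
        fix x
        have "(\<lambda>n. bump a b n x * (indicator (cbox a b) x *\<^sub>R g x)) \<longlonglongrightarrow> indicator (box a b) x * (indicator (cbox a b) x *\<^sub>R g x)"
          by (intro tendsto_mult_right bump_tendsto)
        then show "(\<lambda>n. bump a b n x * (indicator (cbox a b) x *\<^sub>R g x)) \<longlonglongrightarrow> indicator (box a b) x *\<^sub>R g x"
          using eq[of x] by (simp only: real_scaleR_def)
      qed
      show "AE x in lebesgue. norm (bump a b n x * (indicator (cbox a b) x *\<^sub>R g x)) \<le> \<bar>indicator (cbox a b) x *\<^sub>R g x\<bar>" for n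
        using bump_bounds[of a b n] by (intro AE_I2) (simp add: abs_mult mult_left_le_one_le)
    qed (use gi gm bm in auto)
    moreover have "(\<integral>x. bump a b n x * (indicator (cbox a b) x *\<^sub>R g x) \<partial>lebesgue) = 0" for n
    proof -
      have "(\<integral>x. bump a b n x * (indicator (cbox a b) x *\<^sub>R g x) \<partial>lebesgue) = (\<integral>x. indicator \<Omega> x *\<^sub>R (g x * bump a b n x) \<partial>lebesgue)"
        using ab bump_outside[of _ a b n] box_subset_cbox[of a b]
        by (intro Bochner_Integration.integral_cong) (auto simp: indicator_def)
      also have "\<dots> = (\<integral>x. g x * bump a b n x \<partial>lebesgue_on \<Omega>)" by (simp add: integral_restrict_space)
      finally show ?thesis using zero[OF bump_test_function[OF ab]] by simp
    qed
    ultimately show ?thesis using LIMSEQ_unique[OF _ tendsto_const] by auto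
  qed
  have ae_box: "AE x in lebesgue. x \<in> box a b \<longrightarrow> g x = 0" if ab: "cbox a b \<subseteq> \<Omega>" for a b
  proof -
    define g0 where "g0 x = indicator (box a b) x *\<^sub>R g x" for x
    have "integrable lebesgue (\<lambda>x. indicator (cbox a b) x *\<^sub>R g x)"
    proof -
      have "integrable (lebesgue_on (cbox a b)) g" using assms(2) ab unfolding locally_integrable_on_def by auto
      then show ?thesis by (simp add: integrable_restrict_space)
    qed
    then have "integrable lebesgue (\<lambda>x. indicator (box a b) x *\<^sub>R (indicator (cbox a b) x *\<^sub>R g x))"
      by (rule integrable_mult_indicator[rotated]) simp
    moreover have "indicator (box a b) x *\<^sub>R (indicator (cbox a b) x *\<^sub>R g x) = g0 x" for x
      using box_subset_cbox[of a b] by (auto simp: indicator_def g0_def)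
    ultimately have g0: "integrable lebesgue g0" by simp
    \<comment> \<open>The box criterion is about \<open>lborel\<close>, while \<open>g0\<close> is
      measurable only for the completed measure; hence a Borel version.\<close>
    obtain g1 where g1 [measurable]: "g1 \<in> borel_measurable lborel" and eq: "AE x in lborel. g0 x = g1 x"
      using completion_ex_borel_measurable_real[of g0 lborel] g0 by auto
    have eq': "AE x in lebesgue. g0 x = g1 x" using AE_completion[OF eq] .
    have g1': "g1 \<in> borel_measurable lebesgue" using measurable_completion[OF g1] by simp
    have "integrable lebesgue g1"
      using integrable_cong_AE_imp[OF g0 g1'] eq' by (auto simp: eq_commute)
    then have g1i: "integrable lborel g1" by (simp add: integrable_completion)
    have "AE x in lborel. g1 x = 0"
    proof (rule AE_eq_0_if_box_integrals_0[OF g1i])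
      fix c d
      \<comment> \<open>Corners of the intersection with \<open>box a b\<close>: testing over any
        box reduces to a box that is still inside \<open>\<Omega>\<close>.\<close>
      define a' where "a' = (\<Sum>i\<in>Basis. max (c\<bullet>i) (a\<bullet>i) *\<^sub>R i)"
      define b' where "b' = (\<Sum>i\<in>Basis. min (d\<bullet>i) (b\<bullet>i) *\<^sub>R i)"
      have i: "box c d \<inter> box a b = box a' b'" unfolding a'_def b'_def by (rule box_Int_box)
      have sub: "cbox a' b' \<subseteq> cbox a b" by (auto simp: mem_box a'_def b'_def)
      have "(\<integral>x. indicator (box c d) x *\<^sub>R g1 x \<partial>lborel) = (\<integral>x. indicator (box c d) x *\<^sub>R g1 x \<partial>lebesgue)"
        by (rule integral_completion[symmetric]) measurable
      also have "\<dots> = (\<integral>x. indicator (box c d) x *\<^sub>R g0 x \<partial>lebesgue)"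
      proof (rule integral_cong_AE)
        show "AE x in lebesgue. indicator (box c d) x *\<^sub>R g1 x = indicator (box c d) x *\<^sub>R g0 x"
          using eq' by eventually_elim simp
        have "indicator (box c d) \<in> borel_measurable lebesgue" by (intro borel_measurable_indicator) simp
        then show "(\<lambda>x. indicator (box c d) x *\<^sub>R g1 x) \<in> borel_measurable lebesgue"
          "(\<lambda>x. indicator (box c d) x *\<^sub>R g0 x) \<in> borel_measurable lebesgue"
          using g0 g1' by (intro borel_measurable_scaleR; simp)+
      qed
      also have "\<dots> = (\<integral>x. indicator (box a' b') x *\<^sub>R g x \<partial>lebesgue)"
        by (intro Bochner_Integration.integral_cong) (auto simp: g0_def i[symmetric] indicator_def)
      also have "\<dots> = 0" using box sub ab by blast
      finally show "(\<integral>x. indicator (box c d) x *\<^sub>R g1 x \<partial>lborel) = 0" .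
    qed
    then have "AE x in lebesgue. g1 x = 0" by (rule AE_completion)
    with eq' show ?thesis by eventually_elim (auto simp: g0_def)
  qed
  have ae_cbox: "AE x in lebesgue. x \<in> cbox a b \<longrightarrow> g x = 0" if ab: "cbox a b \<subseteq> \<Omega>" for a b
  proof -
    have "AE x in lebesgue. x \<notin> cbox a b - box a b"
      using negligible_frontier_interval[of a b] by (intro AE_not_in) (simp add: negligible_iff_null_sets)
    with ae_box[OF ab] show ?thesis by eventually_elim auto
  qed
  obtain D where D: "countable D" "D \<subseteq> Pow \<Omega>" "\<And>X. X \<in> D \<Longrightarrow> \<exists>a b. X = cbox a b" "\<Union>D = \<Omega>"
    using open_countable_Union_open_cbox[OF assms(1)] by metis
  have "AE x in lebesgue. x \<in> X \<longrightarrow> g x = 0" if "X \<in> D" for X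
    using D(2) D(3)[OF that] that ae_cbox by blast
  then have "AE x in lebesgue. \<forall>X\<in>D. x \<in> X \<longrightarrow> g x = 0"
    using D(1) by (subst AE_ball_countable) auto
  then have "AE x in lebesgue. x \<in> \<Omega> \<longrightarrow> g x = 0"
    by eventually_elim (use D(4) in auto)
  then show ?thesis by (simp add: AE_restrict_space_iff)
qed

subsection \<open>The Gagliardo--Nirenberg--Sobolev inequality\<close>

text \<open>Points are coordinate functions, so integrating along the axis \<open>i\<close> is
  integrating over a function update. This permits induction over the index set of the product
  measure.\<close>

definition line_integral :: "'b measure \<Rightarrow> 'i \<Rightarrow> (('i \<Rightarrow> 'b) \<Rightarrow> real) \<Rightarrow> ('i \<Rightarrow> 'b) \<Rightarrow> real" where
  "line_integral M i f x = (\<integral>t. f (x(i := t)) \<partial>M)"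

lemma finite_measure_PiM:
  assumes "finite_measure M" "finite I"
  shows "finite_measure (PiM I (\<lambda>_. M))"
proof -
  interpret finite_measure M by fact
  interpret product_sigma_finite "\<lambda>_. M" ..
  show ?thesis
  proof (rule finite_measureI)
    have "emeasure (PiM I (\<lambda>_. M)) (PiE I (\<lambda>_. space M)) = (\<Prod>i\<in>I. emeasure M (space M))"
      using assms(2) by (intro emeasure_PiM) auto
    then show "emeasure (PiM I (\<lambda>_. M)) (space (PiM I (\<lambda>_. M))) \<noteq> \<infinity>"
      using emeasure_finite[of "space M"] by (simp add: space_PiM power_eq_top_ennreal)
  qed
qed

lemma measurable_fun_upd_PiM:
  assumes "x \<in> space (PiM I (\<lambda>_. M))" "f \<in> borel_measurable (PiM (insert i I) (\<lambda>_. M))"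
  shows "(\<lambda>t. f (x(i := t))) \<in> borel_measurable M"
proof -
  have "(\<lambda>t. x(i := t)) \<in> M \<rightarrow>\<^sub>M PiM (insert i I) (\<lambda>_. M)"
    using measurable_compose[OF measurable_Pair1'[OF assms(1)] measurable_add_dim[of i I "\<lambda>_. M"]] by simp
  from measurable_compose[OF this assms(2)] show ?thesis .
qed

lemma measurable_line_integral:
  assumes "finite_measure M" "f \<in> borel_measurable (PiM (insert i I) (\<lambda>_. M))"
  shows "line_integral M i f \<in> borel_measurable (PiM I (\<lambda>_. M))"
proof -
  interpret finite_measure M by fact
  have "(\<lambda>(x, t). f (x(i := t))) \<in> borel_measurable (PiM I (\<lambda>_. M) \<Otimes>\<^sub>M M)"
    using measurable_compose[OF measurable_add_dim assms(2)] by (simp add: split_beta)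
  then show ?thesis unfolding line_integral_def by (rule borel_measurable_lebesgue_integral)
qed

lemma fun_upd_in_space_PiM:
  "x \<in> space (PiM I (\<lambda>_. M)) \<Longrightarrow> t \<in> space M \<Longrightarrow> x(i := t) \<in> space (PiM (insert i I) (\<lambda>_. M))"
  by (auto simp: space_PiM PiE_iff extensional_def)

lemma line_integral_bounds:
  assumes "finite_measure M" "x \<in> space (PiM I (\<lambda>_. M))" "f \<in> borel_measurable (PiM (insert i I) (\<lambda>_. M))"
    and f: "\<And>x. x \<in> space (PiM (insert i I) (\<lambda>_. M)) \<Longrightarrow> c \<le> f x \<and> f x \<le> C"
  shows "c * measure M (space M) \<le> line_integral M i f x" "line_integral M i f x \<le> C * measure M (space M)"
    "integrable M (\<lambda>t. f (x(i := t)))"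
proof -
  interpret finite_measure M by fact
  have b: "c \<le> f (x(i := t)) \<and> f (x(i := t)) \<le> C" if "t \<in> space M" for t
    using f fun_upd_in_space_PiM[OF assms(2) that] by blast
  show i: "integrable M (\<lambda>t. f (x(i := t)))"
  proof (rule integrable_const_bound[where B="max \<bar>c\<bar> \<bar>C\<bar>"])
    show "AE t in M. norm (f (x(i := t))) \<le> max \<bar>c\<bar> \<bar>C\<bar>"
      using b by (intro AE_I2) fastforce
  qed (rule measurable_fun_upd_PiM[OF assms(2,3)])
  have "(\<integral>t. c \<partial>M) \<le> (\<integral>t. f (x(i := t)) \<partial>M)" "(\<integral>t. f (x(i := t)) \<partial>M) \<le> (\<integral>t. C \<partial>M)"
    by (rule integral_mono; use i b in simp)+
  then show "c * measure M (space M) \<le> line_integral M i f x" "line_integral M i f x \<le> C * measure M (space M)"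
    by (simp_all add: line_integral_def mult.commute)
qed

text \<open>Integrating out one variable at a time turns the product of line integrals of \<open>f\<close> into the same
  expression for the marginal of \<open>f\<close> in one variable less.\<close>

lemma prod_line_integrals_le:
  fixes M :: "'b measure" and I :: "'i set"
  assumes M: "finite_measure M" "0 < measure M (space M)"
    and "finite I" "0 \<le> r" "(real (card I) - 1) * r \<le> 1" "0 < c"
    and "f \<in> borel_measurable (PiM I (\<lambda>_. M))"
    and "\<And>x. x \<in> space (PiM I (\<lambda>_. M)) \<Longrightarrow> c \<le> f x \<and> f x \<le> C"
  shows "(\<integral>x. f x powr (1 - (real (card I) - 1) * r) * (\<Prod>i\<in>I. line_integral M i f x powr r) \<partial>PiM I (\<lambda>_. M))
     \<le> (\<integral>x. f x \<partial>PiM I (\<lambda>_. M)) powr (1 + r)"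
  using assms(3-)
proof (induction I arbitrary: f c C rule: finite_induct)
  case empty
  then show ?case by (simp add: PiM_empty lebesgue_integral_count_space_finite)
next
  case (insert k s)
  interpret M: finite_measure M by fact
  interpret product_sigma_finite "\<lambda>_::'i. M" ..
  interpret MM: pair_sigma_finite M M ..
  define n where "n = real (card s)"
  \<comment> \<open>The Hoelder weight left for \<open>f\<close> once each of the \<open>n\<close>
    line integrals in the directions of \<open>s\<close> has taken \<open>r\<close>. For
    \<open>r = 1 / (N - 1)\<close> and all \<open>N\<close> coordinates it is
    \<open>0\<close>.\<close>
  define e where "e = 1 - n * r"
  let ?P = "\<lambda>I. PiM I (\<lambda>_::'i. M)"
  note f = insert.prems(4,5)
  note fm[measurable] = insert.prems(4)
  define m where "m = measure M (space M)"
  have m: "0 < m" using M by (simp add: m_def)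
  have card: "real (card (insert k s)) - 1 = n" using insert by (simp add: n_def)
  have e0: "0 \<le> e" using insert.prems(2) by (simp add: card e_def)
  have c: "0 < c" by fact
  define F where "F = line_integral M k f"
  have Fm: "F \<in> borel_measurable (?P s)" unfolding F_def by (rule measurable_line_integral[OF M(1) f(1)])
  have Fb: "c * m \<le> F x \<and> F x \<le> C * m" if "x \<in> space (?P s)" for x
    using line_integral_bounds[OF M(1) that f] by (simp add: F_def m_def)
  have Fpos: "0 < F x" if "x \<in> space (?P s)" for x
    using Fb[OF that] c m by (meson less_le_trans mult_pos_pos)
  have ins: "insert i (insert k s) = insert k s" if "i \<in> insert k s" for i using that by auto
  have Lm: "line_integral M i f \<in> borel_measurable (?P (insert k s))" if "i \<in> insert k s" for i
    by (rule measurable_line_integral[OF M(1)]) (simp only: ins[OF that] fm)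
  have Lb: "c * m \<le> line_integral M i f x \<and> line_integral M i f x \<le> C * m"
    if "i \<in> insert k s" "x \<in> space (?P (insert k s))" for i x
    using line_integral_bounds(1,2)[OF M(1) that(2), of f i c C] f by (simp only: ins[OF that(1)] m_def simp_thms)
  define G where "G x = f x powr e * (\<Prod>i\<in>insert k s. line_integral M i f x powr r)" for x
  have Gm: "G \<in> borel_measurable (?P (insert k s))"
    unfolding G_def using Lm by (intro borel_measurable_times borel_measurable_prod powr_real_measurable borel_measurable_const fm) auto
  define B where "B = C powr e * (\<Prod>i\<in>insert k s. (C * m) powr r)"
  have Gb: "0 \<le> G x \<and> G x \<le> B" if x: "x \<in> space (?P (insert k s))" for x
  proof
    show "0 \<le> G x" unfolding G_def by (intro mult_nonneg_nonneg prod_nonneg) auto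
    have "f x powr e \<le> C powr e" using f(2)[OF x] c e0 by (intro powr_mono2) auto
    moreover have "(\<Prod>i\<in>insert k s. line_integral M i f x powr r) \<le> (\<Prod>i\<in>insert k s. (C * m) powr r)"
    proof (intro prod_mono conjI powr_mono2)
      fix i assume i: "i \<in> insert k s"
      show "0 \<le> line_integral M i f x" using Lb[OF i x] c m by (meson less_imp_le mult_pos_pos order_trans)
      show "line_integral M i f x \<le> C * m" using Lb[OF i x] by simp
    qed (use insert.prems in auto)
    ultimately show "G x \<le> B" unfolding G_def B_def by (intro mult_mono prod_nonneg) auto
  qed
  interpret P: finite_measure "?P s" by (rule finite_measure_PiM) (use M insert in auto)
  interpret P': finite_measure "?P (insert k s)" by (rule finite_measure_PiM) (use M insert in auto)
  have Gi: "integrable (?P (insert k s)) G"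
    by (rule P'.integrable_const_bound[where B=B]) (use Gb Gm in \<open>auto intro!: AE_I2\<close>)
  have fi: "integrable (?P (insert k s)) f"
  proof (rule P'.integrable_const_bound[where B=C])
    show "AE x in ?P (insert k s). norm (f x) \<le> C" using f(2) c by (intro AE_I2) fastforce
  qed (rule fm)
  \<comment> \<open>The line integral in direction \<open>k\<close> is constant in \<open>t\<close>
    and equals \<open>F x\<close>, so it leaves the integral as \<open>F x powr r\<close>. The other
    factors are handled by the generalised Hoelder inequality with the weights \<open>e\<close> for
    \<open>f\<close> and \<open>r\<close> for each direction in \<open>s\<close>, which add up to
    \<open>1\<close>.\<close>
  have inner: "(\<integral>t. G (x(k := t)) \<partial>M) \<le> F x powr (1 - (real (card s) - 1) * r) * (\<Prod>i\<in>s. line_integral M i F x powr r)"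
    if x: "x \<in> space (?P s)" for x
  proof -
    define g where "g i t = (if i = k then f (x(k := t)) else line_integral M i f (x(k := t)))" for i t
    define w where "w i = (if i = k then e else r)" for i
    have xt: "x(k := t) \<in> space (?P (insert k s))" if "t \<in> space M" for t
      using fun_upd_in_space_PiM[OF x that] .
    have Geq: "G (x(k := t)) = F x powr r * (\<Prod>j\<in>insert k s. g j t powr w j)" for t
    proof -
      have "line_integral M k f (x(k := t)) = F x" by (simp add: F_def line_integral_def)
      moreover have "(\<Prod>j\<in>s. g j t powr w j) = (\<Prod>i\<in>s. line_integral M i f (x(k := t)) powr r)"
        using insert by (intro prod.cong refl) (auto simp: g_def w_def)
      ultimately show ?thesis using insert by (simp add: G_def g_def w_def)
    qed
    have "(\<integral>t. (\<Prod>j\<in>insert k s. g j t powr w j) \<partial>M) \<le> (\<Prod>j\<in>insert k s. (\<integral>t. g j t \<partial>M) powr w j)"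
    proof (rule generalized_Holder_inequality[OF M, where c="min c (c * m)" and C="max C (C * m)"])
      show "finite (insert k s)" using insert by simp
      show "0 \<le> w j" for j using e0 insert.prems by (simp add: w_def)
      have "sum w s = (\<Sum>j\<in>s. r)" using insert by (intro sum.cong) (auto simp: w_def)
      then show "sum w (insert k s) = 1" using insert by (simp add: w_def e_def n_def)
      show "g j \<in> borel_measurable M" if "j \<in> insert k s" for j
      proof -
        have "g k = (\<lambda>t. f (x(k := t)))" "j \<noteq> k \<Longrightarrow> g j = (\<lambda>t. line_integral M j f (x(k := t)))"
          by (auto simp: g_def)
        then show ?thesis
          using measurable_fun_upd_PiM[OF x fm] measurable_fun_upd_PiM[OF x Lm[OF that]] by metis
      qed
      show "0 < min c (c * m)" using c m by simp
      fix j t assume j: "j \<in> insert k s" and t: "t \<in> space M"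
      show "min c (c * m) \<le> g j t \<and> g j t \<le> max C (C * m)"
        unfolding g_def using f(2)[OF xt[OF t]] Lb[OF j xt[OF t]] 
        by (cases "j = k") (simp_all only: if_True if_False min_le_iff_disj le_max_iff_disj simp_thms)
    qed
    also have "\<dots> = F x powr e * (\<Prod>i\<in>s. (\<integral>t. g i t \<partial>M) powr r)"
    proof -
      have "(\<Prod>j\<in>s. (\<integral>t. g j t \<partial>M) powr w j) = (\<Prod>i\<in>s. (\<integral>t. g i t \<partial>M) powr r)"
        using insert by (intro prod.cong refl) (auto simp: w_def)
      then show ?thesis using insert by (simp add: g_def w_def F_def line_integral_def)
    qed
    \<comment> \<open>Fubini in the two variables \<open>i\<close> and \<open>k\<close>: integrating
      a line integral of \<open>f\<close> over \<open>k\<close> gives the line integral of the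
      marginal \<open>F\<close>.\<close>
    also have "(\<Prod>i\<in>s. (\<integral>t. g i t \<partial>M) powr r) = (\<Prod>i\<in>s. line_integral M i F x powr r)"
    proof (intro prod.cong refl)
      fix i assume i: "i \<in> s"
      then have ik: "i \<noteq> k" using insert by auto
      have s: "insert i s = s" using i by auto
      have "(\<lambda>t. x(i := t)) \<in> M \<rightarrow>\<^sub>M ?P s"
        using measurable_compose[OF measurable_Pair1'[OF x] measurable_add_dim[of i s "\<lambda>_. M"]] by (simp add: s)
      from measurable_Pair[OF measurable_compose[OF measurable_fst this] measurable_snd]
      have "(\<lambda>z. (x(i := fst z), snd z)) \<in> M \<Otimes>\<^sub>M M \<rightarrow>\<^sub>M ?P s \<Otimes>\<^sub>M M" .
      from measurable_compose[OF measurable_compose[OF this measurable_add_dim] fm]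
      have m2: "(\<lambda>(t', t). f ((x(i := t'))(k := t))) \<in> borel_measurable (M \<Otimes>\<^sub>M M)"
        by (simp only: split_beta' fst_conv snd_conv)
      interpret MMf: finite_measure "M \<Otimes>\<^sub>M M" by (rule finite_measure_pair_measure) (rule M)+
      have int: "integrable (M \<Otimes>\<^sub>M M) (\<lambda>(t', t). f ((x(i := t'))(k := t)))"
      proof (rule MMf.integrable_const_bound[OF AE_I2 m2])
        fix z assume "z \<in> space (M \<Otimes>\<^sub>M M)"
        then have "fst z \<in> space M" "snd z \<in> space M" by (auto simp: space_pair_measure)
        then have "(x(i := fst z))(k := snd z) \<in> space (?P (insert k s))"
          using fun_upd_in_space_PiM[OF x, of "fst z" i] fun_upd_in_space_PiM[of "x(i := fst z)" s M "snd z" k] by (simp add: s)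
        then show "norm (case z of (t', t) \<Rightarrow> f ((x(i := t'))(k := t))) \<le> C"
          using f(2) c by (fastforce simp: split_beta')
      qed
      have "(\<integral>t. g i t \<partial>M) = (\<integral>t. \<integral>t'. f ((x(i := t'))(k := t)) \<partial>M \<partial>M)"
        using ik by (simp add: g_def line_integral_def fun_upd_twist)
      also have "\<dots> = (\<integral>t'. \<integral>t. f ((x(i := t'))(k := t)) \<partial>M \<partial>M)"
        using MM.Fubini_integral[OF int] .
      also have "\<dots> = line_integral M i F x" by (simp add: F_def line_integral_def)
      finally show "(\<integral>t. g i t \<partial>M) powr r = line_integral M i F x powr r" by simp
    qed
    finally have "F x powr r * (\<integral>t. (\<Prod>j\<in>insert k s. g j t powr w j) \<partial>M) 
        \<le> F x powr r * (F x powr e * (\<Prod>i\<in>s. line_integral M i F x powr r))"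
      by (intro mult_left_mono) auto
    \<comment> \<open>The exponents add up to that of the induction hypothesis:
      \<open>r + (1 - n * r) = 1 - (n - 1) * r\<close>.\<close>
    moreover have "F x powr r * F x powr e = F x powr (1 - (real (card s) - 1) * r)"
      unfolding powr_add[symmetric] e_def n_def by (simp add: algebra_simps)
    ultimately show ?thesis by (simp add: Geq mult.assoc[symmetric])
  qed
  have "(\<integral>x. G x \<partial>?P (insert k s)) = (\<integral>x. (\<integral>t. G (x(k := t)) \<partial>M) \<partial>?P s)"
    using insert by (intro product_integral_insert Gi) auto
  also have "\<dots> \<le> (\<integral>x. F x powr (1 - (real (card s) - 1) * r) * (\<Prod>i\<in>s. line_integral M i F x powr r) \<partial>?P s)"
  proof (rule integral_mono')
    have ins': "insert i s = s" if "i \<in> s" for i using that by auto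
    have Lm': "line_integral M i F \<in> borel_measurable (?P s)" if "i \<in> s" for i
      by (rule measurable_line_integral[OF M(1)]) (simp only: ins'[OF that] Fm)
    have Lb': "0 \<le> line_integral M i F x \<and> line_integral M i F x \<le> C * m * m" if "i \<in> s" "x \<in> space (?P s)" for i x
      using line_integral_bounds(1,2)[OF M(1) that(2), of F i "c * m" "C * m"] Fm Fb c m
      by (simp only: ins'[OF that(1)] m_def simp_thms) (meson less_imp_le mult_pos_pos order_trans)
    show "integrable (?P s) (\<lambda>x. F x powr (1 - (real (card s) - 1) * r) * (\<Prod>i\<in>s. line_integral M i F x powr r))"
    proof (rule P.integrable_const_bound[OF AE_I2])
      show "(\<lambda>x. F x powr (1 - (real (card s) - 1) * r) * (\<Prod>i\<in>s. line_integral M i F x powr r)) \<in> borel_measurable (?P s)"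
        using Lm' by (intro borel_measurable_times borel_measurable_prod powr_real_measurable borel_measurable_const Fm) auto
      fix x assume x: "x \<in> space (?P s)"
      have e': "0 \<le> 1 - (real (card s) - 1) * r" using e0 insert.prems(1) by (simp add: e_def n_def algebra_simps)
      have "F x powr (1 - (real (card s) - 1) * r) \<le> (C * m) powr (1 - (real (card s) - 1) * r)"
        using Fb[OF x] Fpos[OF x] e' by (intro powr_mono2) auto
      moreover have "(\<Prod>i\<in>s. line_integral M i F x powr r) \<le> (\<Prod>i\<in>s. (C * m * m) powr r)"
        using Lb' x insert.prems(1) by (intro prod_mono conjI powr_mono2) auto
      ultimately show "norm (F x powr (1 - (real (card s) - 1) * r) * (\<Prod>i\<in>s. line_integral M i F x powr r)) 
          \<le> (C * m) powr (1 - (real (card s) - 1) * r) * (\<Prod>i\<in>s. (C * m * m) powr r)"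
        by (simp add: abs_mult abs_of_nonneg prod_nonneg mult_mono)
    qed
    show "0 \<le> F x powr (1 - (real (card s) - 1) * r) * (\<Prod>i\<in>s. line_integral M i F x powr r)" for x
      by (intro mult_nonneg_nonneg prod_nonneg) auto
  qed (rule inner)
  also have "\<dots> \<le> (\<integral>x. F x \<partial>?P s) powr (1 + r)"
  proof (rule insert.IH)
    show "0 \<le> r" by fact
    show "(real (card s) - 1) * r \<le> 1" using e0 insert.prems(1) by (simp add: e_def n_def algebra_simps)
    show "0 < c * m" using c m by simp
  qed (use Fm Fb in auto)
  also have "(\<integral>x. F x \<partial>?P s) = (\<integral>x. f x \<partial>?P (insert k s))"
    unfolding F_def line_integral_def using insert by (intro product_integral_insert[symmetric] fi) auto
  finally show ?case unfolding G_def e_def n_def[symmetric] card by simp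
qed

section \<open>From product coordinates to the Euclidean space\<close>

text \<open>Lebesgue measure cut down to an interval. The result is finite, as the Hoelder argument
  requires, and being a density it keeps the Borel sets and the whole line as its space, so that
  coordinates need no restriction.\<close>

definition interval_lborel :: "real \<Rightarrow> real measure" where
  "interval_lborel R = density lborel (\<lambda>x. ennreal (indicator {-R..R} x))"

lemma interval_lborel_simps [simp]:
  "sets (interval_lborel R) = sets borel" "space (interval_lborel R) = UNIV"
  by (simp_all add: interval_lborel_def)

lemma emeasure_interval_lborel:
  "A \<in> sets borel \<Longrightarrow> emeasure (interval_lborel R) A = (\<integral>\<^sup>+x. ennreal (indicator {-R..R} x) * indicator A x \<partial>lborel)"
  by (simp add: interval_lborel_def emeasure_density)

lemma finite_measure_interval_lborel:
  assumes "0 < R"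
  shows "finite_measure (interval_lborel R)" "measure (interval_lborel R) (space (interval_lborel R)) = 2 * R"
proof -
  have e: "emeasure (interval_lborel R) UNIV = ennreal (2 * R)"
    using assms by (simp add: emeasure_interval_lborel ennreal_indicator)
  then show "finite_measure (interval_lborel R)" by (intro finite_measureI) simp
  show "measure (interval_lborel R) (space (interval_lborel R)) = 2 * R"
    using e assms by (simp add: measure_def)
qed

lemma PiM_interval_lborel:
  assumes "finite I" "0 < R"
  shows "PiM I (\<lambda>_. interval_lborel R) = density (PiM I (\<lambda>_. lborel)) (\<lambda>x. ennreal (\<Prod>i\<in>I. indicator {-R..R} (x i)))"
proof -
  interpret f: finite_measure "interval_lborel R" using finite_measure_interval_lborel(1)[OF assms(2)] .
  interpret product_sigma_finite "\<lambda>_. interval_lborel R" ..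
  interpret L: product_sigma_finite "\<lambda>_. lborel :: real measure" ..
  have sets_eq: "sets (PiM I (\<lambda>_. lborel :: real measure)) = sets (PiM I (\<lambda>_. interval_lborel R))"
    by (intro sets_PiM_cong) auto
  show ?thesis
  proof (rule PiM_eqI[symmetric, OF assms(1)])
    show "sets (density (PiM I (\<lambda>_. lborel)) (\<lambda>x. ennreal (\<Prod>i\<in>I. indicator {-R..R} (x i)))) = sets (PiM I (\<lambda>_. interval_lborel R))"
      using sets_eq by simp
    fix A assume A: "\<And>i. i \<in> I \<Longrightarrow> A i \<in> sets (interval_lborel R)"
    then have A' [measurable]: "\<And>i. i \<in> I \<Longrightarrow> A i \<in> sets borel" by simp
    have [measurable]: "Pi\<^sub>E I A \<in> sets (PiM I (\<lambda>_. lborel :: real measure))"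
      using assms(1) A by (intro sets_PiM_I_finite) auto
    have "emeasure (density (PiM I (\<lambda>_. lborel)) (\<lambda>x. ennreal (\<Prod>i\<in>I. indicator {-R..R} (x i)))) (Pi\<^sub>E I A)
      = (\<integral>\<^sup>+x. ennreal (\<Prod>i\<in>I. indicator {-R..R} (x i)) * indicator (Pi\<^sub>E I A) x \<partial>PiM I (\<lambda>_. lborel))"
      by (rule emeasure_density) measurable
    also have "\<dots> = (\<integral>\<^sup>+x. (\<Prod>i\<in>I. ennreal (indicator {-R..R} (x i)) * indicator (A i) (x i)) \<partial>PiM I (\<lambda>_. lborel))"
    proof (rule nn_integral_cong)
      fix x assume x: "x \<in> space (PiM I (\<lambda>_. lborel :: real measure))"
      have "indicator (Pi\<^sub>E I A) x = (\<Prod>i\<in>I. indicator (A i) (x i) :: ennreal)"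
        using x assms(1) by (auto simp: indicator_def space_PiM PiE_iff extensional_def prod_eq_1_iff)
      then show "ennreal (\<Prod>i\<in>I. indicator {-R..R} (x i)) * indicator (Pi\<^sub>E I A) x 
        = (\<Prod>i\<in>I. ennreal (indicator {-R..R} (x i)) * indicator (A i) (x i))"
        by (simp add: prod.distrib prod_ennreal)
    qed
    also have "\<dots> = (\<Prod>i\<in>I. \<integral>\<^sup>+x. ennreal (indicator {-R..R} x) * indicator (A i) x \<partial>lborel)"
      using assms(1) by (intro L.product_nn_integral_prod) auto
    also have "\<dots> = (\<Prod>i\<in>I. emeasure (interval_lborel R) (A i))"
      by (intro prod.cong refl emeasure_interval_lborel[symmetric]) auto
    finally show "emeasure (density (PiM I (\<lambda>_. lborel)) (\<lambda>x. ennreal (\<Prod>i\<in>I. indicator {-R..R} (x i)))) (Pi\<^sub>E I A)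
      = (\<Prod>i\<in>I. emeasure (interval_lborel R) (A i))" .
  qed
qed

definition from_coords :: "('a::euclidean_space \<Rightarrow> real) \<Rightarrow> 'a" where
  "from_coords x = (\<Sum>b\<in>Basis. x b *\<^sub>R b)"

lemma from_coords_inner [simp]: "b \<in> Basis \<Longrightarrow> from_coords x \<bullet> b = x b"
  by (simp add: from_coords_def)

lemma from_coords_upd: "b \<in> Basis \<Longrightarrow> from_coords (x(b := t)) = from_coords (x(b := 0)) + t *\<^sub>R b"
  by (rule euclidean_eqI) (auto simp: inner_add_left inner_Basis)

lemma integral_PiM_interval_lborel:
  fixes h :: "'a::euclidean_space \<Rightarrow> real"
  assumes [measurable]: "h \<in> borel_measurable borel" and R: "0 < R"
    and out: "\<And>x b. b \<in> Basis \<Longrightarrow> \<bar>x \<bullet> b\<bar> > R \<Longrightarrow> h x = 0"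
  shows "(\<integral>x. h (from_coords x) \<partial>PiM Basis (\<lambda>_. interval_lborel R)) = (\<integral>x. h x \<partial>lborel)"
proof -
  have T: "from_coords \<in> measurable (PiM Basis (\<lambda>_::'a. lborel :: real measure)) (borel :: 'a measure)"
    unfolding from_coords_def by measurable
  have eq: "(\<Prod>i\<in>Basis. indicator {-R..R} (x i)) * h (from_coords x) = h (from_coords x)" for x
  proof (cases "h (from_coords x) = 0")
    case False
    then have "\<bar>x b\<bar> \<le> R" if "b \<in> Basis" for b using out[of b "from_coords x"] that by (cases "\<bar>x b\<bar> \<le> R") auto
    then have "(\<Prod>i\<in>Basis. indicator {-R..R} (x i) :: real) = 1" 
      by (intro prod.neutral ballI) (fastforce simp: indicator_def abs_le_iff)
    then show ?thesis by simp
  qed simp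
  have hm: "(\<lambda>x. h (from_coords x)) \<in> borel_measurable (PiM Basis (\<lambda>_::'a. lborel :: real measure))"
    using measurable_compose[OF T assms(1)] .
  have "(\<integral>x. h (from_coords x) \<partial>PiM Basis (\<lambda>_. interval_lborel R)) 
     = (\<integral>x. (\<Prod>i\<in>Basis. indicator {-R..R} (x i)) *\<^sub>R h (from_coords x) \<partial>PiM Basis (\<lambda>_::'a. lborel))"
    unfolding PiM_interval_lborel[OF finite_Basis R]
    by (rule integral_density[OF hm]) (auto intro!: prod_nonneg)
  also have "\<dots> = (\<integral>x. h (from_coords x) \<partial>PiM Basis (\<lambda>_::'a. lborel))" by (simp add: eq)
  also have "\<dots> = (\<integral>x. h x \<partial>distr (PiM Basis (\<lambda>_::'a. lborel)) borel from_coords)"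
    by (rule integral_distr[symmetric, OF T]) simp
  also have "distr (PiM Basis (\<lambda>_::'a. lborel)) borel from_coords = lborel"
    unfolding from_coords_def[abs_def] by (rule lborel_eq[symmetric])
  finally show ?thesis .
qed

lemma integrable_bounded_PiM_interval_lborel:
  fixes h :: "'a::euclidean_space \<Rightarrow> real"
  assumes "0 < R" "h \<in> borel_measurable borel" "\<And>x. \<bar>h x\<bar> \<le> B"
  shows "integrable (PiM Basis (\<lambda>_. interval_lborel R)) (\<lambda>x. h (from_coords x))"
proof -
  interpret finite_measure "PiM Basis (\<lambda>_::'a. interval_lborel R)"
    by (intro finite_measure_PiM finite_measure_interval_lborel(1) assms(1) finite_Basis)
  have "from_coords \<in> measurable (PiM Basis (\<lambda>_::'a. interval_lborel R)) (borel :: 'a measure)"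
    unfolding from_coords_def using measurable_component_singleton[of _ Basis "\<lambda>_::'a. interval_lborel R"]
    by (intro borel_measurable_sum borel_measurable_scaleR borel_measurable_const) (simp cong: measurable_cong_sets)
  then show ?thesis
    using assms by (intro integrable_const_bound[where B=B]) (auto intro: measurable_compose)
qed

text \<open>The fundamental theorem of calculus on the line through the point in direction
  \<open>b\<close>, starting at the coordinate \<open>-R\<close>: that point lies outside
  \<open>\<Omega>\<close>, so the function vanishes there. The integrand \<open>f\<close> dominates
  the derivative of \<open>\<bar>\<phi>\<bar> powr s\<close>, and enlarging the interval up to
  \<open>R\<close> makes the bound independent of the coordinate \<open>x b\<close>.\<close>

lemma abs_powr_le_line_integral:
  fixes \<phi> :: "'a::euclidean_space \<Rightarrow> real"
  assumes \<phi>: "\<phi> \<in> test_functions \<Omega>" and R: "\<And>x b. x \<in> \<Omega> \<Longrightarrow> b \<in> Basis \<Longrightarrow> \<bar>x \<bullet> b\<bar> < R"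
    and s: "1 < s" and b: "b \<in> Basis"
  shows "\<bar>\<phi> (from_coords x)\<bar> powr s 
     \<le> line_integral (interval_lborel R) b (\<lambda>x. s * \<bar>\<phi> (from_coords x)\<bar> powr (s - 1) * norm (gradient \<phi> (from_coords x))) x"
proof -
  define f where "f y = s * \<bar>\<phi> y\<bar> powr (s - 1) * norm (gradient \<phi> y)" for y
  define y where "y t = from_coords (x(b := 0)) + t *\<^sub>R b" for t
  have yx: "from_coords (x(b := t)) = y t" for t unfolding y_def by (rule from_coords_upd[OF b])
  have fc: "continuous_on UNIV f"
    unfolding f_def using s by (intro continuous_intros continuous_on_powr' test_function_continuous[OF \<phi>]) auto
  have yc: "continuous_on UNIV y" unfolding y_def by (intro continuous_intros)
  have fyc: "continuous_on UNIV (\<lambda>t. f (y t))" using continuous_on_compose2[OF fc yc] by simp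
  have f0: "0 \<le> f y" for y unfolding f_def using s by auto
  have L: "line_integral (interval_lborel R) b (\<lambda>x. f (from_coords x)) x = integral {-R..R} (\<lambda>t. f (y t))"
  proof -
    have "line_integral (interval_lborel R) b (\<lambda>x. f (from_coords x)) x = (\<integral>t. indicator {-R..R} t *\<^sub>R f (y t) \<partial>lborel)"
      unfolding line_integral_def yx interval_lborel_def
      by (rule integral_density) (use fyc in \<open>auto intro!: borel_measurable_continuous_onI\<close>)
    also have "\<dots> = integral {-R..R} (\<lambda>t. f (y t))"
      using set_borel_integral_eq_integral(2)[OF borel_integrable_atLeastAtMost'[OF continuous_on_subset[OF fyc]], of "-R" R]
      by (simp add: set_lebesgue_integral_def)
    finally show ?thesis .
  qed
  have yb: "y t \<bullet> b = t" for t using from_coords_inner[OF b, of "x(b := t)"] by (simp add: yx)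
  have yx': "y (x b) = from_coords x" using yx[of "x b"] by simp
  show ?thesis
  proof (cases "\<phi> (from_coords x) = 0")
    case True
    then have "\<bar>\<phi> (from_coords x)\<bar> powr s = 0" by simp
    also have "0 \<le> line_integral (interval_lborel R) b (\<lambda>x. f (from_coords x)) x"
      unfolding line_integral_def using f0 by (intro Bochner_Integration.integral_nonneg) auto
    finally show ?thesis unfolding f_def .
  next
    case False
    then have "from_coords x \<in> \<Omega>" using test_function_outside(1)[OF \<phi>] by auto
    then have xb: "-R < x b" "x b < R" using R[of "from_coords x" b] b by auto
    define \<psi> where "\<psi> t = \<bar>\<phi> (y t)\<bar> powr s" for t
    have "y (-R) \<notin> \<Omega>" using R[of "y (-R)" b] b xb by (auto simp: yb)
    then have \<psi>0: "\<psi> (-R) = 0" using test_function_outside(1)[OF \<phi>] by (simp add: \<psi>_def)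
    define \<psi>' where "\<psi>' t = s * \<bar>\<phi> (y t)\<bar> powr (s - 2) * \<phi> (y t) * (gradient \<phi> (y t) \<bullet> b)" for t
    have d: "(\<psi> has_real_derivative \<psi>' t) (at t)" for t
    proof -
      have "(y has_derivative (\<lambda>h. h *\<^sub>R b)) (at t)" unfolding y_def by (auto intro!: derivative_eq_intros)
      from has_derivative_compose[OF this test_function_has_derivative[OF \<phi>]]
      have "((\<lambda>t. \<phi> (y t)) has_real_derivative (gradient \<phi> (y t) \<bullet> b)) (at t)"
        by (simp add: has_field_derivative_def mult.commute[of _ "gradient \<phi> (y t) \<bullet> b"])
      from DERIV_chain'[OF this has_real_derivative_abs_powr[OF s]] show ?thesis
        unfolding \<psi>_def \<psi>'_def .
    qed
    have le: "\<psi>' t \<le> f (y t)" for t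
    proof -
      have e: "\<bar>\<phi> (y t)\<bar> powr (s - 2) * \<bar>\<phi> (y t)\<bar> = \<bar>\<phi> (y t)\<bar> powr (s - 1)"
        using powr_add[of "\<bar>\<phi> (y t)\<bar>" "s - 2" 1] by (cases "\<phi> (y t) = 0") auto
      have "\<psi>' t \<le> \<bar>\<psi>' t\<bar>" by simp
      also have "\<dots> = s * (\<bar>\<phi> (y t)\<bar> powr (s - 2) * \<bar>\<phi> (y t)\<bar>) * \<bar>gradient \<phi> (y t) \<bullet> b\<bar>"
        using s by (simp add: \<psi>'_def abs_mult)
      also have "\<dots> \<le> f (y t)"
        unfolding f_def e using s Basis_le_norm[OF b, of "gradient \<phi> (y t)"] by (intro mult_left_mono) auto
      finally show ?thesis .
    qed
    have "(\<psi>' has_integral (\<psi> (x b) - \<psi> (-R))) {-R..x b}"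
      using xb d by (intro fundamental_theorem_of_calculus) (auto simp: has_real_derivative_iff_has_vector_derivative[symmetric] intro: has_field_derivative_at_within)
    then have "\<psi> (x b) \<le> integral {-R..x b} (\<lambda>t. f (y t))"
      using has_integral_le[of \<psi>' _ "{-R..x b}" "\<lambda>t. f (y t)"] le \<psi>0 
        integrable_integral[OF integrable_continuous_interval[OF continuous_on_subset[OF fyc]]] by simp
    also have "\<dots> \<le> integral {-R..R} (\<lambda>t. f (y t))"
      using xb f0 by (intro integral_subset_le integrable_continuous_interval continuous_on_subset[OF fyc]) auto
    finally show ?thesis using L yx' by (simp add: \<psi>_def f_def)
  qed
qed

text \<open>The one-dimensional bounds in all \<open>N\<close> directions, each raised to the power
  \<open>r = 1 / (N - 1)\<close>, are multiplied and integrated; for this \<open>r\<close> the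
  factor \<open>f\<close> drops out of \<open>prod_line_integrals_le\<close>.\<close>

lemma gagliardo_nirenberg_test:
  fixes \<phi> :: "'a::euclidean_space \<Rightarrow> real" and s :: real
  assumes \<phi>: "\<phi> \<in> test_functions \<Omega>" and bd: "bounded \<Omega>" and N: "2 \<le> DIM('a)" and s: "1 < s"
  shows "(\<integral>x. \<bar>\<phi> x\<bar> powr (s * real DIM('a) / (real DIM('a) - 1)) \<partial>lborel)
     \<le> (\<integral>x. s * \<bar>\<phi> x\<bar> powr (s - 1) * norm (gradient \<phi> x) \<partial>lborel) powr (real DIM('a) / (real DIM('a) - 1))"
proof -
  define n where "n = real DIM('a)"
  define r where "r = 1 / (n - 1)"
  have n: "2 \<le> n" using N by (simp add: n_def)
  have r: "0 < r" "(n - 1) * r = 1" "1 + r = n / (n - 1)" using n by (auto simp: r_def field_simps)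
  obtain R0 where R0: "\<And>x. x \<in> \<Omega> \<Longrightarrow> norm x \<le> R0" using bd bounded_iff by metis
  define R where "R = \<bar>R0\<bar> + 1"
  have Rpos: "0 < R" by (simp add: R_def)
  have R: "\<bar>x \<bullet> b\<bar> < R" if "x \<in> \<Omega>" "b \<in> Basis" for x b
    using R0[OF that(1)] Basis_le_norm[OF that(2), of x] by (simp add: R_def)
  obtain B where B: "0 \<le> B" "\<And>x. \<bar>\<phi> x\<bar> \<le> B" "\<And>x. norm (gradient \<phi> x) \<le> B" using test_function_bounded[OF \<phi> bd] by metis
  define f where "f y = s * \<bar>\<phi> y\<bar> powr (s - 1) * norm (gradient \<phi> y)" for y
  define C where "C = s * B powr (s - 1) * B"
  have f: "0 \<le> f y" "f y \<le> C" for y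
    unfolding f_def C_def using s B by (auto intro!: mult_mono powr_mono2)
  have C: "0 \<le> C" using s B by (simp add: C_def)
  have fc: "continuous_on UNIV f"
    unfolding f_def using s by (intro continuous_intros continuous_on_powr' test_function_continuous[OF \<phi>]) auto
  have fm: "f \<in> borel_measurable borel" by (rule borel_measurable_continuous_onI[OF fc])
  have \<phi>m: "\<phi> \<in> borel_measurable borel" by (rule borel_measurable_continuous_onI[OF test_function_continuous(1)[OF \<phi>]])
  define M where "M = interval_lborel R"
  have M: "finite_measure M" "measure M (space M) = 2 * R" unfolding M_def using finite_measure_interval_lborel[OF Rpos] by auto
  let ?P = "PiM Basis (\<lambda>_::'a. M)"
  interpret finite_measure ?P using M by (intro finite_measure_PiM) auto
  \<comment> \<open>The product inequality asks for a positive lower bound, but \<open>f\<close>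
    vanishes off the support; the constant \<open>e\<close> is added and removed by a limit at the
    end.\<close>
  have key: "(\<integral>x. \<bar>\<phi> (from_coords x)\<bar> powr (s * (n * r)) \<partial>?P) \<le> ((\<integral>x. f (from_coords x) \<partial>?P) + e * measure ?P (space ?P)) powr (1 + r)"
    if e: "0 < e" for e
  proof -
    define F where "F x = f (from_coords x) + e" for x
    have Fi: "integrable ?P F"
      unfolding F_def M_def using f by (intro integrable_bounded_PiM_interval_lborel[OF Rpos, of "\<lambda>y. f y + e" "C + e"]) (use fm e in auto)
    have Fm: "F \<in> borel_measurable ?P" using Fi by auto
    have ins: "insert b Basis = (Basis :: 'a set)" if "b \<in> Basis" for b :: 'a using that by auto
    have Lm: "line_integral M b F \<in> borel_measurable ?P" if "b \<in> Basis" for b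
      by (rule measurable_line_integral[OF M(1)]) (simp only: ins[OF that] Fm)
    have sp: "x \<in> space ?P \<Longrightarrow> x \<in> space (PiM (insert b Basis) (\<lambda>_. M))" if "b \<in> Basis" for b x by (simp only: ins[OF that])
    have Lb: "0 \<le> line_integral M b F x \<and> line_integral M b F x \<le> (C + e) * (2 * R) \<and> integrable M (\<lambda>t. F (x(b := t)))" 
      if "b \<in> Basis" "x \<in> space ?P" for b x
      using line_integral_bounds[OF M(1) that(2), of F b 0 "C + e"] Fm f e C unfolding ins[OF that(1)] M(2) F_def by auto
    have "(\<integral>x. \<bar>\<phi> (from_coords x)\<bar> powr (s * (n * r)) \<partial>?P) \<le> (\<integral>x. F x powr (1 - (n - 1) * r) * (\<Prod>i\<in>Basis. line_integral M i F x powr r) \<partial>?P)"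
    proof (rule integral_mono)
      show "integrable ?P (\<lambda>x. \<bar>\<phi> (from_coords x)\<bar> powr (s * (n * r)))"
        unfolding M_def using B s n r \<phi>m
        by (intro integrable_bounded_PiM_interval_lborel[OF Rpos, of "\<lambda>y. \<bar>\<phi> y\<bar> powr (s * (n * r))" "B powr (s * (n * r))"]) (auto intro!: powr_mono2)
      show "integrable ?P (\<lambda>x. F x powr (1 - (n - 1) * r) * (\<Prod>i\<in>Basis. line_integral M i F x powr r))"
      proof (rule integrable_const_bound[OF AE_I2])
        show "(\<lambda>x. F x powr (1 - (n - 1) * r) * (\<Prod>i\<in>Basis. line_integral M i F x powr r)) \<in> borel_measurable ?P"
          by (intro borel_measurable_times borel_measurable_prod powr_real_measurable Fm Lm borel_measurable_const)
        fix x assume x: "x \<in> space ?P"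
        have "F x \<noteq> 0" using f(1)[of "from_coords x"] e by (auto simp: F_def)
        then have "\<bar>F x powr (1 - (n - 1) * r) * (\<Prod>i\<in>Basis. line_integral M i F x powr r)\<bar> = (\<Prod>i\<in>Basis. line_integral M i F x powr r)"
          using r by (simp add: prod_nonneg)
        also have "\<dots> \<le> (\<Prod>i\<in>(Basis::'a set). ((C + e) * (2 * R)) powr r)"
          using Lb x r by (intro prod_mono conjI powr_mono2) auto
        finally show "norm (F x powr (1 - (n - 1) * r) * (\<Prod>i\<in>Basis. line_integral M i F x powr r)) \<le> (\<Prod>i\<in>(Basis::'a set). ((C + e) * (2 * R)) powr r)"
          by simp
      qed
      fix x assume x: "x \<in> space ?P"
      have "F x \<noteq> 0" using f(1)[of "from_coords x"] e by (auto simp: F_def)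
      \<comment> \<open>The exponent is exactly \<open>0\<close>. As \<open>0 powr 0 = 0\<close>,
        this equation depends on \<open>F x\<close> being nonzero.\<close>
      then have one: "F x powr (1 - (n - 1) * r) = 1" using r by simp
      have le: "\<bar>\<phi> (from_coords x)\<bar> powr s \<le> line_integral M b F x" if b: "b \<in> Basis" for b
      proof -
        have "\<bar>\<phi> (from_coords x)\<bar> powr s \<le> line_integral M b (\<lambda>x. f (from_coords x)) x"
          unfolding M_def f_def by (rule abs_powr_le_line_integral[OF \<phi> R s b])
        also have "\<dots> \<le> line_integral M b F x"
          unfolding line_integral_def using Lb[OF b x] f e by (intro integral_mono') (auto simp: F_def)
        finally show ?thesis .
      qed
      have "\<bar>\<phi> (from_coords x)\<bar> powr (s * (n * r)) = (\<Prod>i\<in>(Basis::'a set). (\<bar>\<phi> (from_coords x)\<bar> powr s) powr r)"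
      proof (cases "\<phi> (from_coords x) = 0")
        case False
        then show ?thesis by (simp add: powr_powr powr_power n_def mult_ac)
      qed (use n r s in simp)
      also have "\<dots> \<le> (\<Prod>i\<in>Basis. line_integral M i F x powr r)"
        using le r by (intro prod_mono conjI powr_mono2) auto
      finally show "\<bar>\<phi> (from_coords x)\<bar> powr (s * (n * r)) \<le> F x powr (1 - (n - 1) * r) * (\<Prod>i\<in>Basis. line_integral M i F x powr r)"
        by (simp add: one)
    qed
    also have "\<dots> \<le> (\<integral>x. F x \<partial>?P) powr (1 + r)"
      unfolding n_def
    proof (rule prod_line_integrals_le[OF M(1)])
      show "0 < measure M (space M)" using M Rpos by simp
      show "(real DIM('a) - 1) * r \<le> 1" using r by (simp add: n_def)
      show "e \<le> F x \<and> F x \<le> C + e" for x using f[of "from_coords x"] by (auto simp: F_def)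
    qed (use r e Fm in auto)
    also have "(\<integral>x. F x \<partial>?P) = (\<integral>x. f (from_coords x) \<partial>?P) + e * measure ?P (space ?P)"
    proof -
      have "integrable ?P (\<lambda>x. f (from_coords x))"
        unfolding M_def using f by (intro integrable_bounded_PiM_interval_lborel[OF Rpos fm, of C]) simp
      then show ?thesis by (simp add: F_def)
    qed
    finally show ?thesis .
  qed
  have I0: "0 \<le> (\<integral>x. f (from_coords x) \<partial>?P)" using f by (intro Bochner_Integration.integral_nonneg) auto
  have "(\<integral>x. \<bar>\<phi> (from_coords x)\<bar> powr (s * (n * r)) \<partial>?P) \<le> ((\<integral>x. f (from_coords x) \<partial>?P) + 0 * measure ?P (space ?P)) powr (1 + r)"
  proof (rule tendsto_lowerbound)
    show "((\<lambda>e. ((\<integral>x. f (from_coords x) \<partial>?P) + e * measure ?P (space ?P)) powr (1 + r)) \<longlongrightarrow> 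
      ((\<integral>x. f (from_coords x) \<partial>?P) + 0 * measure ?P (space ?P)) powr (1 + r)) (at_right 0)"
    proof (rule tendsto_powr')
      show "((\<lambda>e. (\<integral>x. f (from_coords x) \<partial>?P) + e * measure ?P (space ?P)) \<longlongrightarrow> (\<integral>x. f (from_coords x) \<partial>?P) + 0 * measure ?P (space ?P)) (at_right 0)"
        by (intro tendsto_intros)
      show "(\<integral>x. f (from_coords x) \<partial>?P) + 0 * measure ?P (space ?P) \<noteq> 0 \<or> 0 < 1 + r \<and> (\<forall>\<^sub>F x in at_right 0. 0 \<le> (\<integral>x. f (from_coords x) \<partial>?P) + x * measure ?P (space ?P))"
        using r I0 by (intro disjI2 conjI eventually_at_rightI[of 0 1]) auto
    qed (rule tendsto_const)
    show "\<forall>\<^sub>F e in at_right 0. (\<integral>x. \<bar>\<phi> (from_coords x)\<bar> powr (s * (n * r)) \<partial>?P) \<le> ((\<integral>x. f (from_coords x) \<partial>?P) + e * measure ?P (space ?P)) powr (1 + r)"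
      using key by (intro eventually_at_rightI[of 0 1]) auto
  qed simp
  moreover have out: "x \<notin> \<Omega>" if "b \<in> Basis" "\<bar>x \<bullet> b\<bar> > R" for x b using R[of x b] that by auto
  have "(\<integral>x. f (from_coords x) \<partial>?P) = (\<integral>x. f x \<partial>lborel)" unfolding M_def
    using out test_function_outside[OF \<phi>] by (intro integral_PiM_interval_lborel fm Rpos) (simp add: f_def)
  moreover have "(\<integral>x. \<bar>\<phi> (from_coords x)\<bar> powr (s * (n * r)) \<partial>?P) = (\<integral>x. \<bar>\<phi> x\<bar> powr (s * (n * r)) \<partial>lborel)" unfolding M_def
    using out test_function_outside[OF \<phi>] \<phi>m s n r
    by (intro integral_PiM_interval_lborel[OF _ Rpos]) auto
  moreover have "s * (n * r) = s * n / (n - 1)" by (simp add: r_def)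
  ultimately show ?thesis using r(3) unfolding f_def n_def by simp
qed

text \<open>Apply the previous inequality with \<open>s = p (N - 1) / (N - p)\<close>, for which \<open>s N / (N - 1)\<close> and \<open>(s - 1) p / (p - 1)\<close>
  both equal the critical exponent, and use the Hoelder inequality.\<close>

lemma sobolev_inequality_test:
  fixes \<phi> :: "'a::euclidean_space \<Rightarrow> real" and p :: real
  assumes \<phi>: "\<phi> \<in> test_functions \<Omega>" and bd: "bounded \<Omega>" and p: "1 < p" "p < DIM('a)"
  shows "(\<integral>x. \<bar>\<phi> x\<bar> powr crit_exp DIM('a) p \<partial>lborel) powr (p / crit_exp DIM('a) p)
     \<le> (p * (real DIM('a) - 1) / (real DIM('a) - p)) powr p * (\<integral>x. norm (gradient \<phi> x) powr p \<partial>lborel)"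
proof -
  define n where "n = real DIM('a)"
  define s where "s = p * (n - 1) / (n - p)"
  define ps where "ps = crit_exp DIM('a) p"
  define p' where "p' = p / (p - 1)"
  have n: "1 < n" "p < n" "2 \<le> DIM('a)" using p by (auto simp: n_def)
  have s1: "s - 1 = n * (p - 1) / (n - p)"
  proof -
    have "p * (n - 1) - (n - p) = n * (p - 1)" by (simp add: algebra_simps)
    then show ?thesis using n by (simp add: s_def diff_divide_distrib[symmetric] divide_eq_eq eq_divide_eq left_diff_distrib)
  qed
  have "0 < s - 1" unfolding s1 using n p by simp
  then have s: "1 < s" by simp
  have ps: "ps = n * p / (n - p)" by (simp add: ps_def crit_exp_def n_def)
  have psp: "0 < ps" using n p by (simp add: ps)
  have p': "1 < p'" "1 / p + 1 / p' = 1" using p by (auto simp: p'_def add_divide_distrib[symmetric])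
  have e1: "s * n / (n - 1) = ps" using n by (simp add: s_def ps)
  have e2: "(s - 1) * p' = ps" unfolding s1 using n p by (simp add: ps p'_def)
  have cont: "continuous_on UNIV \<phi>" "continuous_on UNIV (gradient \<phi>)" using test_function_continuous[OF \<phi>] by auto
  have int: "integrable lborel (\<lambda>x. \<bar>\<phi> x\<bar> powr ps)" "integrable lborel (\<lambda>x. norm (gradient \<phi> x) powr p)"
  proof -
    have "continuous_on UNIV (\<lambda>x. \<bar>\<phi> x\<bar> powr ps)" "continuous_on UNIV (\<lambda>x. norm (gradient \<phi> x) powr p)"
      by (rule continuous_on_powr'; use psp p in \<open>auto intro!: continuous_intros cont\<close>)+
    then show "integrable lborel (\<lambda>x. \<bar>\<phi> x\<bar> powr ps)" "integrable lborel (\<lambda>x. norm (gradient \<phi> x) powr p)"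
      using test_function_outside[OF \<phi>] by (auto intro!: integrable_continuous_compact_support[OF _ bd])
  qed
  have [measurable]: "\<phi> \<in> borel_measurable borel" "gradient \<phi> \<in> borel_measurable borel"
    using cont by (auto intro: borel_measurable_continuous_onI)
  define X where "X = (\<integral>x. \<bar>\<phi> x\<bar> powr ps \<partial>lborel)"
  define E where "E = (\<integral>x. norm (gradient \<phi> x) powr p \<partial>lborel)"
  have XE: "0 \<le> X" "0 \<le> E" by (auto simp: X_def E_def)
  have pw: "(\<bar>\<phi> x\<bar> powr (s - 1)) powr p' = \<bar>\<phi> x\<bar> powr ps" for x by (simp add: powr_powr e2)
  have "(\<integral>x. \<bar>\<phi> x\<bar> powr (s - 1) * norm (gradient \<phi> x) \<partial>lborel) \<le> X powr (1 / p') * E powr (1 / p)"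
    using Holder_inequality(2)[OF p'(1) p(1), of "\<lambda>x. \<bar>\<phi> x\<bar> powr (s - 1)" lborel "\<lambda>x. norm (gradient \<phi> x)"] p' int
    by (simp add: pw X_def E_def add.commute)
  then have le: "(\<integral>x. s * \<bar>\<phi> x\<bar> powr (s - 1) * norm (gradient \<phi> x) \<partial>lborel) \<le> s * (X powr (1 / p') * E powr (1 / p))"
    using s by (simp add: mult.assoc)
  have "X \<le> (\<integral>x. s * \<bar>\<phi> x\<bar> powr (s - 1) * norm (gradient \<phi> x) \<partial>lborel) powr (n / (n - 1))"
    using gagliardo_nirenberg_test[OF \<phi> bd n(3) s] by (simp add: X_def n_def[symmetric] e1)
  also have "\<dots> \<le> (s * (X powr (1 / p') * E powr (1 / p))) powr (n / (n - 1))"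
    using le n s by (intro powr_mono2 Bochner_Integration.integral_nonneg) auto
  finally have main: "X \<le> (s * (X powr (1 / p') * E powr (1 / p))) powr (n / (n - 1))" .
  show ?thesis
  proof (cases "X = 0")
    case True
    then show ?thesis using XE s by (simp add: X_def[symmetric] ps_def[symmetric] E_def[symmetric])
  next
    case False
    then have X: "0 < X" using XE by simp
    have "X powr ((n - 1) / n) \<le> ((s * (X powr (1 / p') * E powr (1 / p))) powr (n / (n - 1))) powr ((n - 1) / n)"
      using main X n by (intro powr_mono2) auto
    also have "\<dots> = s * (X powr (1 / p') * E powr (1 / p))"
      using n s XE by (simp add: powr_powr)
    \<comment> \<open>The power of \<open>X\<close> on the right is moved to the left, which is
      possible since \<open>X > 0\<close>; the resulting exponent is
      \<open>(1 - 1 / n) - (1 - 1 / p) = 1 / ps\<close>.\<close>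
    finally have "X powr ((n - 1) / n) * X powr (- (1 / p')) \<le> s * (X powr (1 / p') * E powr (1 / p)) * X powr (- (1 / p'))"
      by (intro mult_right_mono) auto
    also have "\<dots> = s * E powr (1 / p)" using X by (simp add: powr_minus)
    also have "X powr ((n - 1) / n) * X powr (- (1 / p')) = X powr (1 / ps)"
    proof -
      have "(n - 1) / n + (- (1 / p')) = 1 / ps" 
      proof -
        have "(n - 1) / n = 1 - 1 / n" "1 / p' = 1 - 1 / p" "1 / ps = 1 / p - 1 / n"
          using n p by (simp_all add: ps p'_def diff_divide_distrib)
        then show ?thesis by simp
      qed
      then show ?thesis by (simp add: powr_add[symmetric])
    qed
    finally have "(X powr (1 / ps)) powr p \<le> (s * E powr (1 / p)) powr p" using p by (intro powr_mono2) auto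
    then have "X powr (p / ps) \<le> s powr p * E" using s p XE by (simp add: powr_powr powr_mult)
    then show ?thesis by (simp add: X_def E_def ps_def s_def n_def)
  qed
qed

subsection \<open>Rellich compactness\<close>

text \<open>The fundamental theorem of calculus along the segment from \<open>x\<close> to
  \<open>x + z\<close>, followed by Tonelli's theorem and translation invariance. Nonnegative
  integrals spare the joint integrability that Fubini's theorem would ask for.\<close>

lemma integral_translate_diff_le:
  fixes \<phi> :: "'a::euclidean_space \<Rightarrow> real"
  assumes \<phi>: "\<phi> \<in> test_functions \<Omega>" and bd: "bounded \<Omega>"
  shows "(\<integral>\<^sup>+x. ennreal \<bar>\<phi> (x + z) - \<phi> x\<bar> \<partial>lborel) \<le> ennreal (norm z * (\<integral>x. norm (gradient \<phi> x) \<partial>lborel))"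
proof -
  have cont: "continuous_on UNIV \<phi>" "continuous_on UNIV (gradient \<phi>)" using test_function_continuous[OF \<phi>] by auto
  have [measurable]: "\<phi> \<in> borel_measurable borel" "gradient \<phi> \<in> borel_measurable borel"
    using cont by (auto intro: borel_measurable_continuous_onI)
  have gi: "integrable lborel (\<lambda>x. norm (gradient \<phi> x))"
    using test_function_outside(2)[OF \<phi>] by (intro integrable_continuous_compact_support[OF _ bd] continuous_intros cont) auto
  have pt: "ennreal \<bar>\<phi> (x + z) - \<phi> x\<bar> \<le> (\<integral>\<^sup>+t. ennreal (norm z * norm (gradient \<phi> (x + t *\<^sub>R z))) * indicator {0..1} t \<partial>lborel)" for x
  proof -
    have c: "continuous_on {0..1} (\<lambda>t. norm z * norm (gradient \<phi> (x + t *\<^sub>R z)))"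
      by (intro continuous_intros continuous_on_compose2[OF cont(2)]) auto
    have d: "((\<lambda>t. \<phi> (x + t *\<^sub>R z)) has_real_derivative (gradient \<phi> (x + t *\<^sub>R z) \<bullet> z)) (at t)" for t
    proof -
      have "((\<lambda>t::real. x + t *\<^sub>R z) has_derivative (\<lambda>h. h *\<^sub>R z)) (at t)" by (auto intro!: derivative_eq_intros)
      from has_derivative_compose[OF this test_function_has_derivative[OF \<phi>]] show ?thesis
        by (simp add: has_field_derivative_def mult.commute[of _ "gradient \<phi> (x + t *\<^sub>R z) \<bullet> z"])
    qed
    have "((\<lambda>t. gradient \<phi> (x + t *\<^sub>R z) \<bullet> z) has_integral (\<phi> (x + 1 *\<^sub>R z) - \<phi> (x + 0 *\<^sub>R z))) {0..1}"
      using d by (intro fundamental_theorem_of_calculus)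
        (auto simp: has_real_derivative_iff_has_vector_derivative[symmetric] intro: has_field_derivative_at_within)
    then have "\<phi> (x + z) - \<phi> x = integral {0..1} (\<lambda>t. gradient \<phi> (x + t *\<^sub>R z) \<bullet> z)" by (simp add: integral_unique)
    then have "\<bar>\<phi> (x + z) - \<phi> x\<bar> \<le> integral {0..1} (\<lambda>t. norm z * norm (gradient \<phi> (x + t *\<^sub>R z)))"
    proof -
      have "norm (integral {0..1} (\<lambda>t. gradient \<phi> (x + t *\<^sub>R z) \<bullet> z)) \<le> integral {0..1} (\<lambda>t. norm z * norm (gradient \<phi> (x + t *\<^sub>R z)))"
      proof (rule integral_norm_bound_integral)
        show "(\<lambda>t. gradient \<phi> (x + t *\<^sub>R z) \<bullet> z) integrable_on {0..1}"
          by (intro integrable_continuous_interval continuous_intros continuous_on_compose2[OF cont(2)]) auto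
        show "norm (gradient \<phi> (x + t *\<^sub>R z) \<bullet> z) \<le> norm z * norm (gradient \<phi> (x + t *\<^sub>R z))" for t
          using Cauchy_Schwarz_ineq2[of "gradient \<phi> (x + t *\<^sub>R z)" z] by (simp add: mult.commute)
      qed (rule integrable_continuous_interval[OF c])
      then show ?thesis using \<open>\<phi> (x + z) - \<phi> x = _\<close> by simp
    qed
    also have "\<dots> = (\<integral>t. indicator {0..1} t *\<^sub>R (norm z * norm (gradient \<phi> (x + t *\<^sub>R z))) \<partial>lborel)"
      using set_borel_integral_eq_integral(2)[OF borel_integrable_atLeastAtMost'[OF c]] unfolding set_lebesgue_integral_def by (rule sym)
    finally have "ennreal \<bar>\<phi> (x + z) - \<phi> x\<bar> \<le> ennreal (\<integral>t. indicator {0..1} t *\<^sub>R (norm z * norm (gradient \<phi> (x + t *\<^sub>R z))) \<partial>lborel)"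
      by (rule ennreal_leI)
    also have "\<dots> = (\<integral>\<^sup>+t. ennreal (indicator {0..1} t *\<^sub>R (norm z * norm (gradient \<phi> (x + t *\<^sub>R z)))) \<partial>lborel)"
      using borel_integrable_atLeastAtMost'[OF c] by (intro nn_integral_eq_integral[symmetric]) (auto simp: set_integrable_def)
    also have "\<dots> = (\<integral>\<^sup>+t. ennreal (norm z * norm (gradient \<phi> (x + t *\<^sub>R z))) * indicator {0..1} t \<partial>lborel)"
      by (intro nn_integral_cong) (auto simp: indicator_def)
    finally show ?thesis .
  qed
  have "(\<integral>\<^sup>+x. ennreal \<bar>\<phi> (x + z) - \<phi> x\<bar> \<partial>lborel) 
     \<le> (\<integral>\<^sup>+x. (\<integral>\<^sup>+t. ennreal (norm z * norm (gradient \<phi> (x + t *\<^sub>R z))) * indicator {0..1::real} t \<partial>lborel) \<partial>lborel)"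
    by (intro nn_integral_mono pt)
  also have "\<dots> = (\<integral>\<^sup>+t. (\<integral>\<^sup>+x. ennreal (norm z * norm (gradient \<phi> (x + t *\<^sub>R z))) * indicator {0..1::real} t \<partial>lborel) \<partial>lborel)"
    by (rule lborel_pair.Fubini') measurable
  also have "\<dots> = (\<integral>\<^sup>+t. ennreal (norm z * (\<integral>x. norm (gradient \<phi> x) \<partial>lborel)) * indicator {0..1::real} t \<partial>lborel)"
  proof (rule nn_integral_cong)
    fix t :: real
    have "(\<integral>\<^sup>+x. ennreal (norm z * norm (gradient \<phi> (x + t *\<^sub>R z))) * indicator {0..1::real} t \<partial>lborel)
      = (\<integral>\<^sup>+x. ennreal (norm z * norm (gradient \<phi> (x + t *\<^sub>R z))) \<partial>lborel) * indicator {0..1::real} t"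
      by (rule nn_integral_multc) measurable
    also have "(\<integral>\<^sup>+x. ennreal (norm z * norm (gradient \<phi> (x + t *\<^sub>R z))) \<partial>lborel) = ennreal (\<integral>x. norm z * norm (gradient \<phi> (x + t *\<^sub>R z)) \<partial>lborel)"
      using integrable_lborel_translate[OF gi, of "t *\<^sub>R z"] by (intro nn_integral_eq_integral) auto
    also have "(\<integral>x. norm z * norm (gradient \<phi> (x + t *\<^sub>R z)) \<partial>lborel) = norm z * (\<integral>x. norm (gradient \<phi> x) \<partial>lborel)"
      using integral_lborel_translate[of "\<lambda>x. norm (gradient \<phi> x)" "t *\<^sub>R z"] by simp
    finally show "(\<integral>\<^sup>+x. ennreal (norm z * norm (gradient \<phi> (x + t *\<^sub>R z))) * indicator {0..1::real} t \<partial>lborel)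
      = ennreal (norm z * (\<integral>x. norm (gradient \<phi> x) \<partial>lborel)) * indicator {0..1::real} t" .
  qed
  also have "\<dots> = ennreal (norm z * (\<integral>x. norm (gradient \<phi> x) \<partial>lborel))"
    by (subst nn_integral_cmult_indicator) auto
  finally show ?thesis .
qed

section \<open>Averaging against a tent function\<close>

text \<open>A mollifier of radius \<open>1 / m\<close> that is merely Lipschitz, which is enough for
  equicontinuity of the averages.\<close>

definition tent :: "real \<Rightarrow> 'a::euclidean_space \<Rightarrow> real" where
  "tent m z = max 0 (1 - m * norm z)"

text \<open>Not divided by the integral of the tent, so it approximates \<open>c * \<phi>\<close>
  with \<open>c\<close> that integral.\<close>

definition tent_average :: "real \<Rightarrow> ('a::euclidean_space \<Rightarrow> real) \<Rightarrow> 'a \<Rightarrow> real" where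
  "tent_average m \<phi> x = (\<integral>z. tent m z * \<phi> (x + z) \<partial>lborel)"

lemma tent_bounds: "0 \<le> m \<Longrightarrow> 0 \<le> tent m z \<and> tent m z \<le> 1"
  by (simp add: tent_def)

lemma tent_lipschitz: "0 \<le> m \<Longrightarrow> \<bar>tent m z - tent m z'\<bar> \<le> m * norm (z - z')"
proof -
  assume m: "0 \<le> m"
  have "\<bar>m * norm z - m * norm z'\<bar> \<le> m * norm (z - z')"
    using m norm_triangle_ineq3[of z z'] by (simp add: right_diff_distrib[symmetric] abs_mult mult_left_mono)
  then show ?thesis unfolding tent_def by (auto simp: max_def abs_le_iff)
qed

lemma continuous_tent: "continuous_on A (tent m)"
  unfolding tent_def by (intro continuous_intros)

lemma tent_eq_0: "0 < m \<Longrightarrow> 1 / m < norm z \<Longrightarrow> tent m z = 0"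
  by (simp add: tent_def field_simps)

lemma integrable_tent: "0 < m \<Longrightarrow> integrable lborel (tent m :: 'a::euclidean_space \<Rightarrow> real)"
  by (intro integrable_continuous_compact_support[of _ "cball 0 (1/m)"] continuous_tent) (auto intro: tent_eq_0)

lemma integral_tent_pos:
  assumes "0 < m"
  shows "0 < (\<integral>z. tent m (z :: 'a::euclidean_space) \<partial>lborel)"
proof -
  have le: "(1/2) * indicator (ball 0 (1 / (2 * m))) z \<le> tent m z" for z :: 'a
  proof (cases "z \<in> ball 0 (1 / (2 * m))")
    case True
    then have "m * norm z \<le> 1/2" using assms by (simp add: field_simps)
    then show ?thesis using True by (simp add: tent_def)
  qed (use assms tent_bounds[of m z] in simp)
  have fin: "emeasure lborel (ball (0::'a) (1 / (2 * m))) < \<infinity>" by (rule emeasure_lborel_ball_finite)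
  have "0 < measure lborel (ball (0::'a) (1 / (2 * m)))"
    using assms by (simp add: content_ball_pos)
  then have "0 < (\<integral>z. (1/2::real) * indicator (ball (0::'a) (1 / (2 * m))) z \<partial>lborel)" using fin by simp
  also have "\<dots> \<le> (\<integral>z. tent m (z :: 'a) \<partial>lborel)"
    using le integrable_tent[OF assms] fin by (intro integral_mono) auto
  finally show ?thesis .
qed

lemma tent_average_alt:
  fixes \<phi> :: "'a::euclidean_space \<Rightarrow> real"
  assumes [measurable]: "\<phi> \<in> borel_measurable borel"
  shows "tent_average m \<phi> x = (\<integral>y. tent m (y - x) * \<phi> y \<partial>lborel)"
proof -
  have [measurable]: "tent m \<in> borel_measurable (borel :: 'a measure)" by (rule borel_measurable_continuous_onI[OF continuous_tent])
  show ?thesis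
    using integral_lborel_translate[of "\<lambda>y. tent m (y - x) * \<phi> y" x] by (simp add: tent_average_def add.commute)
qed

lemma integrable_tent_mult:
  fixes \<phi> :: "'a::euclidean_space \<Rightarrow> real"
  assumes "0 < m" "integrable lborel \<phi>"
  shows "integrable lborel (\<lambda>y. tent m (y - x) * \<phi> y)"
proof (rule Bochner_Integration.integrable_bound[OF assms(2)])
  have [measurable]: "tent m \<in> borel_measurable (borel :: 'a measure)" by (rule borel_measurable_continuous_onI[OF continuous_tent])
  have [measurable]: "\<phi> \<in> borel_measurable borel" using borel_measurable_integrable[OF assms(2)] by simp
  show "(\<lambda>y. tent m (y - x) * \<phi> y) \<in> borel_measurable lborel" by measurable
  show "AE y in lborel. norm (tent m (y - x) * \<phi> y) \<le> norm (\<phi> y)"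
  proof (intro AE_I2)
    fix y
    show "norm (tent m (y - x) * \<phi> y) \<le> norm (\<phi> y)"
      using tent_bounds[of m "y - x"] assms(1) by (simp add: abs_mult mult_left_le_one_le)
  qed
qed

text \<open>At a fixed scale a bound on the integral of \<open>\<bar>\<phi>\<bar>\<close> alone
  makes the averages equibounded and equi-Lipschitz, because all variation in \<open>x\<close> falls
  on the tent.\<close>

lemma tent_average_bound:
  fixes \<phi> :: "'a::euclidean_space \<Rightarrow> real"
  assumes "0 < m" and i: "integrable lborel \<phi>"
  shows "\<bar>tent_average m \<phi> x\<bar> \<le> (\<integral>y. \<bar>\<phi> y\<bar> \<partial>lborel)"
    "\<bar>tent_average m \<phi> x - tent_average m \<phi> x'\<bar> \<le> m * norm (x - x') * (\<integral>y. \<bar>\<phi> y\<bar> \<partial>lborel)"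
proof -
  have [measurable]: "\<phi> \<in> borel_measurable borel" using borel_measurable_integrable[OF i] by simp
  note alt = tent_average_alt[of \<phi> m]
  have "\<bar>tent_average m \<phi> x\<bar> \<le> (\<integral>y. \<bar>tent m (y - x) * \<phi> y\<bar> \<partial>lborel)"
    using integral_norm_bound[of lborel "\<lambda>y. tent m (y - x) * \<phi> y"] by (simp add: alt)
  also have "\<dots> \<le> (\<integral>y. \<bar>\<phi> y\<bar> \<partial>lborel)"
  proof (rule integral_mono)
    show "integrable lborel (\<lambda>y. \<bar>tent m (y - x) * \<phi> y\<bar>)" "integrable lborel (\<lambda>y. \<bar>\<phi> y\<bar>)"
      using integrable_tent_mult[OF assms] i by (auto simp only: integrable_abs)
    show "\<bar>tent m (y - x) * \<phi> y\<bar> \<le> \<bar>\<phi> y\<bar>" for y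
      using tent_bounds[of m "y - x"] assms(1) by (simp add: abs_mult mult_left_le_one_le)
  qed
  finally show "\<bar>tent_average m \<phi> x\<bar> \<le> (\<integral>y. \<bar>\<phi> y\<bar> \<partial>lborel)" .
  have "tent_average m \<phi> x - tent_average m \<phi> x' = (\<integral>y. tent m (y - x) * \<phi> y - tent m (y - x') * \<phi> y \<partial>lborel)"
    using integrable_tent_mult[OF assms] by (simp add: alt)
  also have "\<bar>\<dots>\<bar> \<le> (\<integral>y. \<bar>tent m (y - x) * \<phi> y - tent m (y - x') * \<phi> y\<bar> \<partial>lborel)"
    using integral_norm_bound[of lborel "\<lambda>y. tent m (y - x) * \<phi> y - tent m (y - x') * \<phi> y"] by simp
  also have "\<dots> \<le> (\<integral>y. (m * norm (x - x')) * \<bar>\<phi> y\<bar> \<partial>lborel)"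
  proof (rule integral_mono)
    show "\<bar>tent m (y - x) * \<phi> y - tent m (y - x') * \<phi> y\<bar> \<le> (m * norm (x - x')) * \<bar>\<phi> y\<bar>" for y
      using tent_lipschitz[of m "y - x" "y - x'"] assms(1)
      by (simp add: left_diff_distrib[symmetric] abs_mult mult_right_mono norm_minus_commute)
  qed (use integrable_tent_mult[OF assms] i in auto)
  also have "\<dots> = m * norm (x - x') * (\<integral>y. \<bar>\<phi> y\<bar> \<partial>lborel)" by simp
  finally show "\<bar>tent_average m \<phi> x - tent_average m \<phi> x'\<bar> \<le> m * norm (x - x') * (\<integral>y. \<bar>\<phi> y\<bar> \<partial>lborel)" .
qed

text \<open>The translation estimate, averaged over the support of the tent, where
  \<open>norm z \<le> 1 / m\<close>. The error is uniform over functions with a bounded integral of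
  the gradient.\<close>

lemma tent_average_close:
  fixes \<phi> :: "'a::euclidean_space \<Rightarrow> real"
  assumes \<phi>: "\<phi> \<in> test_functions \<Omega>" and bd: "bounded \<Omega>" and m: "0 < m"
  defines "c \<equiv> (\<integral>z. tent m (z :: 'a) \<partial>lborel)"
  shows "integrable lborel (\<lambda>x. c * \<phi> x - tent_average m \<phi> x)"
    "(\<integral>x. \<bar>c * \<phi> x - tent_average m \<phi> x\<bar> \<partial>lborel) \<le> c / m * (\<integral>x. norm (gradient \<phi> x) \<partial>lborel)"
proof -
  have tb: "0 \<le> tent m z" for z :: 'a using tent_bounds[of m z] m by simp
  have c0: "0 < c" unfolding c_def by (rule integral_tent_pos[OF m])
  have cont: "continuous_on UNIV \<phi>" using test_function_continuous[OF \<phi>] by auto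
  have [measurable]: "\<phi> \<in> borel_measurable borel"
    using cont by (auto intro: borel_measurable_continuous_onI)
  have [measurable]: "tent m \<in> borel_measurable (borel :: 'a measure)" by (rule borel_measurable_continuous_onI[OF continuous_tent])
  have \<phi>i: "integrable lborel \<phi>"
    using integrable_continuous_compact_support[OF cont bd test_function_outside(1)[OF \<phi>]] .
  define E where "E = (\<integral>x. norm (gradient \<phi> x) \<partial>lborel)"
  have E0: "0 \<le> E" by (simp add: E_def)
  have i1: "integrable lborel (\<lambda>z. tent m z * \<phi> (x + z))" for x
    using integrable_lborel_translate[OF integrable_tent_mult[OF m \<phi>i, of x], of x] by (simp add: add.commute)
  have tavm [measurable]: "tent_average m \<phi> \<in> borel_measurable borel"
    unfolding tent_average_def by (rule lborel.borel_measurable_lebesgue_integral) measurable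
  have pt: "ennreal \<bar>c * \<phi> x - tent_average m \<phi> x\<bar> \<le> (\<integral>\<^sup>+z. ennreal (tent m z) * ennreal \<bar>\<phi> (x + z) - \<phi> x\<bar> \<partial>lborel)" for x
  proof -
    have i2: "integrable lborel (\<lambda>z. tent m z * \<phi> (x + z) - tent m z * \<phi> x)"
      using i1 integrable_tent[OF m, where 'a='a] by (intro Bochner_Integration.integrable_diff) auto
    have "tent_average m \<phi> x - c * \<phi> x = (\<integral>z. tent m z * \<phi> (x + z) - tent m z * \<phi> x \<partial>lborel)"
    proof -
      have "integrable lborel (\<lambda>z::'a. tent m z * \<phi> x)" using integrable_tent[OF m, where 'a='a] by simp
      from Bochner_Integration.integral_diff[OF i1 this] show ?thesis by (simp add: tent_average_def c_def)
    qed
    also have "ennreal \<bar>\<dots>\<bar> \<le> (\<integral>\<^sup>+z. ennreal \<bar>tent m z * \<phi> (x + z) - tent m z * \<phi> x\<bar> \<partial>lborel)"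
      using integral_norm_bound_ennreal[OF i2] by simp
    also have "\<dots> = (\<integral>\<^sup>+z. ennreal (tent m z) * ennreal \<bar>\<phi> (x + z) - \<phi> x\<bar> \<partial>lborel)"
      using tb m
      by (intro nn_integral_cong) (simp add: right_diff_distrib[symmetric] abs_mult ennreal_mult)
    finally show ?thesis by (simp add: abs_minus_commute)
  qed
  have "(\<integral>\<^sup>+x. ennreal \<bar>c * \<phi> x - tent_average m \<phi> x\<bar> \<partial>lborel) 
    \<le> (\<integral>\<^sup>+x. (\<integral>\<^sup>+z. ennreal (tent m z) * ennreal \<bar>\<phi> (x + z) - \<phi> x\<bar> \<partial>lborel) \<partial>lborel)"
    by (intro nn_integral_mono pt)
  also have "\<dots> = (\<integral>\<^sup>+z. (\<integral>\<^sup>+x. ennreal (tent m z) * ennreal \<bar>\<phi> (x + z) - \<phi> x\<bar> \<partial>lborel) \<partial>lborel)"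
    by (rule lborel_pair.Fubini') measurable
  also have "\<dots> \<le> (\<integral>\<^sup>+z. ennreal (tent m (z :: 'a) * (E / m)) \<partial>lborel)"
  proof (rule nn_integral_mono)
    fix z :: 'a
    have "(\<integral>\<^sup>+x. ennreal (tent m z) * ennreal \<bar>\<phi> (x + z) - \<phi> x\<bar> \<partial>lborel) = ennreal (tent m z) * (\<integral>\<^sup>+x. ennreal \<bar>\<phi> (x + z) - \<phi> x\<bar> \<partial>lborel)"
      by (rule nn_integral_cmult) measurable
    also have "\<dots> \<le> ennreal (tent m z) * ennreal (norm z * E)"
      unfolding E_def by (intro mult_left_mono integral_translate_diff_le[OF \<phi> bd]) auto
    also have "\<dots> = ennreal (tent m z * (norm z * E))" using tb[of z] m E0 by (simp add: ennreal_mult)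
    also have "\<dots> \<le> ennreal (tent m z * (E / m))"
    proof (cases "1 / m < norm z")
      case True then show ?thesis using tent_eq_0[OF m True] by simp
    next
      case False
      then have "norm z * E \<le> (1 / m) * E" using E0 by (intro mult_right_mono) auto
      then show ?thesis using tb[of z] m by (intro ennreal_leI mult_left_mono) auto
    qed
    finally show "(\<integral>\<^sup>+x. ennreal (tent m z) * ennreal \<bar>\<phi> (x + z) - \<phi> x\<bar> \<partial>lborel) \<le> ennreal (tent m z * (E / m))" .
  qed
  also have "\<dots> = ennreal (\<integral>z. tent m (z :: 'a) * (E / m) \<partial>lborel)"
    using integrable_tent[OF m, where 'a='a] tb m E0 by (intro nn_integral_eq_integral) auto
  also have "(\<integral>z. tent m (z :: 'a) * (E / m) \<partial>lborel) = c / m * E" by (simp add: c_def)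
  finally have le: "(\<integral>\<^sup>+x. ennreal \<bar>c * \<phi> x - tent_average m \<phi> x\<bar> \<partial>lborel) \<le> ennreal (c / m * E)" .
  show int: "integrable lborel (\<lambda>x. c * \<phi> x - tent_average m \<phi> x)"
    using le by (intro integrableI_bounded) (auto intro: le_less_trans[OF _ ennreal_less_top])
  have "ennreal (\<integral>x. \<bar>c * \<phi> x - tent_average m \<phi> x\<bar> \<partial>lborel) \<le> ennreal (c / m * E)"
    using le int by (subst nn_integral_eq_integral[symmetric]) auto
  then show "(\<integral>x. \<bar>c * \<phi> x - tent_average m \<phi> x\<bar> \<partial>lborel) \<le> c / m * (\<integral>x. norm (gradient \<phi> x) \<partial>lborel)"
    using c0 m E0 by (simp add: E_def[symmetric])
qed

text \<open>At each scale the averages converge everywhere along a common subsequence, hence in mean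
  on a ball; the error between \<open>c * \<phi> n\<close> and its average is small uniformly in
  \<open>n\<close>. Together these make the subsequence Cauchy in mean, and a further subsequence
  converges a.e.\<close>

lemma rellich_test:
  fixes \<phi> :: "nat \<Rightarrow> 'a::euclidean_space \<Rightarrow> real"
  assumes \<phi>: "\<And>n. \<phi> n \<in> test_functions \<Omega>" and bd: "bounded \<Omega>"
    and C: "\<And>n. (\<integral>x. \<bar>\<phi> n x\<bar> \<partial>lborel) \<le> C" "\<And>n. (\<integral>x. norm (gradient (\<phi> n) x) \<partial>lborel) \<le> C"
  shows "\<exists>k u. strict_mono (k :: nat \<Rightarrow> nat) \<and> u \<in> borel_measurable borel \<and> (AE x in lborel. (\<lambda>n. \<phi> (k n) x) \<longlonglongrightarrow> u x)"
proof -
  have \<phi>m[measurable]: "\<phi> n \<in> borel_measurable borel" for n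
    using test_function_continuous[OF \<phi>] by (auto intro: borel_measurable_continuous_onI)
  have \<phi>i: "integrable lborel (\<phi> n)" for n
    using integrable_continuous_compact_support[OF test_function_continuous(1)[OF \<phi>] bd test_function_outside(1)[OF \<phi>]] .
  have C0: "0 \<le> C" using C(1)[of 0] by (meson Bochner_Integration.integral_nonneg abs_ge_zero order_trans)
  obtain D :: "'a set" where D: "countable D" "\<And>x e. 0 < e \<Longrightarrow> \<exists>y\<in>D. dist x y < e"
  proof -
    obtain D :: "'a set" where D: "countable D" "\<And>X. open X \<Longrightarrow> X \<noteq> {} \<Longrightarrow> \<exists>d\<in>D. d \<in> X" 
      using countable_dense_exists by blast
    have "\<exists>y\<in>D. dist x y < e" if "0 < e" for x e
      using D(2)[of "ball x e"] that by auto
    then show ?thesis using that D(1) by blast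
  qed
  \<comment> \<open>A pair codes a scale and a point of a countable dense set, so one diagonal
    subsequence serves all scales at once.\<close>
  define f where "f n mx = tent_average (real (Suc (fst mx))) (\<phi> n) (snd mx)" for n and mx :: "nat \<times> 'a"
  have "countable ((UNIV :: nat set) \<times> D)" using D by auto
  moreover have "norm (f n mx) \<le> C" for n mx
    using tent_average_bound(1)[OF _ \<phi>i, of "real (Suc (fst mx))" n "snd mx"] C(1)[of n] by (simp add: f_def del: of_nat_Suc)
  ultimately obtain k where k: "strict_mono (k::nat\<Rightarrow>nat)" "\<And>mx. mx \<in> UNIV \<times> D \<Longrightarrow> \<exists>l. (\<lambda>n. f (k n) mx) \<longlonglongrightarrow> l"
    using function_convergent_subsequence[of "UNIV \<times> D" f C] by metis
  \<comment> \<open>The common Lipschitz constant extends convergence from the dense set to every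
    point.\<close>
  have conv: "convergent (\<lambda>n. tent_average m (\<phi> (k n)) x)" if m: "m = real (Suc j)" for m j x
  proof -
    have m0: "0 < m" using m by simp
    have "Cauchy (\<lambda>n. tent_average m (\<phi> (k n)) x)"
    proof (rule metric_CauchyI)
      fix e :: real assume e: "0 < e"
      have "0 < e / (4 * m * (C + 1))" using e m0 C0 by auto
      then obtain y where y: "y \<in> D" "dist x y < e / (4 * m * (C + 1))" using D(2) by blast
      have close: "\<bar>tent_average m (\<phi> n) x - tent_average m (\<phi> n) y\<bar> \<le> e / 4" for n
      proof -
        have "\<bar>tent_average m (\<phi> n) x - tent_average m (\<phi> n) y\<bar> \<le> m * norm (x - y) * (\<integral>y. \<bar>\<phi> n y\<bar> \<partial>lborel)"
          by (rule tent_average_bound(2)[OF m0 \<phi>i])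
        also have "\<dots> \<le> m * (e / (4 * m * (C + 1))) * (C + 1)"
          using y C(1)[of n] m0 C0 by (intro mult_mono mult_left_mono) (auto simp: dist_norm intro: less_imp_le intro!: divide_nonneg_nonneg less_imp_le[OF e] mult_nonneg_nonneg)
        also have "\<dots> = e / 4"
        proof -
          have "m * (e / (4 * m * a)) * a = e / 4" if "a \<noteq> 0" for a using m0 that by simp
          then show ?thesis using C0 by simp
        qed
        finally show ?thesis .
      qed
      have "Cauchy (\<lambda>n. tent_average m (\<phi> (k n)) y)"
        using k(2)[of "(j, y)"] y(1) m by (auto simp: f_def intro: LIMSEQ_imp_Cauchy)
      then obtain N where N: "\<And>a b. N \<le> a \<Longrightarrow> N \<le> b \<Longrightarrow> dist (tent_average m (\<phi> (k a)) y) (tent_average m (\<phi> (k b)) y) < e / 4"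
        using metric_CauchyD[of _ "e / 4"] e by (metis (no_types, lifting) zero_less_divide_iff zero_less_numeral)
      show "\<exists>N. \<forall>a\<ge>N. \<forall>b\<ge>N. dist (tent_average m (\<phi> (k a)) x) (tent_average m (\<phi> (k b)) x) < e"
      proof (intro exI[of _ N] allI impI)
        fix a b assume "N \<le> a" "N \<le> b"
        from N[OF this] close[of "k a"] close[of "k b"] e
        show "dist (tent_average m (\<phi> (k a)) x) (tent_average m (\<phi> (k b)) x) < e"
          unfolding dist_real_def by linarith
      qed
    qed
    then show ?thesis by (simp add: Cauchy_convergent_iff)
  qed
  obtain R where R: "\<And>x. x \<in> \<Omega> \<Longrightarrow> norm x \<le> R" using bd bounded_iff by metis
  define B where "B = cball (0::'a) R"
  have Bfin: "integrable lborel (indicator B :: 'a \<Rightarrow> real)"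
    unfolding B_def using emeasure_lborel_cball_finite[of "0::'a" R] by (simp add: integrable_indicator_iff)
  have outB: "\<phi> n x = 0" if "x \<notin> B" for n x
    using test_function_outside(1)[OF \<phi>, of x n] R[of x] that by (auto simp: B_def)
  have cauchy: "\<exists>N. \<forall>a\<ge>N. \<forall>b\<ge>N. (\<integral>x. norm (\<phi> (k a) x - \<phi> (k b) x) powr 1 \<partial>lborel) < e" if e: "0 < e" for e
  proof -
    \<comment> \<open>The scale makes the two averaging errors, each at most
      \<open>c / m * C\<close>, together smaller than \<open>c * e / 2\<close>.\<close>
    obtain j :: nat where j: "4 * (C + 1) / e < real j" using reals_Archimedean2 by blast
    define m where "m = real (Suc j)"
    have m: "0 < m" "2 * C / m < e / 2"
    proof -
      show m0: "0 < m" by (simp add: m_def)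
      have "4 * (C + 1) < m * e" using j e by (simp add: m_def field_simps)
      then show "2 * C / m < e / 2" using m0 C0 by (simp add: field_simps)
    qed
    define c where "c = (\<integral>z. tent m (z :: 'a) \<partial>lborel)"
    have c: "0 < c" unfolding c_def by (rule integral_tent_pos[OF m(1)])
    define g where "g n x = tent_average m (\<phi> (k n)) x" for n x
    define G where "G x = lim (\<lambda>n. g n x)" for x
    have gm [measurable]: "g n \<in> borel_measurable borel" for n
      unfolding g_def tent_average_def
    proof (rule lborel.borel_measurable_lebesgue_integral)
      have [measurable]: "tent m \<in> borel_measurable (borel :: 'a measure)" by (rule borel_measurable_continuous_onI[OF continuous_tent])
      show "(\<lambda>(x, z). tent m z * \<phi> (k n) (x + z)) \<in> borel_measurable (borel \<Otimes>\<^sub>M lborel)" by measurable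
    qed
    have Gm [measurable]: "G \<in> borel_measurable borel" unfolding G_def by measurable
    have lim: "(\<lambda>n. g n x) \<longlonglongrightarrow> G x" for x
      using conv[OF m_def, of x] unfolding g_def G_def by (simp add: convergent_LIMSEQ_iff)
    have gb: "\<bar>g n x\<bar> \<le> C" for n x
      using tent_average_bound(1)[OF m(1) \<phi>i, of "k n" x] C(1)[of "k n"] by (simp add: g_def)
    have Gb: "\<bar>G x\<bar> \<le> C" for x
      by (rule LIMSEQ_le_const2[OF tendsto_rabs[OF lim]]) (use gb in auto)
    have gGi: "integrable lborel (\<lambda>x. indicator B x * \<bar>g n x - G x\<bar>)" for n
    proof (rule Bochner_Integration.integrable_bound[where f="\<lambda>x. indicator B x * (2 * C)"])
      have "\<bar>g n x - G x\<bar> \<le> 2 * C" for x using gb[of n x] Gb[of x] by linarith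
      then show "AE x in lborel. norm (indicator B x * \<bar>g n x - G x\<bar>) \<le> norm (indicator B x * (2 * C))"
        using C0 by (intro AE_I2) (auto simp: indicator_def)
    qed (use Bfin in \<open>auto simp: B_def\<close>)
    have "(\<lambda>n. \<integral>x. indicator B x * \<bar>g n x - G x\<bar> \<partial>lborel) \<longlonglongrightarrow> (\<integral>x. 0 \<partial>(lborel :: 'a measure))"
    proof (rule integral_dominated_convergence[where w="\<lambda>x. indicator B x * (2 * C)"])
      show "AE x in lborel. (\<lambda>n. indicator B x * \<bar>g n x - G x\<bar>) \<longlonglongrightarrow> 0"
      proof (intro AE_I2)
        fix x
        have "(\<lambda>n. indicator B x * \<bar>g n x - G x\<bar>) \<longlonglongrightarrow> indicator B x * \<bar>G x - G x\<bar>"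
          by (intro tendsto_intros lim)
        then show "(\<lambda>n. indicator B x * \<bar>g n x - G x\<bar>) \<longlonglongrightarrow> 0" by simp
      qed
      show "AE x in lborel. norm (indicator B x * \<bar>g n x - G x\<bar>) \<le> indicator B x * (2 * C)" for n
      proof (intro AE_I2)
        fix x
        have "\<bar>g n x - G x\<bar> \<le> 2 * C" using gb[of n x] Gb[of x] by linarith
        then show "norm (indicator B x * \<bar>g n x - G x\<bar>) \<le> indicator B x * (2 * C)"
          by (auto simp: indicator_def)
      qed
    qed (use gGi Bfin in auto)
    then have "(\<lambda>n. \<integral>x. indicator B x * \<bar>g n x - G x\<bar> \<partial>lborel) \<longlonglongrightarrow> 0" by simp
    moreover have "0 < c * e / 4" using c e by simp
    ultimately obtain N where N: "\<And>n. N \<le> n \<Longrightarrow> \<bar>\<integral>x. indicator B x * \<bar>g n x - G x\<bar> \<partial>lborel\<bar> < c * e / 4"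
      using LIMSEQ_D[of _ 0 "c * e / 4"] by fastforce
    have "(\<integral>x. norm (\<phi> (k a) x - \<phi> (k b) x) powr 1 \<partial>lborel) < e" if ab: "N \<le> a" "N \<le> b" for a b
    proof -
      let ?d = "\<lambda>n x. \<bar>c * \<phi> (k n) x - g n x\<bar>"
      let ?h = "\<lambda>n x. indicator B x * \<bar>g n x - G x\<bar>"
      have di: "integrable lborel (?d n)" for n
        using tent_average_close(1)[OF \<phi>[of "k n"] bd m(1)] by (auto simp: c_def g_def)
      have dle: "integral\<^sup>L lborel (?d n) \<le> c / m * C" for n
      proof -
        have "integral\<^sup>L lborel (?d n) \<le> c / m * (\<integral>x. norm (gradient (\<phi> (k n)) x) \<partial>lborel)"
          using tent_average_close(2)[OF \<phi>[of "k n"] bd m(1)] by (simp add: c_def g_def)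
        also have "\<dots> \<le> c / m * C" using c m C(2) by (intro mult_left_mono) auto
        finally show ?thesis .
      qed
      have "c * (\<integral>x. norm (\<phi> (k a) x - \<phi> (k b) x) powr 1 \<partial>lborel) = (\<integral>x. c * \<bar>\<phi> (k a) x - \<phi> (k b) x\<bar> \<partial>lborel)" by simp
      \<comment> \<open>On the ball this is the triangle inequality through \<open>g a\<close>,
        \<open>G\<close> and \<open>g b\<close>; off the ball the test functions vanish, so the
        terms with \<open>G\<close> may carry the indicator.\<close>
      also have "\<dots> \<le> (\<integral>x. (?d a x + ?d b x) + (?h a x + ?h b x) \<partial>lborel)"
      proof (rule integral_mono)
        show "integrable lborel (\<lambda>x. c * \<bar>\<phi> (k a) x - \<phi> (k b) x\<bar>)" using \<phi>i by auto
        show "integrable lborel (\<lambda>x. (?d a x + ?d b x) + (?h a x + ?h b x))"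
          by (intro Bochner_Integration.integrable_add di gGi)
        show "c * \<bar>\<phi> (k a) x - \<phi> (k b) x\<bar> \<le> (?d a x + ?d b x) + (?h a x + ?h b x)" for x
        proof (cases "x \<in> B")
          case True
          have "c * \<bar>\<phi> (k a) x - \<phi> (k b) x\<bar> = \<bar>c * \<phi> (k a) x - c * \<phi> (k b) x\<bar>"
            using c by (simp add: right_diff_distrib[symmetric] abs_mult)
          then show ?thesis using True by simp
        next
          case False
          then show ?thesis using outB by simp
        qed
      qed
      also have "\<dots> = (integral\<^sup>L lborel (?d a) + integral\<^sup>L lborel (?d b)) + (integral\<^sup>L lborel (?h a) + integral\<^sup>L lborel (?h b))"
        using di gGi by (simp add: Bochner_Integration.integral_add Bochner_Integration.integrable_add)
      also have "\<dots> < c / m * C + c / m * C + (c * e / 4 + c * e / 4)"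
        using dle[of a] dle[of b] N[OF ab(1)] N[OF ab(2)] by linarith
      also have "\<dots> = c * (2 * C / m + e / 2)" by (simp add: field_simps)
      also have "\<dots> < c * e" using c m(2) by (intro mult_strict_left_mono) auto
      finally show ?thesis using c by simp
    qed
    then show ?thesis by blast
  qed
  obtain u where u: "u \<in> borel_measurable lborel" "integrable lborel (\<lambda>x. norm (u x) powr 1)"
    "(\<lambda>n. \<integral>x. norm (\<phi> (k n) x - u x) powr 1 \<partial>lborel) \<longlonglongrightarrow> 0"
  proof (rule Lp_complete[of 1 "\<lambda>n. \<phi> (k n)" lborel])
    show "integrable lborel (\<lambda>x. norm (\<phi> (k n) x) powr 1)" for n using \<phi>i by simp
  qed (use cauchy in auto)
  have "integrable lborel (\<lambda>x. norm (\<phi> (k n) x - u x) powr 1)" for n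
    using \<phi>i u by (intro integrable_norm_powr_diff) auto
  from tendsto_Lp_AE_subseq[OF _ this u(3)] obtain r :: "nat \<Rightarrow> nat" 
    where r: "strict_mono r" "AE x in lborel. (\<lambda>n. \<phi> (k (r n)) x) \<longlonglongrightarrow> u x" by auto
  have "strict_mono (k \<circ> r)" using k(1) r(1) by (rule strict_mono_o)
  then show ?thesis using r u(1) by (intro exI[of _ "k \<circ> r"] exI[of _ u]) auto
qed

subsection \<open>The space \<open>W1p_0\<close>\<close>

text \<open>Completeness of Lebesgue measure. It is needed because \<open>weak_grad\<close> is an
  arbitrary choice that is known only a.e., while equality of integrals also requires
  measurability.\<close>

lemma borel_measurable_lebesgue_on_AE_cong:
  fixes f g :: "'a::euclidean_space \<Rightarrow> 'b::euclidean_space"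
  assumes \<Omega>: "\<Omega> \<in> sets lebesgue" and g: "g \<in> borel_measurable (lebesgue_on \<Omega>)"
    and ae: "AE x in lebesgue_on \<Omega>. f x = g x"
  shows "f \<in> borel_measurable (lebesgue_on \<Omega>)"
proof -
  let ?f = "\<lambda>x. if x \<in> \<Omega> then f x else 0" and ?g = "\<lambda>x. if x \<in> \<Omega> then g x else 0"
  have g': "?g \<in> borel_measurable lebesgue" using g borel_measurable_if[OF \<Omega>] by blast
  have ae': "AE x in lebesgue. ?f x = ?g x"
    using ae \<Omega> by (simp add: AE_restrict_space_iff) 
  have "?f \<in> borel_measurable lebesgue"
  proof (rule measurableI)
    fix A :: "'b set" assume A: "A \<in> sets borel"
    have B: "?g -` A \<inter> space lebesgue \<in> sets lebesgue" using g' A by (rule measurable_sets)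
    show "?f -` A \<inter> space lebesgue \<in> sets lebesgue"
    proof (rule completion.in_sets_AE[OF _ B])
      show "AE x in lebesgue. (x \<in> ?g -` A \<inter> space lebesgue) = (x \<in> ?f -` A \<inter> space lebesgue)"
        using ae' by eventually_elim auto
    qed auto
  qed auto
  then show ?thesis using borel_measurable_if[OF \<Omega>] by blast
qed

locale bounded_open_domain =
  fixes \<Omega> :: "'a::euclidean_space set" and p ps :: real
  assumes open_\<Omega>: "open \<Omega>" and bounded_\<Omega>: "bounded \<Omega>" and nonempty_\<Omega>: "\<Omega> \<noteq> {}"
    and p_gt_1: "1 < p" and p_less_dim: "p < real DIM('a)"
    and ps_eq: "ps = crit_exp DIM('a) p"
begin

abbreviation "M \<equiv> lebesgue_on \<Omega>"

lemma sets_\<Omega> [simp]: "\<Omega> \<in> sets lebesgue" using open_\<Omega> by simp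

sublocale finite_measure M
  by (rule finite_measure_lebesgue_on[OF bounded_set_imp_lmeasurable[OF bounded_\<Omega> sets_\<Omega>]])

lemma p_less_ps: "p < ps"
proof -
  have "p * (real DIM('a) - p) < real DIM('a) * p" using p_gt_1 p_less_dim by (simp add: algebra_simps)
  then show ?thesis using p_less_dim by (simp add: ps_eq crit_exp_def pos_less_divide_eq)
qed

lemma ps_gt_1: "1 < ps" using p_less_ps p_gt_1 by simp

section \<open>Integrability on the domain\<close>

lemma measurable_continuous:
  fixes f :: "'a \<Rightarrow> 'b::euclidean_space"
  assumes "continuous_on UNIV f" shows "f \<in> borel_measurable M"
  using borel_measurable_continuous_onI[OF assms] by (simp add: measurable_completion measurable_restrict_space1)

lemma test_measurable [measurable]:
  assumes "\<phi> \<in> test_functions \<Omega>"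
  shows "\<phi> \<in> borel_measurable M" "gradient \<phi> \<in> borel_measurable M"
  using test_function_continuous[OF assms] measurable_continuous by auto

lemma test_integral_lborel:
  assumes \<phi>: "\<phi> \<in> test_functions \<Omega>" and r: "0 < r"
  shows "integrable M (\<lambda>x. \<bar>\<phi> x\<bar> powr r)" "integrable M (\<lambda>x. norm (gradient \<phi> x) powr r)"
    "(\<integral>x. \<bar>\<phi> x\<bar> powr r \<partial>M) = (\<integral>x. \<bar>\<phi> x\<bar> powr r \<partial>lborel)"
    "(\<integral>x. norm (gradient \<phi> x) powr r \<partial>M) = (\<integral>x. norm (gradient \<phi> x) powr r \<partial>lborel)"
proof -
  note c = test_function_continuous[OF \<phi>]
  have c1: "continuous_on UNIV (\<lambda>x. \<bar>\<phi> x\<bar> powr r)" "continuous_on UNIV (\<lambda>x. norm (gradient \<phi> x) powr r)"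
    by (rule continuous_on_powr'; use r in \<open>auto intro!: continuous_intros c\<close>)+
  have o: "\<bar>\<phi> x\<bar> powr r = 0" "norm (gradient \<phi> x) powr r = 0" if "x \<notin> \<Omega>" for x
    using test_function_outside[OF \<phi> that] by auto
  have i: "integrable lborel (\<lambda>x. \<bar>\<phi> x\<bar> powr r)" "integrable lborel (\<lambda>x. norm (gradient \<phi> x) powr r)"
    using o by (auto intro!: integrable_continuous_compact_support[OF _ bounded_\<Omega>] c1)
  show "integrable M (\<lambda>x. \<bar>\<phi> x\<bar> powr r)" "(\<integral>x. \<bar>\<phi> x\<bar> powr r \<partial>M) = (\<integral>x. \<bar>\<phi> x\<bar> powr r \<partial>lborel)"
    using integral_lebesgue_on_eq_lborel[OF sets_\<Omega> borel_measurable_continuous_onI[OF c1(1)] o(1)] i by auto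
  show "integrable M (\<lambda>x. norm (gradient \<phi> x) powr r)" "(\<integral>x. norm (gradient \<phi> x) powr r \<partial>M) = (\<integral>x. norm (gradient \<phi> x) powr r \<partial>lborel)"
    using integral_lebesgue_on_eq_lborel[OF sets_\<Omega> borel_measurable_continuous_onI[OF c1(2)] o(2)] i by auto
qed

lemma Lp_onD:
  assumes "u \<in> Lp_on \<Omega> p"
  shows "u \<in> borel_measurable M" "integrable M (\<lambda>x. norm (u x) powr p)"
  using assms by (auto simp: Lp_on_def)

lemma test_Lp:
  assumes "\<phi> \<in> test_functions \<Omega>"
  shows "\<phi> \<in> Lp_on \<Omega> p" "gradient \<phi> \<in> Lp_on \<Omega> p"
  using test_measurable[OF assms] test_integral_lborel[OF assms, of p] p_gt_1 by (auto simp: Lp_on_def)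

lemma Lp_add:
  assumes "u \<in> Lp_on \<Omega> p" "v \<in> Lp_on \<Omega> p" shows "(\<lambda>x. u x + v x) \<in> Lp_on \<Omega> p"
  using Lp_onD[OF assms(1)] Lp_onD[OF assms(2)] p_gt_1 integrable_norm_powr_add[of u M v p] by (auto simp: Lp_on_def)

lemma Lp_scaleR:
  assumes "u \<in> Lp_on \<Omega> p" shows "(\<lambda>x. c *\<^sub>R u x) \<in> Lp_on \<Omega> p"
  using Lp_onD[OF assms(1)] integrable_norm_powr_scaleR[of M u p c] by (auto simp: Lp_on_def simp del: norm_scaleR)

lemma Lp_diff:
  assumes "u \<in> Lp_on \<Omega> p" "v \<in> Lp_on \<Omega> p" shows "(\<lambda>x. u x - v x) \<in> Lp_on \<Omega> p"
  using Lp_add[OF assms(1) Lp_scaleR[OF assms(2), of "-1"]] by simp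

lemma Lp_integrable:
  fixes u :: "'a \<Rightarrow> 'b::euclidean_space"
  assumes "u \<in> Lp_on \<Omega> p" shows "integrable M u"
proof (rule Bochner_Integration.integrable_bound[where f="\<lambda>x. 1 + norm (u x) powr p"])
  have "norm (u x) \<le> 1 + norm (u x) powr p" for x
  proof (cases "norm (u x) \<le> 1")
    case False
    then have "norm (u x) powr 1 \<le> norm (u x) powr p" using p_gt_1 by (intro powr_mono) auto
    then show ?thesis by simp
  qed (use powr_ge_zero[of "norm (u x)" p] in linarith)
  then show "AE x in M. norm (u x) \<le> norm (1 + norm (u x) powr p)" by (intro AE_I2) (simp add: abs_of_nonneg)
qed (use Lp_onD[OF assms] in auto)

lemma Lp_locally_integrable:
  fixes u :: "'a \<Rightarrow> 'b::euclidean_space"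
  assumes "u \<in> Lp_on \<Omega> p" shows "locally_integrable_on u \<Omega>"
  unfolding locally_integrable_on_def
proof (intro allI impI)
  fix K assume K: "K \<subseteq> \<Omega>" "compact K"
  have Ks: "K \<in> sets lebesgue" using K(2) by (simp add: compact_imp_closed)
  have "integrable lebesgue (\<lambda>x. indicator \<Omega> x *\<^sub>R u x)" using Lp_integrable[OF assms] by (simp add: integrable_restrict_space)
  then have "integrable lebesgue (\<lambda>x. indicator K x *\<^sub>R (indicator \<Omega> x *\<^sub>R u x))" using Ks by (rule integrable_mult_indicator[rotated])
  moreover have "indicator K x *\<^sub>R (indicator \<Omega> x *\<^sub>R u x) = indicator K x *\<^sub>R u x" for x
    using K(1) by (auto simp: indicator_def)
  ultimately have "integrable lebesgue (\<lambda>x. indicator K x *\<^sub>R u x)" by (simp only:)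
  then show "integrable (lebesgue_on K) u" using Ks by (simp add: integrable_restrict_space)
qed

lemma locally_integrable_mult:
  fixes w \<psi> :: "'a \<Rightarrow> real"
  assumes w: "locally_integrable_on w \<Omega>" and K: "compact K" "K \<subseteq> \<Omega>"
    and \<psi>: "continuous_on UNIV \<psi>" "\<And>x. x \<notin> K \<Longrightarrow> \<psi> x = 0"
  shows "integrable M (\<lambda>x. w x * \<psi> x)"
proof -
  have Ks: "K \<in> sets lebesgue" using K(1) by (simp add: compact_imp_closed)
  obtain B where B: "0 \<le> B" "\<And>x. norm (\<psi> x) \<le> B"
    using bounded_continuous_compact_support[OF \<psi>(1) compact_imp_bounded[OF K(1)] \<psi>(2)] by metis
  have i: "integrable lebesgue (\<lambda>x. indicator K x *\<^sub>R w x)"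
  proof -
    have "integrable (lebesgue_on K) w" using w K unfolding locally_integrable_on_def by blast
    then show ?thesis using Ks by (simp add: integrable_restrict_space)
  qed
  have \<psi>m: "\<psi> \<in> borel_measurable lebesgue" using borel_measurable_continuous_onI[OF \<psi>(1)] by (simp add: measurable_completion)
  have "integrable lebesgue (\<lambda>x. (indicator K x *\<^sub>R w x) * \<psi> x)"
  proof (rule Bochner_Integration.integrable_bound[where f="\<lambda>x. B * (indicator K x *\<^sub>R w x)"])
    show "integrable lebesgue (\<lambda>x. B * (indicator K x *\<^sub>R w x))" using i by simp
    show "(\<lambda>x. (indicator K x *\<^sub>R w x) * \<psi> x) \<in> borel_measurable lebesgue"
      using borel_measurable_integrable[OF i] \<psi>m by (rule borel_measurable_times)
    show "AE x in lebesgue. norm ((indicator K x *\<^sub>R w x) * \<psi> x) \<le> norm (B * (indicator K x *\<^sub>R w x))"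
    proof (intro AE_I2)
      fix x
      show "norm ((indicator K x *\<^sub>R w x) * \<psi> x) \<le> norm (B * (indicator K x *\<^sub>R w x))"
        using B mult_right_mono[OF B(2)[of x], of "\<bar>indicator K x *\<^sub>R w x\<bar>"] by (simp add: abs_mult mult_ac)
    qed
  qed
  moreover have "(indicator K x *\<^sub>R w x) * \<psi> x = indicator \<Omega> x *\<^sub>R (w x * \<psi> x)" for x
    using K \<psi>(2)[of x] by (auto simp: indicator_def)
  ultimately have "integrable lebesgue (\<lambda>x. indicator \<Omega> x *\<^sub>R (w x * \<psi> x))" by (simp only:)
  then show ?thesis by (simp add: integrable_restrict_space)
qed

section \<open>Weak gradients\<close>

lemma weak_gradient_integrable:
  assumes \<phi>: "\<phi> \<in> test_functions \<Omega>"
  shows "locally_integrable_on u \<Omega> \<Longrightarrow> integrable M (\<lambda>x. u x * (gradient \<phi> x \<bullet> v))"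
    "locally_integrable_on g \<Omega> \<Longrightarrow> integrable M (\<lambda>x. (g x \<bullet> v) * \<phi> x)"
proof -
  obtain K where K: "compact K" "K \<subseteq> \<Omega>" "\<And>x. x \<notin> K \<Longrightarrow> \<phi> x = 0"
    using test_function_support[OF \<phi>] by blast
  \<comment> \<open>Seen as a test function of its own support, \<open>\<phi>\<close> has a gradient
    that vanishes off \<open>K\<close> as well, where local integrability gives no control.\<close>
  have "\<phi> \<in> test_functions K"
    by (rule test_functionsI[OF test_function_Ck_fun[OF \<phi>] _ K(1)]) (use K(3) in auto)
  note out = test_function_outside[OF this]
  show "integrable M (\<lambda>x. u x * (gradient \<phi> x \<bullet> v))" if "locally_integrable_on u \<Omega>"
    by (rule locally_integrable_mult[OF that K(1,2)])
      (use out in \<open>auto intro!: continuous_intros test_function_continuous[OF \<phi>]\<close>)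
  show "integrable M (\<lambda>x. (g x \<bullet> v) * \<phi> x)" if g: "locally_integrable_on g \<Omega>"
  proof (rule locally_integrable_mult[OF _ K(1,2)])
    show "locally_integrable_on (\<lambda>x. g x \<bullet> v) \<Omega>" using g by (auto simp: locally_integrable_on_def)
  qed (use out in \<open>auto intro!: test_function_continuous[OF \<phi>]\<close>)
qed

lemma has_weak_gradient_iff:
  "has_weak_gradient \<Omega> u g \<longleftrightarrow> locally_integrable_on u \<Omega> \<and> locally_integrable_on g \<Omega> \<and>
     (\<forall>\<phi>\<in>test_functions \<Omega>. \<forall>i\<in>Basis. (\<integral>x. u x * (gradient \<phi> x \<bullet> i) \<partial>M) = - (\<integral>x. (g x \<bullet> i) * \<phi> x \<partial>M))"
  unfolding has_weak_gradient_def by (simp add: gradient_inner_Basis)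

text \<open>Each component of the difference is orthogonal to all test functions, so the fundamental
  lemma applies. This is what makes the choice in \<open>weak_grad\<close> harmless.\<close>

lemma has_weak_gradient_unique:
  assumes g: "has_weak_gradient \<Omega> u g" and h: "has_weak_gradient \<Omega> u h"
  shows "AE x in M. g x = h x"
proof -
  have "AE x in M. \<forall>i\<in>Basis. g x \<bullet> i - h x \<bullet> i = 0"
  proof (subst AE_ball_countable, simp add: countable_finite, intro ballI)
    fix i :: 'a assume i: "i \<in> Basis"
    have lg: "locally_integrable_on g \<Omega>" "locally_integrable_on h \<Omega>" using g h by (auto simp: has_weak_gradient_def)
    show "AE x in M. g x \<bullet> i - h x \<bullet> i = 0"
    proof (rule fundamental_lemma_calculus_of_variations[OF open_\<Omega>])
      show "locally_integrable_on (\<lambda>x. g x \<bullet> i - h x \<bullet> i) \<Omega>" using lg by (auto simp: locally_integrable_on_def)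
      fix \<phi> assume \<phi>: "\<phi> \<in> test_functions \<Omega>"
      have "(\<integral>x. (g x \<bullet> i - h x \<bullet> i) * \<phi> x \<partial>M) = (\<integral>x. (g x \<bullet> i) * \<phi> x \<partial>M) - (\<integral>x. (h x \<bullet> i) * \<phi> x \<partial>M)"
        using weak_gradient_integrable(2)[OF \<phi>, of _ i] lg by (simp add: left_diff_distrib)
      also have "\<dots> = 0"
      proof -
        have "- (\<integral>x. (g x \<bullet> i) * \<phi> x \<partial>M) = - (\<integral>x. (h x \<bullet> i) * \<phi> x \<partial>M)"
          using g h \<phi> i unfolding has_weak_gradient_iff by (metis (no_types))
        then show ?thesis by simp
      qed
      finally show "(\<integral>x. (g x \<bullet> i - h x \<bullet> i) * \<phi> x \<partial>M) = 0" .
    qed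
  qed
  then show ?thesis by eventually_elim (auto intro: euclidean_eqI)
qed

lemma weak_grad_AE:
  assumes "has_weak_gradient \<Omega> u g"
  shows "AE x in M. weak_grad \<Omega> u x = g x" "has_weak_gradient \<Omega> u (weak_grad \<Omega> u)"
proof -
  show "has_weak_gradient \<Omega> u (weak_grad \<Omega> u)"
    unfolding weak_grad_def using someI[of "has_weak_gradient \<Omega> u", OF assms] .
  then show "AE x in M. weak_grad \<Omega> u x = g x" using has_weak_gradient_unique assms by blast
qed

lemma test_has_weak_gradient:
  assumes \<phi>: "\<phi> \<in> test_functions \<Omega>"
  shows "has_weak_gradient \<Omega> \<phi> (gradient \<phi>)"
  unfolding has_weak_gradient_iff
proof (intro conjI ballI)
  show "locally_integrable_on \<phi> \<Omega>" "locally_integrable_on (gradient \<phi>) \<Omega>"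
    using test_Lp[OF \<phi>] Lp_locally_integrable by auto
  fix \<psi> and i :: 'a assume \<psi>: "\<psi> \<in> test_functions \<Omega>"
  note c = test_function_continuous[OF \<phi>] test_function_continuous[OF \<psi>]
  have "(\<integral>x. \<phi> x * (gradient \<psi> x \<bullet> i) \<partial>M) = (\<integral>x. \<phi> x * (gradient \<psi> x \<bullet> i) \<partial>lborel)"
    using test_function_outside[OF \<phi>]
    by (intro integral_lebesgue_on_eq_lborel(2)[OF sets_\<Omega>] borel_measurable_continuous_onI continuous_intros c) auto
  also have "\<dots> = - (\<integral>x. (gradient \<phi> x \<bullet> i) * \<psi> x \<partial>lborel)"
    by (rule integration_by_parts_test[OF \<psi> \<phi> bounded_\<Omega>])
  also have "(\<integral>x. (gradient \<phi> x \<bullet> i) * \<psi> x \<partial>lborel) = (\<integral>x. (gradient \<phi> x \<bullet> i) * \<psi> x \<partial>M)"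
    using test_function_outside[OF \<psi>]
    by (intro integral_lebesgue_on_eq_lborel(2)[OF sets_\<Omega>, symmetric] borel_measurable_continuous_onI continuous_intros c) auto
  finally show "(\<integral>x. \<phi> x * (gradient \<psi> x \<bullet> i) \<partial>M) = - (\<integral>x. (gradient \<phi> x \<bullet> i) * \<psi> x \<partial>M)" .
qed

lemma has_weak_gradient_add_scale:
  assumes u: "has_weak_gradient \<Omega> u g" and v: "has_weak_gradient \<Omega> v h"
  shows "has_weak_gradient \<Omega> (\<lambda>x. u x + c * v x) (\<lambda>x. g x + c *\<^sub>R h x)"
  unfolding has_weak_gradient_iff
proof (intro conjI ballI)
  have l: "locally_integrable_on u \<Omega>" "locally_integrable_on g \<Omega>" "locally_integrable_on v \<Omega>" "locally_integrable_on h \<Omega>"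
    using u v by (auto simp: has_weak_gradient_def)
  then show "locally_integrable_on (\<lambda>x. u x + c * v x) \<Omega>" "locally_integrable_on (\<lambda>x. g x + c *\<^sub>R h x) \<Omega>"
    by (auto simp: locally_integrable_on_def)
  fix \<phi> and i :: 'a assume \<phi>: "\<phi> \<in> test_functions \<Omega>" and i: "i \<in> Basis"
  note int = weak_gradient_integrable(1)[OF \<phi> l(1), of i] weak_gradient_integrable(1)[OF \<phi> l(3), of i]
    weak_gradient_integrable(2)[OF \<phi> l(2), of i] weak_gradient_integrable(2)[OF \<phi> l(4), of i]
  have "(\<integral>x. (u x + c * v x) * (gradient \<phi> x \<bullet> i) \<partial>M) = (\<integral>x. u x * (gradient \<phi> x \<bullet> i) + c * (v x * (gradient \<phi> x \<bullet> i)) \<partial>M)"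
    by (simp add: algebra_simps)
  also have "\<dots> = (\<integral>x. u x * (gradient \<phi> x \<bullet> i) \<partial>M) + c * (\<integral>x. v x * (gradient \<phi> x \<bullet> i) \<partial>M)"
    using int by simp
  also have "\<dots> = - ((\<integral>x. (g x \<bullet> i) * \<phi> x \<partial>M) + c * (\<integral>x. (h x \<bullet> i) * \<phi> x \<partial>M))"
    using u v \<phi> i unfolding has_weak_gradient_iff by simp
  also have "(\<integral>x. (g x \<bullet> i) * \<phi> x \<partial>M) + c * (\<integral>x. (h x \<bullet> i) * \<phi> x \<partial>M) = (\<integral>x. (g x \<bullet> i) * \<phi> x + c * ((h x \<bullet> i) * \<phi> x) \<partial>M)"
    using int by simp
  also have "\<dots> = (\<integral>x. ((g x + c *\<^sub>R h x) \<bullet> i) * \<phi> x \<partial>M)" by (simp add: algebra_simps inner_add_left)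
  finally show "(\<integral>x. (u x + c * v x) * (gradient \<phi> x \<bullet> i) \<partial>M) = - (\<integral>x. ((g x + c *\<^sub>R h x) \<bullet> i) * \<phi> x \<partial>M)" .
qed

text \<open>On a finite measure space the pointwise bound
  \<open>t \<le> e + e powr (1 - p) * t powr p\<close> replaces Hoelder's inequality.\<close>

lemma tendsto_Lp_imp_L1:
  fixes f :: "nat \<Rightarrow> 'a \<Rightarrow> 'b::euclidean_space"
  assumes f: "\<And>n. f n \<in> Lp_on \<Omega> p" and lim: "(\<lambda>n. \<integral>x. norm (f n x) powr p \<partial>M) \<longlonglongrightarrow> 0"
  shows "(\<lambda>n. \<integral>x. norm (f n x) \<partial>M) \<longlonglongrightarrow> 0"
proof (rule LIMSEQ_I)
  fix r :: real assume r: "0 < r"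
  define e where "e = r / (2 * (measure M (space M) + 1))"
  have e: "0 < e" "e * measure M (space M) < r / 2"
    using r by (auto simp: e_def field_simps add_pos_nonneg)
  define K where "K = e powr (1 - p)"
  have K: "0 < K" using e by (simp add: K_def)
  have pt: "t \<le> e + K * t powr p" if "0 \<le> t" for t :: real
  proof (cases "t \<le> e")
    case False
    then have "K * t powr p \<ge> t powr (1 - p) * t powr p"
      unfolding K_def using e p_gt_1 by (intro mult_right_mono powr_mono2') auto
    also have "t powr (1 - p) * t powr p = t" using False e by (simp add: powr_add[symmetric])
    finally show ?thesis using e by simp
  qed (use K in \<open>simp add: add_increasing2\<close>)
  have "0 < r / (2 * K)" using r K by simp
  from LIMSEQ_D[OF lim this] obtain N where N: "\<And>n. N \<le> n \<Longrightarrow> (\<integral>x. norm (f n x) powr p \<partial>M) < r / (2 * K)" by fastforce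
  show "\<exists>N. \<forall>n\<ge>N. norm ((\<integral>x. norm (f n x) \<partial>M) - 0) < r"
  proof (intro exI[of _ N] allI impI)
    fix n assume n: "N \<le> n"
    have "(\<integral>x. norm (f n x) \<partial>M) \<le> (\<integral>x. e + K * norm (f n x) powr p \<partial>M)"
      using Lp_integrable[OF f, of n] Lp_onD(2)[OF f, of n] pt by (intro integral_mono) auto
    also have "\<dots> = e * measure M (space M) + K * (\<integral>x. norm (f n x) powr p \<partial>M)"
      using Lp_onD(2)[OF f, of n] by simp
    also have "\<dots> < r" using e(2) mult_strict_left_mono[OF N[OF n] K] K by simp
    finally show "norm ((\<integral>x. norm (f n x) \<partial>M) - 0) < r" by simp
  qed
qed

lemma tendsto_integral_mult_test:
  fixes f :: "nat \<Rightarrow> 'a \<Rightarrow> real"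
  assumes f: "\<And>n. f n \<in> Lp_on \<Omega> p" "f' \<in> Lp_on \<Omega> p"
    and lim: "(\<lambda>n. \<integral>x. norm (f n x - f' x) powr p \<partial>M) \<longlonglongrightarrow> 0"
    and \<psi>: "\<psi> \<in> borel_measurable M" "\<And>x. \<bar>\<psi> x\<bar> \<le> B"
  shows "(\<lambda>n. \<integral>x. f n x * \<psi> x \<partial>M) \<longlonglongrightarrow> (\<integral>x. f' x * \<psi> x \<partial>M)"
proof -
  have B: "0 \<le> B" using \<psi>(2)[of undefined] by (meson abs_ge_zero order_trans)
  have int: "integrable M (\<lambda>x. w x * \<psi> x)" if "w \<in> Lp_on \<Omega> p" for w
  proof (rule Bochner_Integration.integrable_bound[where f="\<lambda>x. B * w x"])
    show "AE x in M. norm (w x * \<psi> x) \<le> norm (B * w x)"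
    proof (intro AE_I2)
      fix x show "norm (w x * \<psi> x) \<le> norm (B * w x)"
        using B mult_right_mono[OF \<psi>(2)[of x], of "\<bar>w x\<bar>"] by (simp add: abs_mult mult_ac)
    qed
  qed (use Lp_integrable[OF that] Lp_onD(1)[OF that] \<psi>(1) in auto)
  have d: "(\<lambda>x. f n x - f' x) \<in> Lp_on \<Omega> p" for n using Lp_diff f by auto
  have L1: "(\<lambda>n. B * (\<integral>x. norm (f n x - f' x) \<partial>M)) \<longlonglongrightarrow> 0"
    using tendsto_mult_right_zero[OF tendsto_Lp_imp_L1[OF d lim]] by simp
  have bd: "norm ((\<integral>x. f n x * \<psi> x \<partial>M) - (\<integral>x. f' x * \<psi> x \<partial>M)) \<le> B * (\<integral>x. norm (f n x - f' x) \<partial>M)" for n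
  proof -
    have "(\<integral>x. f n x * \<psi> x \<partial>M) - (\<integral>x. f' x * \<psi> x \<partial>M) = (\<integral>x. (f n x - f' x) * \<psi> x \<partial>M)"
      using int f by (simp add: left_diff_distrib)
    also have "norm \<dots> \<le> (\<integral>x. norm ((f n x - f' x) * \<psi> x) \<partial>M)" by (rule integral_norm_bound)
    also have "\<dots> \<le> (\<integral>x. B * norm (f n x - f' x) \<partial>M)"
    proof (rule integral_mono)
      show "norm ((f n x - f' x) * \<psi> x) \<le> B * norm (f n x - f' x)" for x
        using mult_right_mono[OF \<psi>(2)[of x], of "\<bar>f n x - f' x\<bar>"] by (simp add: abs_mult mult_ac)
    qed (use int[OF d] Lp_integrable[OF d] in auto)
    finally show ?thesis by simp
  qed
  have "(\<lambda>n. (\<integral>x. f n x * \<psi> x \<partial>M) - (\<integral>x. f' x * \<psi> x \<partial>M)) \<longlonglongrightarrow> 0"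
    by (rule Lim_null_comparison[OF always_eventually[OF allI[OF bd]] L1])
  then show ?thesis by (simp add: LIM_zero_iff)
qed

section \<open>Approximating sequences of test functions\<close>

text \<open>Membership in the closure with its witness: a sequence of test functions converging to
  \<open>u\<close> whose gradients converge to \<open>g\<close>. Naming the limit \<open>g\<close>
  defers the choice in \<open>weak_grad\<close>.\<close>

definition W0_approx :: "('a \<Rightarrow> real) \<Rightarrow> ('a \<Rightarrow> 'a) \<Rightarrow> (nat \<Rightarrow> 'a \<Rightarrow> real) \<Rightarrow> bool" where
  "W0_approx u g \<psi> \<longleftrightarrow> u \<in> Lp_on \<Omega> p \<and> g \<in> Lp_on \<Omega> p \<and> (\<forall>n. \<psi> n \<in> test_functions \<Omega>) \<and>
    (\<lambda>n. \<integral>x. norm (\<psi> n x - u x) powr p \<partial>M) \<longlonglongrightarrow> 0 \<and>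
    (\<lambda>n. \<integral>x. norm (gradient (\<psi> n) x - g x) powr p \<partial>M) \<longlonglongrightarrow> 0"

text \<open>Integration by parts for \<open>\<psi> n\<close> passes to the limit on both sides,
  since the test function and its gradient are bounded.\<close>

lemma W0_approx_has_weak_gradient:
  assumes "W0_approx u g \<psi>"
  shows "has_weak_gradient \<Omega> u g"
  unfolding has_weak_gradient_iff
proof (intro conjI ballI)
  have u: "u \<in> Lp_on \<Omega> p" "g \<in> Lp_on \<Omega> p" and \<psi>: "\<And>n. \<psi> n \<in> test_functions \<Omega>"
    and lim: "(\<lambda>n. \<integral>x. norm (\<psi> n x - u x) powr p \<partial>M) \<longlonglongrightarrow> 0"
      "(\<lambda>n. \<integral>x. norm (gradient (\<psi> n) x - g x) powr p \<partial>M) \<longlonglongrightarrow> 0"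
    using assms by (auto simp: W0_approx_def)
  show "locally_integrable_on u \<Omega>" "locally_integrable_on g \<Omega>" using Lp_locally_integrable u by auto
  fix \<phi> and i :: 'a assume \<phi>: "\<phi> \<in> test_functions \<Omega>" and i: "i \<in> Basis"
  obtain B where B: "0 \<le> B" "\<And>x. \<bar>\<phi> x\<bar> \<le> B" "\<And>x. norm (gradient \<phi> x) \<le> B"
    using test_function_bounded[OF \<phi> bounded_\<Omega>] by metis
  have 1: "(\<lambda>n. \<integral>x. \<psi> n x * (gradient \<phi> x \<bullet> i) \<partial>M) \<longlonglongrightarrow> (\<integral>x. u x * (gradient \<phi> x \<bullet> i) \<partial>M)"
  proof (rule tendsto_integral_mult_test[OF test_Lp(1)[OF \<psi>] u(1) lim(1)])
    show "(\<lambda>x. gradient \<phi> x \<bullet> i) \<in> borel_measurable M" using test_measurable[OF \<phi>] by measurable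
    show "\<bar>gradient \<phi> x \<bullet> i\<bar> \<le> B" for x using Basis_le_norm[OF i, of "gradient \<phi> x"] B(3)[of x] by simp
  qed
  have comp: "(\<lambda>x. w x \<bullet> i) \<in> Lp_on \<Omega> p" if "w \<in> Lp_on \<Omega> p" for w :: "'a \<Rightarrow> 'a"
  proof -
    have "integrable M (\<lambda>x. norm (w x \<bullet> i) powr p)"
    proof (rule Bochner_Integration.integrable_bound[OF Lp_onD(2)[OF that]])
      show "AE x in M. norm (norm (w x \<bullet> i) powr p) \<le> norm (norm (w x) powr p)"
        using Basis_le_norm[OF i] p_gt_1 by (intro AE_I2) (auto intro!: powr_mono2)
    qed (use Lp_onD(1)[OF that] in measurable)
    then show ?thesis using Lp_onD(1)[OF that] by (auto simp: Lp_on_def)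
  qed
  have 2: "(\<lambda>n. \<integral>x. (gradient (\<psi> n) x \<bullet> i) * \<phi> x \<partial>M) \<longlonglongrightarrow> (\<integral>x. (g x \<bullet> i) * \<phi> x \<partial>M)"
  proof (rule tendsto_integral_mult_test[OF comp[OF test_Lp(2)[OF \<psi>]] comp[OF u(2)] _ test_measurable(1)[OF \<phi>] B(2)])
    show "(\<lambda>n. \<integral>x. norm (gradient (\<psi> n) x \<bullet> i - g x \<bullet> i) powr p \<partial>M) \<longlonglongrightarrow> 0"
    proof (rule Lim_null_comparison[OF always_eventually lim(2)], rule allI)
      fix n
      have "(\<lambda>x. gradient (\<psi> n) x - g x) \<in> Lp_on \<Omega> p" using Lp_diff test_Lp(2)[OF \<psi>] u by auto
      note L = Lp_onD(2)[OF this] Lp_onD(2)[OF comp[OF this]]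
      have "(\<integral>x. norm (gradient (\<psi> n) x \<bullet> i - g x \<bullet> i) powr p \<partial>M) \<le> (\<integral>x. norm (gradient (\<psi> n) x - g x) powr p \<partial>M)"
      proof (rule integral_mono)
        show "norm (gradient (\<psi> n) x \<bullet> i - g x \<bullet> i) powr p \<le> norm (gradient (\<psi> n) x - g x) powr p" for x
          using Basis_le_norm[OF i, of "gradient (\<psi> n) x - g x"] p_gt_1 by (intro powr_mono2) (auto simp: inner_diff_left)
      qed (use L in \<open>auto simp: inner_diff_left\<close>)
      then show "norm (\<integral>x. norm (gradient (\<psi> n) x \<bullet> i - g x \<bullet> i) powr p \<partial>M) \<le> (\<integral>x. norm (gradient (\<psi> n) x - g x) powr p \<partial>M)"
        by simp
    qed
  qed
  have "(\<integral>x. \<psi> n x * (gradient \<phi> x \<bullet> i) \<partial>M) = - (\<integral>x. (gradient (\<psi> n) x \<bullet> i) * \<phi> x \<partial>M)" for n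
    using test_has_weak_gradient[OF \<psi>] \<phi> i unfolding has_weak_gradient_iff by blast
  then show "(\<integral>x. u x * (gradient \<phi> x \<bullet> i) \<partial>M) = - (\<integral>x. (g x \<bullet> i) * \<phi> x \<partial>M)"
    using LIMSEQ_unique[OF 1] tendsto_minus[OF 2] by simp
qed

lemma sobolev_norm_diff:
  assumes u: "has_weak_gradient \<Omega> u g" "g \<in> Lp_on \<Omega> p" and \<phi>: "\<phi> \<in> test_functions \<Omega>"
  shows "sobolev_norm \<Omega> p (\<lambda>x. u x - \<phi> x) = ((\<integral>x. norm (\<phi> x - u x) powr p \<partial>M) + (\<integral>x. norm (gradient \<phi> x - g x) powr p \<partial>M)) powr (1 / p)"
proof -
  have w: "has_weak_gradient \<Omega> (\<lambda>x. u x + (-1) * \<phi> x) (\<lambda>x. g x + (-1) *\<^sub>R gradient \<phi> x)"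
    by (rule has_weak_gradient_add_scale[OF u(1) test_has_weak_gradient[OF \<phi>]])
  then have w: "has_weak_gradient \<Omega> (\<lambda>x. u x - \<phi> x) (\<lambda>x. g x - gradient \<phi> x)" by simp
  have m: "(\<lambda>x. g x - gradient \<phi> x) \<in> borel_measurable M"
    using Lp_onD(1)[OF u(2)] test_measurable[OF \<phi>] by measurable
  have m': "weak_grad \<Omega> (\<lambda>x. u x - \<phi> x) \<in> borel_measurable M"
    by (rule borel_measurable_lebesgue_on_AE_cong[OF sets_\<Omega> m weak_grad_AE(1)[OF w]])
  have "(\<integral>x. norm (weak_grad \<Omega> (\<lambda>x. u x - \<phi> x) x) powr p \<partial>M) = (\<integral>x. norm (gradient \<phi> x - g x) powr p \<partial>M)"
  proof (rule integral_cong_AE)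
    show "AE x in M. norm (weak_grad \<Omega> (\<lambda>x. u x - \<phi> x) x) powr p = norm (gradient \<phi> x - g x) powr p"
      using weak_grad_AE(1)[OF w] by eventually_elim (simp add: norm_minus_commute)
    show "(\<lambda>x. norm (gradient \<phi> x - g x) powr p) \<in> borel_measurable M"
      using Lp_onD(1)[OF u(2)] test_measurable[OF \<phi>] by measurable
  qed (use m' in measurable)
  then show ?thesis by (simp add: sobolev_norm_def abs_minus_commute)
qed

lemma W0_approx_imp_W1p_0:
  assumes "W0_approx u g \<psi>"
  shows "u \<in> W1p_0 \<Omega> p" "AE x in M. weak_grad \<Omega> u x = g x"
proof -
  note w = W0_approx_has_weak_gradient[OF assms]
  show "AE x in M. weak_grad \<Omega> u x = g x" by (rule weak_grad_AE(1)[OF w])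
  have u: "u \<in> Lp_on \<Omega> p" "g \<in> Lp_on \<Omega> p" and \<psi>: "\<And>n. \<psi> n \<in> test_functions \<Omega>"
    and lim: "(\<lambda>n. \<integral>x. norm (\<psi> n x - u x) powr p \<partial>M) \<longlonglongrightarrow> 0"
      "(\<lambda>n. \<integral>x. norm (gradient (\<psi> n) x - g x) powr p \<partial>M) \<longlonglongrightarrow> 0"
    using assms by (auto simp: W0_approx_def)
  have "\<exists>\<phi>\<in>test_functions \<Omega>. sobolev_norm \<Omega> p (\<lambda>x. u x - \<phi> x) < e" if e: "0 < e" for e
  proof -
    have "0 < e powr p" using e by simp
    from LIMSEQ_D[OF tendsto_add[OF lim] this] obtain n where 
      n: "\<bar>(\<integral>x. norm (\<psi> n x - u x) powr p \<partial>M) + (\<integral>x. norm (gradient (\<psi> n) x - g x) powr p \<partial>M)\<bar> < e powr p" by auto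
    have "sobolev_norm \<Omega> p (\<lambda>x. u x - \<psi> n x) < (e powr p) powr (1 / p)"
      unfolding sobolev_norm_diff[OF w u(2) \<psi>] using n p_gt_1 by (intro powr_less_mono2) (auto intro!: add_nonneg_nonneg)
    also have "\<dots> = e" using e p_gt_1 by (simp add: powr_powr)
    finally show ?thesis using \<psi> by auto
  qed
  then show "u \<in> W1p_0 \<Omega> p" using u w by (auto simp: W1p_0_def W1p_def)
qed

lemma W1p_0_approx:
  assumes "u \<in> W1p_0 \<Omega> p"
  shows "\<exists>\<psi>. W0_approx u (weak_grad \<Omega> u) \<psi>"
proof -
  obtain g where g: "g \<in> Lp_on \<Omega> p" "has_weak_gradient \<Omega> u g" and u: "u \<in> Lp_on \<Omega> p"
    using assms by (auto simp: W1p_0_def W1p_def)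
  note ae = weak_grad_AE[OF g(2)]
  have m: "weak_grad \<Omega> u \<in> borel_measurable M"
    by (rule borel_measurable_lebesgue_on_AE_cong[OF sets_\<Omega> Lp_onD(1)[OF g(1)] ae(1)])
  have "integrable M (\<lambda>x. norm (weak_grad \<Omega> u x) powr p)"
  proof (rule integrable_cong_AE_imp[OF Lp_onD(2)[OF g(1)]])
    show "AE x in M. norm (g x) powr p = norm (weak_grad \<Omega> u x) powr p" using ae(1) by eventually_elim simp
  qed (use m in measurable)
  with m have G: "weak_grad \<Omega> u \<in> Lp_on \<Omega> p" by (simp add: Lp_on_def)
  \<comment> \<open>The root undoes the exponent \<open>1 / p\<close> of the norm, so that the two
    \<open>p\<close>-th power integrals together are at most
    \<open>1 / real (Suc n)\<close>.\<close>
  have "\<exists>\<phi>\<in>test_functions \<Omega>. sobolev_norm \<Omega> p (\<lambda>x. u x - \<phi> x) < (1 / real (Suc n)) powr (1 / p)" for n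
    using assms unfolding W1p_0_def by auto
  then obtain \<psi> where \<psi>: "\<And>n. \<psi> n \<in> test_functions \<Omega>" 
    "\<And>n. sobolev_norm \<Omega> p (\<lambda>x. u x - \<psi> n x) < (1 / real (Suc n)) powr (1 / p)" by metis
  have le: "(\<integral>x. norm (\<psi> n x - u x) powr p \<partial>M) + (\<integral>x. norm (gradient (\<psi> n) x - weak_grad \<Omega> u x) powr p \<partial>M) \<le> 1 / real (Suc n)" for n
  proof (rule ccontr)
    assume "\<not> ?thesis"
    then have "(1 / real (Suc n)) powr (1 / p) \<le> ((\<integral>x. norm (\<psi> n x - u x) powr p \<partial>M) + (\<integral>x. norm (gradient (\<psi> n) x - weak_grad \<Omega> u x) powr p \<partial>M)) powr (1 / p)"
      using p_gt_1 by (intro powr_mono2) auto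
    then show False using \<psi>(2)[of n] unfolding sobolev_norm_diff[OF ae(2) G \<psi>(1)] by simp
  qed
  have l0: "(\<lambda>n. 1 / real (Suc n)) \<longlonglongrightarrow> 0" using LIMSEQ_inverse_real_of_nat by (simp add: inverse_eq_divide)
  have nn: "0 \<le> (\<integral>x. norm (\<psi> n x - u x) powr p \<partial>M)" "0 \<le> (\<integral>x. norm (gradient (\<psi> n) x - weak_grad \<Omega> u x) powr p \<partial>M)" for n by auto
  have "(\<lambda>n. \<integral>x. norm (\<psi> n x - u x) powr p \<partial>M) \<longlonglongrightarrow> 0"
    by (rule Lim_null_comparison[OF always_eventually l0]) (intro allI, use le nn in \<open>smt (verit) real_norm_def\<close>)
  moreover have "(\<lambda>n. \<integral>x. norm (gradient (\<psi> n) x - weak_grad \<Omega> u x) powr p \<partial>M) \<longlonglongrightarrow> 0"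
    by (rule Lim_null_comparison[OF always_eventually l0]) (intro allI, use le nn in \<open>smt (verit) real_norm_def\<close>)
  ultimately show ?thesis using u G \<psi>(1) by (auto simp: W0_approx_def)
qed

end

context bounded_open_domain
begin

section \<open>The energy and its lower semicontinuity\<close>

definition energy :: "('a \<Rightarrow> real) \<Rightarrow> real" where
  "energy u = (\<integral>x. norm (weak_grad \<Omega> u x) powr p \<partial>M)"

lemma energy_nonneg [simp]: "0 \<le> energy u"
  by (simp add: energy_def)

lemma W0_approxD:
  assumes "W0_approx u g \<psi>"
  shows "u \<in> Lp_on \<Omega> p" "g \<in> Lp_on \<Omega> p" "\<psi> n \<in> test_functions \<Omega>"
    "(\<lambda>n. \<integral>x. norm (\<psi> n x - u x) powr p \<partial>M) \<longlonglongrightarrow> 0"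
    "(\<lambda>n. \<integral>x. norm (gradient (\<psi> n) x - g x) powr p \<partial>M) \<longlonglongrightarrow> 0"
  using assms by (auto simp: W0_approx_def)

lemma energy_eq:
  assumes "W0_approx u g \<psi>"
  shows "energy u = (\<integral>x. norm (g x) powr p \<partial>M)"
  unfolding energy_def
proof (rule integral_cong_AE)
  note ae = W0_approx_imp_W1p_0(2)[OF assms]
  have g: "g \<in> borel_measurable M" using Lp_onD(1)[OF W0_approxD(2)[OF assms]] .
  have "weak_grad \<Omega> u \<in> borel_measurable M"
    by (rule borel_measurable_lebesgue_on_AE_cong[OF sets_\<Omega> g ae])
  then show "(\<lambda>x. norm (weak_grad \<Omega> u x) powr p) \<in> borel_measurable M" by measurable
  show "(\<lambda>x. norm (g x) powr p) \<in> borel_measurable M" using g by measurable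
  show "AE x in M. norm (weak_grad \<Omega> u x) powr p = norm (g x) powr p" using ae by eventually_elim simp
qed

lemma W0_approx_test: "\<phi> \<in> test_functions \<Omega> \<Longrightarrow> W0_approx \<phi> (gradient \<phi>) (\<lambda>n. \<phi>)"
  using test_Lp by (simp add: W0_approx_def)

lemma test_W1p_0: "\<phi> \<in> test_functions \<Omega> \<Longrightarrow> \<phi> \<in> W1p_0 \<Omega> p"
  using W0_approx_imp_W1p_0(1)[OF W0_approx_test] .

lemma energy_test: "\<phi> \<in> test_functions \<Omega> \<Longrightarrow> energy \<phi> = (\<integral>x. norm (gradient \<phi> x) powr p \<partial>M)"
  using energy_eq[OF W0_approx_test] .

lemma W1p_0_Lp:
  assumes "u \<in> W1p_0 \<Omega> p"
  shows "u \<in> Lp_on \<Omega> p" "weak_grad \<Omega> u \<in> Lp_on \<Omega> p"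
  using W1p_0_approx[OF assms] by (auto simp: W0_approx_def)

lemma tendsto_Lp_add_scale:
  fixes f h :: "nat \<Rightarrow> 'a \<Rightarrow> 'b::euclidean_space"
  assumes f: "\<And>n. f n \<in> Lp_on \<Omega> p" and h: "\<And>n. h n \<in> Lp_on \<Omega> p"
    and lim: "(\<lambda>n. \<integral>x. norm (f n x) powr p \<partial>M) \<longlonglongrightarrow> 0" "(\<lambda>n. \<integral>x. norm (h n x) powr p \<partial>M) \<longlonglongrightarrow> 0"
  shows "(\<lambda>n. \<integral>x. norm (f n x + c *\<^sub>R h n x) powr p \<partial>M) \<longlonglongrightarrow> 0"
proof -
  define C where "C = 2 powr p * (1 + \<bar>c\<bar> powr p)"
  have "norm (\<integral>x. norm (f n x + c *\<^sub>R h n x) powr p \<partial>M)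
    \<le> C * ((\<integral>x. norm (f n x) powr p \<partial>M) + (\<integral>x. norm (h n x) powr p \<partial>M))" for n
  proof -
    have "(\<integral>x. norm (f n x + c *\<^sub>R h n x) powr p \<partial>M) \<le> (\<integral>x. C * (norm (f n x) powr p + norm (h n x) powr p) \<partial>M)"
    proof (rule integral_mono)
      show "integrable M (\<lambda>x. norm (f n x + c *\<^sub>R h n x) powr p)"
        using Lp_onD(2)[OF Lp_add[OF f Lp_scaleR[OF h]]] .
      show "integrable M (\<lambda>x. C * (norm (f n x) powr p + norm (h n x) powr p))"
        by (intro integrable_mult_right Bochner_Integration.integrable_add Lp_onD(2)[OF f] Lp_onD(2)[OF h])
      fix x
      have "norm (f n x + c *\<^sub>R h n x) powr p \<le> (norm (f n x) + norm (c *\<^sub>R h n x)) powr p"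
        using p_gt_1 norm_triangle_ineq[of "f n x" "c *\<^sub>R h n x"] by (intro powr_mono2) auto
      also have "\<dots> \<le> 2 powr p * (norm (f n x) powr p + norm (c *\<^sub>R h n x) powr p)"
        using p_gt_1 by (intro powr_add_le) auto
      also have "\<dots> = 2 powr p * (norm (f n x) powr p + \<bar>c\<bar> powr p * norm (h n x) powr p)"
        by (simp add: powr_mult)
      also have "\<dots> \<le> 2 powr p * ((1 + \<bar>c\<bar> powr p) * norm (f n x) powr p + (1 + \<bar>c\<bar> powr p) * norm (h n x) powr p)"
      proof (rule mult_left_mono)
        have "0 \<le> norm (h n x) powr p" "0 \<le> \<bar>c\<bar> powr p * norm (f n x) powr p" by simp_all
        then show "norm (f n x) powr p + \<bar>c\<bar> powr p * norm (h n x) powr p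
          \<le> (1 + \<bar>c\<bar> powr p) * norm (f n x) powr p + (1 + \<bar>c\<bar> powr p) * norm (h n x) powr p"
          unfolding distrib_right mult_1 by linarith
      qed simp
      also have "\<dots> = C * (norm (f n x) powr p + norm (h n x) powr p)" by (simp add: C_def algebra_simps)
      finally show "norm (f n x + c *\<^sub>R h n x) powr p \<le> C * (norm (f n x) powr p + norm (h n x) powr p)" .
    qed
    also have "\<dots> = C * ((\<integral>x. norm (f n x) powr p \<partial>M) + (\<integral>x. norm (h n x) powr p \<partial>M))"
      by (simp only: integral_mult_right_zero Bochner_Integration.integral_add[OF Lp_onD(2)[OF f] Lp_onD(2)[OF h]])
    finally show ?thesis by simp
  qed
  note bd = this
  have "(\<lambda>n. C * ((\<integral>x. norm (f n x) powr p \<partial>M) + (\<integral>x. norm (h n x) powr p \<partial>M))) \<longlonglongrightarrow> C * (0 + 0)"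
    by (intro tendsto_intros lim)
  then have "(\<lambda>n. C * ((\<integral>x. norm (f n x) powr p \<partial>M) + (\<integral>x. norm (h n x) powr p \<partial>M))) \<longlonglongrightarrow> 0" by simp
  from Lim_null_comparison[OF always_eventually[OF allI[OF bd]] this] show ?thesis .
qed

lemma W0_approx_add_scale:
  assumes u: "W0_approx u g \<psi>" and v: "W0_approx v h \<zeta>"
  shows "W0_approx (\<lambda>x. u x + c * v x) (\<lambda>x. g x + c *\<^sub>R h x) (\<lambda>n x. \<psi> n x + c * \<zeta> n x)"
proof -
  note uD = W0_approxD[OF u] and vD = W0_approxD[OF v]
  have t: "(\<lambda>x. \<psi> n x + c * \<zeta> n x) \<in> test_functions \<Omega>" for n
    by (rule test_functions_add[OF uD(3) test_functions_cmult[OF vD(3)]])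
  have gr: "gradient (\<lambda>x. \<psi> n x + c * \<zeta> n x) x = gradient (\<psi> n) x + c *\<^sub>R gradient (\<zeta> n) x" for n x
    using gradient_add[OF uD(3) test_functions_cmult[OF vD(3)]] gradient_cmult[OF vD(3)] by simp
  have 1: "(\<lambda>n. \<integral>x. norm ((\<psi> n x - u x) + c *\<^sub>R (\<zeta> n x - v x)) powr p \<partial>M) \<longlonglongrightarrow> 0"
    by (rule tendsto_Lp_add_scale[OF Lp_diff[OF test_Lp(1)[OF uD(3)] uD(1)] Lp_diff[OF test_Lp(1)[OF vD(3)] vD(1)] uD(4) vD(4)])
  have e1: "(\<psi> n x - u x) + c *\<^sub>R (\<zeta> n x - v x) = (\<psi> n x + c * \<zeta> n x) - (u x + c * v x)" for n x
    by (simp add: algebra_simps)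
  have 2: "(\<lambda>n. \<integral>x. norm ((gradient (\<psi> n) x - g x) + c *\<^sub>R (gradient (\<zeta> n) x - h x)) powr p \<partial>M) \<longlonglongrightarrow> 0"
    by (rule tendsto_Lp_add_scale[OF Lp_diff[OF test_Lp(2)[OF uD(3)] uD(2)] Lp_diff[OF test_Lp(2)[OF vD(3)] vD(2)] uD(5) vD(5)])
  have e2: "(gradient (\<psi> n) x - g x) + c *\<^sub>R (gradient (\<zeta> n) x - h x) 
      = gradient (\<lambda>x. \<psi> n x + c * \<zeta> n x) x - (g x + c *\<^sub>R h x)" for n x
    unfolding gr by (simp add: algebra_simps)
  have "(\<lambda>x. u x + c * v x) \<in> Lp_on \<Omega> p" using Lp_add[OF uD(1) Lp_scaleR[OF vD(1)]] by simp
  moreover have "(\<lambda>x. g x + c *\<^sub>R h x) \<in> Lp_on \<Omega> p" using Lp_add[OF uD(2) Lp_scaleR[OF vD(2)]] .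
  ultimately show ?thesis unfolding W0_approx_def using t 1[unfolded e1] 2[unfolded e2] by blast
qed

lemma W1p_0_add_scale:
  assumes "u \<in> W1p_0 \<Omega> p" "v \<in> W1p_0 \<Omega> p"
  shows "(\<lambda>x. u x + c * v x) \<in> W1p_0 \<Omega> p"
    "energy (\<lambda>x. u x + c * v x) = (\<integral>x. norm (weak_grad \<Omega> u x + c *\<^sub>R weak_grad \<Omega> v x) powr p \<partial>M)"
proof -
  obtain \<psi> \<zeta> where "W0_approx u (weak_grad \<Omega> u) \<psi>" "W0_approx v (weak_grad \<Omega> v) \<zeta>"
    using assms W1p_0_approx by blast
  note w = W0_approx_add_scale[OF this, of c]
  show "(\<lambda>x. u x + c * v x) \<in> W1p_0 \<Omega> p" using W0_approx_imp_W1p_0(1)[OF w] .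
  show "energy (\<lambda>x. u x + c * v x) = (\<integral>x. norm (weak_grad \<Omega> u x + c *\<^sub>R weak_grad \<Omega> v x) powr p \<partial>M)"
    using energy_eq[OF w] .
qed

text \<open>Test functions close to \<open>w\<close> whose energy is nearly minimal among those at least as close have a
  Cauchy sequence of gradients, since midpoints cannot lower the energy and the norm is uniformly convex.\<close>

lemma W1p_0_closure:
  assumes w: "w \<in> Lp_on \<Omega> p"
    and ex: "\<And>\<delta>. 0 < \<delta> \<Longrightarrow> \<exists>\<psi>\<in>test_functions \<Omega>. (\<integral>x. norm (\<psi> x - w x) powr p \<partial>M) < \<delta> \<and> energy \<psi> \<le> A"
  shows "w \<in> W1p_0 \<Omega> p" "energy w \<le> A"
proof -
  define T where "T n = {\<psi>\<in>test_functions \<Omega>. (\<integral>x. norm (\<psi> x - w x) powr p \<partial>M) < 1 / real (Suc n)}" for n :: nat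
  \<comment> \<open>The classes \<open>T n\<close> shrink, so \<open>d n\<close> increases, and by
    \<open>ex\<close> it stays below \<open>A\<close>. Its limit \<open>dl\<close> is the least
    energy with which test functions approach \<open>w\<close>.\<close>
  define d where "d n = Inf (energy ` T n)" for n
  have bdd: "bdd_below (energy ` T n)" for n by (rule bdd_belowI[of _ 0]) auto
  have ne: "T n \<noteq> {}" for n using ex[of "1 / real (Suc n)"] by (auto simp: T_def)
  have dle: "d n \<le> energy \<psi>" if "\<psi> \<in> T n" for n \<psi>
    unfolding d_def using that bdd by (intro cINF_lower) auto
  have dA: "d n \<le> A" for n
  proof -
    obtain \<psi> where "\<psi> \<in> T n" "energy \<psi> \<le> A" using ex[of "1 / real (Suc n)"] by (auto simp: T_def)
    then show ?thesis using dle[of \<psi> n] by linarith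
  qed
  have sub: "T m \<subseteq> T n" if "n \<le> m" for n m
  proof -
    have "1 / real (Suc m) \<le> 1 / real (Suc n)" using that by (intro divide_left_mono) auto
    then show ?thesis unfolding T_def by auto
  qed
  have mono: "d n \<le> d m" if "n \<le> m" for n m
    unfolding d_def using sub[OF that] ne bdd by (intro cInf_superset_mono) auto
  have "incseq d" using mono by (simp add: incseq_def)
  then obtain dl where dl: "d \<longlonglongrightarrow> dl" "\<And>n. d n \<le> dl" using incseq_convergent[of d A] dA by metis
  have dlA: "dl \<le> A" by (rule LIMSEQ_le_const2[OF dl(1)]) (use dA in auto)
  have "\<exists>\<psi>\<in>T n. energy \<psi> < d n + 1 / real (Suc n)" for n
  proof (rule ccontr)
    assume "\<not> ?thesis"
    then have "d n + 1 / real (Suc n) \<le> Inf (energy ` T n)" using ne[of n] by (intro cINF_greatest) auto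
    then show False by (simp add: d_def)
  qed
  then obtain \<psi> where \<psi>: "\<And>n. \<psi> n \<in> T n" "\<And>n. energy (\<psi> n) < d n + 1 / real (Suc n)" by metis
  have \<psi>t: "\<psi> n \<in> test_functions \<Omega>" for n using \<psi>(1) by (auto simp: T_def)
  have inv0: "1 / real (Suc n) \<le> 1 / real (Suc k)" if "k \<le> n" for k n using that by (intro divide_left_mono) auto
  have l0: "(\<lambda>n. 1 / real (Suc n)) \<longlonglongrightarrow> 0" using LIMSEQ_inverse_real_of_nat by (simp add: inverse_eq_divide)
  have enA: "energy (\<psi> n) \<le> A + 1 / real (Suc n)" for n using \<psi>(2)[of n] dA[of n] by linarith
  have gi: "integrable M (\<lambda>x. norm (gradient (\<psi> n) x) powr p)" for n using Lp_onD(2)[OF test_Lp(2)[OF \<psi>t]] .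
  \<comment> \<open>The midpoint belongs to \<open>T k\<close> by convexity, so its energy is at
    least \<open>d k\<close>; each end point has energy below \<open>dl + 1 / real (Suc k)\<close>.
    Hence the convexity defect is at most the difference.\<close>
  have mid: "(energy (\<psi> n) + energy (\<psi> m)) / 2 - (\<integral>x. norm ((1/2) *\<^sub>R (gradient (\<psi> n) x + gradient (\<psi> m) x)) powr p \<partial>M) 
      \<le> dl - d k + 1 / real (Suc k)" if nm: "k \<le> n" "k \<le> m" for n m k
  proof -
    define \<zeta> where "\<zeta> x = (1/2) * (\<psi> n x + \<psi> m x)" for x
    have \<zeta>t: "\<zeta> \<in> test_functions \<Omega>" unfolding \<zeta>_def by (intro test_functions_cmult test_functions_add \<psi>t)
    have g\<zeta>: "gradient \<zeta> x = (1/2) *\<^sub>R (gradient (\<psi> n) x + gradient (\<psi> m) x)" for x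
      unfolding \<zeta>_def gradient_cmult[OF test_functions_add[OF \<psi>t \<psi>t]] gradient_add[OF \<psi>t \<psi>t] ..
    have wi: "integrable M (\<lambda>x. norm (\<psi> n x - w x) powr p)" for n using Lp_onD(2)[OF Lp_diff[OF test_Lp(1)[OF \<psi>t] w]] .
    have "(\<integral>x. norm (\<zeta> x - w x) powr p \<partial>M) \<le> (\<integral>x. (norm (\<psi> n x - w x) powr p + norm (\<psi> m x - w x) powr p) / 2 \<partial>M)"
    proof (rule integral_mono)
      show "integrable M (\<lambda>x. norm (\<zeta> x - w x) powr p)" using Lp_onD(2)[OF Lp_diff[OF test_Lp(1)[OF \<zeta>t] w]] .
      show "norm (\<zeta> x - w x) powr p \<le> (norm (\<psi> n x - w x) powr p + norm (\<psi> m x - w x) powr p) / 2" for x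
        using norm_powr_midconvex[OF p_gt_1, of "\<psi> n x - w x" "\<psi> m x - w x"] by (simp add: \<zeta>_def field_simps)
    qed (use wi in auto)
    also have "\<dots> = ((\<integral>x. norm (\<psi> n x - w x) powr p \<partial>M) + (\<integral>x. norm (\<psi> m x - w x) powr p \<partial>M)) / 2" using wi by simp
    also have "\<dots> < 1 / real (Suc k)"
    proof -
      have "\<psi> n \<in> T k" "\<psi> m \<in> T k" using sub[OF nm(1)] sub[OF nm(2)] \<psi>(1) by blast+
      then have "(\<integral>x. norm (\<psi> n x - w x) powr p \<partial>M) < 1 / real (Suc k)" "(\<integral>x. norm (\<psi> m x - w x) powr p \<partial>M) < 1 / real (Suc k)"
        by (simp_all only: T_def mem_Collect_eq)
      moreover have "(a + b) / 2 < c" if "a < c" "b < c" for a b c :: real using that by simp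
      ultimately show ?thesis by blast
    qed
    finally have "\<zeta> \<in> T k" using \<zeta>t by (simp add: T_def)
    then have "d k \<le> energy \<zeta>" by (rule dle)
    also have "energy \<zeta> = (\<integral>x. norm ((1/2) *\<^sub>R (gradient (\<psi> n) x + gradient (\<psi> m) x)) powr p \<partial>M)"
      unfolding energy_test[OF \<zeta>t] g\<zeta> ..
    finally have le: "d k \<le> (\<integral>x. norm ((1/2) *\<^sub>R (gradient (\<psi> n) x + gradient (\<psi> m) x)) powr p \<partial>M)" .
    have arith: "(a + b) / 2 - y \<le> dl - z + r"
      if "a < dn + rn" "b < dm + rm" "dn \<le> dl" "dm \<le> dl" "rn \<le> r" "rm \<le> r" "z \<le> y" for a b dn rn dm rm r z y :: real
      using that by (simp add: field_simps)
    show ?thesis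
      by (rule arith[OF \<psi>(2) \<psi>(2) dl(2) dl(2) inv0[OF nm(1)] inv0[OF nm(2)] le])
  qed
  \<comment> \<open>Uniform convexity bounds the distance of two gradients by \<open>e1\<close>
    times their energies, which are below \<open>A + 1\<close>, plus \<open>C\<close> times the
    defect, which tends to \<open>0\<close> because \<open>d k\<close> tends to
    \<open>dl\<close>.\<close>
  have cauchy: "\<exists>N. \<forall>m\<ge>N. \<forall>n\<ge>N. (\<integral>x. norm (gradient (\<psi> m) x - gradient (\<psi> n) x) powr p \<partial>M) < e" if e: "0 < e" for e
  proof -
    have A0: "0 \<le> A + 1" using order_trans[OF energy_nonneg enA[of 0]] by simp
    define e1 where "e1 = e / (4 * (A + 2))"
    have e1: "0 < e1" "e1 * (2 * (A + 1)) < e / 2"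
    proof -
      show "0 < e1" using e A0 by (auto simp: e1_def)
      have "e1 * (2 * (A + 1)) < e1 * (2 * (A + 2))" using \<open>0 < e1\<close> by (intro mult_strict_left_mono) auto
      also have "\<dots> = e / 2" using A0 by (simp add: e1_def field_simps)
      finally show "e1 * (2 * (A + 1)) < e / 2" .
    qed
    obtain C where C: "0 \<le> C" "\<And>a b :: 'a. norm (a - b) powr p \<le> e1 * (norm a powr p + norm b powr p)
       + C * ((norm a powr p + norm b powr p) / 2 - norm ((1/2) *\<^sub>R (a + b)) powr p)"
      using norm_powr_uniformly_convex[OF p_gt_1 e1(1), where 'b='a] by blast
    have "(\<lambda>k. C * (dl - d k + 1 / real (Suc k))) \<longlonglongrightarrow> C * (dl - dl + 0)" by (intro tendsto_intros dl(1) l0)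
    then have lk: "(\<lambda>k. C * (dl - d k + 1 / real (Suc k))) \<longlonglongrightarrow> 0" by simp
    have "0 < e / 2" using e by simp
    from LIMSEQ_D[OF lk this] obtain k where "\<bar>C * (dl - d k + 1 / real (Suc k))\<bar> < e / 2" by auto
    then have k: "C * (dl - d k + 1 / real (Suc k)) < e / 2" by linarith
    have "(\<integral>x. norm (gradient (\<psi> m) x - gradient (\<psi> n) x) powr p \<partial>M) < e" if mn: "k \<le> m" "k \<le> n" for m n
    proof -
      let ?a = "gradient (\<psi> m)" and ?b = "gradient (\<psi> n)"
      have hi: "integrable M (\<lambda>x. norm ((1/2) *\<^sub>R (?a x + ?b x)) powr p)"
        using Lp_onD(2)[OF Lp_scaleR[OF Lp_add[OF test_Lp(2)[OF \<psi>t] test_Lp(2)[OF \<psi>t]]]] .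
      have "(\<integral>x. norm (?a x - ?b x) powr p \<partial>M) \<le> (\<integral>x. e1 * (norm (?a x) powr p + norm (?b x) powr p)
          + C * ((norm (?a x) powr p + norm (?b x) powr p) / 2 - norm ((1/2) *\<^sub>R (?a x + ?b x)) powr p) \<partial>M)"
      proof (rule integral_mono)
        show "integrable M (\<lambda>x. norm (?a x - ?b x) powr p)"
          using Lp_onD(2)[OF Lp_diff[OF test_Lp(2)[OF \<psi>t] test_Lp(2)[OF \<psi>t]]] .
        show "integrable M (\<lambda>x. e1 * (norm (?a x) powr p + norm (?b x) powr p)
          + C * ((norm (?a x) powr p + norm (?b x) powr p) / 2 - norm ((1/2) *\<^sub>R (?a x + ?b x)) powr p))"
          by (intro Bochner_Integration.integrable_add Bochner_Integration.integrable_diff integrable_mult_right integrable_divide gi hi)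
      qed (rule C(2))
      also have "\<dots> = e1 * (energy (\<psi> m) + energy (\<psi> n)) 
          + C * ((energy (\<psi> m) + energy (\<psi> n)) / 2 - (\<integral>x. norm ((1/2) *\<^sub>R (?a x + ?b x)) powr p \<partial>M))"
        unfolding energy_test[OF \<psi>t]
        by (simp only: Bochner_Integration.integral_add Bochner_Integration.integral_diff integral_mult_right_zero integral_divide_zero
            Bochner_Integration.integrable_add Bochner_Integration.integrable_diff integrable_mult_right integrable_divide gi hi)
      also have "\<dots> \<le> e1 * (2 * (A + 1)) + C * (dl - d k + 1 / real (Suc k))"
      proof (intro add_mono mult_left_mono)
        have "1 / real (Suc j) \<le> 1" for j by simp
        then show "energy (\<psi> m) + energy (\<psi> n) \<le> 2 * (A + 1)" using enA[of m] enA[of n] by (smt (verit))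
      qed (use mid[OF mn] e1 C in auto)
      also have "\<dots> < e" using e1(2) k by linarith
      finally show ?thesis .
    qed
    then show ?thesis by blast
  qed
  obtain g where g: "g \<in> borel_measurable M" "integrable M (\<lambda>x. norm (g x) powr p)"
    "(\<lambda>n. \<integral>x. norm (gradient (\<psi> n) x - g x) powr p \<partial>M) \<longlonglongrightarrow> 0"
  proof (rule Lp_complete[of p "\<lambda>n. gradient (\<psi> n)" M])
    show "gradient (\<psi> n) \<in> borel_measurable M" for n using test_measurable(2)[OF \<psi>t] .
  qed (use p_gt_1 gi cauchy in auto)
  have wl: "(\<lambda>n. \<integral>x. norm (\<psi> n x - w x) powr p \<partial>M) \<longlonglongrightarrow> 0"
  proof (rule Lim_null_comparison[OF always_eventually l0], intro allI)
    fix n show "norm (\<integral>x. norm (\<psi> n x - w x) powr p \<partial>M) \<le> 1 / real (Suc n)"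
      using \<psi>(1)[of n] by (auto simp: T_def)
  qed
  have ap: "W0_approx w g \<psi>" using w g \<psi>t wl by (auto simp: W0_approx_def Lp_on_def)
  show "w \<in> W1p_0 \<Omega> p" using W0_approx_imp_W1p_0(1)[OF ap] .
  have "(\<lambda>n. energy (\<psi> n)) \<longlonglongrightarrow> energy w"
    unfolding energy_eq[OF ap] energy_test[OF \<psi>t]
    using tendsto_integral_norm_powr[OF p_gt_1 test_measurable(2)[OF \<psi>t] g(1) gi g(2,3)] .
  moreover have "(\<lambda>n. A + 1 / real (Suc n)) \<longlonglongrightarrow> A + 0" by (intro tendsto_intros l0)
  ultimately show "energy w \<le> A" using LIMSEQ_le[of "\<lambda>n. energy (\<psi> n)" "energy w" "\<lambda>n. A + 1 / real (Suc n)" A] enA by auto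
qed

lemma energy_approx:
  assumes "W0_approx u g \<psi>"
  shows "(\<lambda>n. energy (\<psi> n)) \<longlonglongrightarrow> energy u"
proof -
  note D = W0_approxD[OF assms]
  show ?thesis
    unfolding energy_eq[OF assms] energy_test[OF D(3)]
    using tendsto_integral_norm_powr[OF p_gt_1 test_measurable(2)[OF D(3)] Lp_onD(1)[OF D(2)] Lp_onD(2)[OF test_Lp(2)[OF D(3)]] Lp_onD(2)[OF D(2)] D(5)] .
qed

lemma approx_AE_subseq:
  assumes "W0_approx u g \<psi>"
  shows "\<exists>r::nat\<Rightarrow>nat. strict_mono r \<and> (AE x in M. (\<lambda>n. \<psi> (r n) x) \<longlonglongrightarrow> u x)"
proof -
  note D = W0_approxD[OF assms]
  show ?thesis
    using p_gt_1 by (intro tendsto_Lp_AE_subseq[OF _ _ D(4)] Lp_onD(2)[OF Lp_diff[OF test_Lp(1)[OF D(3)] D(1)]]) simp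
qed

section \<open>The Sobolev inequality on the closure\<close>

text \<open>Fatou's lemma along an a.e. convergent approximating sequence. The energies of the
  sequence exceed \<open>energy u\<close> by at most an arbitrary \<open>e\<close> from some index
  on, and \<open>e\<close> is removed by continuity of the power.\<close>

lemma sobolev_W1p_0:
  "\<exists>K>0. \<forall>u\<in>W1p_0 \<Omega> p. integrable M (\<lambda>x. \<bar>u x\<bar> powr ps) \<and> (\<integral>x. \<bar>u x\<bar> powr ps \<partial>M) \<le> (K * energy u) powr (ps / p)"
proof -
  define K where "K = (p * (real DIM('a) - 1) / (real DIM('a) - p)) powr p"
  have K: "0 < K" using p_gt_1 p_less_dim by (simp add: K_def)
  have pp: "0 < ps / p" "0 < ps" using ps_gt_1 p_gt_1 by auto
  have test: "(\<integral>x. \<bar>\<phi> x\<bar> powr ps \<partial>M) \<le> (K * energy \<phi>) powr (ps / p)" if \<phi>: "\<phi> \<in> test_functions \<Omega>" for \<phi>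
  proof -
    have "(\<integral>x. \<bar>\<phi> x\<bar> powr ps \<partial>M) powr (p / ps) \<le> K * energy \<phi>"
      using sobolev_inequality_test[OF \<phi> bounded_\<Omega> p_gt_1 p_less_dim] test_integral_lborel[OF \<phi>] pp p_gt_1
      by (simp add: K_def ps_eq[symmetric] energy_test[OF \<phi>])
    then have "((\<integral>x. \<bar>\<phi> x\<bar> powr ps \<partial>M) powr (p / ps)) powr (ps / p) \<le> (K * energy \<phi>) powr (ps / p)"
      using pp by (intro powr_mono2) auto
    then show ?thesis using pp p_gt_1 by (simp add: powr_powr)
  qed
  have main: "integrable M (\<lambda>x. \<bar>u x\<bar> powr ps) \<and> (\<integral>x. \<bar>u x\<bar> powr ps \<partial>M) \<le> (K * (energy u + e)) powr (ps / p)"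
    if u: "u \<in> W1p_0 \<Omega> p" and e: "0 < e" for u e
  proof -
    obtain \<psi> where \<psi>: "W0_approx u (weak_grad \<Omega> u) \<psi>" using W1p_0_approx[OF u] by blast
    note D = W0_approxD[OF \<psi>]
    obtain r :: "nat \<Rightarrow> nat" where r: "strict_mono r" "AE x in M. (\<lambda>n. \<psi> (r n) x) \<longlonglongrightarrow> u x" using approx_AE_subseq[OF \<psi>] by blast
    have "(\<lambda>n. energy (\<psi> (r n))) \<longlonglongrightarrow> energy u"
      using LIMSEQ_subseq_LIMSEQ[OF energy_approx[OF \<psi>] r(1)] by (simp add: comp_def)
    from LIMSEQ_D[OF this e] obtain N where N: "\<And>n. N \<le> n \<Longrightarrow> \<bar>energy (\<psi> (r n)) - energy u\<bar> < e" by auto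
    have lim: "AE x in M. (\<lambda>n. \<bar>\<psi> (r (n + N)) x\<bar> powr ps) \<longlonglongrightarrow> \<bar>u x\<bar> powr ps"
      using r(2)
    proof eventually_elim
      case (elim x)
      then have "(\<lambda>n. \<psi> (r (n + N)) x) \<longlonglongrightarrow> u x" by (rule LIMSEQ_ignore_initial_segment)
      then show ?case using pp by (intro tendsto_powr' tendsto_intros) auto
    qed
    have le: "(\<integral>x. \<bar>\<psi> (r (n + N)) x\<bar> powr ps \<partial>M) \<le> (K * (energy u + e)) powr (ps / p)" for n
    proof -
      have "energy (\<psi> (r (n + N))) \<le> energy u + e" using N[of "n + N"] by auto
      then have "(K * energy (\<psi> (r (n + N)))) powr (ps / p) \<le> (K * (energy u + e)) powr (ps / p)"
        using K pp by (intro powr_mono2) auto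
      then show ?thesis using test[OF D(3), of "r (n + N)"] by linarith
    qed
    have um: "(\<lambda>x. \<bar>u x\<bar> powr ps) \<in> borel_measurable M" using Lp_onD(1)[OF D(1)] by measurable
    show ?thesis
      using Fatou_bounded[of M "\<lambda>n x. \<bar>\<psi> (r (n + N)) x\<bar> powr ps", OF test_integral_lborel(1)[OF D(3) pp(2)] _ le um lim] by auto
  qed
  have "integrable M (\<lambda>x. \<bar>u x\<bar> powr ps) \<and> (\<integral>x. \<bar>u x\<bar> powr ps \<partial>M) \<le> (K * energy u) powr (ps / p)" if u: "u \<in> W1p_0 \<Omega> p" for u
  proof
    show "integrable M (\<lambda>x. \<bar>u x\<bar> powr ps)" using main[OF u, of 1] by simp
    have "(\<lambda>n. (K * (energy u + 1 / real (Suc n))) powr (ps / p)) \<longlonglongrightarrow> (K * (energy u + 0)) powr (ps / p)"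
      using pp K LIMSEQ_inverse_real_of_nat
      by (intro tendsto_powr' tendsto_intros) (auto simp: inverse_eq_divide)
    then show "(\<integral>x. \<bar>u x\<bar> powr ps \<partial>M) \<le> (K * energy u) powr (ps / p)"
      using main[OF u] by (intro LIMSEQ_le_const[of _ "(K * energy u) powr (ps / p)"]) auto
  qed
  then show ?thesis using K by blast
qed

lemma W1p_0_integrable_ps: "u \<in> W1p_0 \<Omega> p \<Longrightarrow> integrable M (\<lambda>x. \<bar>u x\<bar> powr ps)"
  using sobolev_W1p_0 by blast

text \<open>Ensures that the infimum in \<open>sobolev_const\<close> ranges over a nonempty
  set.\<close>

lemma exists_nonzero_W1p_0: "\<exists>u\<in>W1p_0 \<Omega> p. \<not> (AE x in M. u x = 0)"
proof -
  obtain x0 where x0: "x0 \<in> \<Omega>" using nonempty_\<Omega> by auto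
  obtain a b where ab: "x0 \<in> box a b" "cbox a b \<subseteq> \<Omega>"
    using open_contains_cbox[OF open_\<Omega> x0] by metis
  have pos: "bump a b 1 x \<noteq> 0" if "x \<in> box a b" for x
    using that by (auto simp: bump_def mem_box exp_inv_poly_def)
  have "\<not> (AE x in M. bump a b 1 x = 0)"
  proof
    assume "AE x in M. bump a b 1 x = 0"
    then have "AE x in lebesgue. x \<in> \<Omega> \<longrightarrow> bump a b 1 x = 0" by (simp add: AE_restrict_space_iff)
    then have "AE x in lebesgue. x \<notin> box a b"
      by eventually_elim (use pos ab(2) box_subset_cbox[of a b] in blast)
    then have "negligible (box a b)" by (simp add: negligible_iff_null_sets AE_iff_null_sets)
    then show False using ab(1) open_not_negligible[OF open_box, of a b] by auto
  qed
  then show ?thesis using test_W1p_0[OF bump_test_function[OF ab(2)]] by blast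
qed

text \<open>The inequality is the definition of the infimum, raised to the power
  \<open>ps / p\<close>; functions that vanish a.e. are excluded there and treated directly.\<close>

lemma sobolev_const_inequality:
  defines "S \<equiv> sobolev_const \<Omega> p"
  shows "0 < S" and "\<And>u. u \<in> W1p_0 \<Omega> p \<Longrightarrow> (\<integral>x. \<bar>u x\<bar> powr ps \<partial>M) \<le> S powr (- (ps / p)) * energy u powr (ps / p)"
proof -
  have pp: "0 < ps / p" "0 < ps" "0 < p / ps" using ps_gt_1 p_gt_1 by auto
  define N where "N = {u \<in> W1p_0 \<Omega> p. \<not> (AE x in M. u x = 0)}"
  define q where "q u = energy u / (\<integral>x. \<bar>u x\<bar> powr ps \<partial>M) powr (p / ps)" for u
  have S: "S = (INF u\<in>N. q u)" by (simp add: S_def sobolev_const_def N_def q_def energy_def ps_eq)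
  obtain K where K: "0 < K" "\<And>u. u \<in> W1p_0 \<Omega> p \<Longrightarrow> (\<integral>x. \<bar>u x\<bar> powr ps \<partial>M) \<le> (K * energy u) powr (ps / p)"
    using sobolev_W1p_0 by blast
  have X: "0 < (\<integral>x. \<bar>u x\<bar> powr ps \<partial>M)" if u: "u \<in> N" for u
  proof -
    have i: "integrable M (\<lambda>x. \<bar>u x\<bar> powr ps)" using W1p_0_integrable_ps u by (auto simp: N_def)
    have "(\<integral>x. \<bar>u x\<bar> powr ps \<partial>M) \<noteq> 0"
    proof
      assume "(\<integral>x. \<bar>u x\<bar> powr ps \<partial>M) = 0"
      then have "AE x in M. \<bar>u x\<bar> powr ps = 0" using integral_nonneg_eq_0_iff_AE[OF i] by simp
      then have "AE x in M. u x = 0" by eventually_elim auto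
      then show False using u by (auto simp: N_def)
    qed
    moreover have "0 \<le> (\<integral>x. \<bar>u x\<bar> powr ps \<partial>M)" by simp
    ultimately show ?thesis by linarith
  qed
  \<comment> \<open>The non-sharp constant bounds all quotients from below, which yields
    \<open>0 < S\<close>.\<close>
  have "1 / K \<le> q u" if u: "u \<in> N" for u
  proof -
    have "(\<integral>x. \<bar>u x\<bar> powr ps \<partial>M) powr (p / ps) \<le> ((K * energy u) powr (ps / p)) powr (p / ps)"
      using K u pp by (intro powr_mono2) (auto simp: N_def)
    also have "\<dots> = K * energy u" using pp K p_gt_1 ps_gt_1 by (simp add: powr_powr)
    finally show ?thesis using X[OF u] K(1) by (simp add: q_def field_simps)
  qed
  moreover have "N \<noteq> {}" using exists_nonzero_W1p_0 by (auto simp: N_def)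
  ultimately have "1 / K \<le> S" unfolding S by (intro cINF_greatest) auto
  moreover have "0 < 1 / K" using K by simp
  ultimately show S0: "0 < S" by linarith
  have bdd: "bdd_below (q ` N)" by (rule bdd_belowI[of _ 0]) (auto simp: q_def)
  fix u assume u: "u \<in> W1p_0 \<Omega> p"
  show "(\<integral>x. \<bar>u x\<bar> powr ps \<partial>M) \<le> S powr (- (ps / p)) * energy u powr (ps / p)"
  proof (cases "u \<in> N")
    case True
    then have "S \<le> q u" unfolding S using bdd by (intro cINF_lower) auto
    then have "(\<integral>x. \<bar>u x\<bar> powr ps \<partial>M) powr (p / ps) \<le> energy u / S"
      using X[OF True] S0 by (simp add: q_def field_simps)
    then have "((\<integral>x. \<bar>u x\<bar> powr ps \<partial>M) powr (p / ps)) powr (ps / p) \<le> (energy u / S) powr (ps / p)"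
      using pp by (intro powr_mono2) auto
    also have "\<dots> = S powr (- (ps / p)) * energy u powr (ps / p)"
      using S0 by (simp add: powr_divide powr_minus_divide)
    finally show ?thesis using pp p_gt_1 ps_gt_1 by (simp add: powr_powr)
  next
    case False
    then have "AE x in M. u x = 0" using u by (auto simp: N_def)
    then have "AE x in M. \<bar>u x\<bar> powr ps = 0" by eventually_elim simp
    then have "(\<integral>x. \<bar>u x\<bar> powr ps \<partial>M) = 0" by (rule integral_eq_zero_AE)
    then show ?thesis by simp
  qed
qed

text \<open>The Sobolev inequality is applied to \<open>\<psi> n - u\<close>, which is itself
  approximated by the functions \<open>\<psi> n - \<psi> m\<close>.\<close>

lemma approx_ps:
  assumes "W0_approx u g \<psi>"
  shows "(\<lambda>n. \<integral>x. \<bar>\<psi> n x - u x\<bar> powr ps \<partial>M) \<longlonglongrightarrow> 0"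
    "(\<lambda>n. \<integral>x. \<bar>\<psi> n x\<bar> powr ps \<partial>M) \<longlonglongrightarrow> (\<integral>x. \<bar>u x\<bar> powr ps \<partial>M)"
proof -
  note D = W0_approxD[OF assms]
  have pp: "0 < ps / p" "0 < ps" using ps_gt_1 p_gt_1 by auto
  obtain K where K: "0 < K" "\<And>u. u \<in> W1p_0 \<Omega> p \<Longrightarrow> (\<integral>x. \<bar>u x\<bar> powr ps \<partial>M) \<le> (K * energy u) powr (ps / p)"
    using sobolev_W1p_0 by blast
  have bd: "norm (\<integral>x. \<bar>\<psi> n x - u x\<bar> powr ps \<partial>M) \<le> (K * (\<integral>x. norm (gradient (\<psi> n) x - g x) powr p \<partial>M)) powr (ps / p)" for n
  proof -
    have w: "W0_approx (\<lambda>x. \<psi> n x + (-1) * u x) (\<lambda>x. gradient (\<psi> n) x + (-1) *\<^sub>R g x) (\<lambda>m x. \<psi> n x + (-1) * \<psi> m x)"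
      by (rule W0_approx_add_scale[OF W0_approx_test[OF D(3)] assms])
    show ?thesis using K(2)[OF W0_approx_imp_W1p_0(1)[OF w]] energy_eq[OF w] by simp
  qed
  have "(\<lambda>n. (K * (\<integral>x. norm (gradient (\<psi> n) x - g x) powr p \<partial>M)) powr (ps / p)) \<longlonglongrightarrow> (K * 0) powr (ps / p)"
    using pp K by (intro tendsto_powr' tendsto_intros D(5)) auto
  then have l: "(\<lambda>n. (K * (\<integral>x. norm (gradient (\<psi> n) x - g x) powr p \<partial>M)) powr (ps / p)) \<longlonglongrightarrow> 0" by simp
  show 1: "(\<lambda>n. \<integral>x. \<bar>\<psi> n x - u x\<bar> powr ps \<partial>M) \<longlonglongrightarrow> 0"
    by (rule Lim_null_comparison[OF always_eventually[OF allI[OF bd]] l])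
  show "(\<lambda>n. \<integral>x. \<bar>\<psi> n x\<bar> powr ps \<partial>M) \<longlonglongrightarrow> (\<integral>x. \<bar>u x\<bar> powr ps \<partial>M)"
    using tendsto_integral_norm_powr[OF ps_gt_1, of \<psi> M u] 1 test_measurable(1)[OF D(3)] Lp_onD(1)[OF D(1)]
      test_integral_lborel(1)[OF D(3) pp(2)] W1p_0_integrable_ps[OF W0_approx_imp_W1p_0(1)[OF assms]] by simp
qed

end

subsection \<open>Truncation and lower semicontinuity\<close>

text \<open>A smooth truncation, so that truncated test functions are test functions.\<close>

definition trunc :: "real \<Rightarrow> real \<Rightarrow> real" where
  "trunc k s = k * arctan (s / k)"

lemma trunc_bounds:
  assumes "0 < k"
  shows "\<bar>trunc k s\<bar> \<le> k * (pi / 2)" "\<bar>trunc k s\<bar> \<le> \<bar>s\<bar>" "\<bar>s - trunc k s\<bar> \<le> \<bar>s\<bar>"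
proof -
  have "\<bar>arctan (s / k)\<bar> \<le> pi / 2" using arctan_bounded[of "s / k"] by linarith
  then show "\<bar>trunc k s\<bar> \<le> k * (pi / 2)" using assms by (simp add: trunc_def abs_mult)
  have a: "\<bar>arctan y\<bar> \<le> \<bar>y\<bar>" for y :: real
    using arctan_le_self[of y] arctan_le_self[of "-y"] by (cases "0 \<le> y") (auto simp: arctan_minus)
  have s: "0 \<le> s / k \<longleftrightarrow> 0 \<le> s" using assms by (simp add: zero_le_divide_iff)
  have sg: "0 \<le> s \<Longrightarrow> 0 \<le> trunc k s" "s \<le> 0 \<Longrightarrow> trunc k s \<le> 0"
    using assms by (auto simp: trunc_def mult_le_0_iff divide_le_0_iff)
  have "k * \<bar>arctan (s / k)\<bar> \<le> k * \<bar>s / k\<bar>" using assms by (intro mult_left_mono a) auto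
  then show le: "\<bar>trunc k s\<bar> \<le> \<bar>s\<bar>" using assms by (simp add: trunc_def abs_mult)
  show "\<bar>s - trunc k s\<bar> \<le> \<bar>s\<bar>" using le sg by (cases "0 \<le> s") auto
qed

lemma continuous_trunc: "continuous_on A (trunc k)"
  unfolding trunc_def divide_inverse by (intro continuous_intros)

lemma trunc_tendsto: "(\<lambda>n. trunc (real (Suc n)) s) \<longlonglongrightarrow> s"
proof (cases "s = 0")
  case False
  have "((\<lambda>h. arctan h / h) \<longlongrightarrow> 1) (at 0)"
    using DERIV_arctan[of 0] by (simp add: DERIV_def)
  moreover have "filterlim (\<lambda>n. s / real (Suc n)) (at 0) sequentially"
  proof (rule filterlim_atI)
    have "(\<lambda>n. s * inverse (real (Suc n))) \<longlonglongrightarrow> s * 0" by (intro tendsto_intros LIMSEQ_inverse_real_of_nat)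
    then show "(\<lambda>n. s / real (Suc n)) \<longlonglongrightarrow> 0" by (simp add: divide_inverse)
  qed (use False in auto)
  ultimately have "(\<lambda>n. arctan (s / real (Suc n)) / (s / real (Suc n))) \<longlonglongrightarrow> 1" by (rule filterlim_compose)
  then have "(\<lambda>n. s * (arctan (s / real (Suc n)) / (s / real (Suc n)))) \<longlonglongrightarrow> s * 1" by (intro tendsto_intros)
  moreover have "s * (arctan (s / real (Suc n)) / (s / real (Suc n))) = trunc (real (Suc n)) s" for n
    using False by (simp add: trunc_def)
  ultimately show ?thesis by simp
qed (simp add: trunc_def)

lemma trunc_test:
  assumes \<phi>: "\<phi> \<in> test_functions \<Omega>" and k: "0 < k"
  shows "(\<lambda>x. trunc k (\<phi> x)) \<in> test_functions \<Omega>"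
    "gradient (\<lambda>x. trunc k (\<phi> x)) x = (1 / (1 + (\<phi> x / k)\<^sup>2)) *\<^sub>R gradient \<phi> x"
proof -
  obtain K where K: "compact K" "K \<subseteq> \<Omega>" "\<And>x. x \<notin> K \<Longrightarrow> \<phi> x = 0"
    using test_function_support[OF \<phi>] by blast
  show "(\<lambda>x. trunc k (\<phi> x)) \<in> test_functions \<Omega>"
  proof (rule test_functionsI[OF _ _ K(1,2)])
    show "{x. trunc k (\<phi> x) \<noteq> 0} \<subseteq> K" using K(3) by (force simp: trunc_def)
    have "Ck_fun j (\<lambda>x. k * arctan (inverse k * \<phi> x))" for j
      by (intro Ck_fun_mult Ck_fun_arctan Ck_fun_const test_function_Ck_fun[OF \<phi>])
    then show "Ck_fun j (\<lambda>x. trunc k (\<phi> x))" for j by (simp add: trunc_def divide_inverse mult.commute)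
  qed
  have "(trunc k has_real_derivative (1 / (1 + (s / k)\<^sup>2))) (at s)" for s
    unfolding trunc_def using k by (auto intro!: derivative_eq_intros simp: inverse_eq_divide)
  from has_derivative_compose[OF test_function_has_derivative[OF \<phi>] has_field_derivative_imp_has_derivative[OF this]]
  show "gradient (\<lambda>x. trunc k (\<phi> x)) x = (1 / (1 + (\<phi> x / k)\<^sup>2)) *\<^sub>R gradient \<phi> x"
    by (intro gradient_eqI) (simp add: mult.commute)
qed

context bounded_open_domain
begin

text \<open>The two gradients are \<open>a x\<close> and \<open>1 - a x\<close> times that of
  \<open>\<phi>\<close>, where \<open>a x\<close> in \<open>[0, 1]\<close> is the slope of
  \<open>trunc k\<close> at \<open>\<phi> x\<close>, and
  \<open>a powr p + (1 - a) powr p \<le> 1\<close>. The energy thus splits between the truncated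
  part and the remainder.\<close>

lemma energy_trunc_le:
  assumes \<phi>: "\<phi> \<in> test_functions \<Omega>" and k: "0 < k"
  shows "energy (\<lambda>x. trunc k (\<phi> x)) + energy (\<lambda>x. \<phi> x - trunc k (\<phi> x)) \<le> energy \<phi>"
proof -
  note t = trunc_test[OF \<phi> k]
  note g = test_functions_diff[OF \<phi> t(1)]
  define a where "a x = 1 / (1 + (\<phi> x / k)\<^sup>2)" for x
  have a: "0 \<le> a x" "a x \<le> 1" for x by (auto simp: a_def divide_le_eq_1 add_pos_nonneg)
  have gr: "gradient (\<lambda>x. trunc k (\<phi> x)) x = a x *\<^sub>R gradient \<phi> x"
    "gradient (\<lambda>x. \<phi> x - trunc k (\<phi> x)) x = (1 - a x) *\<^sub>R gradient \<phi> x" for x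
    using t(2) gradient_diff[OF \<phi> t(1)] by (auto simp: a_def scaleR_diff_left)
  have pw: "y powr p \<le> y" if "0 \<le> y" "y \<le> 1" for y using powr_mono'[of 1 p y] that p_gt_1 by simp
  have i: "integrable M (\<lambda>x. norm (gradient (\<lambda>x. trunc k (\<phi> x)) x) powr p)" 
    "integrable M (\<lambda>x. norm (gradient (\<lambda>x. \<phi> x - trunc k (\<phi> x)) x) powr p)"
    "integrable M (\<lambda>x. norm (gradient \<phi> x) powr p)"
    using Lp_onD(2)[OF test_Lp(2)] t(1) g \<phi> by auto
  have "energy (\<lambda>x. trunc k (\<phi> x)) + energy (\<lambda>x. \<phi> x - trunc k (\<phi> x)) 
    = (\<integral>x. norm (gradient (\<lambda>x. trunc k (\<phi> x)) x) powr p + norm (gradient (\<lambda>x. \<phi> x - trunc k (\<phi> x)) x) powr p \<partial>M)"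
    unfolding energy_test[OF t(1)] energy_test[OF g] using i by simp
  also have "\<dots> \<le> energy \<phi>"
    unfolding energy_test[OF \<phi>]
  proof (rule integral_mono)
    fix x
    have "norm (gradient (\<lambda>x. trunc k (\<phi> x)) x) powr p + norm (gradient (\<lambda>x. \<phi> x - trunc k (\<phi> x)) x) powr p
      = (a x powr p + (1 - a x) powr p) * norm (gradient \<phi> x) powr p"
      using a[of x] unfolding gr by (simp add: powr_mult distrib_right)
    also have "\<dots> \<le> 1 * norm (gradient \<phi> x) powr p"
      using pw[of "a x"] pw[of "1 - a x"] a[of x] by (intro mult_right_mono) auto
    finally show "norm (gradient (\<lambda>x. trunc k (\<phi> x)) x) powr p + norm (gradient (\<lambda>x. \<phi> x - trunc k (\<phi> x)) x) powr p
      \<le> norm (gradient \<phi> x) powr p" by simp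
  qed (use i in auto)
  finally show ?thesis .
qed

lemma integrable_powr_absorb:
  fixes w :: "'a \<Rightarrow> real"
  assumes "w \<in> borel_measurable M" "integrable M (\<lambda>x. \<bar>w x\<bar> powr s)" "0 < r" "r \<le> s"
  shows "integrable M (\<lambda>x. \<bar>w x\<bar> powr r)"
proof (cases "r = s")
  case False
  then obtain C where C: "0 \<le> C" "\<And>t. 0 \<le> t \<Longrightarrow> t powr r \<le> 1 * t powr s + C"
    using powr_absorb[of r s 1] assms by auto
  show ?thesis
    by (rule Bochner_Integration.integrable_bound[where f="\<lambda>x. \<bar>w x\<bar> powr s + C"])
      (use assms C in \<open>auto intro!: AE_I2\<close>)
qed (use assms in simp)

lemma trunc_Lp_tendsto:
  assumes u: "u \<in> Lp_on \<Omega> p"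
  shows "(\<lambda>n. \<integral>x. \<bar>trunc (real (Suc n)) (u x) - u x\<bar> powr p \<partial>M) \<longlonglongrightarrow> 0"
proof -
  note [measurable] = Lp_onD(1)[OF u]
  have tm: "(\<lambda>x. trunc k (u x)) \<in> borel_measurable M" for k
    by (rule measurable_compose[OF Lp_onD(1)[OF u] borel_measurable_continuous_onI[OF continuous_trunc]])
  have "(\<lambda>n. \<integral>x. \<bar>trunc (real (Suc n)) (u x) - u x\<bar> powr p \<partial>M) \<longlonglongrightarrow> (\<integral>x. 0 \<partial>M)"
  proof (rule integral_dominated_convergence[where w="\<lambda>x. \<bar>u x\<bar> powr p"])
    show "AE x in M. (\<lambda>n. \<bar>trunc (real (Suc n)) (u x) - u x\<bar> powr p) \<longlonglongrightarrow> 0"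
    proof (intro AE_I2)
      fix x
      have "(\<lambda>n. \<bar>trunc (real (Suc n)) (u x) - u x\<bar> powr p) \<longlonglongrightarrow> \<bar>u x - u x\<bar> powr p"
        using p_gt_1 by (intro tendsto_powr' tendsto_intros trunc_tendsto) auto
      then show "(\<lambda>n. \<bar>trunc (real (Suc n)) (u x) - u x\<bar> powr p) \<longlonglongrightarrow> 0" by simp
    qed
    show "AE x in M. norm (\<bar>trunc (real (Suc n)) (u x) - u x\<bar> powr p) \<le> \<bar>u x\<bar> powr p" for n
    proof (intro AE_I2)
      fix x
      have "\<bar>trunc (real (Suc n)) (u x) - u x\<bar> \<le> \<bar>u x\<bar>"
        using trunc_bounds(3)[of "real (Suc n)" "u x"] by (simp add: abs_minus_commute)
      then have "\<bar>trunc (real (Suc n)) (u x) - u x\<bar> powr p \<le> \<bar>u x\<bar> powr p" using p_gt_1 by (intro powr_mono2) auto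
      then show "norm (\<bar>trunc (real (Suc n)) (u x) - u x\<bar> powr p) \<le> \<bar>u x\<bar> powr p" by simp
    qed
  qed (use Lp_onD[OF u] tm in auto)
  then show ?thesis by simp
qed

text \<open>Since \<open>trunc k\<close> is bounded, subtracting the remainder lowers the growth
  from the power \<open>ps\<close> to the power \<open>ps - 1\<close>. Vitali's theorem then
  applies, although it would not for the critical power alone.\<close>

lemma critical_term_truncated_limit:
  assumes \<phi>: "\<And>n. \<phi> n \<in> test_functions \<Omega>" and u: "u \<in> borel_measurable M"
    and ae: "AE x in M. (\<lambda>n. \<phi> n x) \<longlonglongrightarrow> u x"
    and C: "\<And>n. (\<integral>x. \<bar>\<phi> n x\<bar> powr ps \<partial>M) \<le> C" and k: "0 < k"
  shows "(\<lambda>n. (\<integral>x. \<bar>\<phi> n x\<bar> powr ps - \<bar>\<phi> n x - trunc k (\<phi> n x)\<bar> powr ps \<partial>M)) 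
      \<longlonglongrightarrow> (\<integral>x. \<bar>u x\<bar> powr ps - \<bar>u x - trunc k (u x)\<bar> powr ps \<partial>M)"
proof -
  have ps0: "0 < ps" using ps_gt_1 by simp
  define h where "h s = \<bar>s\<bar> powr ps - \<bar>s - trunc k s\<bar> powr ps" for s
  have hc: "continuous_on UNIV h"
    unfolding h_def by (intro continuous_intros continuous_on_powr' continuous_trunc) (use ps0 in auto)
  have hm: "h \<in> borel_measurable borel" by (rule borel_measurable_continuous_onI[OF hc])
  have \<phi>m: "\<phi> n \<in> borel_measurable M" for n using test_measurable(1)[OF \<phi>] .
  have "(\<lambda>n. (\<integral>x. h (\<phi> n x) \<partial>M)) \<longlonglongrightarrow> (\<integral>x. h (u x) \<partial>M)"
  proof (rule Vitali_convergence(4)[where w="\<lambda>n x. \<bar>\<phi> n x\<bar> powr ps"])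
    show "finite_measure M" by (rule finite_measure_axioms)
    show "(\<lambda>x. h (\<phi> n x)) \<in> borel_measurable M" for n by (rule measurable_compose[OF \<phi>m hm])
    show "(\<lambda>x. h (u x)) \<in> borel_measurable M" by (rule measurable_compose[OF u hm])
    show "AE x in M. (\<lambda>n. h (\<phi> n x)) \<longlonglongrightarrow> h (u x)"
      using ae by eventually_elim (rule continuous_on_tendsto_compose[OF hc], auto)
    show "integrable M (\<lambda>x. \<bar>\<phi> n x\<bar> powr ps)" for n by (rule test_integral_lborel(1)[OF \<phi> ps0])
    fix e :: real assume e: "0 < e"
    \<comment> \<open>From the mean value bound: \<open>ps\<close> from the derivative and
      \<open>k * (pi / 2)\<close> as the bound of \<open>trunc k\<close>.\<close>
    define c where "c = ps * (k * (pi / 2))"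
    have c: "0 < c" using k ps0 by (simp add: c_def)
    obtain K where K: "0 \<le> K" "\<And>t. 0 \<le> t \<Longrightarrow> t powr (ps - 1) \<le> (e / c) * t powr ps + K"
      using powr_absorb[of "ps - 1" ps "e / c"] ps_gt_1 e c by auto
    have "\<bar>h s\<bar> \<le> e * \<bar>s\<bar> powr ps + c * K" for s
    proof -
      have "\<bar>h s\<bar> \<le> ps * (max \<bar>s - trunc k s\<bar> \<bar>s\<bar>) powr (ps - 1) * \<bar>\<bar>s\<bar> - \<bar>s - trunc k s\<bar>\<bar>"
        unfolding h_def by (rule abs_powr_diff_le[OF ps_gt_1]) auto
      also have "max \<bar>s - trunc k s\<bar> \<bar>s\<bar> = \<bar>s\<bar>" using trunc_bounds(3)[OF k, of s] by simp
      also have "ps * \<bar>s\<bar> powr (ps - 1) * \<bar>\<bar>s\<bar> - \<bar>s - trunc k s\<bar>\<bar> \<le> ps * \<bar>s\<bar> powr (ps - 1) * (k * (pi / 2))"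
        using trunc_bounds(1)[OF k, of s] ps0 abs_triangle_ineq3[of s "s - trunc k s"] by (intro mult_left_mono) auto
      also have "\<dots> = c * \<bar>s\<bar> powr (ps - 1)" by (simp add: c_def)
      also have "\<dots> \<le> c * ((e / c) * \<bar>s\<bar> powr ps + K)" using K(2)[of "\<bar>s\<bar>"] c by (intro mult_left_mono) auto
      also have "\<dots> = e * \<bar>s\<bar> powr ps + c * K" using c by (simp add: distrib_left)
      finally show ?thesis .
    qed
    then show "\<exists>K. \<forall>n x. \<bar>h (\<phi> n x)\<bar> \<le> e * \<bar>\<phi> n x\<bar> powr ps + K" by blast
  qed (use C in auto)
  then show ?thesis by (simp add: h_def)
qed

text \<open>Replaces the concentration-compactness principle: all of the critical mass that is lost in the limit
  sits in the parts \<open>\<phi> n x - trunc k (\<phi> n x)\<close>, while the truncated parts keep almost the energy of the limit.\<close>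

lemma critical_mass_le:
  assumes \<phi>: "\<And>n. \<phi> n \<in> test_functions \<Omega>" and u: "u \<in> Lp_on \<Omega> p"
    and ae: "AE x in M. (\<lambda>n. \<phi> n x) \<longlonglongrightarrow> u x"
    and lp: "(\<lambda>n. \<integral>x. \<bar>\<phi> n x - u x\<bar> powr p \<partial>M) \<longlonglongrightarrow> 0"
    and t: "(\<lambda>n. energy (\<phi> n)) \<longlonglongrightarrow> t" and X: "(\<lambda>n. \<integral>x. \<bar>\<phi> n x\<bar> powr ps \<partial>M) \<longlonglongrightarrow> X"
    and k0: "\<And>u. u \<in> W1p_0 \<Omega> p \<Longrightarrow> (\<integral>x. \<bar>u x\<bar> powr ps \<partial>M) \<le> \<kappa> * energy u powr (ps / p)" and \<kappa>: "0 \<le> \<kappa>"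
  shows "u \<in> W1p_0 \<Omega> p" "energy u \<le> t" 
    "X \<le> (\<integral>x. \<bar>u x\<bar> powr ps \<partial>M) + \<kappa> * (t - energy u) powr (ps / p)"
proof -
  have pp: "0 < ps / p" using ps_gt_1 p_gt_1 by simp
  \<comment> \<open>The \<open>\<phi> n\<close> themselves are close to \<open>u\<close> with energy
    near \<open>t\<close>, which is what the closure lemma requires.\<close>
  have cl: "u \<in> W1p_0 \<Omega> p \<and> energy u \<le> t + e" if e: "0 < e" for e
  proof -
    have "\<exists>\<psi>\<in>test_functions \<Omega>. (\<integral>x. norm (\<psi> x - u x) powr p \<partial>M) < \<delta> \<and> energy \<psi> \<le> t + e" if \<delta>: "0 < \<delta>" for \<delta>
    proof -
      have "\<forall>\<^sub>F n in sequentially. (\<integral>x. \<bar>\<phi> n x - u x\<bar> powr p \<partial>M) < \<delta>" using order_tendstoD(2)[OF lp \<delta>] .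
      moreover have "\<forall>\<^sub>F n in sequentially. energy (\<phi> n) < t + e" using order_tendstoD(2)[OF t] e by simp
      ultimately have "\<forall>\<^sub>F n in sequentially. (\<integral>x. \<bar>\<phi> n x - u x\<bar> powr p \<partial>M) < \<delta> \<and> energy (\<phi> n) < t + e" by (rule eventually_conj)
      then obtain n where "(\<integral>x. \<bar>\<phi> n x - u x\<bar> powr p \<partial>M) < \<delta>" "energy (\<phi> n) < t + e"
        using eventually_happens trivial_limit_sequentially by blast
      then show ?thesis using \<phi> by (intro bexI[of _ "\<phi> n"]) auto
    qed
    then show ?thesis using W1p_0_closure[OF u, of "t + e"] by blast
  qed
  show uW: "u \<in> W1p_0 \<Omega> p" using cl[of 1] by simp
  show ut: "energy u \<le> t" by (rule field_le_epsilon) (rule conjunct2[OF cl])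
  have main: "X \<le> (\<integral>x. \<bar>u x\<bar> powr ps \<partial>M) + \<kappa> * (t - energy u + e) powr (ps / p)" if e: "0 < e" for e
  proof -
    \<comment> \<open>Lower semicontinuity for test functions near \<open>u\<close>: otherwise the
      closure lemma would give \<open>energy u \<le> energy u - e\<close>.\<close>
    have "\<exists>\<delta>>0. \<forall>\<psi>\<in>test_functions \<Omega>. (\<integral>x. norm (\<psi> x - u x) powr p \<partial>M) < \<delta> \<longrightarrow> energy u - e < energy \<psi>"
    proof (rule ccontr)
      assume n: "\<not> ?thesis"
      have "\<exists>\<psi>\<in>test_functions \<Omega>. (\<integral>x. norm (\<psi> x - u x) powr p \<partial>M) < \<delta> \<and> energy \<psi> \<le> energy u - e" if "0 < \<delta>" for \<delta>
        using n that by (meson not_less)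
      from W1p_0_closure(2)[OF u this] e show False by simp
    qed
    then obtain \<delta> where \<delta>: "0 < \<delta>"
      "\<And>\<psi>. \<psi> \<in> test_functions \<Omega> \<Longrightarrow> (\<integral>x. norm (\<psi> x - u x) powr p \<partial>M) < \<delta> \<Longrightarrow> energy u - e < energy \<psi>"
      by blast
    \<comment> \<open>The level is fixed from the limit \<open>u\<close> alone; the truncated
      \<open>\<phi> n\<close> then come \<open>\<delta>\<close>-close to \<open>u\<close> for large
      \<open>n\<close>, as their bounded values permit dominated convergence.\<close>
    obtain n0 where n0: "(\<integral>x. \<bar>trunc (real (Suc n0)) (u x) - u x\<bar> powr p \<partial>M) < \<delta>"
      using order_tendstoD(2)[OF trunc_Lp_tendsto[OF u] \<delta>(1)] eventually_happens trivial_limit_sequentially by blast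
    define k where "k = real (Suc n0)"
    have k: "0 < k" by (simp add: k_def)
    define c where "c = k * (pi / 2)"
    have tc: "\<bar>trunc k s\<bar> \<le> c" for s using trunc_bounds(1)[OF k] by (simp add: c_def)
    have um: "u \<in> borel_measurable M" using Lp_onD(1)[OF u] .
    have tm: "(\<lambda>x. trunc k (w x)) \<in> borel_measurable M" if "w \<in> borel_measurable M" for w :: "'a \<Rightarrow> real"
      by (rule measurable_compose[OF that borel_measurable_continuous_onI[OF continuous_trunc]])
    have "(\<lambda>n. \<integral>x. \<bar>trunc k (\<phi> n x) - u x\<bar> powr p \<partial>M) \<longlonglongrightarrow> (\<integral>x. \<bar>trunc k (u x) - u x\<bar> powr p \<partial>M)"
    proof (rule integral_dominated_convergence[where w="\<lambda>x. 2 powr p * (c powr p + \<bar>u x\<bar> powr p)"])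
      show "(\<lambda>x. \<bar>trunc k (u x) - u x\<bar> powr p) \<in> borel_measurable M" using tm[OF um] um by measurable
      show "(\<lambda>x. \<bar>trunc k (\<phi> n x) - u x\<bar> powr p) \<in> borel_measurable M" for n
        using tm[OF test_measurable(1)[OF \<phi>[of n]]] um by measurable
      show "integrable M (\<lambda>x. 2 powr p * (c powr p + \<bar>u x\<bar> powr p))" using Lp_onD(2)[OF u] by simp
      show "AE x in M. (\<lambda>n. \<bar>trunc k (\<phi> n x) - u x\<bar> powr p) \<longlonglongrightarrow> \<bar>trunc k (u x) - u x\<bar> powr p"
        using ae
      proof eventually_elim
        case (elim x)
        have "(\<lambda>n. trunc k (\<phi> n x)) \<longlonglongrightarrow> trunc k (u x)"
          by (rule continuous_on_tendsto_compose[OF continuous_trunc[of UNIV] elim]) auto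
        then show ?case using p_gt_1 by (intro tendsto_powr' tendsto_intros) auto
      qed
      show "AE x in M. norm (\<bar>trunc k (\<phi> n x) - u x\<bar> powr p) \<le> 2 powr p * (c powr p + \<bar>u x\<bar> powr p)" for n
      proof (intro AE_I2)
        fix x
        have "\<bar>trunc k (\<phi> n x) - u x\<bar> powr p \<le> (c + \<bar>u x\<bar>) powr p"
          using tc[of "\<phi> n x"] p_gt_1 by (intro powr_mono2) auto
        also have "\<dots> \<le> 2 powr p * (c powr p + \<bar>u x\<bar> powr p)"
          using p_gt_1 k by (intro powr_add_le) (auto simp: c_def)
        finally show "norm (\<bar>trunc k (\<phi> n x) - u x\<bar> powr p) \<le> 2 powr p * (c powr p + \<bar>u x\<bar> powr p)" by simp
      qed
    qed
    then have ev: "\<forall>\<^sub>F n in sequentially. (\<integral>x. \<bar>trunc k (\<phi> n x) - u x\<bar> powr p \<partial>M) < \<delta>"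
      using n0 unfolding k_def by (rule order_tendstoD(2))
    obtain C where C: "\<And>n. (\<integral>x. \<bar>\<phi> n x\<bar> powr ps \<partial>M) \<le> C"
    proof -
      obtain C where C: "\<And>n. norm (\<integral>x. \<bar>\<phi> n x\<bar> powr ps \<partial>M) \<le> C"
        using convergent_imp_Bseq[OF convergentI[OF X]] by (auto simp: Bseq_def)
      have "(\<integral>x. \<bar>\<phi> n x\<bar> powr ps \<partial>M) \<le> C" for n
        using C[of n] unfolding real_norm_def by (rule abs_le_D1)
      then show ?thesis by (rule that)
    qed
    let ?h = "\<lambda>n. (\<integral>x. \<bar>\<phi> n x\<bar> powr ps - \<bar>\<phi> n x - trunc k (\<phi> n x)\<bar> powr ps \<partial>M)"
    \<comment> \<open>The truncated part has energy above \<open>energy u - e\<close>, so by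
      \<open>energy_trunc_le\<close> the remainder has at most
      \<open>energy (\<phi> n) - energy u + e\<close>; \<open>k0\<close> converts this into a bound
      on its critical mass.\<close>
    have le: "\<forall>\<^sub>F n in sequentially. (\<integral>x. \<bar>\<phi> n x\<bar> powr ps \<partial>M) \<le> ?h n + \<kappa> * (energy (\<phi> n) - energy u + e) powr (ps / p)"
      using ev
    proof eventually_elim
      case (elim n)
      note tt = trunc_test(1)[OF \<phi>[of n] k]
      note gg = test_functions_diff[OF \<phi>[of n] tt]
      have "energy u - e < energy (\<lambda>x. trunc k (\<phi> n x))" using elim by (intro \<delta>(2) tt) simp
      then have en: "energy (\<lambda>x. \<phi> n x - trunc k (\<phi> n x)) \<le> energy (\<phi> n) - energy u + e"
        using energy_trunc_le[OF \<phi>[of n] k] by simp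
      have "(\<integral>x. \<bar>\<phi> n x - trunc k (\<phi> n x)\<bar> powr ps \<partial>M) \<le> \<kappa> * energy (\<lambda>x. \<phi> n x - trunc k (\<phi> n x)) powr (ps / p)"
        by (rule k0[OF test_W1p_0[OF gg]])
      also have "\<dots> \<le> \<kappa> * (energy (\<phi> n) - energy u + e) powr (ps / p)"
        using en \<kappa> pp by (intro mult_left_mono powr_mono2) auto
      finally have "(\<integral>x. \<bar>\<phi> n x - trunc k (\<phi> n x)\<bar> powr ps \<partial>M) \<le> \<kappa> * (energy (\<phi> n) - energy u + e) powr (ps / p)" .
      moreover have "?h n = (\<integral>x. \<bar>\<phi> n x\<bar> powr ps \<partial>M) - (\<integral>x. \<bar>\<phi> n x - trunc k (\<phi> n x)\<bar> powr ps \<partial>M)"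
        using test_integral_lborel(1)[OF \<phi>[of n], of ps] test_integral_lborel(1)[OF gg, of ps] ps_gt_1
        by (intro Bochner_Integration.integral_diff) auto
      ultimately show ?case by simp
    qed
    have "(\<lambda>n. ?h n + \<kappa> * (energy (\<phi> n) - energy u + e) powr (ps / p))
      \<longlonglongrightarrow> (\<integral>x. \<bar>u x\<bar> powr ps - \<bar>u x - trunc k (u x)\<bar> powr ps \<partial>M) + \<kappa> * (t - energy u + e) powr (ps / p)"
      using ut e by (intro tendsto_add critical_term_truncated_limit[OF \<phi> um ae C k] tendsto_mult tendsto_const tendsto_powr' tendsto_intros t) auto
    from tendsto_le[OF trivial_limit_sequentially this X le]
    have "X \<le> (\<integral>x. \<bar>u x\<bar> powr ps - \<bar>u x - trunc k (u x)\<bar> powr ps \<partial>M) + \<kappa> * (t - energy u + e) powr (ps / p)" .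
    also have "(\<integral>x. \<bar>u x\<bar> powr ps - \<bar>u x - trunc k (u x)\<bar> powr ps \<partial>M) \<le> (\<integral>x. \<bar>u x\<bar> powr ps \<partial>M)"
      using W1p_0_integrable_ps[OF uW] by (intro integral_mono') auto
    finally show ?thesis by simp
  qed
  have "(\<lambda>n. (\<integral>x. \<bar>u x\<bar> powr ps \<partial>M) + \<kappa> * (t - energy u + inverse (real (Suc n))) powr (ps / p))
    \<longlonglongrightarrow> (\<integral>x. \<bar>u x\<bar> powr ps \<partial>M) + \<kappa> * (t - energy u + 0) powr (ps / p)"
    using ut pp by (intro tendsto_add tendsto_mult tendsto_const tendsto_powr' LIMSEQ_inverse_real_of_nat) auto
  then show "X \<le> (\<integral>x. \<bar>u x\<bar> powr ps \<partial>M) + \<kappa> * (t - energy u) powr (ps / p)"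
    using main by (intro LIMSEQ_le_const[of _ "(\<integral>x. \<bar>u x\<bar> powr ps \<partial>M) + \<kappa> * (t - energy u) powr (ps / p)" X]) auto
qed

end

subsection \<open>The energy functional\<close>

text \<open>Continuity and growth are required at every point; the general case is brought to this
  form by changing \<open>f\<close> on a null set.\<close>

locale caratheodory_nonlinearity = bounded_open_domain \<Omega> p ps
  for \<Omega> :: "'a::euclidean_space set" and p ps :: real +
  fixes f :: "'a \<Rightarrow> real \<Rightarrow> real" and a1 a2 q b \<gamma> :: real
  assumes f_measurable: "\<And>t. (\<lambda>x. f x t) \<in> borel_measurable M"
    and f_continuous: "\<And>x. continuous_on UNIV (f x)"
    and f_bound: "\<And>x t. \<bar>f x t\<bar> \<le> a1 * \<bar>t\<bar> powr (q - 1) + a2"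
    and a_pos: "0 < a1" "0 < a2" and q: "1 < q" "q < ps" and b_pos: "0 < b" and \<gamma>_gt_1: "1 < \<gamma>"
begin

section \<open>The nonlinearity and its primitive\<close>

text \<open>Rounding the second argument down to a multiple of \<open>1 / real (Suc n)\<close>
  leaves countably many values, for which measurability in \<open>x\<close> is enough; continuity of
  \<open>f x\<close> gives convergence to \<open>f\<close>.\<close>

lemma f_joint_measurable: "(\<lambda>z. f (fst z) (snd z)) \<in> borel_measurable (M \<Otimes>\<^sub>M borel)"
proof (rule borel_measurable_LIMSEQ_real)
  fix z :: "'a \<times> real"
  have "(\<lambda>n. real_of_int \<lfloor>real (Suc n) * snd z\<rfloor> / real (Suc n)) \<longlonglongrightarrow> snd z"
  proof (rule LIMSEQ_I)
    fix r :: real assume "0 < r"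
    then obtain N where N: "inverse (real (Suc N)) < r" using reals_Archimedean by blast
    have "\<bar>real_of_int \<lfloor>real (Suc n) * snd z\<rfloor> / real (Suc n) - snd z\<bar> < r" if n: "N \<le> n" for n
    proof -
      have "\<bar>real_of_int \<lfloor>real (Suc n) * snd z\<rfloor> - real (Suc n) * snd z\<bar> \<le> 1" by linarith
      then have "\<bar>(real_of_int \<lfloor>real (Suc n) * snd z\<rfloor> - real (Suc n) * snd z) / real (Suc n)\<bar> \<le> 1 / real (Suc n)"
        by (simp add: abs_divide divide_right_mono del: of_nat_Suc)
      moreover have "(real_of_int \<lfloor>real (Suc n) * snd z\<rfloor> - real (Suc n) * snd z) / real (Suc n) = real_of_int \<lfloor>real (Suc n) * snd z\<rfloor> / real (Suc n) - snd z"
        by (simp add: diff_divide_distrib del: of_nat_Suc)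
      moreover have "1 / real (Suc n) \<le> inverse (real (Suc N))" using n by (simp add: inverse_eq_divide frac_le)
      ultimately show ?thesis using N by (simp only:)
    qed
    then show "\<exists>N. \<forall>n\<ge>N. norm (real_of_int \<lfloor>real (Suc n) * snd z\<rfloor> / real (Suc n) - snd z) < r" unfolding real_norm_def by blast
  qed
  then show "(\<lambda>n. f (fst z) (real_of_int \<lfloor>real (Suc n) * snd z\<rfloor> / real (Suc n))) \<longlonglongrightarrow> f (fst z) (snd z)"
    by (rule continuous_on_tendsto_compose[OF f_continuous]) auto
next
  fix n
  have "(\<lambda>z. f (fst z) (real_of_int i / real (Suc n))) \<in> borel_measurable (M \<Otimes>\<^sub>M borel)" for i :: int
    by (rule measurable_compose[OF measurable_fst f_measurable])
  moreover have "(\<lambda>z. \<lfloor>real (Suc n) * snd z\<rfloor>) \<in> measurable (M \<Otimes>\<^sub>M (borel :: real measure)) (count_space UNIV)"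
    by measurable
  ultimately show "(\<lambda>z. f (fst z) (real_of_int \<lfloor>real (Suc n) * snd z\<rfloor> / real (Suc n))) \<in> borel_measurable (M \<Otimes>\<^sub>M borel)"
    by (rule measurable_compose_countable)
qed

lemma f_compose_measurable:
  assumes "u \<in> borel_measurable M"
  shows "(\<lambda>x. f x (u x)) \<in> borel_measurable M"
  using measurable_compose[OF measurable_Pair[OF measurable_ident_sets[OF refl] assms] f_joint_measurable] by simp

text \<open>The primitive of \<open>f x\<close>, rescaled to a fixed interval so that oriented integrals are avoided for \<open>t < 0\<close>.\<close>

definition F :: "'a \<Rightarrow> real \<Rightarrow> real" where
  "F x t = (\<integral>\<tau>. (t * f x (t * \<tau>)) * indicator {0..1} \<tau> \<partial>lborel)"

text \<open>If \<open>G\<close> is an antiderivative of \<open>f x\<close>, then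
  \<open>G (t * \<tau>)\<close> has the derivative \<open>t * f x (t * \<tau>)\<close> in
  \<open>\<tau>\<close>, so \<open>F x t = G t - G 0\<close>.\<close>

lemma F_has_derivative: "(F x has_real_derivative f x t) (at t)"
proof -
  have "\<exists>G. \<forall>t. (G has_real_derivative f x t) (at t)"
    using einterval_antiderivative[of "-\<infinity>" "\<infinity>" "f x"] f_continuous[of x]
    by (auto simp: has_real_derivative_iff_has_vector_derivative continuous_on_eq_continuous_at)
  then obtain G where G: "\<And>t. (G has_real_derivative f x t) (at t)" by blast
  have "F x t = G t - G 0" for t
  proof -
    have d: "((\<lambda>\<tau>. G (t * \<tau>)) has_real_derivative t * f x (t * \<tau>)) (at \<tau>)" for \<tau>
    proof -
      have "((\<lambda>\<tau>. t * \<tau>) has_real_derivative t) (at \<tau>)" by (auto intro!: derivative_eq_intros)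
      from DERIV_chain'[OF this G] show ?thesis by (simp add: mult.commute)
    qed
    have "isCont (\<lambda>\<tau>. t * f x (t * \<tau>)) \<tau>" for \<tau>
    proof -
      have "continuous_on UNIV (\<lambda>\<tau>. t * f x (t * \<tau>))"
        by (intro continuous_intros continuous_on_compose2[OF f_continuous]) auto
      then show ?thesis by (simp add: continuous_on_eq_continuous_at)
    qed
    then have "(\<integral>\<tau>. (t * f x (t * \<tau>)) * indicator {0..1} \<tau> \<partial>lborel) = G (t * 1) - G (t * 0)"
      using d by (intro integral_FTC_Icc_real) auto
    then show ?thesis by (simp add: F_def)
  qed
  then have "F x = (\<lambda>t. G t - G 0)" by auto
  then show ?thesis using DERIV_diff[OF G DERIV_const] by simp
qed

lemma F_continuous: "continuous_on UNIV (F x)"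
  using F_has_derivative DERIV_isCont continuous_at_imp_continuous_on by blast

lemma F_compose_measurable:
  assumes u: "u \<in> borel_measurable M"
  shows "(\<lambda>x. F x (u x)) \<in> borel_measurable M"
  unfolding F_def
proof (rule lborel.borel_measurable_lebesgue_integral)
  have 1: "(\<lambda>z. u (fst z)) \<in> borel_measurable (M \<Otimes>\<^sub>M (lborel :: real measure))"
    by (rule measurable_compose[OF measurable_fst u])
  have sn: "snd \<in> borel_measurable (M \<Otimes>\<^sub>M (lborel :: real measure))"
    using measurable_snd[of M "lborel :: real measure"] by simp
  have ind: "(\<lambda>z. indicator {0..1::real} (snd z) :: real) \<in> borel_measurable (M \<Otimes>\<^sub>M (lborel :: real measure))"
    by (rule measurable_compose[OF sn borel_measurable_indicator]) simp
  have "(\<lambda>z. u (fst z) * snd z) \<in> borel_measurable (M \<Otimes>\<^sub>M (lborel :: real measure))"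
    by (intro borel_measurable_times 1 sn)
  from measurable_compose[OF measurable_Pair[OF measurable_fst this] f_joint_measurable]
  have "(\<lambda>z. f (fst z) (u (fst z) * snd z)) \<in> borel_measurable (M \<Otimes>\<^sub>M (lborel :: real measure))" by simp
  with 1 have "(\<lambda>z. (u (fst z) * f (fst z) (u (fst z) * snd z)) * indicator {0..1} (snd z)) \<in> borel_measurable (M \<Otimes>\<^sub>M (lborel :: real measure))"
    by (intro borel_measurable_times ind)
  then show "(\<lambda>(x, \<tau>). (u x * f x (u x * \<tau>)) * indicator {0..1} \<tau>) \<in> borel_measurable (M \<Otimes>\<^sub>M lborel)"
    by (simp add: split_beta')
qed

lemma F_0 [simp]: "F x 0 = 0"
  by (simp add: F_def)

lemma F_increment_le:
  assumes "\<bar>s\<bar> \<le> w" "\<bar>t\<bar> \<le> w"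
  shows "\<bar>F x s - F x t\<bar> \<le> \<bar>s - t\<bar> * (a1 * w powr (q - 1) + a2)"
proof -
  have *: "\<bar>F x s - F x t\<bar> \<le> \<bar>s - t\<bar> * (a1 * w powr (q - 1) + a2)" if ts: "t < s" "\<bar>s\<bar> \<le> w" "\<bar>t\<bar> \<le> w" for s t
  proof -
    obtain z where z: "t < z" "z < s" "F x s - F x t = (s - t) * f x z"
      using MVT2[OF ts(1), of "F x" "f x"] F_has_derivative by blast
    have "\<bar>z\<bar> \<le> w" using z ts by linarith
    then have "a1 * \<bar>z\<bar> powr (q - 1) \<le> a1 * w powr (q - 1)" using a_pos q by (intro mult_left_mono powr_mono2) auto
    then have "\<bar>f x z\<bar> \<le> a1 * w powr (q - 1) + a2" using f_bound[of x z] by linarith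
    then show ?thesis unfolding z(3) abs_mult by (intro mult_left_mono) auto
  qed
  consider "t < s" | "s < t" | "s = t" by linarith
  then show ?thesis
    by cases (use *[of t s] *[of s t] assms in \<open>auto simp: abs_minus_commute\<close>)
qed

lemma powr_q_mult:
  assumes "0 \<le> t" shows "t * (a1 * t powr (q - 1) + a2) = a1 * t powr q + a2 * t"
  using assms by (cases "t = 0") (auto simp: powr_diff distrib_left)

lemma growth_absorb:
  assumes "q < r" "0 < e"
  shows "\<exists>K\<ge>0. \<forall>t\<ge>0. a1 * t powr q + a2 * t \<le> e * t powr r + K"
proof -
  obtain C1 where C1: "0 \<le> C1" "\<And>t. 0 \<le> t \<Longrightarrow> t powr q \<le> (e / (2 * a1)) * t powr r + C1"
    using powr_absorb[of q r "e / (2 * a1)"] assms a_pos q by auto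
  obtain C2 where C2: "0 \<le> C2" "\<And>t. 0 \<le> t \<Longrightarrow> t powr 1 \<le> (e / (2 * a2)) * t powr r + C2"
    using powr_absorb[of 1 r "e / (2 * a2)"] assms a_pos q by auto
  have "a1 * t powr q + a2 * t \<le> e * t powr r + (a1 * C1 + a2 * C2)" if t: "0 \<le> t" for t
  proof -
    have "a1 * t powr q \<le> a1 * ((e / (2 * a1)) * t powr r + C1)" using C1(2)[OF t] a_pos by (intro mult_left_mono) auto
    moreover have "a2 * t \<le> a2 * ((e / (2 * a2)) * t powr r + C2)" using C2(2)[OF t] a_pos t by (intro mult_left_mono) auto
    moreover have "a1 * ((e / (2 * a1)) * t powr r + C1) = e / 2 * t powr r + a1 * C1"
      "a2 * ((e / (2 * a2)) * t powr r + C2) = e / 2 * t powr r + a2 * C2" using a_pos by (auto simp: distrib_left)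
    ultimately show ?thesis by linarith
  qed
  moreover have "0 \<le> a1 * C1 + a2 * C2" using C1 C2 a_pos by simp
  ultimately show ?thesis by blast
qed

lemma F_growth:
  assumes "q < r" "0 < e"
  shows "\<exists>K\<ge>0. \<forall>x t. \<bar>F x t\<bar> \<le> e * \<bar>t\<bar> powr r + K"
proof -
  obtain K where K: "0 \<le> K" "\<And>t. 0 \<le> t \<Longrightarrow> a1 * t powr q + a2 * t \<le> e * t powr r + K"
    using growth_absorb[OF assms] by blast
  have "\<bar>F x t\<bar> \<le> e * \<bar>t\<bar> powr r + K" for x t
    using F_increment_le[of t "\<bar>t\<bar>" 0 x] powr_q_mult[of "\<bar>t\<bar>"] K(2)[of "\<bar>t\<bar>"] by simp
  then show ?thesis using K(1) by blast
qed

lemma integrable_growth: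
  assumes w: "w \<in> borel_measurable M" "integrable M (\<lambda>x. \<bar>w x\<bar> powr ps)"
  shows "integrable M (\<lambda>x. a1 * \<bar>w x\<bar> powr q + a2 * \<bar>w x\<bar>)"
  using integrable_powr_absorb[OF w, of q] integrable_powr_absorb[OF w, of 1] q ps_gt_1 by simp

lemma F_integrable:
  assumes w: "w \<in> borel_measurable M" "integrable M (\<lambda>x. \<bar>w x\<bar> powr ps)"
  shows "integrable M (\<lambda>x. F x (w x))"
proof (rule Bochner_Integration.integrable_bound[OF integrable_growth[OF w]])
  show "AE x in M. norm (F x (w x)) \<le> norm (a1 * \<bar>w x\<bar> powr q + a2 * \<bar>w x\<bar>)"
  proof (intro AE_I2)
    fix x
    show "norm (F x (w x)) \<le> norm (a1 * \<bar>w x\<bar> powr q + a2 * \<bar>w x\<bar>)"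
      using F_increment_le[of "w x" "\<bar>w x\<bar>" 0 x] powr_q_mult[of "\<bar>w x\<bar>"] by simp
  qed
qed (rule F_compose_measurable[OF w(1)])

text \<open>Subcritical growth, \<open>q < ps\<close>, makes \<open>F\<close> negligible against the
  bounded critical masses, so a.e. convergence is enough.\<close>

lemma F_integral_tendsto:
  assumes w: "\<And>n. w n \<in> borel_measurable M" "\<And>n. integrable M (\<lambda>x. \<bar>w n x\<bar> powr ps)"
    and C: "\<And>n. (\<integral>x. \<bar>w n x\<bar> powr ps \<partial>M) \<le> C"
    and u: "u \<in> borel_measurable M" and ae: "AE x in M. (\<lambda>n. w n x) \<longlonglongrightarrow> u x"
  shows "(\<lambda>n. \<integral>x. F x (w n x) \<partial>M) \<longlonglongrightarrow> (\<integral>x. F x (u x) \<partial>M)"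
proof (rule Vitali_convergence(4)[where w="\<lambda>n x. \<bar>w n x\<bar> powr ps"])
  show "finite_measure M" by (rule finite_measure_axioms)
  show "AE x in M. (\<lambda>n. F x (w n x)) \<longlonglongrightarrow> F x (u x)"
    using ae by eventually_elim (rule continuous_on_tendsto_compose[OF F_continuous], auto)
  show "\<exists>K. \<forall>n x. \<bar>F x (w n x)\<bar> \<le> e * \<bar>w n x\<bar> powr ps + K" if "0 < e" for e
    using F_growth[OF q(2) that] by blast
qed (use w C u F_compose_measurable in auto)

section \<open>The functional, its derivative and its minimum\<close>

definition \<Phi> :: "('a \<Rightarrow> real) \<Rightarrow> real" where
  "\<Phi> u = energy u / p + b / (p * \<gamma>) * energy u powr \<gamma> - (\<integral>x. F x (u x) \<partial>M) - (\<integral>x. \<bar>u x\<bar> powr ps \<partial>M) / ps"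

text \<open>\<open>\<Phi>\<close> is continuous along a subsequence of an approximating sequence, so
  a lower bound on test functions holds on all of \<open>W1p_0\<close>.\<close>

lemma \<Phi>_approx:
  assumes u: "u \<in> W1p_0 \<Omega> p" and I: "\<And>\<phi>. \<phi> \<in> test_functions \<Omega> \<Longrightarrow> I \<le> \<Phi> \<phi>"
  shows "I \<le> \<Phi> u"
proof -
  obtain \<psi> where \<psi>: "W0_approx u (weak_grad \<Omega> u) \<psi>" using W1p_0_approx[OF u] by blast
  note D = W0_approxD[OF \<psi>]
  obtain r :: "nat \<Rightarrow> nat" where r: "strict_mono r" "AE x in M. (\<lambda>n. \<psi> (r n) x) \<longlonglongrightarrow> u x" using approx_AE_subseq[OF \<psi>] by blast
  have ps0: "0 < ps" using ps_gt_1 by simp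
  have e: "(\<lambda>n. energy (\<psi> (r n))) \<longlonglongrightarrow> energy u"
    using LIMSEQ_subseq_LIMSEQ[OF energy_approx[OF \<psi>] r(1)] by (simp add: comp_def)
  have X: "(\<lambda>n. \<integral>x. \<bar>\<psi> (r n) x\<bar> powr ps \<partial>M) \<longlonglongrightarrow> (\<integral>x. \<bar>u x\<bar> powr ps \<partial>M)"
    using LIMSEQ_subseq_LIMSEQ[OF approx_ps(2)[OF \<psi>] r(1)] by (simp add: comp_def)
  obtain C where C: "\<And>n. norm (\<integral>x. \<bar>\<psi> (r n) x\<bar> powr ps \<partial>M) \<le> C"
    using convergent_imp_Bseq[OF convergentI[OF X]] by (auto simp: Bseq_def)
  have C': "(\<integral>x. \<bar>\<psi> (r n) x\<bar> powr ps \<partial>M) \<le> C" for n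
    using C[of n] unfolding real_norm_def by (rule abs_le_D1)
  have "(\<lambda>n. \<integral>x. F x (\<psi> (r n) x) \<partial>M) \<longlonglongrightarrow> (\<integral>x. F x (u x) \<partial>M)"
    by (rule F_integral_tendsto[OF test_measurable(1)[OF D(3)] test_integral_lborel(1)[OF D(3) ps0] C' Lp_onD(1)[OF D(1)] r(2)])
  then have "(\<lambda>n. \<Phi> (\<psi> (r n))) \<longlonglongrightarrow> \<Phi> u"
    unfolding \<Phi>_def using \<gamma>_gt_1 p_gt_1 ps0
    by (intro tendsto_diff tendsto_add tendsto_divide tendsto_mult tendsto_const e X tendsto_powr') auto
  then show ?thesis by (rule LIMSEQ_le_const) (use I[OF D(3)] in auto)
qed

text \<open>The function of \<open>s\<close> given by \<open>\<Phi>\<close> at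
  \<open>u + s * v\<close> has a minimum at \<open>0\<close>; its derivative there, computed term by
  term under the integrals, is the difference of the two sides.\<close>

lemma euler_lagrange:
  assumes u: "u \<in> W1p_0 \<Omega> p" and min: "\<And>w. w \<in> W1p_0 \<Omega> p \<Longrightarrow> \<Phi> u \<le> \<Phi> w" and v: "v \<in> W1p_0 \<Omega> p"
  shows "(1 + b * energy u powr (\<gamma> - 1)) * (\<integral>x. norm (weak_grad \<Omega> u x) powr (p - 2) * (weak_grad \<Omega> u x \<bullet> weak_grad \<Omega> v x) \<partial>M)
    = (\<integral>x. f x (u x) * v x \<partial>M) + (\<integral>x. \<bar>u x\<bar> powr (ps - 2) * u x * v x \<partial>M)"
proof -
  let ?g = "weak_grad \<Omega> u" and ?h = "weak_grad \<Omega> v"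
  note um [measurable] = Lp_onD(1)[OF W1p_0_Lp(1)[OF u]] and vm [measurable] = Lp_onD(1)[OF W1p_0_Lp(1)[OF v]]
  note gm [measurable] = Lp_onD(1)[OF W1p_0_Lp(2)[OF u]] and hm [measurable] = Lp_onD(1)[OF W1p_0_Lp(2)[OF v]]
  have W: "(\<lambda>x. u x + s * v x) \<in> W1p_0 \<Omega> p" for s by (rule W1p_0_add_scale(1)[OF u v])
  define A where "A s = (\<integral>x. norm (?g x + s *\<^sub>R ?h x) powr p \<partial>M)" for s
  define B where "B s = (\<integral>x. F x (u x + s * v x) \<partial>M)" for s
  define X where "X s = (\<integral>x. norm (u x + s *\<^sub>R v x) powr ps \<partial>M)" for s
  define A' where "A' = (\<integral>x. p * norm (?g x) powr (p - 2) * (?g x \<bullet> ?h x) \<partial>M)"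
  define B' where "B' = (\<integral>x. f x (u x) * v x \<partial>M)"
  define X' where "X' = (\<integral>x. ps * norm (u x) powr (ps - 2) * (u x \<bullet> v x) \<partial>M)"
  have pow: "\<bar>t\<bar> powr (r - 1) * \<bar>t\<bar> = \<bar>t\<bar> powr r" for t r :: real
    by (cases "t = 0") (auto simp: powr_diff)
  have dom: "r * (norm y + norm z) powr (r - 1) * norm z \<le> r * norm (norm y + norm z) powr r"
    if "1 < r" for r and y z :: "'c::real_normed_vector"
  proof -
    have "(norm y + norm z) powr (r - 1) * norm z \<le> (norm y + norm z) powr (r - 1) * (norm y + norm z)"
      by (intro mult_left_mono) auto
    also have "\<dots> = norm (norm y + norm z) powr r" using pow[of "norm y + norm z" r] by simp
    finally show ?thesis using that by (simp add: mult.assoc mult_left_mono)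
  qed
  have dA: "(A has_real_derivative A') (at 0)"
    unfolding A_def[abs_def] A'_def
  proof (rule has_real_derivative_integral(2)[where W="\<lambda>x. p * norm (norm (?g x) + norm (?h x)) powr p"])
    show "integrable M (\<lambda>x. norm (?g x + s *\<^sub>R ?h x) powr p)" for s
      using Lp_onD(2)[OF Lp_add[OF W1p_0_Lp(2)[OF u] Lp_scaleR[OF W1p_0_Lp(2)[OF v]]]] .
    have "integrable M (\<lambda>x. norm (norm (?g x) + norm (?h x)) powr p)"
      using Lp_onD(2)[OF W1p_0_Lp(2)[OF u]] Lp_onD(2)[OF W1p_0_Lp(2)[OF v]] p_gt_1
      by (intro integrable_norm_powr_add) auto
    then show "integrable M (\<lambda>x. p * norm (norm (?g x) + norm (?h x)) powr p)" by simp
    show "AE x in M. ((\<lambda>s. norm (?g x + s *\<^sub>R ?h x) powr p) has_real_derivative p * norm (?g x) powr (p - 2) * (?g x \<bullet> ?h x)) (at 0)"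
      by (intro AE_I2 has_real_derivative_norm_powr p_gt_1)
    show "AE x in M. \<forall>s. \<bar>s\<bar> \<le> 1 \<longrightarrow> \<bar>norm (?g x + s *\<^sub>R ?h x) powr p - norm (?g x + 0 *\<^sub>R ?h x) powr p\<bar> \<le> \<bar>s\<bar> * (p * norm (norm (?g x) + norm (?h x)) powr p)"
    proof (intro AE_I2 allI impI)
      fix x and s :: real assume "\<bar>s\<bar> \<le> 1"
      from norm_powr_increment_le[OF p_gt_1 this, of "?g x" "?h x"] mult_left_mono[OF dom[OF p_gt_1, of "?g x" "?h x"], of "\<bar>s\<bar>"]
      show "\<bar>norm (?g x + s *\<^sub>R ?h x) powr p - norm (?g x + 0 *\<^sub>R ?h x) powr p\<bar> \<le> \<bar>s\<bar> * (p * norm (norm (?g x) + norm (?h x)) powr p)"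
        by simp
    qed
  qed measurable
  note ui = W1p_0_integrable_ps[OF u] and vi = W1p_0_integrable_ps[OF v]
  have wi: "integrable M (\<lambda>x. norm (norm (u x) + norm (v x)) powr ps)"
    using ui vi ps_gt_1 by (intro integrable_norm_powr_add) auto
  have dX: "(X has_real_derivative X') (at 0)"
    unfolding X_def[abs_def] X'_def
  proof (rule has_real_derivative_integral(2)[where W="\<lambda>x. ps * norm (norm (u x) + norm (v x)) powr ps"])
    show "integrable M (\<lambda>x. norm (u x + s *\<^sub>R v x) powr ps)" for s
      using W1p_0_integrable_ps[OF W[of s]] by simp
    show "integrable M (\<lambda>x. ps * norm (norm (u x) + norm (v x)) powr ps)" using wi by simp
    show "AE x in M. ((\<lambda>s. norm (u x + s *\<^sub>R v x) powr ps) has_real_derivative ps * norm (u x) powr (ps - 2) * (u x \<bullet> v x)) (at 0)"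
      by (intro AE_I2 has_real_derivative_norm_powr ps_gt_1)
    show "AE x in M. \<forall>s. \<bar>s\<bar> \<le> 1 \<longrightarrow> \<bar>norm (u x + s *\<^sub>R v x) powr ps - norm (u x + 0 *\<^sub>R v x) powr ps\<bar> \<le> \<bar>s\<bar> * (ps * norm (norm (u x) + norm (v x)) powr ps)"
    proof (intro AE_I2 allI impI)
      fix x and s :: real assume "\<bar>s\<bar> \<le> 1"
      from norm_powr_increment_le[OF ps_gt_1 this, of "u x" "v x"] mult_left_mono[OF dom[OF ps_gt_1, of "u x" "v x"], of "\<bar>s\<bar>"]
      show "\<bar>norm (u x + s *\<^sub>R v x) powr ps - norm (u x + 0 *\<^sub>R v x) powr ps\<bar> \<le> \<bar>s\<bar> * (ps * norm (norm (u x) + norm (v x)) powr ps)"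
        by simp
    qed
  qed measurable
  have dB: "(B has_real_derivative B') (at 0)"
    unfolding B_def[abs_def] B'_def
  proof (rule has_real_derivative_integral(2)[where W="\<lambda>x. a1 * \<bar>\<bar>u x\<bar> + \<bar>v x\<bar>\<bar> powr q + a2 * \<bar>\<bar>u x\<bar> + \<bar>v x\<bar>\<bar>"])
    show "integrable M (\<lambda>x. F x (u x + s * v x))" for s
      by (intro F_integrable W1p_0_integrable_ps W) measurable
    show "integrable M (\<lambda>x. a1 * \<bar>\<bar>u x\<bar> + \<bar>v x\<bar>\<bar> powr q + a2 * \<bar>\<bar>u x\<bar> + \<bar>v x\<bar>\<bar>)"
      using wi by (intro integrable_growth) auto
    show "(\<lambda>x. f x (u x) * v x) \<in> borel_measurable M"
      using f_compose_measurable[OF um] vm by (rule borel_measurable_times)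
    show "AE x in M. ((\<lambda>s. F x (u x + s * v x)) has_real_derivative f x (u x) * v x) (at 0)"
    proof (intro AE_I2)
      fix x
      have "((\<lambda>s. u x + s * v x) has_real_derivative v x) (at 0)" by (auto intro!: derivative_eq_intros)
      from DERIV_chain'[OF this F_has_derivative]
      show "((\<lambda>s. F x (u x + s * v x)) has_real_derivative f x (u x) * v x) (at 0)" by simp
    qed
    show "AE x in M. \<forall>s. \<bar>s\<bar> \<le> 1 \<longrightarrow> \<bar>F x (u x + s * v x) - F x (u x + 0 * v x)\<bar> \<le> \<bar>s\<bar> * (a1 * \<bar>\<bar>u x\<bar> + \<bar>v x\<bar>\<bar> powr q + a2 * \<bar>\<bar>u x\<bar> + \<bar>v x\<bar>\<bar>)"
    proof (intro AE_I2 allI impI)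
      fix x and s :: real assume s: "\<bar>s\<bar> \<le> 1"
      let ?w = "\<bar>u x\<bar> + \<bar>v x\<bar>"
      have sv: "\<bar>s * v x\<bar> \<le> \<bar>v x\<bar>" using s by (simp add: abs_mult mult_left_le_one_le)
      have "\<bar>F x (u x + s * v x) - F x (u x)\<bar> \<le> \<bar>(u x + s * v x) - u x\<bar> * (a1 * ?w powr (q - 1) + a2)"
        using sv by (intro F_increment_le) auto
      also have "\<dots> = \<bar>s\<bar> * (\<bar>v x\<bar> * (a1 * ?w powr (q - 1) + a2))" by (simp add: abs_mult)
      also have "\<dots> \<le> \<bar>s\<bar> * (?w * (a1 * ?w powr (q - 1) + a2))"
        using a_pos by (intro mult_left_mono mult_right_mono) auto
      also have "?w * (a1 * ?w powr (q - 1) + a2) = a1 * \<bar>?w\<bar> powr q + a2 * \<bar>?w\<bar>" using powr_q_mult[of ?w] by simp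
      finally show "\<bar>F x (u x + s * v x) - F x (u x + 0 * v x)\<bar> \<le> \<bar>s\<bar> * (a1 * \<bar>?w\<bar> powr q + a2 * \<bar>?w\<bar>)" by simp
    qed
  qed
  have A0: "0 \<le> A s" for s by (simp add: A_def)
  have Aeq: "energy (\<lambda>x. u x + s * v x) = A s" for s unfolding A_def by (rule W1p_0_add_scale(2)[OF u v])
  have A_0: "A 0 = energy u" using Aeq[of 0] by simp
  \<comment> \<open>The energy is written with an absolute value so that the derivative of its power
    \<open>\<gamma>\<close> is available also when \<open>A 0 = 0\<close>.\<close>
  define D where "D = A' / p + b / (p * \<gamma>) * (\<gamma> * \<bar>A 0\<bar> powr (\<gamma> - 2) * A 0 * A') - B' - X' / ps"
  have "((\<lambda>s. A s / p + b / (p * \<gamma>) * \<bar>A s\<bar> powr \<gamma> - B s - X s / ps) has_real_derivative D) (at 0)"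
    unfolding D_def
    by (intro DERIV_diff DERIV_add DERIV_cdivide DERIV_cmult dA dB dX DERIV_chain'[OF dA has_real_derivative_abs_powr[OF \<gamma>_gt_1]])
  moreover have "A s / p + b / (p * \<gamma>) * \<bar>A s\<bar> powr \<gamma> - B s - X s / ps = \<Phi> (\<lambda>x. u x + s * v x)" for s
    unfolding \<Phi>_def Aeq B_def X_def using A0[of s] by simp
  ultimately have d: "((\<lambda>s. \<Phi> (\<lambda>x. u x + s * v x)) has_real_derivative D) (at 0)" by simp
  have "D = 0"
  proof (rule DERIV_local_min[OF d, of 1])
    show "\<forall>s. \<bar>0 - s\<bar> < 1 \<longrightarrow> \<Phi> (\<lambda>x. u x + 0 * v x) \<le> \<Phi> (\<lambda>x. u x + s * v x)" using min[OF W] by simp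
  qed simp
  moreover have "\<bar>A 0\<bar> powr (\<gamma> - 2) * A 0 = energy u powr (\<gamma> - 1)"
    using A0[of 0] unfolding A_0 by (cases "energy u = 0") (auto simp: powr_diff power2_eq_square)
  ultimately have eq: "A' / p + b / (p * \<gamma>) * (\<gamma> * (energy u powr (\<gamma> - 1)) * A') = B' + X' / ps"
    unfolding D_def by (simp add: mult.assoc)
  have "A' = p * (\<integral>x. norm (?g x) powr (p - 2) * (?g x \<bullet> ?h x) \<partial>M)" unfolding A'_def by (simp add: mult.assoc)
  moreover have "X' = ps * (\<integral>x. \<bar>u x\<bar> powr (ps - 2) * u x * v x \<partial>M)" unfolding X'_def by (simp add: mult.assoc)
  ultimately show ?thesis using eq p_gt_1 ps_gt_1 \<gamma>_gt_1 unfolding B'_def by (simp add: distrib_right mult.assoc)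
qed

text \<open>Let \<open>t\<close> and \<open>X\<close> be the limits of the energies and critical
  masses of the minimising sequence, and \<open>s\<close> the excess of \<open>t\<close> over the
  energy of the limit \<open>u\<close>. Passing to \<open>u\<close> loses at most
  \<open>\<kappa> * s powr (ps / p)\<close> of critical mass, while the energy terms drop by at
  least \<open>s / p + b / (p * \<gamma>) * s powr \<gamma>\<close>. By \<open>dom\<close> the drop
  covers the loss, so \<open>\<Phi> u \<le> I\<close>.\<close>

lemma exists_minimizer:
  assumes \<kappa>: "0 \<le> \<kappa>" "\<And>u. u \<in> W1p_0 \<Omega> p \<Longrightarrow> (\<integral>x. \<bar>u x\<bar> powr ps \<partial>M) \<le> \<kappa> * energy u powr (ps / p)"
    and dom: "\<And>s. 0 \<le> s \<Longrightarrow> \<kappa> * s powr (ps / p) / ps \<le> s / p + b / (p * \<gamma>) * s powr \<gamma>"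
    and coercive: "0 < c" "\<And>\<phi>. \<phi> \<in> test_functions \<Omega> \<Longrightarrow> c * energy \<phi> \<le> \<Phi> \<phi> + C"
  shows "\<exists>u\<in>W1p_0 \<Omega> p. \<forall>w\<in>W1p_0 \<Omega> p. \<Phi> u \<le> \<Phi> w"
proof -
  have ps0: "0 < ps" and p0: "0 < p" using ps_gt_1 p_gt_1 by auto
  define I where "I = Inf (\<Phi> ` test_functions \<Omega>)"
  have bdd: "bdd_below (\<Phi> ` test_functions \<Omega>)"
  proof (rule bdd_belowI2)
    fix \<phi> assume "\<phi> \<in> test_functions \<Omega>"
    then show "- C \<le> \<Phi> \<phi>" using coercive(2)[of \<phi>] mult_nonneg_nonneg[of c "energy \<phi>"] coercive(1) energy_nonneg[of \<phi>] by linarith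
  qed
  have I: "I \<le> \<Phi> \<phi>" if "\<phi> \<in> test_functions \<Omega>" for \<phi> unfolding I_def using that bdd by (intro cINF_lower) auto
  have "\<exists>\<phi>\<in>test_functions \<Omega>. \<Phi> \<phi> < I + inverse (real (Suc n))" for n
  proof (rule ccontr)
    assume "\<not> ?thesis"
    then have "I + inverse (real (Suc n)) \<le> I" unfolding I_def using test_functions_0 by (intro cINF_greatest) (auto simp: I_def)
    then show False by simp
  qed
  then obtain \<phi>0 where \<phi>0: "\<And>n. \<phi>0 n \<in> test_functions \<Omega>" "\<And>n. \<Phi> (\<phi>0 n) < I + inverse (real (Suc n))" by metis
  have \<Phi>lim: "(\<lambda>n. \<Phi> (\<phi>0 n)) \<longlonglongrightarrow> I"
  proof (rule tendsto_sandwich[of "\<lambda>_. I" _ _ "\<lambda>n. I + inverse (real (Suc n))"])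
    have "(\<lambda>n. I + inverse (real (Suc n))) \<longlonglongrightarrow> I + 0" by (intro tendsto_intros LIMSEQ_inverse_real_of_nat)
    then show "(\<lambda>n. I + inverse (real (Suc n))) \<longlonglongrightarrow> I" by simp
  qed (use I[OF \<phi>0(1)] less_imp_le[OF \<phi>0(2)] in \<open>auto intro!: always_eventually\<close>)
  \<comment> \<open>Coercivity together with \<open>\<Phi> (\<phi>0 n) < I + 1\<close>.\<close>
  define A where "A = (I + 1 + C) / c"
  have A: "energy (\<phi>0 n) \<le> A" for n
  proof -
    have "inverse (real (Suc n)) \<le> 1" by (simp add: inverse_le_1_iff)
    then have "c * energy (\<phi>0 n) \<le> I + 1 + C" using coercive(2)[OF \<phi>0(1), of n] \<phi>0(2)[of n] by linarith
    then show ?thesis using coercive(1) by (simp add: A_def field_simps)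
  qed
  have A0: "0 \<le> A" using order_trans[OF energy_nonneg A[of 0]] .
  define B where "B = \<kappa> * A powr (ps / p)"
  have B: "(\<integral>x. \<bar>\<phi>0 n x\<bar> powr ps \<partial>M) \<le> B" for n
  proof -
    have "\<kappa> * energy (\<phi>0 n) powr (ps / p) \<le> B"
      unfolding B_def using A[of n] \<kappa>(1) ps0 p0 by (intro mult_left_mono powr_mono2) auto
    then show ?thesis using \<kappa>(2)[OF test_W1p_0[OF \<phi>0(1)], of n] by linarith
  qed
  define m where "m = measure M (space M)"
  have one: "t \<le> 1 + t powr r" if "0 \<le> t" "1 < r" for t r :: real
  proof (cases "t \<le> 1")
    case False
    then have "t powr 1 \<le> t powr r" using that by (intro powr_mono) auto
    then show ?thesis using that by simp
  qed (use powr_ge_zero[of t r] in linarith)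
  have "\<exists>k u. strict_mono (k :: nat \<Rightarrow> nat) \<and> u \<in> borel_measurable borel \<and> (AE x in lborel. (\<lambda>n. \<phi>0 (k n) x) \<longlonglongrightarrow> u x)"
  proof (rule rellich_test[OF \<phi>0(1) bounded_\<Omega>])
    fix n
    have "(\<integral>x. \<bar>\<phi>0 n x\<bar> \<partial>lborel) = (\<integral>x. \<bar>\<phi>0 n x\<bar> powr 1 \<partial>M)" using test_integral_lborel(3)[OF \<phi>0(1)[of n], of 1] by simp
    also have "\<dots> \<le> (\<integral>x. 1 + \<bar>\<phi>0 n x\<bar> powr ps \<partial>M)"
      using one[of _ ps] ps_gt_1 test_integral_lborel(1)[OF \<phi>0(1)[of n], of 1] test_integral_lborel(1)[OF \<phi>0(1)[of n] ps0] by (intro integral_mono) auto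
    also have "\<dots> = m + (\<integral>x. \<bar>\<phi>0 n x\<bar> powr ps \<partial>M)" using test_integral_lborel(1)[OF \<phi>0(1)[of n] ps0] by (simp add: m_def)
    finally show "(\<integral>x. \<bar>\<phi>0 n x\<bar> \<partial>lborel) \<le> max (m + B) (m + A)" using B[of n] by linarith
    have "(\<integral>x. norm (gradient (\<phi>0 n) x) \<partial>lborel) = (\<integral>x. norm (gradient (\<phi>0 n) x) powr 1 \<partial>M)" using test_integral_lborel(4)[OF \<phi>0(1)[of n], of 1] by simp
    also have "\<dots> \<le> (\<integral>x. 1 + norm (gradient (\<phi>0 n) x) powr p \<partial>M)"
      using one[of _ p] p_gt_1 test_integral_lborel(2)[OF \<phi>0(1)[of n], of 1] test_integral_lborel(2)[OF \<phi>0(1)[of n] p0] by (intro integral_mono) auto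
    also have "\<dots> = m + energy (\<phi>0 n)" using test_integral_lborel(2)[OF \<phi>0(1)[of n] p0] by (simp add: m_def energy_test[OF \<phi>0(1)])
    finally show "(\<integral>x. norm (gradient (\<phi>0 n) x) \<partial>lborel) \<le> max (m + B) (m + A)" using A[of n] by linarith
  qed
  then obtain k1 :: "nat \<Rightarrow> nat" and u where k1: "strict_mono k1" "u \<in> borel_measurable borel" "AE x in lborel. (\<lambda>n. \<phi>0 (k1 n) x) \<longlonglongrightarrow> u x" by blast
  have um: "u \<in> borel_measurable M" using k1(2) by (simp add: measurable_completion measurable_restrict_space1)
  have ae1: "AE x in M. (\<lambda>n. \<phi>0 (k1 n) x) \<longlonglongrightarrow> u x"
    using AE_completion[OF k1(3)] by (simp add: AE_restrict_space_iff) (auto elim: eventually_mono)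
  \<comment> \<open>Energies and critical masses are extracted as one bounded sequence in the plane,
    so that both converge along the same subsequence.\<close>
  have "bounded (range (\<lambda>n. (energy (\<phi>0 (k1 n)), \<integral>x. \<bar>\<phi>0 (k1 n) x\<bar> powr ps \<partial>M)))"
  proof (rule bounded_subset)
    show "range (\<lambda>n. (energy (\<phi>0 (k1 n)), \<integral>x. \<bar>\<phi>0 (k1 n) x\<bar> powr ps \<partial>M)) \<subseteq> {0..A} \<times> {0..B}" using A B by auto
    show "bounded ({0..A} \<times> {0..B})" by (intro bounded_Times bounded_closed_interval)
  qed
  from bounded_imp_convergent_subsequence[OF this] obtain l and k2 :: "nat \<Rightarrow> nat" where
    k2: "strict_mono k2" "((\<lambda>n. (energy (\<phi>0 (k1 n)), \<integral>x. \<bar>\<phi>0 (k1 n) x\<bar> powr ps \<partial>M)) \<circ> k2) \<longlonglongrightarrow> l" by blast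
  define k where "k n = k1 (k2 n)" for n
  define \<phi> where "\<phi> n = \<phi>0 (k n)" for n
  have k: "strict_mono k" using strict_mono_o[OF k1(1) k2(1)] by (simp add: k_def[abs_def] comp_def)
  define t where "t = fst l"
  define X where "X = snd l"
  have t: "(\<lambda>n. energy (\<phi> n)) \<longlonglongrightarrow> t" using tendsto_fst[OF k2(2)] by (simp add: comp_def \<phi>_def k_def t_def)
  have X: "(\<lambda>n. \<integral>x. \<bar>\<phi> n x\<bar> powr ps \<partial>M) \<longlonglongrightarrow> X" using tendsto_snd[OF k2(2)] by (simp add: comp_def \<phi>_def k_def X_def)
  have \<phi>t: "\<phi> n \<in> test_functions \<Omega>" for n using \<phi>0(1) by (simp add: \<phi>_def)
  note \<phi>m = test_measurable(1)[OF \<phi>t] and \<phi>i = test_integral_lborel(1)[OF \<phi>t ps0]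
  have \<Phi>I: "(\<lambda>n. \<Phi> (\<phi> n)) \<longlonglongrightarrow> I" using LIMSEQ_subseq_LIMSEQ[OF \<Phi>lim k] by (simp add: comp_def \<phi>_def)
  have ae: "AE x in M. (\<lambda>n. \<phi> n x) \<longlonglongrightarrow> u x"
    using ae1 by eventually_elim (use LIMSEQ_subseq_LIMSEQ[OF _ k2(1)] in \<open>auto simp: comp_def \<phi>_def k_def\<close>)
  have B': "(\<integral>x. \<bar>\<phi> n x\<bar> powr ps \<partial>M) \<le> B" for n using B by (simp add: \<phi>_def)
  have usm: "(\<lambda>x. \<bar>u x\<bar> powr ps) \<in> borel_measurable M" using um by measurable
  have "AE x in M. (\<lambda>n. \<bar>\<phi> n x\<bar> powr ps) \<longlonglongrightarrow> \<bar>u x\<bar> powr ps"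
    using ae by eventually_elim (use ps0 in \<open>auto intro!: tendsto_powr' tendsto_intros\<close>)
  note ui = Fatou_bounded[OF \<phi>i _ B' usm this]
  have uip: "integrable M (\<lambda>x. \<bar>u x\<bar> powr ps)" "(\<integral>x. \<bar>u x\<bar> powr ps \<partial>M) \<le> B" using ui by auto
  have uLp: "u \<in> Lp_on \<Omega> p" using um integrable_powr_absorb[OF um uip(1), of p] p_less_ps p_gt_1 by (simp add: Lp_on_def)
  \<comment> \<open>A.e. convergence improves to convergence in mean of order \<open>p\<close>,
    because \<open>p < ps\<close> and the critical masses are bounded.\<close>
  have lp: "(\<lambda>n. \<integral>x. \<bar>\<phi> n x - u x\<bar> powr p \<partial>M) \<longlonglongrightarrow> 0"
  proof -
    have "(\<lambda>n. \<integral>x. \<bar>\<phi> n x - u x\<bar> powr p \<partial>M) \<longlonglongrightarrow> (\<integral>x. 0 \<partial>M)"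
    proof (rule Vitali_convergence(4)[where w="\<lambda>n x. \<bar>\<phi> n x - u x\<bar> powr ps" and C="2 powr ps * (B + B)"])
      show "finite_measure M" by (rule finite_measure_axioms)
      show "(\<lambda>x. \<bar>\<phi> n x - u x\<bar> powr p) \<in> borel_measurable M" for n using \<phi>m[of n] um by measurable
      show "AE x in M. (\<lambda>n. \<bar>\<phi> n x - u x\<bar> powr p) \<longlonglongrightarrow> 0"
        using ae
      proof eventually_elim
        case (elim x)
        then have "(\<lambda>n. \<bar>\<phi> n x - u x\<bar> powr p) \<longlonglongrightarrow> \<bar>u x - u x\<bar> powr p" using p_gt_1 by (intro tendsto_powr' tendsto_intros) auto
        then show ?case by simp
      qed
      have i: "integrable M (\<lambda>x. norm (\<phi> n x - u x) powr ps)" for n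
        using \<phi>i[of n] uip(1) um \<phi>m[of n] ps0 by (intro integrable_norm_powr_diff) auto
      then show "integrable M (\<lambda>x. \<bar>\<phi> n x - u x\<bar> powr ps)" for n by simp
      show "(\<integral>x. \<bar>\<phi> n x - u x\<bar> powr ps \<partial>M) \<le> 2 powr ps * (B + B)" for n
      proof -
        have "(\<integral>x. \<bar>\<phi> n x - u x\<bar> powr ps \<partial>M) \<le> (\<integral>x. 2 powr ps * (\<bar>\<phi> n x\<bar> powr ps + \<bar>u x\<bar> powr ps) \<partial>M)"
        proof (rule integral_mono)
          fix x
          have "\<bar>\<phi> n x - u x\<bar> powr ps \<le> (\<bar>\<phi> n x\<bar> + \<bar>u x\<bar>) powr ps" using ps0 by (intro powr_mono2) auto
          also have "\<dots> \<le> 2 powr ps * (\<bar>\<phi> n x\<bar> powr ps + \<bar>u x\<bar> powr ps)" using ps0 by (intro powr_add_le) auto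
          finally show "\<bar>\<phi> n x - u x\<bar> powr ps \<le> 2 powr ps * (\<bar>\<phi> n x\<bar> powr ps + \<bar>u x\<bar> powr ps)" .
        qed (use i[of n] \<phi>i[of n] uip(1) in auto)
        also have "\<dots> = 2 powr ps * ((\<integral>x. \<bar>\<phi> n x\<bar> powr ps \<partial>M) + (\<integral>x. \<bar>u x\<bar> powr ps \<partial>M))" using \<phi>i[of n] uip(1) by simp
        also have "\<dots> \<le> 2 powr ps * (B + B)" using B'[of n] uip(2) by (intro mult_left_mono) auto
        finally show ?thesis .
      qed
      show "\<exists>K. \<forall>n x. \<bar>\<bar>\<phi> n x - u x\<bar> powr p\<bar> \<le> e * \<bar>\<phi> n x - u x\<bar> powr ps + K" if e: "0 < e" for e
      proof -
        obtain K where "\<And>t. 0 \<le> t \<Longrightarrow> t powr p \<le> e * t powr ps + K" using powr_absorb[of p ps e] p_less_ps p0 e by auto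
        then show ?thesis by (intro exI[of _ K]) simp
      qed
    qed auto
    then show ?thesis by simp
  qed
  note cm = critical_mass_le[OF \<phi>t uLp ae lp t X \<kappa>(2) \<kappa>(1)]
  have Flim: "(\<lambda>n. \<integral>x. F x (\<phi> n x) \<partial>M) \<longlonglongrightarrow> (\<integral>x. F x (u x) \<partial>M)" by (rule F_integral_tendsto[OF \<phi>m \<phi>i B' um ae])
  have t0: "0 \<le> t" using order_trans[OF energy_nonneg cm(2)] .
  have "(\<lambda>n. \<Phi> (\<phi> n)) \<longlonglongrightarrow> t / p + b / (p * \<gamma>) * t powr \<gamma> - (\<integral>x. F x (u x) \<partial>M) - X / ps"
    unfolding \<Phi>_def using \<gamma>_gt_1 p0 ps0
    by (intro tendsto_diff tendsto_add tendsto_divide tendsto_mult tendsto_const t X Flim tendsto_powr') auto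
  then have Ieq: "I = t / p + b / (p * \<gamma>) * t powr \<gamma> - (\<integral>x. F x (u x) \<partial>M) - X / ps" using LIMSEQ_unique[OF \<Phi>I] by simp
  define e where "e = energy u"
  define s where "s = t - e"
  have s: "0 \<le> s" "0 \<le> e" "t = s + e" using cm(2) by (auto simp: s_def e_def)
  \<comment> \<open>For \<open>0 \<le> y \<le> t\<close> one has
    \<open>y powr \<gamma> \<le> y * t powr (\<gamma> - 1)\<close>; add this for
    \<open>y = s\<close> and \<open>y = e\<close>, whose sum is \<open>t\<close>.\<close>
  have superadd: "s powr \<gamma> + e powr \<gamma> \<le> t powr \<gamma>"
  proof -
    have pw: "y powr \<gamma> \<le> y * t powr (\<gamma> - 1)" if "0 \<le> y" "y \<le> t" for y
    proof -
      have "y powr \<gamma> = y * y powr (\<gamma> - 1)" using that by (cases "y = 0") (auto simp: powr_diff)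
      also have "\<dots> \<le> y * t powr (\<gamma> - 1)" using that \<gamma>_gt_1 by (intro mult_left_mono powr_mono2) auto
      finally show ?thesis .
    qed
    have "s powr \<gamma> + e powr \<gamma> \<le> s * t powr (\<gamma> - 1) + e * t powr (\<gamma> - 1)" using pw[of s] pw[of e] s by simp
    also have "\<dots> = t * t powr (\<gamma> - 1)" using s by (simp add: distrib_right)
    also have "\<dots> = t powr \<gamma>" using t0 by (cases "t = 0") (auto simp: powr_diff)
    finally show ?thesis .
  qed
  have "\<Phi> u \<le> I"
  proof -
    have 1: "b / (p * \<gamma>) * (s powr \<gamma> + e powr \<gamma>) \<le> b / (p * \<gamma>) * t powr \<gamma>"
      using superadd b_pos p0 \<gamma>_gt_1 by (intro mult_left_mono) auto
    have 2: "X / ps \<le> ((\<integral>x. \<bar>u x\<bar> powr ps \<partial>M) + \<kappa> * s powr (ps / p)) / ps"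
      using cm(3) ps0 by (intro divide_right_mono) (auto simp: s_def e_def)
    have 3: "t / p = s / p + e / p" using s by (simp add: add_divide_distrib)
    show ?thesis unfolding Ieq \<Phi>_def e_def[symmetric]
      using 1 2 3 dom[OF s(1)] by (simp add: add_divide_distrib distrib_left)
  qed
  moreover have "I \<le> \<Phi> w" if "w \<in> W1p_0 \<Omega> p" for w using \<Phi>_approx[OF that I] .
  ultimately show ?thesis using cm(1) by (meson order_trans)
qed

end

subsection \<open>Coercivity and existence\<close>

text \<open>The difference of the two sides vanishes at \<open>0\<close> and has the derivative
  \<open>(1 + b * r powr (\<gamma> - 1) - \<kappa> * r powr (ps / p - 1)) / p\<close>, which
  \<open>pw\<close> makes nonnegative.\<close>

lemma powr_dominated_of_derivative:
  fixes p ps b \<gamma> \<kappa> s :: real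
  assumes p: "1 < p" "p < ps" and \<gamma>: "1 < \<gamma>" and s: "0 \<le> s"
    and pw: "\<And>r. 0 \<le> r \<Longrightarrow> \<kappa> * r powr (ps / p - 1) \<le> 1 + b * r powr (\<gamma> - 1)"
  shows "\<kappa> * s powr (ps / p) / ps \<le> s / p + b / (p * \<gamma>) * s powr \<gamma>"
proof -
  have pp: "1 < ps / p" using p by simp
  define k where "k r = r / p + b / (p * \<gamma>) * \<bar>r\<bar> powr \<gamma> - \<kappa> * \<bar>r\<bar> powr (ps / p) / ps" for r
  have mul: "\<bar>r\<bar> powr (z - 2) * r = r powr (z - 1)" if "0 \<le> r" for r z :: real
    using that powr_add[of r "z - 2" 1] by (cases "r = 0") auto
  have d: "(k has_real_derivative (1 + b * r powr (\<gamma> - 1) - \<kappa> * r powr (ps / p - 1)) / p) (at r)" if r: "0 \<le> r" for r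
  proof -
    have "(k has_real_derivative (1 / p + b / (p * \<gamma>) * (\<gamma> * \<bar>r\<bar> powr (\<gamma> - 2) * r) - \<kappa> * (ps / p * \<bar>r\<bar> powr (ps / p - 2) * r) / ps)) (at r)"
      unfolding k_def[abs_def]
      by (intro DERIV_diff DERIV_add DERIV_cdivide DERIV_cmult DERIV_ident has_real_derivative_abs_powr \<gamma> pp)
    moreover have "1 / p + b / (p * \<gamma>) * (\<gamma> * \<bar>r\<bar> powr (\<gamma> - 2) * r) - \<kappa> * (ps / p * \<bar>r\<bar> powr (ps / p - 2) * r) / ps
      = (1 + b * r powr (\<gamma> - 1) - \<kappa> * r powr (ps / p - 1)) / p"
      using p \<gamma> unfolding mult.assoc mul[OF r] by (simp add: field_simps)
    ultimately show ?thesis by simp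
  qed
  have "k 0 \<le> k s"
  proof (rule DERIV_nonneg_imp_nondecreasing[OF s])
    fix r assume "0 \<le> r" "r \<le> s"
    then show "\<exists>y. (k has_real_derivative y) (at r) \<and> 0 \<le> y"
      using d[of r] pw[of r] p by (intro exI[of _ "(1 + b * r powr (\<gamma> - 1) - \<kappa> * r powr (ps / p - 1)) / p"]) simp
  qed
  then show ?thesis using s by (simp add: k_def)
qed

text \<open>To be read with \<open>a = ps / p - 1\<close>, \<open>c = \<gamma> - ps / p\<close> and
  \<open>m = \<gamma> - 1\<close>. Weighted AM-GM with the weights \<open>c / m\<close> and
  \<open>a / m\<close>, applied to \<open>1 = c / m * (m / c)\<close> and
  \<open>b * r powr m = a / m * (m * b / a * r powr m)\<close>, gives
  \<open>T powr (1 / m) * r powr a\<close> as a lower bound for their sum; \<open>le\<close> is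
  \<open>\<kappa> powr m \<le> T\<close> rewritten. Equality holds at a suitable \<open>r\<close>,
  so this form of the threshold in (iii) is sharp for the inequality.\<close>

lemma young_powr_bound:
  fixes a c b r :: real
  assumes a: "0 < a" and c: "0 < c" and b: "0 < b" and r: "0 \<le> r" and \<kappa>: "0 \<le> \<kappa>"
    and le: "c powr c * a powr a / (a + c) powr (a + c) * \<kappa> powr (a + c) \<le> b powr a"
  shows "\<kappa> * r powr a \<le> 1 + b * r powr (a + c)"
proof (cases "r = 0")
  case False
  then have r: "0 < r" using r by simp
  define m where "m = a + c"
  have m: "0 < m" using a c by (simp add: m_def)
  define T where "T = (m / c) powr c * (m * b / a) powr a"
  have "\<kappa> powr m \<le> T"
  proof -
    have "\<kappa> powr m = c powr c * a powr a / m powr m * \<kappa> powr m * (m powr m / (c powr c * a powr a))"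
      using a c m by simp
    also have "\<dots> \<le> b powr a * (m powr m / (c powr c * a powr a))"
      using le by (intro mult_right_mono) (auto simp: m_def)
    also have "\<dots> = T"
      unfolding T_def m_def[symmetric] using a b c m
      by (simp add: powr_divide powr_mult) (simp add: m_def powr_add)
    finally show ?thesis .
  qed
  then have "(\<kappa> powr m) powr (1 / m) \<le> T powr (1 / m)" using m by (intro powr_mono2) auto
  then have "\<kappa> \<le> T powr (1 / m)" using \<kappa> m by (simp add: powr_powr)
  then have "\<kappa> * r powr a \<le> T powr (1 / m) * r powr a" by (intro mult_right_mono) auto
  also have "\<dots> = (m / c) powr (c / m) * (m * b / a * r powr m) powr (a / m)"
  proof -
    have "(m * b / a * r powr m) powr (a / m) = (m * b / a) powr (a / m) * r powr a"
      using m by (simp only: powr_mult powr_powr) simp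
    moreover have "T powr (1 / m) = (m / c) powr (c / m) * (m * b / a) powr (a / m)"
      unfolding T_def by (simp only: powr_mult powr_powr) simp
    ultimately show ?thesis by simp
  qed
  also have "\<dots> \<le> c / m * (m / c) + a / m * (m * b / a * r powr m)"
    using a b c m r by (intro Youngs_inequality_0) (auto simp: m_def add_divide_distrib[symmetric] add.commute)
  also have "\<dots> = 1 + b * r powr m" using a c m by simp
  finally show ?thesis by (simp add: m_def)
qed (use a in simp)

context bounded_open_domain
begin

text \<open>With \<open>y = K * energy u\<close> and \<open>l powr p = y\<close>, the pointwise
  bound \<open>t powr p \<le> y + l powr (p - ps) * t powr ps\<close> is integrated. The Sobolev
  bound \<open>l powr ps\<close> on the critical mass makes the second term at most
  \<open>y\<close>, so the result is linear in the energy.\<close>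

lemma poincare:
  "\<exists>C\<ge>0. \<forall>u\<in>W1p_0 \<Omega> p. (\<integral>x. \<bar>u x\<bar> powr p \<partial>M) \<le> C * energy u"
proof -
  obtain K where K: "0 < K" "\<And>u. u \<in> W1p_0 \<Omega> p \<Longrightarrow> (\<integral>x. \<bar>u x\<bar> powr ps \<partial>M) \<le> (K * energy u) powr (ps / p)"
    using sobolev_W1p_0 by blast
  define m where "m = measure M (space M)"
  have p0: "0 < p" "0 < ps" using p_gt_1 ps_gt_1 by auto
  have "(\<integral>x. \<bar>u x\<bar> powr p \<partial>M) \<le> (m + 1) * K * energy u" if u: "u \<in> W1p_0 \<Omega> p" for u
  proof -
    note Xi = W1p_0_integrable_ps[OF u]
    note ui = Lp_onD(2)[OF W1p_0_Lp(1)[OF u]]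
    define y where "y = K * energy u"
    have y0: "0 \<le> y" using K by (simp add: y_def)
    have X: "(\<integral>x. \<bar>u x\<bar> powr ps \<partial>M) \<le> y powr (ps / p)" using K(2)[OF u] by (simp add: y_def)
    show ?thesis
    proof (cases "y = 0")
      case True
      then have "(\<integral>x. \<bar>u x\<bar> powr ps \<partial>M) = 0" using X by (simp add: antisym)
      then have "AE x in M. \<bar>u x\<bar> powr ps = 0" using integral_nonneg_eq_0_iff_AE[OF Xi] by simp
      then have "AE x in M. \<bar>u x\<bar> powr p = 0" by eventually_elim simp
      then have "(\<integral>x. \<bar>u x\<bar> powr p \<partial>M) = 0" by (rule integral_eq_zero_AE)
      then show ?thesis using K by (simp add: m_def)
    next
      case False
      then have y: "0 < y" using y0 by simp
      define l where "l = y powr (1 / p)"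
      have l: "0 < l" "l powr p = y" "l powr ps = y powr (ps / p)" using y p0 by (auto simp: l_def powr_powr)
      have pt: "t powr p \<le> y + l powr (p - ps) * t powr ps" if t: "0 \<le> t" for t
      proof (cases "t \<le> l")
        case True
        then have "t powr p \<le> y" unfolding l(2)[symmetric] using t p0 by (intro powr_mono2) auto
        then show ?thesis by (simp add: add_increasing2)
      next
        case False
        then have "t powr (p - ps) \<le> l powr (p - ps)" using l p_less_ps by (intro powr_mono2') auto
        then have "t powr (p - ps) * t powr ps \<le> l powr (p - ps) * t powr ps" by (intro mult_right_mono) auto
        moreover have "t powr (p - ps) * t powr ps = t powr p" using False l by (simp add: powr_add[symmetric])
        ultimately show ?thesis using y by simp
      qed
      have "(\<integral>x. \<bar>u x\<bar> powr p \<partial>M) \<le> (\<integral>x. y + l powr (p - ps) * \<bar>u x\<bar> powr ps \<partial>M)"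
        using ui Xi pt by (intro integral_mono) auto
      also have "\<dots> = m * y + l powr (p - ps) * (\<integral>x. \<bar>u x\<bar> powr ps \<partial>M)" using Xi by (simp add: m_def)
      also have "\<dots> \<le> m * y + l powr (p - ps) * l powr ps"
        using X l by (intro add_left_mono mult_left_mono) auto
      also have "l powr (p - ps) * l powr ps = y"
        using powr_add[of l "p - ps" ps] l(2) by simp
      finally show ?thesis by (simp add: y_def algebra_simps)
    qed
  qed
  moreover have "0 \<le> (m + 1) * K" using K by (simp add: m_def)
  ultimately show ?thesis by blast
qed

end

context caratheodory_nonlinearity
begin

section \<open>Coercivity in the three cases\<close>

lemma F_integral_le:
  assumes w: "w \<in> borel_measurable M" "integrable M (\<lambda>x. \<bar>w x\<bar> powr ps)" "integrable M (\<lambda>x. \<bar>w x\<bar> powr r)"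
    and K: "\<And>x t. \<bar>F x t\<bar> \<le> e * \<bar>t\<bar> powr r + K"
  shows "(\<integral>x. F x (w x) \<partial>M) \<le> e * (\<integral>x. \<bar>w x\<bar> powr r \<partial>M) + K * measure M (space M)"
proof -
  have "(\<integral>x. F x (w x) \<partial>M) \<le> (\<integral>x. e * \<bar>w x\<bar> powr r + K \<partial>M)"
  proof (rule integral_mono)
    show "F x (w x) \<le> e * \<bar>w x\<bar> powr r + K" for x using K[of x "w x"] by simp
  qed (use F_integrable[OF w(1,2)] w(3) in auto)
  also have "\<dots> = e * (\<integral>x. \<bar>w x\<bar> powr r \<partial>M) + K * measure M (space M)" using w(3) by simp
  finally show ?thesis .
qed

text \<open>The slack \<open>e\<close> in \<open>dom\<close> leaves room to absorb \<open>F\<close>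
  into the critical term, so the term \<open>energy u / p\<close> remains untouched.\<close>

lemma coercive_if_dominated:
  assumes \<kappa>: "\<And>u. u \<in> W1p_0 \<Omega> p \<Longrightarrow> (\<integral>x. \<bar>u x\<bar> powr ps \<partial>M) \<le> \<kappa> * energy u powr (ps / p)" "0 \<le> \<kappa>"
    and e: "0 < e" and dom: "\<And>s. 0 \<le> s \<Longrightarrow> (1 / ps + e) * (\<kappa> * s powr (ps / p)) \<le> b / (p * \<gamma>) * s powr \<gamma> + C"
  shows "\<exists>C. \<forall>u\<in>W1p_0 \<Omega> p. 1 / p * energy u \<le> \<Phi> u + C"
proof -
  obtain K where K: "\<And>x t. \<bar>F x t\<bar> \<le> e * \<bar>t\<bar> powr ps + K" using F_growth[OF q(2) e] by blast
  have "1 / p * energy u \<le> \<Phi> u + (K * measure M (space M) + C)" if u: "u \<in> W1p_0 \<Omega> p" for u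
  proof -
    define X where "X = (\<integral>x. \<bar>u x\<bar> powr ps \<partial>M)"
    note ui = W1p_0_integrable_ps[OF u]
    have "(\<integral>x. F x (u x) \<partial>M) \<le> e * X + K * measure M (space M)"
      unfolding X_def by (rule F_integral_le[OF Lp_onD(1)[OF W1p_0_Lp(1)[OF u]] ui ui K])
    moreover have "(1 / ps + e) * X \<le> (1 / ps + e) * (\<kappa> * energy u powr (ps / p))"
      using \<kappa>(1)[OF u] e ps_gt_1 by (intro mult_left_mono) (auto simp: X_def)
    moreover have "(1 / ps + e) * X = X / ps + e * X" by (simp add: distrib_right)
    ultimately show ?thesis
      using dom[OF energy_nonneg[of u]] unfolding \<Phi>_def X_def[symmetric] by simp
  qed
  then show ?thesis by blast
qed

text \<open>Without slack only \<open>energy u / p\<close> is left to control \<open>F\<close>. For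
  \<open>q < p\<close> the growth of \<open>F\<close> is below the power \<open>p\<close>, and by
  the Poincare inequality it uses up at most half of that term.\<close>

lemma coercive_if_subhomogeneous:
  assumes \<kappa>: "\<And>u. u \<in> W1p_0 \<Omega> p \<Longrightarrow> (\<integral>x. \<bar>u x\<bar> powr ps \<partial>M) \<le> \<kappa> * energy u powr (ps / p)"
    and qp: "q < p" and dom: "\<And>s. 0 \<le> s \<Longrightarrow> \<kappa> * s powr (ps / p) / ps \<le> b / (p * \<gamma>) * s powr \<gamma>"
  shows "\<exists>C. \<forall>u\<in>W1p_0 \<Omega> p. 1 / (2 * p) * energy u \<le> \<Phi> u + C"
proof -
  obtain P where P: "0 \<le> P" "\<And>u. u \<in> W1p_0 \<Omega> p \<Longrightarrow> (\<integral>x. \<bar>u x\<bar> powr p \<partial>M) \<le> P * energy u"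
    using poincare by blast
  \<comment> \<open>\<open>P + 1\<close> instead of \<open>P\<close>, because \<open>P\<close> may
    be \<open>0\<close>.\<close>
  define e where "e = 1 / (2 * p * (P + 1))"
  have e: "0 < e" "e * P \<le> 1 / (2 * p)"
  proof -
    show "0 < e" using p_gt_1 P by (simp add: e_def)
    have "e * P \<le> e * (P + 1)" using \<open>0 < e\<close> by (intro mult_left_mono) auto
    also have "\<dots> = 1 / (2 * p)" using P by (simp add: e_def)
    finally show "e * P \<le> 1 / (2 * p)" .
  qed
  obtain K where K: "\<And>x t. \<bar>F x t\<bar> \<le> e * \<bar>t\<bar> powr p + K" using F_growth[OF qp e(1)] by blast
  have "1 / (2 * p) * energy u \<le> \<Phi> u + K * measure M (space M)" if u: "u \<in> W1p_0 \<Omega> p" for u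
  proof -
    define X where "X = (\<integral>x. \<bar>u x\<bar> powr ps \<partial>M)"
    define Y where "Y = (\<integral>x. \<bar>u x\<bar> powr p \<partial>M)"
    have ui: "integrable M (\<lambda>x. \<bar>u x\<bar> powr p)" using Lp_onD(2)[OF W1p_0_Lp(1)[OF u]] by simp
    have F: "(\<integral>x. F x (u x) \<partial>M) \<le> e * Y + K * measure M (space M)"
      unfolding Y_def by (rule F_integral_le[OF Lp_onD(1)[OF W1p_0_Lp(1)[OF u]] W1p_0_integrable_ps[OF u] ui K])
    have "e * Y \<le> e * (P * energy u)" using P(2)[OF u] e(1) by (intro mult_left_mono) (auto simp: Y_def)
    also have "\<dots> \<le> 1 / (2 * p) * energy u" using mult_right_mono[OF e(2) energy_nonneg[of u]] by (simp add: mult.assoc)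
    finally have 1: "e * Y \<le> 1 / (2 * p) * energy u" .
    have 2: "X / ps \<le> \<kappa> * energy u powr (ps / p) / ps"
      using \<kappa>[OF u] ps_gt_1 by (intro divide_right_mono) (auto simp: X_def)
    have 3: "energy u / p = 1 / (2 * p) * energy u + 1 / (2 * p) * energy u" using p_gt_1 by (simp add: field_simps)
    show ?thesis
      using F 1 2 3 dom[OF energy_nonneg[of u]] unfolding \<Phi>_def X_def[symmetric] by linarith
  qed
  then show ?thesis by blast
qed

lemma \<Phi>_attains_minimum:
  assumes cases: "(\<gamma> = ps / p \<and> b = sobolev_const \<Omega> p powr (- (ps / p)) \<and> q < p) \<or>
         (\<gamma> = ps / p \<and> b > sobolev_const \<Omega> p powr (- (ps / p))) \<or>
         (\<gamma> > ps / p \<and>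
          b powr (ps / p - 1) >
            (\<gamma> - ps / p) powr (\<gamma> - ps / p) * (ps / p - 1) powr (ps / p - 1)
              / (\<gamma> - 1) powr (\<gamma> - 1)
              * sobolev_const \<Omega> p powr (- ((ps / p) * (\<gamma> - 1))))"
  shows "\<exists>u\<in>W1p_0 \<Omega> p. \<forall>w\<in>W1p_0 \<Omega> p. \<Phi> u \<le> \<Phi> w"
proof -
  define S where "S = sobolev_const \<Omega> p"
  define \<kappa> where "\<kappa> = S powr (- (ps / p))"
  have S: "0 < S" unfolding S_def by (rule sobolev_const_inequality(1))
  have \<kappa>: "0 < \<kappa>" using S by (simp add: \<kappa>_def)
  have X: "(\<integral>x. \<bar>u x\<bar> powr ps \<partial>M) \<le> \<kappa> * energy u powr (ps / p)" if "u \<in> W1p_0 \<Omega> p" for u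
    unfolding \<kappa>_def S_def by (rule sobolev_const_inequality(2)[OF that])
  have p0: "0 < p" "0 < ps" "1 < ps / p" using p_gt_1 ps_gt_1 p_less_ps by auto
  \<comment> \<open>In the first two cases the powers of \<open>r\<close> coincide and
    \<open>\<kappa> \<le> b\<close> is enough; in the third this is the sharp weighted AM-GM
    bound.\<close>
  have pw: "\<kappa> * r powr (ps / p - 1) \<le> 1 + b * r powr (\<gamma> - 1)" if r: "0 \<le> r" for r
    using cases
  proof (elim disjE conjE)
    assume "\<gamma> = ps / p" "b = sobolev_const \<Omega> p powr (- (ps / p))"
    then show ?thesis by (simp add: \<kappa>_def S_def)
  next
    assume "\<gamma> = ps / p" "sobolev_const \<Omega> p powr (- (ps / p)) < b"
    then show ?thesis using mult_right_mono[of \<kappa> b "r powr (\<gamma> - 1)"] by (simp add: \<kappa>_def S_def)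
  next
    assume g: "ps / p < \<gamma>" and le: "(\<gamma> - ps / p) powr (\<gamma> - ps / p) * (ps / p - 1) powr (ps / p - 1)
              / (\<gamma> - 1) powr (\<gamma> - 1) * sobolev_const \<Omega> p powr (- ((ps / p) * (\<gamma> - 1))) < b powr (ps / p - 1)"
    have "\<kappa> powr (\<gamma> - 1) = sobolev_const \<Omega> p powr (- ((ps / p) * (\<gamma> - 1)))"
      by (simp add: \<kappa>_def S_def powr_powr)
    then show ?thesis
      using young_powr_bound[of "ps / p - 1" "\<gamma> - ps / p" b r \<kappa>] g le p0 b_pos r \<kappa> by simp
  qed
  have dom: "\<kappa> * s powr (ps / p) / ps \<le> s / p + b / (p * \<gamma>) * s powr \<gamma>" if "0 \<le> s" for s
    by (rule powr_dominated_of_derivative[OF p_gt_1 p_less_ps \<gamma>_gt_1 that pw])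
  have "\<exists>c>0. \<exists>C. \<forall>u\<in>W1p_0 \<Omega> p. c * energy u \<le> \<Phi> u + C"
    using cases
  proof (elim disjE conjE)
    assume g: "\<gamma> = ps / p" "b = sobolev_const \<Omega> p powr (- (ps / p))" "q < p"
    have "\<exists>C. \<forall>u\<in>W1p_0 \<Omega> p. 1 / (2 * p) * energy u \<le> \<Phi> u + C"
      by (rule coercive_if_subhomogeneous[OF X g(3)]) (use g p0 in \<open>auto simp: \<kappa>_def S_def\<close>)
    then show ?thesis using p0 by (intro exI[of _ "1 / (2 * p)"]) simp
  next
    assume g: "\<gamma> = ps / p" "sobolev_const \<Omega> p powr (- (ps / p)) < b"
    \<comment> \<open>The slack given by \<open>b > \<kappa>\<close>: it solves
      \<open>(1 / ps + e) * \<kappa> = b / ps\<close>, and \<open>p * \<gamma> = ps\<close> in this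
      case.\<close>
    define e where "e = (b - \<kappa>) / (ps * \<kappa>)"
    have "0 < e" using g p0 \<kappa> by (simp add: e_def \<kappa>_def S_def)
    moreover have "(1 / ps + e) * \<kappa> = b / ps" using \<kappa> p0 by (simp add: e_def field_simps)
    then have "(1 / ps + e) * (\<kappa> * s powr (ps / p)) \<le> b / (p * \<gamma>) * s powr \<gamma> + 0" for s
      using g p0 by (simp add: mult.assoc[symmetric])
    ultimately have "\<exists>C. \<forall>u\<in>W1p_0 \<Omega> p. 1 / p * energy u \<le> \<Phi> u + C"
      using coercive_if_dominated[OF X, of e 0] \<kappa> by simp
    then show ?thesis using p0 by (intro exI[of _ "1 / p"]) simp
  next
    \<comment> \<open>Here the power \<open>\<gamma>\<close> of the energy beats
      \<open>ps / p\<close>, so any multiple of the critical bound is absorbed up to a constant; the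
      slack is taken to be \<open>1\<close>.\<close>
    assume g: "ps / p < \<gamma>"
    define k where "k = (1 / ps + 1) * \<kappa>"
    have k: "0 < k" using p0 \<kappa> by (simp add: k_def add_pos_pos)
    have "0 < b / (p * \<gamma>) / k" using b_pos p0 \<gamma>_gt_1 k by simp
    then obtain C where C: "\<And>t. 0 \<le> t \<Longrightarrow> t powr (ps / p) \<le> b / (p * \<gamma>) / k * t powr \<gamma> + C"
      using powr_absorb[of "ps / p" \<gamma> "b / (p * \<gamma>) / k"] g p0 by auto
    have "(1 / ps + 1) * (\<kappa> * s powr (ps / p)) \<le> b / (p * \<gamma>) * s powr \<gamma> + k * C" if "0 \<le> s" for s
    proof -
      have "k * s powr (ps / p) \<le> k * (b / (p * \<gamma>) / k * s powr \<gamma> + C)" using C[OF that] k by (intro mult_left_mono) auto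
      also have "\<dots> = b / (p * \<gamma>) * s powr \<gamma> + k * C" using k by (simp add: distrib_left)
      finally show ?thesis by (simp add: k_def mult.assoc)
    qed
    then have "\<exists>C. \<forall>u\<in>W1p_0 \<Omega> p. 1 / p * energy u \<le> \<Phi> u + C"
      using coercive_if_dominated[OF X, of 1 "k * C"] \<kappa> by simp
    then show ?thesis using p0 by (intro exI[of _ "1 / p"]) simp
  qed
  then obtain c C where c: "0 < c" "\<And>u. u \<in> W1p_0 \<Omega> p \<Longrightarrow> c * energy u \<le> \<Phi> u + C" by blast
  show ?thesis
    by (rule exists_minimizer[OF less_imp_le[OF \<kappa>] X dom c(1) c(2)[OF test_W1p_0]])
qed

end

text \<open>The Caratheodory and growth conditions hold only a.e. Replacing \<open>f\<close> by
  \<open>0\<close> at the exceptional points gives a nonlinearity that satisfies them everywhere and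
  has the same weak formulation.\<close>

lemma (in bounded_open_domain) exists_weak_solution:
  assumes "b > 0" "\<gamma> > 1"
    and carath: "caratheodory \<Omega> f"
    and "a1 > 0" "a2 > 0" "1 < q" "q < ps"
    and growth: "AE x in lebesgue_on \<Omega>. \<forall>t. \<bar>f x t\<bar> \<le> a1 * \<bar>t\<bar> powr (q - 1) + a2"
    and cases: "(\<gamma> = ps / p \<and> b = sobolev_const \<Omega> p powr (- (ps / p)) \<and> q < p) \<or>
         (\<gamma> = ps / p \<and> b > sobolev_const \<Omega> p powr (- (ps / p))) \<or>
         (\<gamma> > ps / p \<and>
          b powr (ps / p - 1) >
            (\<gamma> - ps / p) powr (\<gamma> - ps / p) * (ps / p - 1) powr (ps / p - 1)
              / (\<gamma> - 1) powr (\<gamma> - 1)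
              * sobolev_const \<Omega> p powr (- ((ps / p) * (\<gamma> - 1))))"
  shows "\<exists>u. weak_solution \<Omega> p b \<gamma> f u"
proof -
  define P where "P x \<longleftrightarrow> continuous_on UNIV (f x) \<and> (\<forall>t. \<bar>f x t\<bar> \<le> a1 * \<bar>t\<bar> powr (q - 1) + a2)" for x
  have P: "AE x in M. P x"
    using carath growth unfolding caratheodory_def P_def by auto
  define g where "g x = (if P x then f x else (\<lambda>t. 0))" for x
  have fg: "AE x in M. g x = f x" using P by eventually_elim (simp add: g_def)
  interpret caratheodory_nonlinearity \<Omega> p ps g a1 a2 q b \<gamma>
  proof unfold_locales
    show "(\<lambda>x. g x t) \<in> borel_measurable M" for t
    proof (rule borel_measurable_lebesgue_on_AE_cong[OF sets_\<Omega>])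
      show "(\<lambda>x. f x t) \<in> borel_measurable M" using carath by (simp add: caratheodory_def)
      show "AE x in M. g x t = f x t" using fg by eventually_elim simp
    qed
    show "continuous_on UNIV (g x)" for x by (simp add: g_def P_def)
    show "\<bar>g x t\<bar> \<le> a1 * \<bar>t\<bar> powr (q - 1) + a2" for x t using \<open>a1 > 0\<close> \<open>a2 > 0\<close> by (simp add: g_def P_def)
  qed (use assms in auto)
  obtain u where u: "u \<in> W1p_0 \<Omega> p" "\<And>w. w \<in> W1p_0 \<Omega> p \<Longrightarrow> \<Phi> u \<le> \<Phi> w"
    using \<Phi>_attains_minimum cases by blast
  have "weak_solution \<Omega> p b \<gamma> f u"
    unfolding weak_solution_def ps_eq[symmetric] energy_def[symmetric]
  proof (intro conjI ballI u(1))
    fix v assume v: "v \<in> W1p_0 \<Omega> p"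
    have gm: "(\<lambda>x. g x (u x) * v x) \<in> borel_measurable M"
      using f_compose_measurable[OF Lp_onD(1)[OF W1p_0_Lp(1)[OF u(1)]]] Lp_onD(1)[OF W1p_0_Lp(1)[OF v]]
      by (rule borel_measurable_times)
    have ae: "AE x in M. f x (u x) * v x = g x (u x) * v x" using fg by eventually_elim simp
    \<comment> \<open>Measurability of the left integrand is inherited from the modified one, by
      completeness of the measure.\<close>
    have "(\<integral>x. f x (u x) * v x \<partial>M) = (\<integral>x. g x (u x) * v x \<partial>M)"
      by (rule integral_cong_AE[OF borel_measurable_lebesgue_on_AE_cong[OF sets_\<Omega> gm ae] gm ae])
    then show "(1 + b * energy u powr (\<gamma> - 1)) *
        (\<integral>x. norm (weak_grad \<Omega> u x) powr (p - 2) * (weak_grad \<Omega> u x \<bullet> weak_grad \<Omega> v x) \<partial>lebesgue_on \<Omega>) =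
        (\<integral>x. f x (u x) * v x \<partial>lebesgue_on \<Omega>) + (\<integral>x. \<bar>u x\<bar> powr (ps - 2) * u x * v x \<partial>lebesgue_on \<Omega>)"
      using euler_lagrange[OF u(1) u(2) v] by simp
  qed
  then show ?thesis by blast
qed

theorem corollary1p4:
  fixes \<Omega> :: "(real ^ 'n) set"
    and p ps S b \<gamma> a1 a2 q :: real
    and f :: "real ^ 'n \<Rightarrow> real \<Rightarrow> real"
  defines "ps \<equiv> crit_exp CARD('n) p"
    and "S \<equiv> sobolev_const \<Omega> p"
  assumes "CARD('n) \<ge> 2"
    and "open \<Omega>" "connected \<Omega>" "\<Omega> \<noteq> {}" "bounded \<Omega>"
    and "1 < p" "p < real CARD('n)"
    and "b > 0" "\<gamma> > 1"
    and "caratheodory \<Omega> f"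
    and "a1 > 0" "a2 > 0" "1 < q" "q < ps"
    and "AE x in lebesgue_on \<Omega>. \<forall>t. \<bar>f x t\<bar> \<le> a1 * \<bar>t\<bar> powr (q - 1) + a2"
    and "(\<gamma> = ps / p \<and> b = S powr (- (ps / p)) \<and> q < p) \<or>
         (\<gamma> = ps / p \<and> b > S powr (- (ps / p))) \<or>
         (\<gamma> > ps / p \<and>
          b powr (ps / p - 1) >
            (\<gamma> - ps / p) powr (\<gamma> - ps / p) * (ps / p - 1) powr (ps / p - 1)
              / (\<gamma> - 1) powr (\<gamma> - 1)
              * S powr (- ((ps / p) * (\<gamma> - 1))))"
  shows "\<exists>u. weak_solution \<Omega> p b \<gamma> f u"
proof -
  interpret bounded_open_domain \<Omega> p ps
    using assms by unfold_locales (simp_all add: ps_def)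
  show ?thesis
    using assms(10-18) unfolding S_def by (rule exists_weak_solution)
qed

end
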